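(* Let the genus function $g:\mathbb{N}\to\mathbb{N}_0$ be non-decreasing and let $\mathcal A^g$ be any one of $\mathcal E^g$, $\mathcal O\mathcal E^g$, $\mathcal N\mathcal E^g$ or $\mathcal O\mathcal E^g\cap\mathcal N\mathcal E^g$. Suppose that either (a) $g(n)=O(n/\log n)$ and $\tilde R_n$ is uniformly random from $\widetilde{\mathcal A}^g_n$ or from $\mbox{Hered}(\widetilde{\mathcal A}^g)_n$; or (b) $\mathcal A^g$ does not contain all graphs and $\tilde R_n$ is uniformly random from $\mathrm{Minor}(\widetilde{\mathcal A}^g)_n$. Then for any $\varepsilon>0$ there is a set $I\subseteq\mathbb{N}$ with lower density at least $1-\varepsilon$ such that $\sup_{n\in I}\mathbb{P}(\tilde R_n\text{ is connected})<1$, and a fortiori $\liminf_{n\to\infty}\mathbb{P}(\tilde R_n\text{ is connected})<1$.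
   Context: All graphs are finite and simple. $\mathcal E^g$ is the class of graphs $G$ such that, if $G$ has $n$ vertices, $G$ embeds in some surface of Euler genus at most $g(n)$; $\mathcal O\mathcal E^g$ / $\mathcal N\mathcal E^g$ require the surface to be orientable / non-orientable (with $\mathcal N\mathcal E^0$ = planar graphs). $\mbox{Hered}(\mathcal A^g)$ is the class of graphs $G$ such that for every nonempty $W\subseteq V(G)$ the induced subgraph $G[W]$ lies in $\mathcal A^g$; $\mathrm{Minor}(\mathcal A^g)$ is the class of graphs all of whose minors lie in $\mathcal A^g$. For a class $\mathcal B$ of labelled graphs, $\widetilde{\mathcal B}$ is the corresponding set of unlabelled graphs and $\widetilde{\mathcal B}_n$ those with $n$ vertices. A set $I\subseteq\mathbb{N}$ has lower density at least $\delta$ if $|I\cap[n]|\ge\delta n$ for all sufficiently large $n$. *)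

theory Defs
  imports "HOL-Probability.Probability" "HOL-Library.Landau_Symbols"
begin

section \<open>Graphs\<close>

type_synonym 'a sgraph = "'a set \<times> 'a set set"

abbreviation verts :: "'a sgraph \<Rightarrow> 'a set" where "verts \<equiv> fst"
abbreviation edges :: "'a sgraph \<Rightarrow> 'a set set" where "edges \<equiv> snd"

text \<open>Every finite simple graph has an isomorphic copy with vertices in \<open>nat\<close>, so graph classes
  are rendered as sets of such graphs.\<close>

definition graphs :: "nat sgraph set" where
  "graphs = {G. finite (verts G) \<and> (\<forall>e\<in>edges G. e \<subseteq> verts G \<and> card e = 2)}"

definition graph_iso :: "(nat sgraph \<times> nat sgraph) set" where
  "graph_iso = {(G, H). G \<in> graphs \<and> H \<in> graphs \<and>
     (\<exists>f. bij_betw f (verts G) (verts H) \<and> edges H = (`) f ` edges G)}"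

definition connected_graphs :: "nat sgraph set" where
  "connected_graphs = {G \<in> graphs. verts G \<noteq> {} \<and>
     (\<forall>u\<in>verts G. \<forall>v\<in>verts G. (\<lambda>x y. {x, y} \<in> edges G)\<^sup>*\<^sup>* u v)}"

definition induced_subgraph :: "'a sgraph \<Rightarrow> 'a set \<Rightarrow> 'a sgraph" where
  "induced_subgraph G W = (W, {e \<in> edges G. e \<subseteq> W})"

definition delete_edge :: "'a sgraph \<Rightarrow> 'a set \<Rightarrow> 'a sgraph" where
  "delete_edge G e = (verts G, edges G - {e})"

text \<open>Contracting \<open>{u, v}\<close> merges \<open>v\<close> into \<open>u\<close>. Requiring images of edges to have two elements
  discards the loop that would arise; parallel edges coincide as sets.\<close>

definition contract_edge :: "'a sgraph \<Rightarrow> 'a \<Rightarrow> 'a \<Rightarrow> 'a sgraph" where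
  "contract_edge G u v =
     (let f = (\<lambda>x. if x = v then u else x)
      in (verts G - {v}, {f ` e |e. e \<in> edges G \<and> card (f ` e) = 2}))"

inductive minor_step :: "'a sgraph \<Rightarrow> 'a sgraph \<Rightarrow> bool" where
  "v \<in> verts G \<Longrightarrow> minor_step G (induced_subgraph G (verts G - {v}))"
| "e \<in> edges G \<Longrightarrow> minor_step G (delete_edge G e)"
| "{u, v} \<in> edges G \<Longrightarrow> u \<noteq> v \<Longrightarrow> minor_step G (contract_edge G u v)"

definition is_minor :: "'a sgraph \<Rightarrow> 'a sgraph \<Rightarrow> bool" where
  "is_minor H G \<longleftrightarrow> minor_step\<^sup>*\<^sup>* G H"

definition Hered :: "nat sgraph set \<Rightarrow> nat sgraph set" where
  "Hered A = {G \<in> graphs. \<forall>W. W \<subseteq> verts G \<and> W \<noteq> {} \<longrightarrow> induced_subgraph G W \<in> A}"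

definition Minor :: "nat sgraph set \<Rightarrow> nat sgraph set" where
  "Minor A = {G \<in> graphs. \<forall>H. is_minor H G \<longrightarrow> H \<in> A}"


section \<open>Surfaces\<close>

definition quotient_space :: "'a topology \<Rightarrow> ('a \<Rightarrow> 'a set) \<Rightarrow> 'a set topology" where
  "quotient_space X q =
     topology (\<lambda>U. U \<subseteq> q ` topspace X \<and> openin X {x \<in> topspace X. q x \<in> U})"

lemma openin_quotient_space:
  "openin (quotient_space X q) U \<longleftrightarrow>
     U \<subseteq> q ` topspace X \<and> openin X {x \<in> topspace X. q x \<in> U}"
proof -
  have "istopology (\<lambda>U. U \<subseteq> q ` topspace X \<and> openin X {x \<in> topspace X. q x \<in> U})"
    unfolding istopology_def
  proof (intro conjI allI impI)
    fix S T
    assume "S \<subseteq> q ` topspace X \<and> openin X {x \<in> topspace X. q x \<in> S}"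
      and "T \<subseteq> q ` topspace X \<and> openin X {x \<in> topspace X. q x \<in> T}"
    moreover have "{x \<in> topspace X. q x \<in> S \<inter> T} =
        {x \<in> topspace X. q x \<in> S} \<inter> {x \<in> topspace X. q x \<in> T}"
      by auto
    ultimately show "S \<inter> T \<subseteq> q ` topspace X" "openin X {x \<in> topspace X. q x \<in> S \<inter> T}"
      by (auto intro: openin_Int)
  next
    fix K
    assume K: "\<forall>S\<in>K. S \<subseteq> q ` topspace X \<and> openin X {x \<in> topspace X. q x \<in> S}"
    then show "\<Union>K \<subseteq> q ` topspace X"
      by blast
    have "{x \<in> topspace X. q x \<in> \<Union>K} = (\<Union>S\<in>K. {x \<in> topspace X. q x \<in> S})"
      by auto
    with K show "openin X {x \<in> topspace X. q x \<in> \<Union>K}"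
      by auto
  qed
  then show ?thesis
    unfolding quotient_space_def by (simp add: topology_inverse')
qed

lemma topspace_quotient_space: "topspace (quotient_space X q) = q ` topspace X"
proof -
  have "{x \<in> topspace X. q x \<in> q ` topspace X} = topspace X"
    by auto
  then have "openin (quotient_space X q) (q ` topspace X)"
    by (simp add: openin_quotient_space)
  then show ?thesis
    by (metis openin_quotient_space openin_subset openin_topspace subset_antisym)
qed

lemma quotient_map_quotient_space: "quotient_map X (quotient_space X q) q"
  unfolding quotient_map_def by (auto simp: topspace_quotient_space openin_quotient_space)

definition glue :: "'a topology \<Rightarrow> ('a \<Rightarrow> 'a \<Rightarrow> bool) \<Rightarrow> 'a set topology" where
  "glue X r = quotient_space X (\<lambda>x. {y. equivclp r x y})"

text \<open>The sphere is the one-point compactification of the complex plane. The holes are the open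
  unit discs about \<open>4j\<close>, for \<open>j < m\<close>, whose closures are pairwise disjoint.\<close>

definition centre :: "nat \<Rightarrow> complex" where
  "centre j = of_nat (4 * j)"

definition holed_sphere :: "nat \<Rightarrow> complex option topology" where
  "holed_sphere m =
     subtopology (Alexandroff_compactification euclidean)
       (- (\<Union>j<m. Some ` ball (centre j) 1))"

text \<open>The boundary circles numbered \<open>2i\<close> and \<open>2i + 1\<close> are identified by the reflection in the line
  midway between them. Since this is orientation reversing on the circles with their boundary
  orientation, each pair of circles gives an orientable handle (not a Klein handle).\<close>

definition sphere_with_handles :: "nat \<Rightarrow> complex option set topology" where
  "sphere_with_handles h =
     glue (holed_sphere (2 * h))
       (\<lambda>x y. \<exists>i<h. \<exists>w. norm w = 1 \<and>
          x = Some (centre (2 * i) + w) \<and> y = Some (centre (2 * i + 1) - cnj w))"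

text \<open>A crosscap identifies antipodal points of a boundary circle.\<close>

definition sphere_with_crosscaps :: "nat \<Rightarrow> complex option set topology" where
  "sphere_with_crosscaps k =
     glue (holed_sphere k)
       (\<lambda>x y. \<exists>j<k. \<exists>w. norm w = 1 \<and> x = Some (centre j + w) \<and> y = Some (centre j - w))"

text \<open>Embeddings need not be cellular: vertices are distinct points, edges are simple arcs joining
  their ends, and arcs meet each other and the vertices only at common ends.\<close>

definition embeds_in :: "'a sgraph \<Rightarrow> 'b topology \<Rightarrow> bool" where
  "embeds_in G X \<longleftrightarrow> (\<exists>\<phi> \<gamma>.
     inj_on \<phi> (verts G) \<and> \<phi> ` verts G \<subseteq> topspace X \<and>
     (\<forall>e\<in>edges G. pathin X (\<gamma> e) \<and> inj_on (\<gamma> e) {0..1} \<and>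
        {\<gamma> e 0, \<gamma> e 1} = \<phi> ` e \<and> \<gamma> e ` {0<..<1} \<inter> \<phi> ` verts G = {}) \<and>
     (\<forall>e\<in>edges G. \<forall>e'\<in>edges G. e \<noteq> e' \<longrightarrow> \<gamma> e ` {0<..<1} \<inter> \<gamma> e' ` {0<..<1} = {}))"


section \<open>Order-dependent genus classes\<close>

text \<open>By the classification of surfaces, the orientable surfaces are the spheres with \<open>h \<ge> 0\<close>
  handles, of Euler genus \<open>2h\<close>, and the non-orientable ones are the spheres with \<open>k \<ge> 1\<close>
  crosscaps, of Euler genus \<open>k\<close>.\<close>

definition OE :: "(nat \<Rightarrow> nat) \<Rightarrow> nat sgraph set" where
  "OE g = {G \<in> graphs. \<exists>h. 2 * h \<le> g (card (verts G)) \<and> embeds_in G (sphere_with_handles h)}"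

text \<open>If the genus bound is \<open>0\<close> there is no non-orientable surface available; by convention the
  graphs allowed are then the planar graphs.\<close>

definition NE :: "(nat \<Rightarrow> nat) \<Rightarrow> nat sgraph set" where
  "NE g = {G \<in> graphs.
     if g (card (verts G)) = 0 then embeds_in G (sphere_with_handles 0)
     else \<exists>k. 1 \<le> k \<and> k \<le> g (card (verts G)) \<and> embeds_in G (sphere_with_crosscaps k)}"

definition E :: "(nat \<Rightarrow> nat) \<Rightarrow> nat sgraph set" where
  "E g = {G \<in> graphs.
     (\<exists>h. 2 * h \<le> g (card (verts G)) \<and> embeds_in G (sphere_with_handles h)) \<or>
     (\<exists>k. 1 \<le> k \<and> k \<le> g (card (verts G)) \<and> embeds_in G (sphere_with_crosscaps k))}"


section \<open>Random unlabelled graphs\<close>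

definition unlabelled :: "nat sgraph set \<Rightarrow> nat sgraph set set" where
  "unlabelled B = B // graph_iso"

text \<open>For the classes above and \<open>n \<ge> 1\<close>, the set on which \<open>pmf_of_set\<close> is applied is finite and,
  since it contains the edgeless graph, nonempty.\<close>

definition random_unlabelled :: "nat sgraph set \<Rightarrow> nat \<Rightarrow> nat sgraph set pmf" where
  "random_unlabelled B n = pmf_of_set (unlabelled {G \<in> B. card (verts G) = n})"

definition prob_connected :: "nat sgraph set pmf \<Rightarrow> real" where
  "prob_connected R = measure_pmf.prob R (unlabelled connected_graphs)"

definition lower_density_at_least :: "nat set \<Rightarrow> real \<Rightarrow> bool" where
  "lower_density_at_least I \<delta> \<longleftrightarrow>
     (\<forall>\<^sub>F n in sequentially. real (card (I \<inter> {1..n})) \<ge> \<delta> * real n)"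

end

theory Submission
  imports Defs
begin

text \<open>Unlabelled graphs in the class grow at most exponentially: the number \<open>a\<^sub>n\<close> of isomorphism types
  on \<open>n\<close> vertices is at most \<open>C\<^sup>n\<close>. Hence \<open>a\<^sub>n \<le> K a\<^sub>n\<^sub>-\<^sub>1\<close> off a set of small upper density, and for such
  \<open>n\<close> adding an isolated vertex shows that a proportion at least \<open>1 / K\<close> of the types is disconnected.

  For the exponential bound, contract disjoint pairs of vertices that are adjacent or have the same
  neighbourhood: if a positive proportion of the vertices can be paired, then the graph is a bounded
  amount of data per vertex and edge on top of a smaller minor. What remains unpaired is independent
  with distinct neighbourhoods, and in a sparse minor-closed class there are few such vertices.

  Sparsity is Mader's theorem for a proper minor-closed class. For graphs on a surface an Euler-type
  inequality suffices for bipartite graphs, as passing to a maximal cut loses a factor \<open>2\<close>. It is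
  proved with winding numbers: the functions without zeros modulo those with a continuous logarithm
  take the place of cohomology, vertices are thickened to discs, and the resulting notion of
  embedding is inherited by minors.\<close>

text \<open>The genus bound depends on the order, so the classes in (a) are not minor-closed. For
  graphs of one order \<open>n\<close> the count is therefore made inside
  \<open>fat_class (g n)\<close>, where the bound is fixed and minors stay in the class. The
  recursion has to be uniform in that bound: the genus enters as an additive defect, hence only in
  the initial term, which has the form \<gamma>^O(\<gamma>), while the factor per vertex is
  independent of it. For \<gamma> = O(n / log n) the initial term is exponential in n; this is what
  the hypothesis on \<open>g\<close> is for.

  Two points shape the topology. On a non-orientable surface a map with a single pole is only known
  to have an even winding number there, so every separation argument has to produce an odd one. And
  the constant 2 in the bound for bipartite graphs matters because it is below 3: it bounds the
  number of vertices of degree at least 3 in an independent set by the number of vertices outside.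
  Vertices of degree at most 2 are counted through their neighbourhoods, once these are
  cliques.\<close>

section \<open>Continuous complex functions on subsets of a space\<close>

definition contX :: "'a topology => 'a set => ('a => complex) => bool" where
 "contX X S f \<longleftrightarrow> continuous_map (subtopology X S) euclidean f"

lemma contX_subset: "contX X S f ==> T <= S ==> contX X T f"
 unfolding contX_def using continuous_map_from_subtopology_mono by blast

lemma contX_cong: "contX X S f ==> (!!x. x \<in> S ==> f x = g x) ==> contX X S g"
 unfolding contX_def by (erule continuous_map_eq) auto

lemma contX_const [simp]: "contX X S (\<lambda>x. c)"
 unfolding contX_def by simp

lemma contX_compose:
 assumes "contX X S f" "continuous_on T h" "!!x. x \<in> S ==> f x \<in> T"
 shows "contX X S (\<lambda>x. h (f x))"
proof -
 have "continuous_map (subtopology X S) (top_of_set T) f"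
  using assms unfolding contX_def continuous_map_in_subtopology by auto
 moreover have "continuous_map (top_of_set T) euclidean h"
  using assms(2) by simp
 ultimately show ?thesis
  unfolding contX_def using continuous_map_compose[of _ _ f _ h] by (simp add: o_def)
qed

lemma contX_compose2:
 assumes "contX X S f" "contX X S g" "continuous_on UNIV (\<lambda>p. h (fst p) (snd p))"
 shows "contX X S (\<lambda>x. h (f x) (g x))"
proof -
 \<comment> \<open>The pair map lands in a product type with its euclidean topology, so its
   continuity is checked on open boxes.\<close>
 have "continuous_map (subtopology X S) euclidean (\<lambda>x. (f x, g x))"
  unfolding continuous_map_def
 proof (intro conjI allI impI)
  fix W :: "(complex \<times> complex) set" assume W: "openin euclidean W"
  let ?P = "{x \<in> topspace (subtopology X S). (f x, g x) \<in> W}"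
  have "\<exists>T. openin (subtopology X S) T \<and> x \<in> T \<and> T <= ?P" if x: "x \<in> ?P" for x
  proof -
   obtain A B where AB: "open A" "open B" "(f x, g x) \<in> A \<times> B" "A \<times> B <= W"
    using W x open_prod_elim[of W "(f x, g x)"] by auto
   let ?T = "{x \<in> topspace (subtopology X S). f x \<in> A} \<inter> {x \<in> topspace (subtopology X S). g x \<in> B}"
   have "openin (subtopology X S) ?T"
    using assms(1,2) AB unfolding contX_def by (intro openin_Int openin_continuous_map_preimage) auto
   then show ?thesis using x AB by (intro exI[of _ ?T]) auto
  qed
  then show "openin (subtopology X S) ?P" using openin_subopen by (metis (no_types, lifting))
 qed auto
 moreover have "continuous_map euclidean euclidean (\<lambda>p. h (fst p) (snd p))"
  using assms(3) by simp
 ultimately show ?thesis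
  unfolding contX_def
  using continuous_map_compose[of _ _ "\<lambda>x. (f x, g x)" _ "\<lambda>p. h (fst p) (snd p)"] by (simp add: o_def)
qed

lemma contX_mult: "contX X S f ==> contX X S g ==> contX X S (\<lambda>x. f x * g x)"
 by (rule contX_compose2) (auto intro!: continuous_intros)

lemma contX_add: "contX X S f ==> contX X S g ==> contX X S (\<lambda>x. f x + g x)"
 by (rule contX_compose2) (auto intro!: continuous_intros)

lemma contX_diff: "contX X S f ==> contX X S g ==> contX X S (\<lambda>x. f x - g x)"
 by (rule contX_compose2) (auto intro!: continuous_intros)

lemma contX_minus: "contX X S f ==> contX X S (\<lambda>x. - f x)"
 using contX_diff[of X S "\<lambda>_. 0" f] by simp

lemma contX_exp: "contX X S f ==> contX X S (\<lambda>x. exp (f x))"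
 by (rule contX_compose[where T = UNIV]) (auto intro!: continuous_intros)

lemma contX_inverse:
 "contX X S f ==> (!!x. x \<in> S ==> f x ~= 0) ==> contX X S (\<lambda>x. inverse (f x))"
 by (rule contX_compose[where T = "- {0}"]) (auto intro!: continuous_intros)

lemma contX_divide:
 "contX X S f ==> contX X S g ==> (!!x. x \<in> S ==> g x ~= 0) ==> contX X S (\<lambda>x. f x / g x)"
 using contX_mult[of X S f "\<lambda>x. inverse (g x)"] contX_inverse[of X S g] by (simp add: divide_inverse)

lemma contX_powi:
 "contX X S f ==> (!!x. x \<in> S ==> f x ~= 0) ==> contX X S (\<lambda>x. f x powi d)"
 by (rule contX_compose[where T = "- {0}"]) (auto intro!: continuous_intros)

lemma contX_local:
 assumes "!!x. x \<in> S ==> x \<in> topspace X ==> \<exists>V. openin X V \<and> x \<in> V \<and> contX X (V \<inter> S) f"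
 shows "contX X S f"
proof -
 obtain V where V: "!!x. x \<in> S \<inter> topspace X ==> openin X (V x) \<and> x \<in> V x \<and> contX X (V x \<inter> S) f"
  using assms by (metis IntE)
 show ?thesis
  unfolding contX_def
 proof (rule pasting_lemma[where I = "S \<inter> topspace X" and T = "\<lambda>x. V x \<inter> S" and f = "\<lambda>_. f"])
  fix i assume "i \<in> S \<inter> topspace X"
  then show "openin (subtopology X S) (V i \<inter> S)"
   using V openin_subtopology by blast
  show "continuous_map (subtopology (subtopology X S) (V i \<inter> S)) euclidean f"
   using V[OF \<open>i \<in> _\<close>] unfolding contX_def subtopology_subtopology
   by (simp add: inf.absorb2 Int_commute Int_left_commute)
 qed (use V in auto)
qed

lemma contX_open_Un:
 assumes "openin X A" "openin X B" "contX X (A \<inter> S) f" "contX X (B \<inter> S) f" "S <= A \<union> B"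
 shows "contX X S f"
 by (rule contX_local) (use assms in blast)

lemma contX_closed_Un:
 assumes "closedin X A" "closedin X B" "contX X (A \<inter> S) f" "contX X (B \<inter> S) f" "S <= A \<union> B"
 shows "contX X S f"
 unfolding contX_def
proof (rule pasting_lemma_closed[where I = "{A, B}" and T = "\<lambda>A. A \<inter> S" and f = "\<lambda>_. f"])
 fix i assume i: "i \<in> {A, B}"
 then show "closedin (subtopology X S) (i \<inter> S)"
  using assms closedin_subtopology by blast
 show "continuous_map (subtopology (subtopology X S) (i \<inter> S)) euclidean f"
  using i assms unfolding contX_def subtopology_subtopology
  by (auto simp add: inf.absorb2 Int_commute Int_left_commute)
qed (use assms in auto)

definition cmap :: "'a topology => 'a set => ('a => complex) => bool" where
 "cmap X S f \<longleftrightarrow> contX X S f \<and> (\<forall>x\<in>S. f x ~= 0)"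

lemma cmap_subset: "cmap X S f ==> T <= S ==> cmap X T f"
 unfolding cmap_def using contX_subset by blast

lemma cmap_cong: "cmap X S f ==> (!!x. x \<in> S ==> f x = g x) ==> cmap X S g"
 unfolding cmap_def using contX_cong[of X S f g] by auto

lemma cmap_one [simp]: "cmap X S (\<lambda>_. 1)"
 unfolding cmap_def by simp

lemma cmap_mult: "cmap X S f ==> cmap X S g ==> cmap X S (\<lambda>x. f x * g x)"
 unfolding cmap_def using contX_mult by auto

lemma cmap_powi: "cmap X S f ==> cmap X S (\<lambda>x. f x powi d)"
 unfolding cmap_def using contX_powi[of X S f d] by auto

lemma cmap_prod: "(!!i. i \<in> I ==> cmap X S (f i)) ==> cmap X S (\<lambda>x. \<Prod>i\<in>I. f i x)"
 by (induction I rule: infinite_finite_induct) (auto intro: cmap_mult)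

lemma cmap_exp: "contX X S f ==> cmap X S (\<lambda>x. exp (f x))"
 unfolding cmap_def using contX_exp by auto

lemma cmap_open_Un:
 assumes "openin X A" "openin X B" "cmap X (A \<inter> S) f" "cmap X (B \<inter> S) f" "S <= A \<union> B"
 shows "cmap X S f"
 using assms contX_open_Un[of X A B S f] unfolding cmap_def by blast

lemma cmap_closed_Un:
 assumes "closedin X A" "closedin X B" "cmap X (A \<inter> S) f" "cmap X (B \<inter> S) f" "S <= A \<union> B"
 shows "cmap X S f"
 using assms contX_closed_Un[of X A B S f] unfolding cmap_def by blast

section \<open>Logarithms and winding numbers in the plane\<close>

text \<open>The maps that are trivial in cohomology: modulo them, the maps without zeros on a
  compact Hausdorff space form its first integral cohomology group.\<close>

definition haslog :: "'a topology => 'a set => ('a => complex) => bool" where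
 "haslog X S f \<longleftrightarrow> (\<exists>\<theta>. contX X S \<theta> \<and> (\<forall>x\<in>S. f x = exp (\<theta> x)))"

text \<open>The values lie in the discrete set of multiples of 2 pi i. Hence two logarithms of one
  map on a connected set differ by a single such constant.\<close>

lemma exp_one_const:
 assumes "connectedin X S" "contX X S g" "!!x. x \<in> S ==> exp (g x) = 1"
 obtains k :: int where "!!x. x \<in> S ==> g x = 2 * of_int k * of_real pi * \<i>"
proof (cases "S = {}")
 case False
 then obtain a where a: "a \<in> S" by blast
 have S: "S <= topspace X" using assms(1) connectedin_subset_topspace by blast
 have "connectedin (subtopology X S) S"
  using assms(1) by (simp add: connectedin_subtopology)
 then have "connectedin euclidean (g ` S)"
  using assms(2) unfolding contX_def by (rule connectedin_continuous_map_image[rotated])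
 then have con: "connected (g ` S)" by simp
 have int: "\<exists>k::int. g x = 2 * of_int k * of_real pi * \<i>" if "x \<in> S" for x
  using assms(3)[OF that] complex_eq_iff exp_eq_1 by (auto simp: exp_eq_1 complex_eq_iff)
 have far: "2 * pi \<le> cmod (g x - g y)" if "x \<in> S" "y \<in> S" "g x ~= g y" for x y
 proof -
  obtain k l :: int where kl: "g x = 2 * of_int k * of_real pi * \<i>" "g y = 2 * of_int l * of_real pi * \<i>"
   using int[OF \<open>x \<in> S\<close>] int[OF \<open>y \<in> S\<close>] by blast
  then have "g x - g y = complex_of_real (2 * pi * of_int (k - l)) * \<i>"
   by (simp add: algebra_simps)
  then have "cmod (g x - g y) = 2 * pi * \<bar>of_int (k - l)\<bar>"
   by (simp add: norm_mult abs_mult del: of_int_diff of_real_mult)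
  moreover have "k ~= l" using kl that by auto
  then have "1 \<le> \<bar>real_of_int (k - l)\<bar>" by linarith
  ultimately show ?thesis using pi_gt_zero by simp
 qed
 have "finite {g a} \<and> (\<exists>z. g ` S = {z})"
 proof -
  have "g ` S <= {g a}"
  proof (rule ccontr)
   assume "\<not> g ` S <= {g a}"
   then obtain b where b: "b \<in> S" "g b ~= g a" by auto
   \<comment> \<open>Distinct values are at least 2 pi apart, so this ball and the outside of a
     smaller closed ball would separate the image.\<close>
   have "ball (g a) (2*pi) \<inter> g ` S <= {g a}"
    using far a by (force simp: dist_norm)
   moreover have "open (ball (g a) (2*pi))" "open (- cball (g a) pi)" by auto
   moreover have "g ` S <= ball (g a) (2*pi) \<union> - cball (g a) pi"
    using pi_gt_zero by (auto simp: dist_norm simp del: pi_gt_zero)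
   moreover have "ball (g a) (2*pi) \<inter> - cball (g a) pi \<inter> g ` S = {}"
    using far a by (force simp: dist_norm)
   moreover have "ball (g a) (2*pi) \<inter> g ` S ~= {}"
   proof -
    have "g a \<in> ball (g a) (2*pi) \<inter> g ` S" using a pi_gt_zero by (simp del: pi_gt_zero)
    then show ?thesis by blast
   qed
   moreover have "- cball (g a) pi \<inter> g ` S ~= {}"
   proof -
    have "2 * pi \<le> cmod (g a - g b)" using far[OF a b(1)] b by metis
    then have "g b \<in> - cball (g a) pi \<inter> g ` S" using b pi_gt_zero by (simp add: dist_norm del: pi_gt_zero)
    then show ?thesis by blast
   qed
   ultimately show False using con unfolding connected_def by blast
  qed
  then show ?thesis using a by auto
 qed
 then have "\<forall>x\<in>S. g x = g a" using a by (metis imageI singletonD)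
 then show ?thesis using int[OF a] that by metis
qed (use that in auto)

lemma exp_one_const_on:
 assumes "connected S" "continuous_on S g" "!!x. x \<in> S ==> exp (g x :: complex) = 1"
 obtains k :: int where "!!x. x \<in> S ==> g x = 2 * of_int k * of_real pi * \<i>"
 using exp_one_const[of euclidean S g] assms unfolding contX_def by auto

text \<open>\<open>exp\<close> maps the half-plane \<open>H\<close> onto the punctured disc. Over
  \<open>H\<close> the map has a logarithm \<open>L\<close>, and translation by 2 pi i changes
  \<open>L\<close> by a constant 2 pi i \<open>d\<close>. Subtracting \<open>d\<close> times the
  identity makes it periodic, so that it descends to the disc; \<open>d\<close> is the winding
  number.\<close>

lemma punctured_ball_degree:
 fixes f :: "complex => complex"
 assumes "r > 0" "continuous_on (ball 0 r - {0}) f" "!!z. z \<in> ball 0 r - {0} ==> f z ~= 0"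
 obtains d :: int and \<theta> where "continuous_on (ball 0 r - {0}) \<theta>"
  "!!z. z \<in> ball 0 r - {0} ==> f z = z powi d * exp (\<theta> z)"
proof -
 define H where "H = {t. Re t < ln r}"
 have Hc: "convex H" unfolding H_def by (rule convex_halfspace_Re_lt)
 have expH: "exp t \<in> ball 0 r - {0}" if "t \<in> H" for t
  using that assms(1) by (simp add: H_def ln_less_cancel_iff flip: exp_less_cancel_iff[of "Re t" "ln r"])
 have HE: "\<exists>t\<in>H. exp t = z" if "z \<in> ball 0 r - {0}" for z
 proof (rule bexI[of _ "Ln z"])
  show "exp (Ln z) = z" using that by simp
  show "Ln z \<in> H" using that assms(1) unfolding H_def by auto
 qed
 have cfe: "continuous_on H (\<lambda>t. f (exp t))"
  by (rule continuous_on_compose2[OF assms(2)]) (use expH in \<open>auto intro!: continuous_intros\<close>)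
 obtain L where L: "continuous_on H L" "!!t. t \<in> H ==> f (exp t) = exp (L t)"
  using continuous_logarithm_on_contractible[OF cfe convex_imp_contractible[OF Hc]] assms(3) expH by metis
 have per: "t + 2 * of_real pi * \<i> \<in> H" if "t \<in> H" for t using that by (simp add: H_def)
 have c2: "continuous_on H (\<lambda>t. L (t + 2 * of_real pi * \<i>) - L t)"
  by (intro continuous_on_diff L continuous_on_compose2[OF L(1)]) (use per in \<open>auto intro!: continuous_intros\<close>)
 have e1: "exp (L (t + 2 * of_real pi * \<i>) - L t) = 1" if "t \<in> H" for t
  using L(2)[OF that] L(2)[OF per[OF that]] assms(3)[OF expH[OF that]]
  by (simp add: exp_add exp_diff)
 obtain d :: int where d: "!!t. t \<in> H ==> L (t + 2 * of_real pi * \<i>) - L t = 2 * of_int d * of_real pi * \<i>"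
  using exp_one_const_on[OF convex_connected[OF Hc] c2 e1] by blast
 define M where "M t = L t - of_int d * t" for t
 have Mc: "continuous_on H M" unfolding M_def by (intro continuous_intros L)
 have Mper: "M (t + 2 * of_real pi * \<i>) = M t" if "t \<in> H" for t
  using d[OF that] unfolding M_def by (simp add: algebra_simps)
 have Mnat: "M (t + 2 * of_nat n * of_real pi * \<i>) = M t" if "t \<in> H" for t n
 proof (induction n)
  case (Suc n)
  have "t + 2 * of_nat n * of_real pi * \<i> \<in> H" using that by (simp add: H_def)
  from Mper[OF this] Suc show ?case by (simp add: algebra_simps)
 qed simp
 have Meq: "M s = M t" if "s \<in> H" "t \<in> H" "exp s = exp t" for s t
 proof -
  obtain n :: int where n: "s = t + of_int (2 * n) * of_real pi * \<i>"
   using \<open>exp s = exp t\<close> exp_eq[of s t] by (auto simp: mult.assoc)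
  show ?thesis
  proof (cases "n \<ge> 0")
   case True
   then show ?thesis using n Mnat[OF \<open>t \<in> H\<close>, of "nat n"] by (simp add: algebra_simps)
  next
   case False
   then have "of_nat (nat (- n)) = (- of_int n :: complex)"
    by (metis linear nat_0_le neg_0_le_iff_le of_int_minus of_int_of_nat_eq)
   then have "t = s + 2 * of_nat (nat (- n)) * of_real pi * \<i>"
    using n by (simp add: algebra_simps)
   then show ?thesis using Mnat[OF \<open>s \<in> H\<close>, of "nat (- n)"] by simp
  qed
 qed
 \<comment> \<open>\<open>Ln\<close> jumps by 2 pi i across its cut, but \<open>M\<close> has that
   period and does not see the jump.\<close>
 define \<theta> where "\<theta> z = M (Ln z)" for z
 have th: "\<theta> (exp t) = M t" if "t \<in> H" for t
  unfolding \<theta>_def by (rule Meq) (use that expH[OF that] in \<open>auto simp: H_def\<close>)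
 have opH: "open H" unfolding H_def by (rule open_halfspace_Re_lt)
 have "isCont \<theta> z0" if z0: "z0 \<in> ball 0 r - {0}" for z0
 proof -
  \<comment> \<open>A branch of the logarithm that is continuous around \<open>z0\<close>, wherever
    \<open>z0\<close> lies with respect to the cut of \<open>Ln\<close>.\<close>
  define h where "h z = Ln (z / z0) + Ln z0" for z
  define B where "B = ball z0 (cmod z0) \<inter> (ball 0 r - {0})"
  have opB: "open B" unfolding B_def by (intro open_Int open_ball open_Diff) auto
  have z0B: "z0 \<in> B" unfolding B_def using z0 by auto
  have Re: "z / z0 \<notin> \<real>\<^sub>\<le>\<^sub>0" if "z \<in> B" for z
  proof -
   have "cmod (z0 - z) < cmod z0" using that by (auto simp: B_def dist_norm)
   then have "cmod (1 - z / z0) < 1"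
    using z0 by (simp add: diff_divide_eq_iff norm_divide)
   then have "0 < Re (z / z0)"
    using abs_Re_le_cmod[of "1 - z / z0"] by auto
   then show ?thesis by (auto simp: complex_nonpos_Reals_iff)
  qed
  have eh: "exp (h z) = z" if "z \<in> B" for z
   using that z0 unfolding h_def B_def by (simp add: exp_add)
  have hH: "h z \<in> H" if "z \<in> B" for z
  proof -
   have "exp (Re (h z)) = cmod z" using eh[OF that] by (metis norm_exp_eq_Re)
   also have "\<dots> < r" using that by (simp add: B_def)
   finally show ?thesis unfolding H_def using assms(1)
    by (metis exp_less_cancel_iff exp_ln mem_Collect_eq)
  qed
  have "continuous_on B h" unfolding h_def
   by (intro continuous_intros) (use Re z0 in auto)
  then have "continuous_on B (\<lambda>z. M (h z))"
   by (intro continuous_on_compose2[OF Mc]) (use hH in auto)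
  moreover have "M (h z) = \<theta> z" if "z \<in> B" for z
   using th[OF hH[OF that]] eh[OF that] by simp
  ultimately have "continuous_on B \<theta>" using continuous_on_cong by (metis (no_types, lifting))
  then show ?thesis using opB z0B continuous_on_eq_continuous_at by blast
 qed
 then have "continuous_on (ball 0 r - {0}) \<theta>"
  by (simp add: continuous_at_imp_continuous_on)
 moreover have "f z = z powi d * exp (\<theta> z)" if z: "z \<in> ball 0 r - {0}" for z
 proof -
  obtain t where t: "t \<in> H" "exp t = z" using HE[OF z] by blast
  have "f z = exp (L t)" using L(2)[OF t(1)] t(2) by simp
  also have "L t = of_int d * t + \<theta> z" using th[OF t(1)] t(2) by (simp add: M_def)
  also have "exp \<dots> = exp t powi d * exp (\<theta> z)" by (simp add: exp_add exp_power_int mult.commute)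
  finally show ?thesis using t(2) by simp
 qed
 ultimately show ?thesis using that by blast
qed

text \<open>Once around the circle a logarithm of the \<open>d\<close>-th power grows by 2 pi i
  \<open>d\<close>, while a function on the circle returns to its initial value.\<close>

lemma circle_power_no_log:
 fixes \<theta> :: "complex => complex"
 assumes "s > 0" "continuous_on (sphere 0 s) \<theta>" "!!z. z \<in> sphere 0 s ==> z powi d = exp (\<theta> z)"
 shows "d = 0"
proof -
 define c where "c t = of_real s * exp (\<i> * of_real t)" for t :: real
 have cs: "c t \<in> sphere 0 s" for t unfolding c_def using assms(1) by (simp add: norm_mult)
 define g where "g t = \<theta> (c t) - of_int d * (of_real (ln s) + \<i> * of_real t)" for t :: real
 have "continuous_on UNIV g" unfolding g_def
  by (intro continuous_intros continuous_on_compose2[OF assms(2)]) (use cs in \<open>auto simp: c_def intro!: continuous_intros\<close>)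
 moreover have "exp (g t) = 1" for t
 proof -
  have "exp (of_real (ln s) + \<i> * of_real t) = c t"
   unfolding c_def using assms(1) by (simp add: exp_add exp_of_real)
  then have "exp (of_int d * (of_real (ln s) + \<i> * of_real t)) = c t powi d"
   by (metis exp_power_int mult.commute)
  moreover have "c t ~= 0" using assms(1) by (simp add: c_def)
  ultimately show ?thesis using assms(3)[OF cs[of t]] unfolding g_def by (simp add: exp_diff)
 qed
 ultimately obtain k :: int where k: "!!t. g t = 2 * of_int k * of_real pi * \<i>"
  using exp_one_const_on[of UNIV g] by auto
 have "c (2 * pi) = c 0" unfolding c_def by (simp add: mult.commute[of \<i>])
 then have "g 0 - g (2 * pi) = of_int d * (\<i> * of_real (2 * pi))"
  unfolding g_def by (simp add: algebra_simps)
 then show ?thesis using k by simp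
qed

text \<open>Radial extension turns a map on the circle into one on a punctured disc.\<close>

lemma circle_degree:
 assumes "continuous_on (sphere 0 1) f" "!!w. w \<in> sphere 0 1 ==> f w ~= (0::complex)"
 obtains d :: int and \<theta> where "continuous_on (sphere 0 1) \<theta>"
  "!!w. w \<in> sphere 0 1 ==> f w = w powi d * exp (\<theta> w)"
proof -
 have "continuous_on (ball 0 2 - {0}) (\<lambda>z. f (z / of_real (cmod z)))"
  by (rule continuous_on_compose2[OF assms(1)]) (auto intro!: continuous_intros simp: norm_divide split: if_splits)
 then obtain d :: int and \<theta> where d: "continuous_on (ball 0 2 - {0}) \<theta>"
  "!!z. z \<in> ball 0 2 - {0} ==> f (z / of_real (cmod z)) = z powi d * exp (\<theta> z)"
  by (rule punctured_ball_degree[rotated]) (use assms(2) in \<open>auto simp: norm_divide\<close>)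
 show ?thesis
 proof
  show "continuous_on (sphere 0 1) \<theta>" by (rule continuous_on_subset[OF d(1)]) auto
  show "f w = w powi d * exp (\<theta> w)" if "w \<in> sphere 0 1" for w
  proof -
   have "w ~= 0" "cmod w = 1" using that by auto
   then show ?thesis using d(2)[of w] by simp
  qed
 qed
qed

section \<open>Charts onto the plane\<close>

text \<open>The image is always the whole plane: every continuous map without zeros on
  \<open>U\<close> then has a logarithm, and discs of any radius are available.\<close>

definition chart :: "'a topology => 'a set => ('a => complex) => (complex => 'a) => bool" where
 "chart X U \<kappa> \<kappa>' \<longleftrightarrow> openin X U \<and> homeomorphic_maps (subtopology X U) euclidean \<kappa> \<kappa>'"

lemma chartD:
 assumes "chart X U \<kappa> \<kappa>'"
 shows "openin X U" "U <= topspace X" "contX X U \<kappa>" "\<kappa>' z \<in> U" "\<kappa> (\<kappa>' z) = z"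
  "x \<in> U ==> \<kappa>' (\<kappa> x) = x" "continuous_map euclidean X \<kappa>'"
proof -
 show op: "openin X U" and sub: "U <= topspace X"
  using assms openin_subset unfolding chart_def by auto
 have h: "continuous_map (subtopology X U) euclidean \<kappa>" "continuous_map euclidean (subtopology X U) \<kappa>'"
  "!!x. x \<in> topspace (subtopology X U) ==> \<kappa>' (\<kappa> x) = x" "!!y. y \<in> topspace euclidean ==> \<kappa> (\<kappa>' y) = y"
  using assms unfolding chart_def homeomorphic_maps_def by auto
 show "contX X U \<kappa>" using h(1) unfolding contX_def .
 show "\<kappa>' z \<in> U" using h(2) by (auto simp: continuous_map_in_subtopology)
 show "\<kappa> (\<kappa>' z) = z" using h(4) by simp
 show "x \<in> U ==> \<kappa>' (\<kappa> x) = x" using h(3) sub by auto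
 show "continuous_map euclidean X \<kappa>'" using h(2) by (simp add: continuous_map_in_subtopology)
qed

lemma chart_open:
 assumes "chart X U \<kappa> \<kappa>'" "open W"
 shows "openin X {x \<in> U. \<kappa> x \<in> W}"
proof -
 have "openin (subtopology X U) {x \<in> topspace (subtopology X U). \<kappa> x \<in> W}"
  using chartD(3)[OF assms(1)] assms(2) unfolding contX_def
  by (intro openin_continuous_map_preimage) auto
 moreover have "{x \<in> topspace (subtopology X U). \<kappa> x \<in> W} = {x \<in> U. \<kappa> x \<in> W}"
  using chartD(2)[OF assms(1)] by auto
 ultimately show ?thesis
  using chartD(1)[OF assms(1)] openin_trans_full by metis
qed

lemma chart_image: "chart X U \<kappa> \<kappa>' ==> {x \<in> U. \<kappa> x \<in> W} = \<kappa>' ` W"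
 using chartD(4,5,6)[of X U \<kappa> \<kappa>'] by (auto simp: image_iff) metis

lemma chart_compact:
 assumes "chart X U \<kappa> \<kappa>'" "compact W"
 shows "compactin X {x \<in> U. \<kappa> x \<in> W}"
 unfolding chart_image[OF assms(1)]
 using image_compactin[OF _ chartD(7)[OF assms(1)], of W] assms(2) by simp

lemma chart_connected:
 assumes "chart X U \<kappa> \<kappa>'" "connected W"
 shows "connectedin X {x \<in> U. \<kappa> x \<in> W}"
 unfolding chart_image[OF assms(1)]
 using connectedin_continuous_map_image[OF chartD(7)[OF assms(1)], of W] assms(2) by simp

lemma chart_pull:
 assumes "chart X U \<kappa> \<kappa>'" "contX X S f" "!!z. z \<in> T ==> \<kappa>' z \<in> S"
 shows "continuous_on T (\<lambda>z. f (\<kappa>' z))"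
proof -
 have "continuous_map (top_of_set T) (subtopology X S) \<kappa>'"
  using chartD(7)[OF assms(1)] assms(3)
  by (auto simp: continuous_map_in_subtopology continuous_map_from_subtopology)
 then have "continuous_map (top_of_set T) euclidean (f \<circ> \<kappa>')"
  using assms(2) unfolding contX_def by (rule continuous_map_compose)
 then show ?thesis by (simp add: o_def)
qed

lemma chart_shift:
 assumes "chart X U \<kappa> \<kappa>'"
 shows "chart X U (\<lambda>x. \<kappa> x - c) (\<lambda>z. \<kappa>' (z + c))"
proof -
 have "continuous_map euclidean euclidean (\<lambda>z::complex. z + c)" by (simp add: continuous_on_add)
 then have "continuous_map euclidean (subtopology X U) (\<kappa>' \<circ> (\<lambda>z. z + c))"
  using continuous_map_compose chartD(4,7)[OF assms]
  by (metis (no_types, lifting) assms chart_def homeomorphic_maps_def)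
 moreover have "continuous_map (subtopology X U) euclidean (\<lambda>x. \<kappa> x - c)"
  using contX_diff[OF chartD(3)[OF assms] contX_const] unfolding contX_def .
 ultimately show ?thesis
  using assms chartD(4-6)[OF assms] unfolding chart_def homeomorphic_maps_def by (simp add: o_def)
qed

section \<open>Germs of maps at a puncture\<close>

text \<open>For germs without zeros this is equality of the winding numbers around \<open>a\<close>.
  The point \<open>a\<close> itself is left out, so it may be a pole of either function.\<close>

definition geq :: "'a topology => 'a => ('a => complex) => ('a => complex) => bool" where
 "geq X a f g \<longleftrightarrow> (\<exists>V \<theta>. openin X V \<and> a \<in> V \<and> contX X (V - {a}) \<theta> \<and>
   (\<forall>x\<in>V - {a}. f x = g x * exp (\<theta> x)))"

definition gcmap :: "'a topology => 'a => ('a => complex) => bool" where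
 "gcmap X a f \<longleftrightarrow> (\<exists>V. openin X V \<and> a \<in> V \<and> cmap X (V - {a}) f)"

text \<open>A generator at \<open>a\<close> plays the role of \<open>z\<close> at the origin of the plane: it has winding number
 \<open>1\<close> or \<open>-1\<close> around \<open>a\<close>, expressed without choosing an orientation.\<close>

definition gen :: "'a topology => 'a => ('a => complex) => bool" where
 "gen X a h \<longleftrightarrow> gcmap X a h \<and> (\<forall>g. gcmap X a g --> (\<exists>d::int. geq X a g (\<lambda>x. h x powi d))) \<and>
   (\<forall>d::int. geq X a (\<lambda>x. h x powi d) (\<lambda>_. 1) --> d = 0)"

lemma geq_refl: "a \<in> topspace X ==> geq X a f f"
 unfolding geq_def by (intro exI[of _ "topspace X"] exI[of _ "\<lambda>_. 0"]) auto

lemma geq_sym: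
 assumes "geq X a f g" shows "geq X a g f"
proof -
 obtain V \<theta> where "openin X V" "a \<in> V" "contX X (V - {a}) \<theta>" "\<forall>x\<in>V - {a}. f x = g x * exp (\<theta> x)"
  using assms unfolding geq_def by blast
 then show ?thesis unfolding geq_def
  by (intro exI[of _ V] exI[of _ "\<lambda>x. - \<theta> x"]) (auto intro: contX_minus simp: exp_minus)
qed

lemma geq_mult:
 assumes "geq X a f g" "geq X a f' g'" shows "geq X a (\<lambda>x. f x * f' x) (\<lambda>x. g x * g' x)"
proof -
 obtain V \<theta> V' \<theta>' where "openin X V" "a \<in> V" "contX X (V - {a}) \<theta>" "\<forall>x\<in>V - {a}. f x = g x * exp (\<theta> x)"
  "openin X V'" "a \<in> V'" "contX X (V' - {a}) \<theta>'" "\<forall>x\<in>V' - {a}. f' x = g' x * exp (\<theta>' x)"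
  using assms unfolding geq_def by blast
 then show ?thesis unfolding geq_def
  by (intro exI[of _ "V \<inter> V'"] exI[of _ "\<lambda>x. \<theta> x + \<theta>' x"])
   (auto intro!: contX_add openin_Int simp: exp_add elim: contX_subset)
qed

lemma geq_trans:
 assumes "geq X a f g" "geq X a g h" shows "geq X a f h"
proof -
 obtain V \<theta> V' \<theta>' where "openin X V" "a \<in> V" "contX X (V - {a}) \<theta>" "\<forall>x\<in>V - {a}. f x = g x * exp (\<theta> x)"
  "openin X V'" "a \<in> V'" "contX X (V' - {a}) \<theta>'" "\<forall>x\<in>V' - {a}. g x = h x * exp (\<theta>' x)"
  using assms unfolding geq_def by blast
 then show ?thesis unfolding geq_def
  by (intro exI[of _ "V \<inter> V'"] exI[of _ "\<lambda>x. \<theta> x + \<theta>' x"])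
   (auto intro!: contX_add openin_Int simp: exp_add elim: contX_subset)
qed

lemma geq_powi:
 assumes "geq X a f g" shows "geq X a (\<lambda>x. f x powi d) (\<lambda>x. g x powi d)"
proof -
 obtain V \<theta> where "openin X V" "a \<in> V" "contX X (V - {a}) \<theta>" "\<forall>x\<in>V - {a}. f x = g x * exp (\<theta> x)"
  using assms unfolding geq_def by blast
 then show ?thesis unfolding geq_def
  by (intro exI[of _ V] exI[of _ "\<lambda>x. of_int d * \<theta> x"])
   (auto intro!: contX_mult simp: power_int_mult_distrib exp_power_int mult.commute)
qed

lemma geq_cong:
 assumes "openin X V" "a \<in> V" "!!x. x \<in> V - {a} ==> f x = g x"
 shows "geq X a f g"
 unfolding geq_def by (intro exI[of _ V] exI[of _ "\<lambda>_. 0"]) (use assms in auto)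

lemma gcmapI: "openin X V ==> a \<in> V ==> cmap X (V - {a}) f ==> gcmap X a f"
 unfolding gcmap_def by blast

lemma gcmap_powi: "gcmap X a f ==> gcmap X a (\<lambda>x. f x powi d)"
 unfolding gcmap_def using cmap_powi by blast

lemma gcmap_geq:
 assumes "geq X a f g" "gcmap X a g" shows "gcmap X a f"
proof -
 obtain V \<theta> W where V: "openin X V" "a \<in> V" "contX X (V - {a}) \<theta>" "\<forall>x\<in>V - {a}. f x = g x * exp (\<theta> x)"
  "openin X W" "a \<in> W" "cmap X (W - {a}) g"
  using assms unfolding geq_def gcmap_def by blast
 have "cmap X (V \<inter> W - {a}) (\<lambda>x. g x * exp (\<theta> x))"
  by (intro cmap_mult cmap_exp) (use V in \<open>auto elim: cmap_subset contX_subset\<close>)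
 then have "cmap X (V \<inter> W - {a}) f" by (rule cmap_cong) (use V in auto)
 then show ?thesis using V by (intro gcmapI[of X "V \<inter> W"]) auto
qed

lemma gcmap_nz:
 assumes "gcmap X a f"
 obtains V where "openin X V" "a \<in> V" "!!x. x \<in> V - {a} ==> f x ~= 0"
 using assms unfolding gcmap_def cmap_def by blast

lemma gen_gcmap: "gen X a h ==> gcmap X a h"
 unfolding gen_def by blast

lemma gen_exists: "gen X a h ==> gcmap X a g ==> \<exists>d::int. geq X a g (\<lambda>x. h x powi d)"
 unfolding gen_def by blast

lemma gen_powi_add:
 assumes "gcmap X a h" shows "geq X a (\<lambda>x. h x powi d * h x powi e) (\<lambda>x. h x powi (d + e))"
proof -
 obtain V where "openin X V" "a \<in> V" "!!x. x \<in> V - {a} ==> h x ~= 0" using gcmap_nz[OF assms] by blast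
 then show ?thesis by (intro geq_cong[of X V]) (auto simp: power_int_add)
qed

lemma gen_powi_unique:
 assumes "gen X a h" "geq X a (\<lambda>x. h x powi d) (\<lambda>x. h x powi e)" shows "d = e"
proof -
 have a: "a \<in> topspace X" using assms(2) openin_subset unfolding geq_def by blast
 note h = gen_gcmap[OF assms(1)]
 have "geq X a (\<lambda>x. h x powi d * h x powi (-e)) (\<lambda>x. h x powi e * h x powi (-e))"
  by (rule geq_mult[OF assms(2) geq_refl[OF a]])
 from geq_trans[OF geq_trans[OF geq_sym[OF gen_powi_add[OF h]] this] gen_powi_add[OF h]]
 have "geq X a (\<lambda>x. h x powi (d - e)) (\<lambda>_. 1)" by simp
 then have "d - e = 0" using assms(1) unfolding gen_def by blast
 then show ?thesis by simp
qed

text \<open>Each generator is a power of the other, and the two exponents are inverse to each other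
  in the integers.\<close>

lemma gen_unique:
 assumes "gen X a f" "gen X a g"
 obtains s :: int where "s = 1 \<or> s = -1" "geq X a g (\<lambda>x. f x powi s)"
proof -
 obtain s t :: int where s: "geq X a g (\<lambda>x. f x powi s)" and t: "geq X a f (\<lambda>x. g x powi t)"
  using gen_exists[OF assms(1) gen_gcmap[OF assms(2)]] gen_exists[OF assms(2) gen_gcmap[OF assms(1)]] by blast
 have "geq X a f (\<lambda>x. (f x powi s) powi t)"
  by (rule geq_trans[OF t geq_powi[OF s]])
 then have "geq X a (\<lambda>x. f x powi 1) (\<lambda>x. f x powi (s * t))"
  by (simp add: power_int_mult)
 then have "1 = s * t" by (rule gen_powi_unique[OF assms(1)])
 then have "s = 1 \<or> s = -1" by (metis zmult_eq_1_iff)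
 with s that show ?thesis by blast
qed

lemma gen_geq:
 assumes "gen X a f" "geq X a g f" shows "gen X a g"
 unfolding gen_def
proof (intro conjI allI impI)
 show "gcmap X a g" by (rule gcmap_geq[OF assms(2) gen_gcmap[OF assms(1)]])
next
 fix k assume "gcmap X a k"
 then obtain d :: int where d: "geq X a k (\<lambda>x. f x powi d)" using gen_exists[OF assms(1)] by blast
 show "\<exists>d::int. geq X a k (\<lambda>x. g x powi d)"
  using geq_trans[OF d geq_powi[OF geq_sym[OF assms(2)]]] by blast
next
 fix d :: int assume d: "geq X a (\<lambda>x. g x powi d) (\<lambda>_. 1)"
 have "geq X a (\<lambda>x. f x powi d) (\<lambda>_. 1)"
  by (rule geq_trans[OF geq_powi[OF geq_sym[OF assms(2)]] d])
 then show "d = 0" using assms(1) unfolding gen_def by blast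
qed

lemma gen_powi_neg:
 assumes "gen X a f" shows "gen X a (\<lambda>x. f x powi -1)"
 unfolding gen_def
proof (intro conjI allI impI)
 show "gcmap X a (\<lambda>x. f x powi - 1)" by (rule gcmap_powi[OF gen_gcmap[OF assms]])
next
 fix k assume "gcmap X a k"
 then obtain d :: int where "geq X a k (\<lambda>x. f x powi d)" using gen_exists[OF assms(1) \<open>gcmap X a k\<close>] by blast
 then have "geq X a k (\<lambda>x. (f x powi -1) powi (-d))" by (simp only: power_int_mult[symmetric]) simp
 then show "\<exists>d::int. geq X a k (\<lambda>x. (f x powi -1) powi d)" by blast
next
 fix d :: int assume "geq X a (\<lambda>x. (f x powi -1) powi d) (\<lambda>_. 1)"
 then have "geq X a (\<lambda>x. f x powi (-d)) (\<lambda>_. 1)" by (simp only: power_int_mult[symmetric]) simp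
 then show "d = 0" using assms unfolding gen_def by fastforce
qed

text \<open>In the chart this is the function \<open>z\<close>: \<open>punctured_ball_degree\<close>
  writes every germ as a power of it, and \<open>circle_power_no_log\<close> makes the exponent
  unique.\<close>

lemma gen_chart:
 assumes ch: "chart X U \<kappa> \<kappa>'" and b: "b \<in> U"
 shows "gen X b (\<lambda>x. \<kappa> x - \<kappa> b)"
proof -
 define k where "k x = \<kappa> x - \<kappa> b" for x
 define k' where "k' z = \<kappa>' (z + \<kappa> b)" for z
 have c: "chart X U k k'" using chart_shift[OF ch] unfolding k_def k'_def .
 have kb: "k b = 0" by (simp add: k_def)
 have inj: "x = b" if "x \<in> U" "k x = 0" for x using chartD(6)[OF c] that b kb by metis
 have small: "\<exists>r>0. \<forall>z\<in>ball 0 r. k' z \<in> V" if "openin X V" "b \<in> V" for V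
 proof -
  have "openin euclidean {z \<in> topspace euclidean. k' z \<in> V}"
   by (rule openin_continuous_map_preimage[OF chartD(7)[OF c] that(1)])
  then have "open {z. k' z \<in> V}" by simp
  moreover have "0 \<in> {z. k' z \<in> V}" using chartD(6)[OF c b] kb that by simp
  ultimately show ?thesis unfolding open_contains_ball by blast
 qed
 have k'nb: "k' z ~= b" if "z ~= 0" for z using chartD(5)[OF c, of z] kb that by auto
 have "gen X b k" unfolding gen_def
 proof (intro conjI allI impI)
  show "gcmap X b k"
   by (rule gcmapI[OF chartD(1)[OF c] b]) (use chartD(3)[OF c] inj in \<open>auto simp: cmap_def elim: contX_subset\<close>)
 next
  fix g assume "gcmap X b g"
  then obtain V where V: "openin X V" "b \<in> V" "cmap X (V - {b}) g" unfolding gcmap_def by blast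
  then obtain r where r: "r > 0" "\<forall>z\<in>ball 0 r. k' z \<in> V" using small by blast
  have "continuous_on (ball 0 r - {0}) (\<lambda>z. g (k' z))"
   by (rule chart_pull[OF c, of "V - {b}"]) (use V r k'nb in \<open>auto simp: cmap_def\<close>)
  then obtain d :: int and \<theta> where d: "continuous_on (ball 0 r - {0}) \<theta>"
    "!!z. z \<in> ball 0 r - {0} ==> g (k' z) = z powi d * exp (\<theta> z)"
   by (rule punctured_ball_degree[OF r(1)]) (use V r k'nb in \<open>auto simp: cmap_def\<close>)
  define W where "W = {x \<in> U. k x \<in> ball 0 r}"
  have "openin X W" unfolding W_def by (rule chart_open[OF c]) simp
  moreover have "b \<in> W" using b kb r by (simp add: W_def)
  moreover have "contX X (W - {b}) (\<lambda>x. \<theta> (k x))"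
   by (rule contX_compose[OF contX_subset[OF chartD(3)[OF c]] d(1)]) (use inj in \<open>auto simp: W_def\<close>)
  moreover have "g x = k x powi d * exp (\<theta> (k x))" if "x \<in> W - {b}" for x
   using d(2)[of "k x"] that inj[of x] chartD(6)[OF c, of x] by (auto simp: W_def)
  ultimately show "\<exists>d::int. geq X b g (\<lambda>x. k x powi d)" unfolding geq_def by blast
 next
  fix d :: int assume "geq X b (\<lambda>x. k x powi d) (\<lambda>_. 1)"
  then obtain V \<theta> where V: "openin X V" "b \<in> V" "contX X (V - {b}) \<theta>"
    "\<forall>x\<in>V - {b}. k x powi d = exp (\<theta> x)" unfolding geq_def by auto
  then obtain r where r: "r > 0" "\<forall>z\<in>ball 0 r. k' z \<in> V" using small by blast
  have "continuous_on (sphere 0 (r/2)) (\<lambda>z. \<theta> (k' z))"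
   by (rule chart_pull[OF c V(3)]) (use r k'nb in force)
  then show "d = 0"
  proof (rule circle_power_no_log[rotated])
   show "r / 2 > 0" using r by simp
   show "z powi d = exp (\<theta> (k' z))" if "z \<in> sphere 0 (r/2)" for z
   proof -
    have "z ~= 0" "z \<in> ball 0 r" using that r by auto
    then have "k' z \<in> V - {b}" using r k'nb[of z] by auto
     then show ?thesis using V(4) chartD(5)[OF c, of z] by metis
   qed
  qed
 qed
 then show ?thesis unfolding k_def .
qed

section \<open>Closed surfaces\<close>

locale closed_surface =
 fixes X :: "'a topology"
 assumes Hausdorff: "Hausdorff_space X" and compact: "compact_space X"
  and connected: "connected_space X"
  and local_chart: "x \<in> topspace X ==> \<exists>U V (\<kappa> :: 'a => complex). openin X U \<and> x \<in> U \<and> open V \<and>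
      homeomorphic_map (subtopology X U) (top_of_set V) \<kappa>"
begin

lemma normal: "normal_space X"
 by (simp add: Hausdorff compact compact_Hausdorff_or_regular_imp_normal_space)

lemma closedin_finite: "finite P ==> P <= topspace X ==> closedin X P"
 using Hausdorff Hausdorff_imp_t1_space t1_space_closedin_finite by blast

lemma openin_diff_finite: "finite P ==> openin X S ==> openin X (S - P)"
proof -
 assume P: "finite P" "openin X S"
 have "closedin X (P \<inter> topspace X)" using P closedin_finite by auto
 then have "openin X (S - P \<inter> topspace X)" using P openin_diff by blast
 moreover have "S - P \<inter> topspace X = S - P" using P openin_subset by fastforce
 ultimately show ?thesis by simp
qed

lemma compact_closed: "compactin X K ==> closedin X K"
 using Hausdorff compactin_imp_closedin by blast

text \<open>A small disc in the image of a local chart is homeomorphic to the plane, which gives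
  charts onto the whole plane inside any neighbourhood.\<close>

lemma small_chart:
 assumes "openin X N" "x \<in> N"
 obtains U \<kappa> \<kappa>' where "chart X U \<kappa> \<kappa>'" "x \<in> U" "U <= N" "\<kappa> x = 0"
proof -
 have x: "x \<in> topspace X" using assms openin_subset by blast
 obtain U0 V0 and k0 :: "'a => complex" where U0: "openin X U0" "x \<in> U0" "open V0"
   and hm: "homeomorphic_map (subtopology X U0) (top_of_set V0) k0"
  using local_chart[OF x] by blast
 obtain k1 where k1: "homeomorphic_maps (subtopology X U0) (top_of_set V0) k0 k1"
  using hm homeomorphic_map_maps by blast
 have U0X: "U0 <= topspace X" using U0 openin_subset by blast
 have k: "continuous_map (subtopology X U0) (top_of_set V0) k0" "continuous_map (top_of_set V0) (subtopology X U0) k1"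
  "!!x. x \<in> U0 ==> k1 (k0 x) = x" "!!y. y \<in> V0 ==> k0 (k1 y) = y"
  using k1 U0X unfolding homeomorphic_maps_def by auto
 have k0V: "k0 y \<in> V0" if "y \<in> U0" for y using k(1) that U0X by (auto simp: continuous_map_def Pi_iff)
 have k1U: "k1 y \<in> U0" if "y \<in> V0" for y using k(2) that by (auto simp: continuous_map_def Pi_iff)
 have "openin (top_of_set V0) {z \<in> topspace (top_of_set V0). k1 z \<in> U0 \<inter> N}"
  by (rule openin_continuous_map_preimage[OF k(2)]) (use assms in \<open>simp add: openin_subtopology_Int2 Int_commute openin_subtopology_Int\<close>)
 then have "open {z \<in> V0. k1 z \<in> U0 \<inter> N}"
  using U0(3) openin_open_trans by fastforce
 moreover have "k0 x \<in> {z \<in> V0. k1 z \<in> U0 \<inter> N}" using k0V k U0 assms by auto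
 ultimately obtain r where r: "r > 0" "ball (k0 x) r <= {z \<in> V0. k1 z \<in> U0 \<inter> N}"
  unfolding open_contains_ball by meson
 obtain f g where fg: "homeomorphism (ball (k0 x) r) (UNIV :: complex set) f g"
  using homeomorphic_ball_UNIV[OF r(1)] unfolding homeomorphic_def by blast
 define U where "U = {y \<in> U0. k0 y \<in> ball (k0 x) r}"
 define \<kappa> where "\<kappa> y = f (k0 y)" for y
 define \<kappa>' where "\<kappa>' z = k1 (g z)" for z
 have gim: "g z \<in> ball (k0 x) r" for z using fg unfolding homeomorphism_def by blast
 have "openin (subtopology X U0) {y \<in> topspace (subtopology X U0). k0 y \<in> ball (k0 x) r}"
 proof (rule openin_continuous_map_preimage)
  show "continuous_map (subtopology X U0) euclidean k0" using k(1) by (simp add: continuous_map_in_subtopology)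
 qed simp
 then have "openin X {y \<in> topspace (subtopology X U0). k0 y \<in> ball (k0 x) r}"
  by (rule openin_trans_full[OF _ U0(1)])
 moreover have "{y \<in> topspace (subtopology X U0). k0 y \<in> ball (k0 x) r} = U"
  using U0X unfolding U_def by auto
 ultimately have opU: "openin X U" by simp
 have "chart X U \<kappa> \<kappa>'" unfolding chart_def
 proof (intro conjI opU)
  have "contX X U0 k0" using k(1) unfolding contX_def by (simp add: continuous_map_in_subtopology)
  then have 1: "contX X U k0" by (rule contX_subset) (auto simp: U_def)
  have "contX X U \<kappa>" unfolding \<kappa>_def
   by (rule contX_compose[OF 1, of "ball (k0 x) r"]) (use fg in \<open>auto simp: homeomorphism_def U_def\<close>)
  moreover have "continuous_map euclidean (subtopology X U) \<kappa>'"
  proof -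
   have "continuous_map euclidean (top_of_set V0) g"
    using fg gim r unfolding homeomorphism_def by (force simp: continuous_map_in_subtopology)
   then have "continuous_map euclidean (subtopology X U0) (k1 \<circ> g)" using k(2) by (rule continuous_map_compose)
   moreover have "\<kappa>' z \<in> U" for z
    using gim[of z] r k1U k(4) unfolding \<kappa>'_def U_def by auto
   ultimately show ?thesis unfolding \<kappa>'_def by (auto simp: continuous_map_in_subtopology o_def)
  qed
  moreover have "\<kappa>' (\<kappa> y) = y" if "y \<in> U" for y
   using that fg k(3) unfolding \<kappa>_def \<kappa>'_def U_def homeomorphism_def by auto
  moreover have "\<kappa> (\<kappa>' z) = z" for z
   using gim[of z] r k(4) fg unfolding \<kappa>_def \<kappa>'_def homeomorphism_def by auto
  ultimately show "homeomorphic_maps (subtopology X U) euclidean \<kappa> \<kappa>'"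
   unfolding homeomorphic_maps_def contX_def using opU openin_subset by auto
 qed
 then have "chart X U (\<lambda>y. \<kappa> y - \<kappa> x) (\<lambda>z. \<kappa>' (z + \<kappa> x))" by (rule chart_shift)
 moreover have "x \<in> U" "U <= N" using U0 r k(3) unfolding U_def by force+
 ultimately show ?thesis using that by auto
qed

text \<open>Near \<open>a\<close> the quotient \<open>f x / f a\<close> stays within distance 1 of
  1, where \<open>Ln\<close> is continuous. So a map that is regular at \<open>a\<close> does not
  wind around it.\<close>

lemma geq_one:
 assumes "openin X V" "a \<in> V" "cmap X V f" shows "geq X a f (\<lambda>_. 1)"
proof -
 have fa: "f a ~= 0" using assms by (simp add: cmap_def)
 have aX: "a \<in> topspace X" using assms openin_subset by blast
 have VX: "V <= topspace X" using assms openin_subset by blast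
 let ?W = "{x \<in> topspace (subtopology X V). f x \<in> ball (f a) (cmod (f a))}"
 have "openin (subtopology X V) ?W"
  using assms by (intro openin_continuous_map_preimage) (auto simp: cmap_def contX_def)
 then have "openin X ?W" using assms(1) openin_trans_full by blast
 moreover have "a \<in> ?W" using assms fa aX by auto
 moreover have nr: "f x / f a \<notin> \<real>\<^sub>\<le>\<^sub>0" if "x \<in> ?W" for x
 proof -
  have "cmod (f a - f x) < cmod (f a)" using that by (auto simp: dist_norm)
  then have "cmod (1 - f x / f a) < 1"
   using fa by (simp add: diff_divide_eq_iff norm_divide)
  then have "0 < Re (f x / f a)"
   using abs_Re_le_cmod[of "1 - f x / f a"] by auto
  then show ?thesis by (auto simp: complex_nonpos_Reals_iff)
 qed
 moreover have "contX X (?W - {a}) (\<lambda>x. Ln (f x / f a) + Ln (f a))"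
 proof (rule contX_add[OF contX_compose[where f = "\<lambda>x. f x / f a" and h = Ln and T = "- \<real>\<^sub>\<le>\<^sub>0"] contX_const])
  show "contX X (?W - {a}) (\<lambda>x. f x / f a)"
   by (rule contX_divide[OF contX_subset contX_const]) (use assms fa in \<open>auto simp: cmap_def\<close>)
  show "continuous_on (- \<real>\<^sub>\<le>\<^sub>0) Ln" by (intro continuous_intros) auto
 qed (use nr in auto)
 moreover have "f x = 1 * exp (Ln (f x / f a) + Ln (f a))" if "x \<in> ?W - {a}" for x
 proof -
  have "f x ~= 0" using that assms by (auto simp: cmap_def)
  then show ?thesis using fa by (simp add: exp_add)
 qed
 ultimately show ?thesis unfolding geq_def by blast
qed

section \<open>Removing, sliding and gathering poles\<close>

text \<open>With winding number 0 the map is \<open>exp \<theta>\<close> on a punctured disc, where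
  \<open>\<theta>\<close> can be damped to 0 towards \<open>a\<close>. The change is confined to
  \<open>N\<close>, which lets later arguments keep all values away from the pole.\<close>

lemma remove_puncture:
 assumes "openin X N" "a \<in> N" "openin X S" "a \<in> S" "cmap X (S - {a}) f" "geq X a f (\<lambda>_. 1)"
 obtains f' where "cmap X S f'" "!!x. x \<notin> N ==> f' x = f x" "!!x. x \<notin> S ==> f' x = f x"
proof -
 obtain V \<theta> where V: "openin X V" "a \<in> V" "contX X (V - {a}) \<theta>" "\<forall>x\<in>V - {a}. f x = exp (\<theta> x)"
  using assms(6) unfolding geq_def by auto
 have "openin X (N \<inter> V \<inter> S)" "a \<in> N \<inter> V \<inter> S" using V assms by auto
 then obtain U \<kappa> \<kappa>' where ch: "chart X U \<kappa> \<kappa>'" "a \<in> U" "U <= N \<inter> V \<inter> S" "\<kappa> a = 0"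
  by (rule small_chart)
 have inj: "x = a" if "x \<in> U" "\<kappa> x = 0" for x using chartD(6)[OF ch(1)] that ch by metis
 \<comment> \<open>0 up to radius 1/2 and 1 from radius 1 on.\<close>
 define cut where "cut z = complex_of_real (max 0 (min 1 (2 * cmod z - 1)))" for z
 define f' where "f' x = (if x \<in> U then if cmod (\<kappa> x) \<le> 1/2 then 1 else exp (cut (\<kappa> x) * \<theta> x) else f x)" for x
 define K where "K = {x \<in> U. \<kappa> x \<in> cball 0 1}"
 have "closedin X K" unfolding K_def by (intro compact_closed chart_compact[OF ch(1)]) simp
 then have opA: "openin X (S - K)" using assms(3) by (rule openin_diff[rotated])
 have "cmap X S f'"
 proof (rule cmap_open_Un[OF opA chartD(1)[OF ch(1)]])
  have "cmap X (S - K) f" by (rule cmap_subset[OF assms(5)]) (use ch in \<open>auto simp: K_def\<close>)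
  moreover have "f x = f' x" if "x \<in> S - K" for x
  proof (cases "x \<in> U")
   case True
   then have "cmod (\<kappa> x) > 1" "x ~= a" "x \<in> V" using that ch by (auto simp: K_def)
   then show ?thesis using V(4) True by (simp add: f'_def cut_def)
  qed (simp add: f'_def)
  ultimately have "cmap X (S - K) f'" by (rule cmap_cong)
  then show "cmap X ((S - K) \<inter> S) f'" by (rule cmap_subset) auto
  have "cmap X U f'"
  proof (rule cmap_open_Un[where A = "{x \<in> U. \<kappa> x \<in> ball 0 (1/2)}" and B = "U - {a}"])
   show "openin X {x \<in> U. \<kappa> x \<in> ball 0 (1/2)}" by (rule chart_open[OF ch(1)]) simp
   show "openin X (U - {a})" using openin_diff_finite chartD(1)[OF ch(1)] by blast
   show "U <= {x \<in> U. \<kappa> x \<in> ball 0 (1/2)} \<union> (U - {a})" using ch by auto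
   show "cmap X ({x \<in> U. \<kappa> x \<in> ball 0 (1/2)} \<inter> U) f'"
    by (rule cmap_cong[OF cmap_one]) (auto simp: f'_def)
   have "cmap X (U - {a}) (\<lambda>x. exp (cut (\<kappa> x) * \<theta> x))"
   proof (intro cmap_exp contX_mult)
    show "contX X (U - {a}) (\<lambda>x. cut (\<kappa> x))"
     by (rule contX_compose[OF contX_subset[OF chartD(3)[OF ch(1)]], of _ UNIV])
      (auto simp: cut_def intro!: continuous_intros)
    show "contX X (U - {a}) \<theta>" by (rule contX_subset[OF V(3)]) (use ch in auto)
   qed
   then have "cmap X (U - {a}) f'"
    by (rule cmap_cong) (auto simp: f'_def cut_def)
   then show "cmap X ((U - {a}) \<inter> U) f'" by (rule cmap_subset) auto
  qed
  then show "cmap X (U \<inter> S) f'" by (rule cmap_subset) auto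
  show "S <= S - K \<union> U" by (auto simp: K_def)
 qed
 moreover have "f' x = f x" if "x \<notin> N \<or> x \<notin> S" for x using that ch by (auto simp: f'_def)
 ultimately show ?thesis using that by blast
qed

text \<open>A dipole supported in \<open>N\<close>. Multiplication by one of its powers trades a
  pole at \<open>a\<close> for one at \<open>b\<close> and changes nothing outside \<open>N\<close>.
  The relative sign of its two poles is left open, as it has no meaning without an
  orientation.\<close>

definition slides :: "'a set => 'a => 'a => bool" where
 "slides N a b \<longleftrightarrow> (\<exists>f. cmap X (topspace X - {a, b}) f \<and> (\<forall>x\<in>topspace X - N. f x = 1) \<and>
   gen X a f \<and> gen X b f)"

text \<open>In the chart the dipole is \<open>(z - p) / (z - q)\<close>. From radius
  \<open>R\<close> on this quotient avoids the cut of \<open>Ln\<close>, and its logarithm is faded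
  out to 0, so that the dipole becomes 1 before it leaves the chart.\<close>

lemma local_slide:
 assumes ch: "chart X U \<kappa> \<kappa>'" and xy: "x \<in> U" "y \<in> U" "x ~= y"
 shows "slides U x y"
proof -
 define p q where "p = \<kappa> x" and "q = \<kappa> y"
 have pq: "p ~= q" using chartD(6)[OF ch] xy unfolding p_def q_def by metis
 define R where "R = max (cmod p) (cmod q) + 1"
 have R: "cmod p < R" "cmod q < R" "R > 0" unfolding R_def using norm_ge_zero[of p] by linarith+
 define h where "h z = (z - p) / (z - q)" for z
 \<comment> \<open>A value \<open>- t\<close> with \<open>t \<ge> 0\<close> would make
   \<open>z\<close> the convex combination \<open>(p + t q) / (1 + t)\<close>, which has norm below
   \<open>R\<close>.\<close>
 have hR: "h z \<notin> \<real>\<^sub>\<le>\<^sub>0" if "cmod z \<ge> R" for z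
 proof
  assume "h z \<in> \<real>\<^sub>\<le>\<^sub>0"
  then obtain s where "h z = of_real s" "s \<le> 0" by (rule nonpos_Reals_cases)
  then have "h z = - of_real (- s)" "- s \<ge> 0" by auto
  then obtain t where t: "h z = - of_real t" "t \<ge> 0" by blast
  have "z - q ~= 0" using that R by auto
  then have "z - p = - of_real t * (z - q)" using t(1) unfolding h_def by (simp add: divide_eq_eq)
  then have "(1 + of_real t) * z = p + of_real t * q" by (simp add: algebra_simps)
  then have "cmod ((1 + of_real t) * z) \<le> cmod p + t * cmod q"
   using norm_triangle_ineq[of p "of_real t * q"] t(2) by (simp add: norm_mult)
  moreover have "cmod ((1 + of_real t) * z) = (1 + t) * cmod z"
  proof -
   have "1 + complex_of_real t = of_real (1 + t)" by simp
   then show ?thesis using t(2) by (metis norm_mult norm_of_real abs_of_nonneg add_nonneg_nonneg zero_le_one)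
  qed
  moreover have "(1 + t) * R \<le> (1 + t) * cmod z" using that t by (simp add: mult_left_mono)
  moreover have "t * cmod q \<le> t * R" using R t by (simp add: mult_left_mono)
  ultimately show False using R by (simp add: algebra_simps)
 qed
 define cut where "cut z = complex_of_real (max 0 (min 1 (R + 2 - cmod z)))" for z
 define f where "f w = (if w \<in> U then if cmod (\<kappa> w) \<le> R + 1 then h (\<kappa> w) else exp (cut (\<kappa> w) * Ln (h (\<kappa> w))) else 1)" for w
 define K where "K = {x \<in> U. \<kappa> x \<in> cball 0 (R + 2)}"
 have "closedin X K" unfolding K_def by (intro compact_closed chart_compact[OF ch]) simp
 then have opA: "openin X (topspace X - K)" by (simp add: openin_diff)
 have inj: "w = y" if "w \<in> U" "\<kappa> w = q" for w using chartD(6)[OF ch] that xy q_def by metis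
 have injx: "w = x" if "w \<in> U" "\<kappa> w = p" for w using chartD(6)[OF ch] that xy p_def by metis
 have Uf: "cmap X (U - {x, y}) f"
 proof (rule cmap_open_Un[where A = "{x \<in> U. \<kappa> x \<in> ball 0 (R + 1)}" and B = "{x \<in> U. \<kappa> x \<in> - cball 0 R}"])
  show "openin X {x \<in> U. \<kappa> x \<in> ball 0 (R + 1)}" by (rule chart_open[OF ch]) simp
  show "openin X {x \<in> U. \<kappa> x \<in> - cball 0 R}" by (rule chart_open[OF ch]) auto
  show "U - {x, y} <= {x \<in> U. \<kappa> x \<in> ball 0 (R + 1)} \<union> {x \<in> U. \<kappa> x \<in> - cball 0 R}" by auto
  have "cmap X (U - {x, y}) (\<lambda>w. h (\<kappa> w))"
   unfolding cmap_def h_def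
   by (intro conjI contX_divide contX_diff contX_const contX_subset[OF chartD(3)[OF ch]])
    (use inj injx in auto)
  then have "cmap X ({x \<in> U. \<kappa> x \<in> ball 0 (R + 1)} \<inter> (U - {x, y})) (\<lambda>w. h (\<kappa> w))"
   by (rule cmap_subset) auto
  then show "cmap X ({x \<in> U. \<kappa> x \<in> ball 0 (R + 1)} \<inter> (U - {x, y})) f"
   by (rule cmap_cong) (auto simp: f_def)
  have "cmap X {x \<in> U. \<kappa> x \<in> - cball 0 R} (\<lambda>w. exp (cut (\<kappa> w) * Ln (h (\<kappa> w))))"
  proof (rule cmap_exp, rule contX_compose[of _ _ \<kappa> "- cball 0 R" "\<lambda>z. cut z * Ln (h z)"])
   show "contX X {x \<in> U. \<kappa> x \<in> - cball 0 R} \<kappa>" by (rule contX_subset[OF chartD(3)[OF ch]]) auto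
   show "continuous_on (- cball 0 R) (\<lambda>z. cut z * Ln (h z))"
    unfolding cut_def h_def by (intro continuous_intros) (use hR R in \<open>auto simp: h_def\<close>)
  qed auto
  then have "cmap X {x \<in> U. \<kappa> x \<in> - cball 0 R} f"
  proof (rule cmap_cong)
   fix w assume w: "w \<in> {x \<in> U. \<kappa> x \<in> - cball 0 R}"
   then have "h (\<kappa> w) ~= 0" using R unfolding h_def by (auto simp: p_def)
   then show "exp (cut (\<kappa> w) * Ln (h (\<kappa> w))) = f w" using w unfolding f_def cut_def by auto
  qed
  then show "cmap X ({x \<in> U. \<kappa> x \<in> - cball 0 R} \<inter> (U - {x, y})) f" by (rule cmap_subset) auto
 qed
 have cf: "cmap X (topspace X - {x, y}) f"
 proof (rule cmap_open_Un[OF opA chartD(1)[OF ch]])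
  show "cmap X ((topspace X - K) \<inter> (topspace X - {x, y})) f"
   by (rule cmap_cong[OF cmap_one]) (auto simp: f_def K_def cut_def)
  show "cmap X (U \<inter> (topspace X - {x, y})) f" by (rule cmap_subset[OF Uf]) auto
 qed (auto simp: K_def)
 define W where "W = {w \<in> U. \<kappa> w \<in> ball 0 (R + 1)}"
 have W: "openin X W" unfolding W_def by (rule chart_open[OF ch]) simp
 have xW: "x \<in> W" and yW: "y \<in> W" using xy R by (auto simp: W_def p_def q_def)
 have fW: "f w = (\<kappa> w - \<kappa> x) * (\<kappa> w - \<kappa> y) powi -1" if "w \<in> W" for w
  using that by (simp add: W_def f_def h_def p_def q_def power_int_minus divide_inverse)
 have near: "geq X z (\<lambda>w. (\<kappa> w - \<kappa> z') powi d) (\<lambda>_. 1)" if "z \<in> U" "z' \<in> U" "z ~= z'" for z z' and d :: int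
 proof (rule geq_one[of "U - {z'}"])
  show "openin X (U - {z'})" using openin_diff_finite chartD(1)[OF ch] by blast
  show "z \<in> U - {z'}" using that by auto
  have "w = z'" if "w \<in> U" "\<kappa> w = \<kappa> z'" for w using chartD(6)[OF ch] that \<open>z' \<in> U\<close> by metis
  then show "cmap X (U - {z'}) (\<lambda>w. (\<kappa> w - \<kappa> z') powi d)"
   by (intro cmap_powi) (auto simp: cmap_def intro!: contX_diff contX_subset[OF chartD(3)[OF ch]])
 qed
 have "gen X x f"
 proof (rule gen_geq[OF gen_chart[OF ch xy(1)]])
  have "geq X x f (\<lambda>w. (\<kappa> w - \<kappa> x) * (\<kappa> w - \<kappa> y) powi -1)"
   by (rule geq_cong[OF W xW]) (use fW in auto)
  moreover have "geq X x (\<lambda>w. (\<kappa> w - \<kappa> x) * (\<kappa> w - \<kappa> y) powi -1) (\<lambda>w. (\<kappa> w - \<kappa> x) * 1)"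
   by (rule geq_mult[OF geq_refl near]) (use xy chartD(2)[OF ch] in auto)
  ultimately show "geq X x f (\<lambda>w. \<kappa> w - \<kappa> x)" using geq_trans by fastforce
 qed
 moreover have "gen X y f"
 proof (rule gen_geq[OF gen_powi_neg[OF gen_chart[OF ch xy(2)]]])
  have "geq X y f (\<lambda>w. (\<kappa> w - \<kappa> x) powi 1 * (\<kappa> w - \<kappa> y) powi -1)"
   by (rule geq_cong[OF W yW]) (use fW in auto)
  moreover have "geq X y (\<lambda>w. (\<kappa> w - \<kappa> x) powi 1 * (\<kappa> w - \<kappa> y) powi -1) (\<lambda>w. 1 * (\<kappa> w - \<kappa> y) powi -1)"
   by (rule geq_mult[OF near geq_refl]) (use xy chartD(2)[OF ch] in auto)
  ultimately show "geq X y f (\<lambda>w. (\<kappa> w - \<kappa> y) powi -1)" using geq_trans by fastforce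
 qed
 moreover have "\<forall>x\<in>topspace X - U. f x = 1" by (simp add: f_def)
 ultimately show ?thesis using cf unfolding slides_def by blast
qed

lemma slides_mono: "slides N a b ==> N <= M ==> slides M a b"
 unfolding slides_def by blast

text \<open>The second dipole or its inverse cancels the pole of the first one at \<open>b\<close>,
  up to a puncture of winding number 0. This is filled in within a neighbourhood of \<open>b\<close>
  that is separated from \<open>a\<close> and \<open>c\<close>.\<close>

lemma slides_trans:
 assumes "openin X N" "slides N a b" "slides N b c" "a ~= b" "b ~= c" "a ~= c" "a \<in> N" "b \<in> N" "c \<in> N"
 shows "slides N a c"
proof -
 have NX: "N <= topspace X" using assms openin_subset by blast
 obtain f where f: "cmap X (topspace X - {a, b}) f" "\<forall>x\<in>topspace X - N. f x = 1" "gen X a f" "gen X b f"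
  using assms(2) unfolding slides_def by blast
 obtain g where g: "cmap X (topspace X - {b, c}) g" "\<forall>x\<in>topspace X - N. g x = 1" "gen X b g" "gen X c g"
  using assms(3) unfolding slides_def by blast
 obtain s :: int where s: "s = 1 \<or> s = -1" "geq X b f (\<lambda>x. g x powi s)" by (rule gen_unique[OF g(3) f(4)])
 define k where "k x = f x * g x powi (- s)" for x
 have kc: "cmap X (topspace X - {a, b, c}) k" unfolding k_def
  by (intro cmap_mult cmap_powi) (auto intro: cmap_subset[OF f(1)] cmap_subset[OF g(1)])
 have "geq X b k (\<lambda>x. g x powi s * g x powi (- s))"
  unfolding k_def by (rule geq_mult[OF s(2) geq_refl]) (use assms NX in auto)
 then have kb: "geq X b k (\<lambda>_. 1)"
  using geq_trans[OF _ gen_powi_add[OF gen_gcmap[OF g(3)], of s "- s"]] by simp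
 have op: "openin X (topspace X - P)" if "finite P" for P using openin_diff_finite that by blast
 have eq: "topspace X - {a, c} - {b} = topspace X - {a, b, c}" by auto
 have sep: "\<exists>V W. openin X V \<and> openin X W \<and> z \<in> V \<and> b \<in> W \<and> V \<inter> W = {}" if "z \<in> N" "z ~= b" for z
 proof -
  have "z \<in> topspace X" "b \<in> topspace X" using that assms NX by auto
  then show ?thesis using Hausdorff that(2) unfolding Hausdorff_space_def disjnt_def by blast
 qed
 obtain Va Wa where Va: "openin X Va" "openin X Wa" "a \<in> Va" "b \<in> Wa" "Va \<inter> Wa = {}"
  using sep[of a] assms by blast
 obtain Vc Wc where Vc: "openin X Vc" "openin X Wc" "c \<in> Vc" "b \<in> Wc" "Vc \<inter> Wc = {}"
  using sep[of c] assms by blast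
 obtain k' where k': "cmap X (topspace X - {a, c}) k'" "!!x. x \<notin> N \<inter> Wa \<inter> Wc ==> k' x = k x"
 proof (rule remove_puncture[of "N \<inter> Wa \<inter> Wc" b "topspace X - {a, c}" k])
  show "openin X (N \<inter> Wa \<inter> Wc)" using assms(1) Va Vc by blast
 qed (use assms NX kc kb eq op[of "{a, c}"] Va Vc in auto)
 have "gen X a k'"
 proof (rule gen_geq[OF f(3)])
  have "geq X a k' (\<lambda>x. f x * g x powi (- s))"
   by (rule geq_cong[OF Va(1,3)]) (use k' Va in \<open>auto simp: k_def\<close>)
  moreover have "geq X a (\<lambda>x. f x * g x powi (- s)) (\<lambda>x. f x * 1)"
  proof (rule geq_mult[OF geq_refl])
   show "geq X a (\<lambda>x. g x powi - s) (\<lambda>x. 1)"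
    by (rule geq_one[of "topspace X - {b, c}"]) (use assms NX op g in \<open>auto intro!: cmap_powi\<close>)
  qed (use assms NX in auto)
  ultimately show "geq X a k' f" using geq_trans by fastforce
 qed
 moreover have "gen X c k'"
 proof (rule gen_geq)
  show "gen X c (\<lambda>x. g x powi (- s))"
   using s(1)
  proof
   assume "s = -1"
   then show ?thesis using g(4) by simp
  next
   assume "s = 1"
   then show ?thesis using gen_powi_neg[OF g(4)] by simp
  qed
  have "geq X c k' (\<lambda>x. f x * g x powi (- s))"
   by (rule geq_cong[OF Vc(1,3)]) (use k' Vc in \<open>auto simp: k_def\<close>)
  moreover have "geq X c (\<lambda>x. f x * g x powi (- s)) (\<lambda>x. 1 * g x powi (- s))"
  proof (rule geq_mult[OF _ geq_refl])
   show "geq X c f (\<lambda>x. 1)"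
    by (rule geq_one[of "topspace X - {a, b}"]) (use assms NX op f in auto)
  qed (use assms NX in auto)
  ultimately show "geq X c k' (\<lambda>x. g x powi (- s))" using geq_trans by fastforce
 qed
 moreover have "\<forall>x\<in>topspace X - N. k' x = 1" using k' f g by (auto simp: k_def)
 ultimately show ?thesis using k'(1) unfolding slides_def by blast
qed

text \<open>By \<open>local_slide\<close> the points that \<open>a\<close> can be moved to form a
  subset of \<open>N\<close> that is open with open complement in \<open>N\<close>.\<close>

lemma slide:
 assumes N: "openin X N" "connectedin X N" and a: "a \<in> N" and b: "b \<in> N" and "a ~= b"
 shows "slides N a b"
proof -
 define G where "G = {c \<in> N. c = a \<or> slides N a c}"
 have loc: "\<exists>U. openin X U \<and> c \<in> U \<and> U <= N \<and> (\<forall>x\<in>U. \<forall>y\<in>U. x \<in> G --> y \<in> G)" if c: "c \<in> N" for c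
 proof -
  obtain U \<kappa> \<kappa>' where ch: "chart X U \<kappa> \<kappa>'" "c \<in> U" "U <= N" "\<kappa> c = 0"
   by (rule small_chart[OF N(1) c])
  have "y \<in> G" if xy: "x \<in> U" "y \<in> U" "x \<in> G" for x y
  proof -
   have "slides N x y" if "x ~= y" using local_slide[OF ch(1) xy(1,2) that] slides_mono ch(3) by blast
   then show ?thesis
    using xy ch(3) slides_trans[OF N(1), of a x y] a unfolding G_def by blast
  qed
  then show ?thesis using chartD(1)[OF ch(1)] ch by blast
 qed
 have "openin X G"
 proof (subst openin_subopen, intro ballI)
  fix c assume "c \<in> G"
  then show "\<exists>T. openin X T \<and> c \<in> T \<and> T <= G" using loc[of c] unfolding G_def by blast
 qed
 moreover have "openin X (N - G)"
 proof (subst openin_subopen, intro ballI)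
  fix c assume c: "c \<in> N - G"
  then obtain U where U: "openin X U" "c \<in> U" "U <= N" "\<forall>x\<in>U. \<forall>y\<in>U. x \<in> G --> y \<in> G"
   using loc[of c] by blast
  then have "U <= N - G" using c by blast
  then show "\<exists>T. openin X T \<and> c \<in> T \<and> T <= N - G" using U by blast
 qed
 moreover have "a \<in> G" using a by (simp add: G_def)
 moreover have "G <= N" by (auto simp: G_def)
 ultimately have "N <= G" using N(2) unfolding connectedin by blast
 then show ?thesis using b \<open>a ~= b\<close> by (auto simp: G_def)
qed

text \<open>Around \<open>a\<close> there is a second logarithm, taken in a chart. The punctured
  chart is connected, so the two differ there by one multiple of 2 pi i and can be joined.\<close>

lemma log_extends:
 assumes S: "openin X S" "a \<in> S" and f: "cmap X S f" and log: "haslog X (S - {a}) f"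
 shows "haslog X S f"
proof -
 obtain \<theta> where th: "contX X (S - {a}) \<theta>" "\<forall>x\<in>S - {a}. f x = exp (\<theta> x)"
  using log unfolding haslog_def by blast
 obtain U \<kappa> \<kappa>' where ch: "chart X U \<kappa> \<kappa>'" "a \<in> U" "U <= S" "\<kappa> a = 0"
  by (rule small_chart[OF S])
 have "continuous_on UNIV (\<lambda>z. f (\<kappa>' z))"
  by (rule chart_pull[OF ch(1), of S]) (use f chartD(4)[OF ch(1)] ch in \<open>auto simp: cmap_def\<close>)
 moreover have "f (\<kappa>' z) ~= 0" for z
  using f chartD(4)[OF ch(1), of z] ch(3) by (auto simp: cmap_def)
 ultimately obtain l where l: "continuous_on UNIV l" "!!z. f (\<kappa>' z) = exp (l z)"
  using continuous_logarithm_on_contractible[of UNIV "\<lambda>z. f (\<kappa>' z)"] contractible_UNIV by (metis UNIV_I)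
 have lk: "contX X U (\<lambda>x. l (\<kappa> x))"
  by (rule contX_compose[OF chartD(3)[OF ch(1)] l(1)]) auto
 have inj: "x = a" if "x \<in> U" "\<kappa> x = 0" for x using chartD(6)[OF ch(1)] that ch by metis
 have Ueq: "U - {a} = {x \<in> U. \<kappa> x \<in> - {0}}"
 proof (intro equalityI subsetI)
  fix x assume "x \<in> U - {a}"
  then show "x \<in> {x \<in> U. \<kappa> x \<in> - {0}}" using inj[of x] by blast
 qed (use ch(4) in auto)
 have con: "connectedin X (U - {a})" unfolding Ueq
  by (rule chart_connected[OF ch(1)]) (simp add: connected_punctured_universe)
 obtain k :: int where k: "!!x. x \<in> U - {a} ==> \<theta> x - l (\<kappa> x) = 2 * of_int k * of_real pi * \<i>"
 proof (rule exp_one_const[OF con])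
  show "contX X (U - {a}) (\<lambda>x. \<theta> x - l (\<kappa> x))"
   by (intro contX_diff contX_subset[OF th(1)] contX_subset[OF lk]) (use ch in auto)
  show "exp (\<theta> x - l (\<kappa> x)) = 1" if "x \<in> U - {a}" for x
  proof -
   have "exp (\<theta> x) = f x" "exp (l (\<kappa> x)) = f x"
    using th(2) that ch l(2)[of "\<kappa> x"] chartD(6)[OF ch(1), of x] by auto
   then show ?thesis by (simp add: exp_diff) (use f that ch in \<open>auto simp: cmap_def\<close>)
  qed
 qed auto
 define \<theta>' where "\<theta>' x = (if x \<in> U then l (\<kappa> x) + 2 * of_int k * of_real pi * \<i> else \<theta> x)" for x
 have "contX X S \<theta>'"
 proof (rule contX_open_Un[where A = "S - {a}" and B = U])
  show "openin X (S - {a})" using openin_diff_finite S by blast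
  show "openin X U" using chartD(1)[OF ch(1)] .
  have "contX X (S - {a}) \<theta>'"
  proof (rule contX_cong[OF th(1)])
   fix x assume x: "x \<in> S - {a}"
   show "\<theta> x = \<theta>' x"
   proof (cases "x \<in> U")
    case True
    then show ?thesis using k[of x] x by (simp add: \<theta>'_def diff_eq_eq add.commute)
   qed (simp add: \<theta>'_def)
  qed
  then show "contX X ((S - {a}) \<inter> S) \<theta>'" by (rule contX_subset) auto
  have "contX X U \<theta>'"
   by (rule contX_cong[OF contX_add[OF lk contX_const]]) (auto simp: \<theta>'_def)
  then show "contX X (U \<inter> S) \<theta>'" by (rule contX_subset) auto
 qed (use ch in auto)
 moreover have "f x = exp (\<theta>' x)" if "x \<in> S" for x
 proof (cases "x \<in> U")
  case True
  then show ?thesis using l(2)[of "\<kappa> x"] chartD(6)[OF ch(1), of x]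
   by (simp add: \<theta>'_def exp_add exp_eq_1 mult.assoc exp_two_pi_i)
 next
  case False
  then show ?thesis using th(2) that ch by (auto simp: \<theta>'_def)
 qed
 ultimately show ?thesis unfolding haslog_def by blast
qed

lemma Tietze_complex:
 assumes "closedin X K" "contX X K \<theta>"
 obtains \<theta>' where "contX X (topspace X) \<theta>'" "!!x. x \<in> K ==> \<theta>' x = \<theta> x"
proof -
 have "continuous_map (subtopology X K) euclideanreal (Re \<circ> \<theta>)" "continuous_map (subtopology X K) euclideanreal (Im \<circ> \<theta>)"
  using assms(2) unfolding contX_def
  by (auto intro!: continuous_map_compose[where X' = euclidean] continuous_intros)
 then obtain u v where u: "continuous_map X euclideanreal u" "!!x. x \<in> K ==> u x = Re (\<theta> x)"
  and v: "continuous_map X euclideanreal v" "!!x. x \<in> K ==> v x = Im (\<theta> x)"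
  using Tietze_extension_realinterval[OF normal assms(1) is_interval_univ UNIV_not_empty] by (metis comp_apply subset_UNIV)
 have "contX X (topspace X) (\<lambda>x. complex_of_real (u x))" "contX X (topspace X) (\<lambda>x. complex_of_real (v x))"
  unfolding contX_def using u(1) v(1) continuous_map_compose[of X euclideanreal _ euclidean complex_of_real]
  by (auto simp: o_def continuous_on_of_real)
 then have "contX X (topspace X) (\<lambda>x. complex_of_real (u x) + \<i> * complex_of_real (v x))"
  by (intro contX_add contX_mult) auto
 then show ?thesis
  by (rule that) (use u v in \<open>auto simp: complex_eq_iff\<close>)
qed

end

section \<open>Integer linear systems, arcs and acyclic sets\<close>

text \<open>Elimination without fractions: a nonzero coefficient \<open>\<Lambda> m a\<close> of the
  last equation is the pivot, and the other equations are multiplied by it before \<open>a\<close>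
  is eliminated.\<close>

lemma integer_system:
 fixes \<Lambda> :: "nat => 'i => int"
 assumes "finite T" "m < card T"
 shows "\<exists>w. (\<exists>e\<in>T. w e ~= 0) \<and> (\<forall>j<m. (\<Sum>e\<in>T. \<Lambda> j e * w e) = 0)"
 using assms
proof (induction m arbitrary: T \<Lambda>)
 case 0
 then have "T ~= {}" by auto
 then show ?case by (intro exI[of _ "\<lambda>_. 1"]) auto
next
 case (Suc m)
 show ?case
 proof (cases "\<forall>e\<in>T. \<Lambda> m e = 0")
  case True
  obtain w where w: "\<exists>e\<in>T. w e ~= 0" "\<forall>j<m. (\<Sum>e\<in>T. \<Lambda> j e * w e) = 0"
   using Suc.IH[of T \<Lambda>] Suc.prems by auto
  have "(\<Sum>e\<in>T. \<Lambda> m e * w e) = 0" using True by simp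
  then have "\<forall>j<Suc m. (\<Sum>e\<in>T. \<Lambda> j e * w e) = 0" using w(2) less_Suc_eq by auto
  then show ?thesis using w(1) by blast
 next
  case False
  then obtain a where a: "a \<in> T" "\<Lambda> m a ~= 0" by blast
  define M where "M j e = \<Lambda> m a * \<Lambda> j e - \<Lambda> m e * \<Lambda> j a" for j e
  have "finite (T - {a})" "m < card (T - {a})" using Suc.prems a by auto
  from Suc.IH[OF this, of M]
  obtain u where u: "\<exists>e\<in>T - {a}. u e ~= 0" "\<forall>j<m. (\<Sum>e\<in>T - {a}. M j e * u e) = 0" by blast
  \<comment> \<open>Scaling \<open>u\<close> by the pivot makes the value at \<open>a\<close> that
    solves equation \<open>m\<close> an integer.\<close>
  define w where "w e = (if e = a then - (\<Sum>e\<in>T - {a}. \<Lambda> m e * u e) else \<Lambda> m a * u e)" for e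
  have eq: "(\<Sum>e\<in>T. \<Lambda> j e * w e) = (\<Sum>e\<in>T - {a}. M j e * u e)" for j
  proof -
   have "(\<Sum>e\<in>T. \<Lambda> j e * w e) = \<Lambda> j a * w a + (\<Sum>e\<in>T - {a}. \<Lambda> j e * w e)"
    using Suc.prems(1) a(1) by (simp add: sum.remove)
   also have "(\<Sum>e\<in>T - {a}. \<Lambda> j e * w e) = (\<Sum>e\<in>T - {a}. \<Lambda> j e * (\<Lambda> m a * u e))"
    by (rule sum.cong) (auto simp: w_def)
   also have "\<Lambda> j a * w a + \<dots> = (\<Sum>e\<in>T - {a}. M j e * u e)"
    by (simp add: w_def M_def sum_distrib_left sum_subtractf[symmetric] algebra_simps)
   finally show ?thesis .
  qed
  have "(\<Sum>e\<in>T. \<Lambda> m e * w e) = 0" unfolding eq by (simp add: M_def)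
  then have "\<forall>j<Suc m. (\<Sum>e\<in>T. \<Lambda> j e * w e) = 0" using u(2) eq less_Suc_eq by auto
  moreover have "\<exists>e\<in>T. w e ~= 0"
  proof -
   obtain e where "e \<in> T - {a}" "u e ~= 0" using u(1) by blast
   then show ?thesis using a(2) by (intro bexI[of _ e]) (auto simp: w_def)
  qed
  ultimately show ?thesis by blast
 qed
qed

text \<open>For compact \<open>K\<close>: the first integral cohomology vanishes.\<close>

definition acyc :: "'a topology => 'a set => bool" where
 "acyc X K \<longleftrightarrow> (\<forall>f. cmap X K f --> haslog X K f)"

definition arcin :: "'a topology => (real => 'a) => bool" where
 "arcin X g \<longleftrightarrow> pathin X g \<and> inj_on g {0..1}"

definition arcparam :: "(real => 'a) => 'a => real" where
 "arcparam g = inv_into {0..1} g"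

lemma arcparam: "arcin X g ==> t \<in> {0..1} ==> arcparam g (g t) = t"
 unfolding arcin_def arcparam_def by (simp add: inv_into_f_f)

lemma arc_subset: "arcin X g ==> g ` {0..1} <= topspace X"
 unfolding arcin_def pathin_def continuous_map_def by auto

lemma arc_pull:
 assumes "arcin X g" "contX X S f" "I <= {0..1}" "!!t. t \<in> I ==> g t \<in> S"
 shows "continuous_on I (\<lambda>t. f (g t))"
proof -
 have "continuous_map (top_of_set I) X g"
  using assms(1,3) unfolding arcin_def pathin_def by (blast intro: continuous_map_from_subtopology_mono)
 then have "continuous_map (top_of_set I) (subtopology X S) g"
  using assms(4) by (auto simp: continuous_map_in_subtopology)
 then have "continuous_map (top_of_set I) euclidean (f \<circ> g)"
  using assms(2) unfolding contX_def by (rule continuous_map_compose)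
 then show ?thesis by (simp add: o_def)
qed

lemma contX_closed_UN:
 assumes "finite I" "!!i. i \<in> I ==> closedin X (A i)" "!!i. i \<in> I ==> contX X (A i) f"
 shows "contX X (\<Union>i\<in>I. A i) f"
 using assms
proof (induction I rule: finite_induct)
 case empty
 then show ?case by (simp add: contX_def)
next
 case (insert i I)
 show ?case
 proof (rule contX_closed_Un[where A = "A i" and B = "\<Union>i\<in>I. A i"])
  show "closedin X (\<Union>i\<in>I. A i)" using insert by (intro closedin_Union) auto
  have "contX X (\<Union>i\<in>I. A i) f" using insert by auto
  then show "contX X ((\<Union>i\<in>I. A i) \<inter> (\<Union>i\<in>insert i I. A i)) f" by (rule contX_subset) auto
  have "contX X (A i) f" using insert by auto
  then show "contX X (A i \<inter> (\<Union>i\<in>insert i I. A i)) f" by (rule contX_subset) auto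
 qed (use insert in auto)
qed

context closed_surface
begin

lemma arc_compact: "arcin X g ==> compactin X (g ` {0..1})"
 unfolding arcin_def pathin_def
 by (metis compactin_euclidean_iff compact_Icc compactin_subtopology image_compactin order_refl)

lemma arc_closed: "arcin X g ==> closedin X (g ` {0..1})"
 using arc_compact compact_closed by blast

lemma arc_connected: "arcin X g ==> connectedin X (g ` {0..1})"
 unfolding arcin_def pathin_def
 by (metis connected_Icc connectedin_continuous_map_image connectedin_iff_connected connectedin_subtopology order_refl)

text \<open>A continuous bijection from a compact space onto a Hausdorff space is a
  homeomorphism.\<close>

lemma arcparam_continuous:
 assumes "arcin X g"
 shows "continuous_map (subtopology X (g ` {0..1})) (top_of_set {0..1}) (arcparam g)"
proof -
 have "homeomorphic_map (top_of_set {0..1}) (subtopology X (g ` {0..1})) g"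
 proof (rule continuous_imp_homeomorphic_map)
  show "continuous_map (top_of_set {0..1}) (subtopology X (g ` {0..1})) g"
   using assms unfolding arcin_def pathin_def by (simp add: continuous_map_in_subtopology)
  show "g ` topspace (top_of_set {0..1}) = topspace (subtopology X (g ` {0..1}))"
   using arc_subset[OF assms] by auto
 qed (use assms Hausdorff in \<open>auto simp: arcin_def Hausdorff_space_subtopology compact_space_subtopology\<close>)
 then obtain h where h: "homeomorphic_maps (top_of_set {0..1}) (subtopology X (g ` {0..1})) g h"
  using homeomorphic_map_maps by blast
 have "h y = arcparam g y" if "y \<in> topspace (subtopology X (g ` {0..1}))" for y
  using that h arcparam[OF assms] unfolding homeomorphic_maps_def by auto
 then show ?thesis
  using h unfolding homeomorphic_maps_def by (metis (no_types, lifting) continuous_map_eq)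
qed

lemma contX_arc:
 assumes "arcin X g" "continuous_on {0..1} h"
 shows "contX X (g ` {0..1}) (\<lambda>x. h (arcparam g x))"
proof -
 have "continuous_map (subtopology X (g ` {0..1})) euclidean (h \<circ> arcparam g)"
  by (rule continuous_map_compose[OF arcparam_continuous[OF assms(1)]]) (use assms in simp)
 then show ?thesis by (simp add: contX_def o_def)
qed

lemma arc_lift:
 assumes "arcin X g" "cmap X (g ` {0..1}) f"
 obtains L where "continuous_on {0..1} L" "!!t. t \<in> {0..1} ==> f (g t) = exp (L t :: complex)"
proof (rule continuous_logarithm_on_contractible[of "{0..1}" "\<lambda>t. f (g t)"])
 show "continuous_on {0..1} (\<lambda>t. f (g t))"
  by (rule arc_pull[OF assms(1)]) (use assms(2) in \<open>auto simp: cmap_def\<close>)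
qed (use assms that in \<open>auto simp: cmap_def convex_imp_contractible\<close>)

lemma acyc_arc: "arcin X g ==> acyc X (g ` {0..1})"
 unfolding acyc_def
proof (intro allI impI)
 fix f assume g: "arcin X g" and f: "cmap X (g ` {0..1}) f"
 obtain L where L: "continuous_on {0..1} L" "!!t. t \<in> {0..1} ==> f (g t) = exp (L t)"
  by (rule arc_lift[OF g f]) blast
 have "contX X (g ` {0..1}) (\<lambda>x. L (arcparam g x))" by (rule contX_arc[OF g L(1)])
 moreover have "\<forall>x\<in>g ` {0..1}. f x = exp (L (arcparam g x))"
  using L(2) arcparam[OF g] by auto
 ultimately show "haslog X (g ` {0..1}) f" unfolding haslog_def by blast
qed

lemma acyc_sing: "acyc X {x}"
 unfolding acyc_def haslog_def
proof (intro allI impI)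
 fix f assume "cmap X {x} f"
 then show "\<exists>\<theta>. contX X {x} \<theta> \<and> (\<forall>y\<in>{x}. f y = exp (\<theta> y))"
  by (intro exI[of _ "\<lambda>_. Ln (f x)"]) (auto simp: cmap_def)
qed

lemma exp_eq_shift:
 assumes "exp a = exp (b::complex)"
 obtains k :: int where "a = b + 2 * of_int k * of_real pi * \<i>"
 using assms exp_eq[of a b] by (auto simp: algebra_simps)

lemma exp_shift: "exp (b + 2 * of_int k * of_real pi * \<i>) = exp b"
 by (subst exp_eq) (auto intro!: exI[of _ k])

text \<open>At the single common point the logarithms on the two parts differ by 2 pi i
  \<open>k\<close>, and shifting one of them by this makes them fit. This is what lets an arc be
  absorbed into a vertex set.\<close>

lemma acyc_Un_point:
 assumes cl: "closedin X A" "closedin X B" and AB: "A \<inter> B = {x}" and ac: "acyc X A" "acyc X B"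
 shows "acyc X (A \<union> B)"
 unfolding acyc_def
proof (intro allI impI)
 fix f assume f: "cmap X (A \<union> B) f"
 have "haslog X A f" "haslog X B f"
  using ac cmap_subset[OF f, of A] cmap_subset[OF f, of B] unfolding acyc_def by auto
 then obtain \<theta> \<theta>' where th: "contX X A \<theta>" "\<forall>x\<in>A. f x = exp (\<theta> x)" "contX X B \<theta>'" "\<forall>x\<in>B. f x = exp (\<theta>' x)"
  unfolding haslog_def by blast
 have xx: "x \<in> A" "x \<in> B" using AB by auto
 then have "exp (\<theta> x) = exp (\<theta>' x)" using th by metis
 then obtain k :: int where k: "\<theta> x = \<theta>' x + 2 * of_int k * of_real pi * \<i>" by (rule exp_eq_shift)
 define \<psi> where "\<psi> y = (if y \<in> A then \<theta> y else \<theta>' y + 2 * of_int k * of_real pi * \<i>)" for y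
 have "contX X A \<psi>" by (rule contX_cong[OF th(1)]) (simp add: \<psi>_def)
 moreover have "contX X B \<psi>"
 proof (rule contX_cong[OF contX_add[OF th(3) contX_const[of X B "2 * of_int k * of_real pi * \<i>"]]])
  fix y assume "y \<in> B"
  then show "\<theta>' y + 2 * of_int k * of_real pi * \<i> = \<psi> y"
   using AB k by (cases "y = x") (auto simp: \<psi>_def)
 qed
 ultimately have "contX X (A \<union> B) \<psi>"
  using contX_closed_Un[OF cl, of "A \<union> B" \<psi>] by (simp add: Int_absorb2)
 moreover have "\<forall>y\<in>A \<union> B. f y = exp (\<psi> y)" using th by (auto simp: \<psi>_def exp_shift)
 ultimately show "haslog X (A \<union> B) f" unfolding haslog_def by blast
qed

lemma openin_codiff: "finite P ==> openin X (topspace X - P)"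
 using openin_diff_finite by blast

text \<open>If \<open>f\<close> has a logarithm on the frontier of \<open>U\<close>, Tietze's theorem replaces \<open>f\<close> inside \<open>U\<close> and so
 cancels all its poles there.\<close>

lemma cancel_poles:
 assumes K: "closedin X K" and f: "cmap X (topspace X - P) f" and PK: "P \<inter> K = {}"
  and log: "haslog X K f" and U: "openin X U" "closedin X (U \<union> K)"
 obtains f' where "cmap X (topspace X - (P - U)) f'" "!!x. x \<notin> U ==> f' x = f x"
proof -
 obtain \<theta> where th: "contX X K \<theta>" "\<forall>x\<in>K. f x = exp (\<theta> x)" using log unfolding haslog_def by blast
 obtain \<theta>' where th': "contX X (topspace X) \<theta>'" "!!x. x \<in> K ==> \<theta>' x = \<theta> x"
  by (rule Tietze_complex[OF K th(1)]) blast
 define f' where "f' x = (if x \<in> U then exp (\<theta>' x) else f x)" for x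
 have "cmap X (topspace X - (P - U)) f'"
 proof (rule cmap_closed_Un[where A = "U \<union> K" and B = "topspace X - U"])
  show "closedin X (U \<union> K)" by fact
  show "closedin X (topspace X - U)" using U by (simp add: closedin_diff)
  have "cmap X (topspace X) (\<lambda>x. exp (\<theta>' x))" by (rule cmap_exp[OF th'(1)])
  then have "cmap X ((U \<union> K) \<inter> (topspace X - (P - U))) (\<lambda>x. exp (\<theta>' x))" by (rule cmap_subset) auto
  then show "cmap X ((U \<union> K) \<inter> (topspace X - (P - U))) f'"
   by (rule cmap_cong) (use th th' in \<open>auto simp: f'_def\<close>)
  have "cmap X ((topspace X - U) \<inter> (topspace X - (P - U))) f" by (rule cmap_subset[OF f]) auto
  then show "cmap X ((topspace X - U) \<inter> (topspace X - (P - U))) f'"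
   by (rule cmap_cong) (auto simp: f'_def)
 qed auto
 moreover have "f' x = f x" if "x \<notin> U" for x using that by (simp add: f'_def)
 ultimately show ?thesis using that by blast
qed

text \<open>If the puncture is filled in within a neighbourhood separated from \<open>P\<close>, the
  germs at the points of \<open>P\<close> stay the same.\<close>

lemma remove_puncture_away:
 assumes "a \<in> topspace X" "finite P" "P <= topspace X" "a \<notin> P" "openin X N" "a \<in> N"
  "cmap X (topspace X - insert a P) f" "geq X a f (\<lambda>_. 1)"
 obtains f' where "cmap X (topspace X - P) f'" "!!x. x \<notin> N ==> f' x = f x"
  "!!b h d. b \<in> P ==> geq X b f (\<lambda>x. h x powi d) ==> geq X b f' (\<lambda>x. h x powi d)"
proof -
 have "\<exists>V W. openin X V \<and> openin X W \<and> b \<in> V \<and> a \<in> W \<and> V \<inter> W = {}" if "b \<in> P" for b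
 proof -
  have "b \<in> topspace X" "b ~= a" using that assms by auto
  then show ?thesis using Hausdorff assms(1) unfolding Hausdorff_space_def disjnt_def by blast
 qed
 then obtain V W where VW: "!!b. b \<in> P ==> openin X (V b) \<and> openin X (W b) \<and> b \<in> V b \<and> a \<in> W b \<and> V b \<inter> W b = {}"
  by metis
 define M where "M = N \<inter> (topspace X \<inter> (\<Inter>b\<in>P. W b))"
 have opM: "openin X M"
 proof (cases "P = {}")
  case True then show ?thesis using openin_Int[OF assms(5) openin_topspace] by (simp add: M_def)
 next
  case False
  then show ?thesis unfolding M_def using assms VW by (intro openin_Int openin_Inter) auto
 qed
 have aM: "a \<in> M" using assms VW by (auto simp: M_def)
 have eq: "topspace X - insert a P = (topspace X - P) - {a}" by auto
 obtain f' where f': "cmap X (topspace X - P) f'" "!!x. x \<notin> M ==> f' x = f x"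
  by (rule remove_puncture[OF opM aM openin_codiff[OF assms(2)] _ assms(7)[unfolded eq] assms(8)])
   (use assms in auto)
 show ?thesis
 proof (rule that[OF f'(1)])
  show "f' x = f x" if "x \<notin> N" for x using f'(2) that by (auto simp: M_def)
  fix b h and d :: int assume b: "b \<in> P" and fb: "geq X b f (\<lambda>x. h x powi d)"
  have "geq X b f' f"
   by (rule geq_cong[of X "V b"]) (use VW[OF b] f'(2) b in \<open>auto simp: M_def\<close>)
  then show "geq X b f' (\<lambda>x. h x powi d)" using fb by (rule geq_trans)
 qed
qed

text \<open>The poles in \<open>S\<close> are slid to \<open>p\<close> one by one; the dipoles used
  are 1 outside \<open>N\<close>.\<close>

lemma gather:
 assumes N: "openin X N" "connectedin X N" and S: "finite S" "S <= N" and p: "p \<in> N" "p \<notin> S"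
  and f: "cmap X (topspace X - insert p S) f"
 shows "\<exists>f'. cmap X (topspace X - {p}) f' \<and> (\<forall>x\<in>topspace X - N. f' x = f x)"
 using S p(2) f
proof (induction S arbitrary: f rule: finite_induct)
 case (insert s S)
 have NX: "N <= topspace X" using N openin_subset by blast
 have s: "s \<in> N" "s ~= p" using insert by auto
 obtain h where h: "cmap X (topspace X - {s, p}) h" "\<forall>x\<in>topspace X - N. h x = 1" "gen X s h"
  using slide[OF N s(1) p(1) s(2)] unfolding slides_def by blast
 have "gcmap X s f"
 proof (rule gcmapI[of X "topspace X - insert p S"])
  show "openin X (topspace X - insert p S)" using insert by (intro openin_codiff) auto
  show "cmap X (topspace X - insert p S - {s}) f" by (rule cmap_subset[OF insert.prems(3)]) auto
 qed (use insert s NX in auto)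
 then obtain d :: int where d: "geq X s f (\<lambda>x. h x powi d)" using gen_exists[OF h(3)] by blast
 define g where "g x = f x * h x powi (- d)" for x
 have "cmap X (topspace X - insert s (insert p S)) g" unfolding g_def
  by (intro cmap_mult cmap_powi cmap_subset[OF insert.prems(3)] cmap_subset[OF h(1)]) auto
 moreover have "geq X s g (\<lambda>_. 1)"
 proof -
  have "geq X s g (\<lambda>x. h x powi d * h x powi (- d))"
   unfolding g_def by (rule geq_mult[OF d geq_refl]) (use s NX in auto)
  from geq_trans[OF this gen_powi_add[OF gen_gcmap[OF h(3)]]] show ?thesis by simp
 qed
 moreover have "s \<in> topspace X" "finite (insert p S)" "insert p S <= topspace X" "s \<notin> insert p S"
  using s NX insert.hyps insert.prems(1) p by auto
 ultimately obtain f' where f': "cmap X (topspace X - insert p S) f'" "!!x. x \<notin> N ==> f' x = g x"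
  using remove_puncture_away[OF _ _ _ _ N(1) s(1)] by metis
 obtain f'' where "cmap X (topspace X - {p}) f''" "\<forall>x\<in>topspace X - N. f'' x = f' x"
  using insert.IH[OF _ _ f'(1)] insert.prems by auto
 then show ?case using f'(2) h(2) by (intro exI[of _ f'']) (auto simp: g_def)
qed auto

end

section \<open>Surfaces with a parity law and a rank bound\<close>

text \<open>The two facts about a surface that the counting rests on. \<open>parity0\<close> is the
  weak form of "the winding numbers add up to 0" that also holds on non-orientable surfaces;
  \<open>rank\<close> says that the classes of maps on the whole surface modulo logarithms have rank
  at most \<open>r\<close>. Edge sets serve as indices because the families considered have one map
  per edge.\<close>

locale ranked_surface = closed_surface X for X :: "'a topology" +
 fixes r :: nat
 assumes parity0: "\<exists>p\<in>topspace X. \<forall>f h d. cmap X (topspace X - {p}) f --> gen X p h -->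
    geq X p f (\<lambda>x. h x powi d) --> even (d::int)"
  and rank: "finite T ==> (!!e::nat set. e \<in> T ==> cmap X (topspace X) (f e)) ==>
    \<exists>\<Lambda>::nat => nat set => int. \<forall>w. (\<forall>j<r. (\<Sum>e\<in>T. \<Lambda> j e * w e) = 0) -->
     haslog X (topspace X) (\<lambda>x. \<Prod>e\<in>T. f e x powi w e)"
begin

text \<open>A dipole between \<open>a\<close> and \<open>p\<close> carries the winding number, up to
  sign, from \<open>a\<close> to the point \<open>p\<close> of \<open>parity0\<close>.\<close>

lemma parity:
 assumes a: "a \<in> topspace X" and f: "cmap X (topspace X - {a}) f" and h: "gen X a h"
  and d: "geq X a f (\<lambda>x. h x powi d)"
 shows "even d"
proof -
 obtain p where p: "p \<in> topspace X" and par: "!!f h d. cmap X (topspace X - {p}) f ==> gen X p h ==>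
    geq X p f (\<lambda>x. h x powi d) ==> even (d::int)" using parity0 by blast
 show ?thesis
 proof (cases "a = p")
  case True then show ?thesis using par f h d by blast
 next
  case False
  have "connectedin X (topspace X)" using connected by (simp add: connectedin_topspace)
  then obtain k where k: "cmap X (topspace X - {a, p}) k" "gen X a k" "gen X p k"
   using slide[OF openin_topspace _ a p False] unfolding slides_def by blast
  obtain s :: int where s: "s = 1 \<or> s = -1" "geq X a h (\<lambda>x. k x powi s)" by (rule gen_unique[OF k(2) h])
  have d': "geq X a f (\<lambda>x. k x powi (s * d))"
   using geq_trans[OF d geq_powi[OF s(2)]] by (simp add: power_int_mult)
  define g where "g x = f x * k x powi (- (s * d))" for x
  have g: "cmap X (topspace X - {a, p}) g" unfolding g_def
   by (intro cmap_mult cmap_powi k(1) cmap_subset[OF f]) auto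
  have "geq X a g (\<lambda>x. k x powi (s * d) * k x powi (- (s * d)))"
   unfolding g_def by (rule geq_mult[OF d' geq_refl[OF a]])
  from geq_trans[OF this gen_powi_add[OF gen_gcmap[OF k(2)]]] have ga: "geq X a g (\<lambda>_. 1)" by simp
  have "geq X p g (\<lambda>x. 1 * k x powi (- (s * d)))" unfolding g_def
  proof (rule geq_mult[OF geq_one geq_refl[OF p]])
   show "openin X (topspace X - {a})" by (rule openin_codiff) simp
  qed (use f p False in auto)
  then have gp: "geq X p g (\<lambda>x. k x powi (- (s * d)))" by simp
  obtain f' where "cmap X (topspace X - {p}) f'" "geq X p f' (\<lambda>x. k x powi (- (s * d)))"
   by (rule remove_puncture_away[of a "{p}" "topspace X" g]) (use a p False g ga gp in auto)
  then have "even (- (s * d))" using par k(3) by blast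
  then show ?thesis using s(1) by auto
 qed
qed

text \<open>A dipole with one pole on each side has a logarithm on \<open>K\<close>. Cancelling the
  pole in \<open>U\<close> leaves a single pole of winding number 1, which is odd.\<close>

lemma acyc_nonseparating:
 assumes K: "closedin X K" "acyc X K" and U: "openin X U" "openin X U'" "U \<inter> U' = {}" "U \<union> U' = topspace X - K"
  and ne: "U ~= {}" "U' ~= {}"
 shows False
proof -
 obtain a b where ab: "a \<in> U" "b \<in> U'" using ne by blast
 have X: "a \<in> topspace X" "b \<in> topspace X" "a ~= b" using ab U by auto
 have "connectedin X (topspace X)" using connected by (simp add: connectedin_topspace)
 then obtain f where f: "cmap X (topspace X - {a, b}) f" "gen X a f" "gen X b f"
  using slide[OF openin_topspace _ X] unfolding slides_def by blast
 have "closedin X (topspace X - U')" using U by (simp add: closedin_diff)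
 moreover have "topspace X - U' = U \<union> K" using U closedin_subset[OF K(1)] openin_subset[OF U(1)] by blast
 ultimately have cl: "closedin X (U \<union> K)" by simp
 have "cmap X K f" by (rule cmap_subset[OF f(1)]) (use ab U closedin_subset[OF K(1)] in blast)
 then have log: "haslog X K f" using K(2) unfolding acyc_def by blast
 obtain f' where f': "cmap X (topspace X - ({a, b} - U)) f'" "!!x. x \<notin> U ==> f' x = f x"
  by (rule cancel_poles[OF K(1) f(1) _ log U(1) cl]) (use ab U in auto)
 have "{a, b} - U = {b}" using ab U by auto
 moreover have "geq X b f' (\<lambda>x. f x powi 1)"
  by (rule geq_cong[OF U(2) ab(2)]) (use f'(2) U in auto)
 ultimately have "even (1::int)" using parity[OF X(2) _ f(3), of f' 1] f'(1) by simp
 then show False by simp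
qed

end

context closed_surface
begin

text \<open>Otherwise the parameter of the arc would embed a circle of a chart into the real
  line.\<close>

lemma arc_nowhere_dense:
 assumes "openin X U" "U ~= {}" "arcin X g" shows "\<not> U <= g ` {0..1}"
proof
 assume sub: "U <= g ` {0..1}"
 obtain x where x: "x \<in> U" using assms by blast
 obtain W \<kappa> \<kappa>' where ch: "chart X W \<kappa> \<kappa>'" "x \<in> W" "W <= U" "\<kappa> x = 0"
  by (rule small_chart[OF assms(1) x])
 have im: "\<kappa>' z \<in> g ` {0..1}" for z using chartD(4)[OF ch(1)] ch(3) sub by blast
 then have "continuous_map euclidean (subtopology X (g ` {0..1})) \<kappa>'"
  using chartD(7)[OF ch(1)] by (auto simp: continuous_map_in_subtopology)
 then have "continuous_map euclidean (top_of_set {0..1}) (arcparam g \<circ> \<kappa>')"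
  using arcparam_continuous[OF assms(3)] by (rule continuous_map_compose)
 then have "continuous_on UNIV (\<lambda>z. arcparam g (\<kappa>' z))"
  by (simp add: continuous_map_in_subtopology o_def)
 then have "continuous_on (sphere 0 1) (\<lambda>z. arcparam g (\<kappa>' z))"
  by (rule continuous_on_subset) auto
 moreover have "inj_on (\<lambda>z. arcparam g (\<kappa>' z)) (sphere 0 1)"
 proof (rule inj_onI)
  fix z z' assume eq: "arcparam g (\<kappa>' z) = arcparam g (\<kappa>' z')"
  have "\<kappa>' z = \<kappa>' z'" using im[of z] im[of z'] eq arcparam[OF assms(3)] by auto
  then show "z = z'" using chartD(5)[OF ch(1)] by metis
 qed
 ultimately have "DIM(complex) \<le> DIM(real)" by (rule no_embedding_sphere_lowdim) simp
 then show False by simp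
qed

lemma arcs_nowhere_dense:
 assumes "finite T" "!!e. e \<in> T ==> arcin X (g e)" "openin X U" "U ~= {}"
 shows "\<not> U <= (\<Union>e\<in>T. g e ` {0..1})"
 using assms
proof (induction T arbitrary: U rule: finite_induct)
 case (insert e T)
 have "openin X (U - g e ` {0..1})" using insert arc_closed[of "g e"] by (auto intro: openin_diff)
 moreover have "U - g e ` {0..1} ~= {}" using arc_nowhere_dense[of U "g e"] insert by auto
 ultimately have "\<not> U - g e ` {0..1} <= (\<Union>e\<in>T. g e ` {0..1})" using insert by auto
 then show ?case by auto
qed auto

lemma arc_lift_loop:
 assumes g: "arcin X g" and f: "cmap X (g ` {0..1}) f" and "f (g 0) = 1" "f (g 1) = 1"
 obtains l and w :: int where "continuous_on {0..1} l" "!!t. t \<in> {0..1} ==> f (g t) = exp (l t)"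
  "l 0 = 0" "l 1 = 2 * of_int w * of_real pi * \<i>"
proof -
 obtain L where L: "continuous_on {0..1} L" "!!t. t \<in> {0..1} ==> f (g t) = exp (L t)"
  by (rule arc_lift[OF g f]) blast
 have "exp (L 0) = exp 0" "exp (L 1) = exp (L 0)" using L(2)[of 0] L(2)[of 1] assms by auto
 then obtain w :: int where w: "L 1 = L 0 + 2 * of_int w * of_real pi * \<i>" using exp_eq_shift by metis
 show ?thesis
 proof (rule that[of "\<lambda>t. L t - L 0" w])
  show "continuous_on {0..1} (\<lambda>t. L t - L 0)" using L(1) by (intro continuous_intros)
  show "f (g t) = exp (L t - L 0)" if "t \<in> {0..1}" for t
   using L(2)[OF that] \<open>exp (L 0) = exp 0\<close> by (simp add: exp_diff)
 qed (use w in auto)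
qed

end

section \<open>Graphs with thickened vertices on a surface\<close>

text \<open>Acyclic connected closed sets in place of points make the notion stable under
  contraction: the arc of the contracted edge joins two vertex sets to one. The directions given by
  \<open>tail\<close> and \<open>head\<close> are arbitrary and serve to speak of winding along an
  edge; \<open>proper\<close> keeps the complement of every drawing nonempty, so that there is room
  for poles.\<close>

locale fat_graph = ranked_surface X r for X :: "'a topology" and r :: nat +
 fixes V :: "nat set" and E :: "nat set set" and \<Phi> :: "nat => 'a set"
  and \<gamma> :: "nat set => real => 'a" and tail head :: "nat set => nat"
 assumes finV: "finite V" and finE: "finite E"
  and vert: "v \<in> V ==> closedin X (\<Phi> v) \<and> connectedin X (\<Phi> v) \<and> \<Phi> v ~= {} \<and> acyc X (\<Phi> v)"
  and vdisj: "u \<in> V ==> v \<in> V ==> u ~= v ==> \<Phi> u \<inter> \<Phi> v = {}"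
  and ends: "e \<in> E ==> tail e \<in> V \<and> head e \<in> V \<and> tail e ~= head e \<and> e = {tail e, head e} \<and>
    \<gamma> e 0 \<in> \<Phi> (tail e) \<and> \<gamma> e 1 \<in> \<Phi> (head e)"
  and arc: "e \<in> E ==> arcin X (\<gamma> e)"
  and inner: "e \<in> E ==> v \<in> V ==> \<gamma> e ` {0<..<1} \<inter> \<Phi> v = {}"
  and edisj: "e \<in> E ==> e' \<in> E ==> e ~= e' ==> \<gamma> e ` {0<..<1} \<inter> \<gamma> e' ` {0<..<1} = {}"
  and proper: "\<exists>p\<in>topspace X. p \<notin> (\<Union>v\<in>V. \<Phi> v) \<union> (\<Union>e\<in>E. \<gamma> e ` {0..1})"
begin

definition drawn :: "nat set set => 'a set" where
 "drawn T = (\<Union>v\<in>V. \<Phi> v) \<union> (\<Union>e\<in>T. \<gamma> e ` {0<..<1})"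

lemma arc_eq: "\<gamma> e ` {0..1} = insert (\<gamma> e 0) (insert (\<gamma> e 1) (\<gamma> e ` {0<..<1}))"
proof -
 have "{0..1::real} = insert 0 (insert 1 {0<..<1})" by auto
 then show ?thesis by (metis image_insert)
qed

lemma arc_in_drawn: "T <= E ==> e \<in> T ==> \<gamma> e ` {0..1} <= drawn T"
 unfolding arc_eq drawn_def using ends by blast

lemma drawn_eq: "T <= E ==> drawn T = (\<Union>v\<in>V. \<Phi> v) \<union> (\<Union>e\<in>T. \<gamma> e ` {0..1})"
 using arc_in_drawn[of T] unfolding drawn_def arc_eq by blast

lemma drawn_mono: "T <= T' ==> drawn T <= drawn T'"
 unfolding drawn_def by blast

lemma verts_drawn: "v \<in> V ==> \<Phi> v <= drawn T"
 unfolding drawn_def by blast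

lemma ends_drawn: "e \<in> E ==> \<gamma> e 0 \<in> drawn T \<and> \<gamma> e 1 \<in> drawn T"
 using ends verts_drawn by blast

lemma closedin_drawn:
 assumes "T <= E" shows "closedin X (drawn T)"
proof -
 have "finite T" using assms finE finite_subset by blast
 then show ?thesis unfolding drawn_eq[OF assms]
  using finV vert arc_closed arc assms by (intro closedin_Un closedin_Union) auto
qed

lemma openin_undrawn: "T <= E ==> openin X (topspace X - drawn T)"
 using closedin_drawn by blast

lemma inner_disj_drawn: "e \<in> E ==> T <= E ==> e \<notin> T ==> \<gamma> e ` {0<..<1} \<inter> drawn T = {}"
 unfolding drawn_def using inner[of e] edisj[of e] by blast

lemma drawn_insert: "drawn (insert e T) = \<gamma> e ` {0<..<1} \<union> drawn T"
 unfolding drawn_def by blast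

lemma undrawn_ne: assumes "T <= E" shows "topspace X - drawn T ~= {}"
proof -
 obtain p where "p \<in> topspace X" "p \<notin> drawn E" using proper unfolding drawn_eq[OF subset_refl] ..
 then show ?thesis using drawn_mono[OF assms] by blast
qed

lemma inner_top: "e \<in> E ==> \<gamma> e ` {0<..<1} <= topspace X"
 using arc_subset[OF arc] unfolding arc_eq by blast

text \<open>Every integer labelling of the edges is a coboundary. This says that \<open>T\<close> is
  a forest, in the form needed to fit logarithms together.\<close>

definition pot :: "nat set set => bool" where
 "pot T \<longleftrightarrow> (\<forall>w::nat set => int. \<exists>k::nat => int. \<forall>e\<in>T. k (head e) - k (tail e) = w e)"

text \<open>Logarithms chosen on the vertex sets and on the arcs disagree along each edge by an
  integer \<open>m e\<close>. A potential for \<open>m\<close> tells by how many multiples of 2 pi i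
  to shift the logarithm on each vertex set.\<close>

lemma acyc_pot:
 assumes T: "T <= E" and "pot T" shows "acyc X (drawn T)"
 unfolding acyc_def
proof (intro allI impI)
 fix f assume f: "cmap X (drawn T) f"
 have finT: "finite T" using T finE finite_subset by blast
 have "\<exists>\<theta>. contX X (\<Phi> v) \<theta> \<and> (\<forall>x\<in>\<Phi> v. f x = exp (\<theta> x))" if v: "v \<in> V" for v
  using vert[OF v] cmap_subset[OF f verts_drawn[OF v]] unfolding acyc_def haslog_def by blast
 then obtain \<theta> where th: "!!v. v \<in> V ==> contX X (\<Phi> v) (\<theta> v)" "!!v x. v \<in> V ==> x \<in> \<Phi> v ==> f x = exp (\<theta> v x)"
  by metis
 have "\<exists>L. continuous_on {0..1} L \<and> (\<forall>t\<in>{0..1}. f (\<gamma> e t) = exp (L t))" if e: "e \<in> T" for e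
 proof -
  have eE: "e \<in> E" using e T by blast
  obtain L where "continuous_on {0..1} L" "!!t. t \<in> {0..1} ==> f (\<gamma> e t) = exp (L t)"
   by (rule arc_lift[OF arc[OF eE] cmap_subset[OF f arc_in_drawn[OF T e]]]) blast
  then show ?thesis by blast
 qed
 then obtain L where L: "!!e. e \<in> T ==> continuous_on {0..1} (L e)"
   "!!e t. e \<in> T ==> t \<in> {0..1} ==> f (\<gamma> e t) = exp (L e t)"
  by metis
 have "\<exists>m::int. L e 1 - L e 0 = \<theta> (head e) (\<gamma> e 1) - \<theta> (tail e) (\<gamma> e 0) + 2 * of_int m * of_real pi * \<i>" if e: "e \<in> T" for e
 proof -
  have eE: "e \<in> E" using e T by blast
  note en = ends[OF eE]
  have 1: "exp (L e 1) = exp (\<theta> (head e) (\<gamma> e 1))" "exp (L e 0) = exp (\<theta> (tail e) (\<gamma> e 0))"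
   using L(2)[OF e, of 1] L(2)[OF e, of 0] th(2)[of "head e" "\<gamma> e 1"] th(2)[of "tail e" "\<gamma> e 0"] en by auto
  then have "exp (L e 1 - L e 0) = exp (\<theta> (head e) (\<gamma> e 1) - \<theta> (tail e) (\<gamma> e 0))" by (simp add: exp_diff)
  then show ?thesis by (rule exp_eq_shift) blast
 qed
 then obtain m where m: "!!e. e \<in> T ==> L e 1 - L e 0 = \<theta> (head e) (\<gamma> e 1) - \<theta> (tail e) (\<gamma> e 0) + 2 * of_int (m e) * of_real pi * \<i>"
  by metis
 obtain k :: "nat => int" where k: "!!e. e \<in> T ==> k (head e) - k (tail e) = m e"
  using assms(2) unfolding pot_def by metis
 define \<theta>' where "\<theta>' v x = \<theta> v x + 2 * of_int (k v) * of_real pi * \<i>" for v x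
 \<comment> \<open>Started at the shifted value at the tail, the logarithm along \<open>e\<close>
   arrives at the shifted value at the head.\<close>
 define L' where "L' e t = L e t + (\<theta>' (tail e) (\<gamma> e 0) - L e 0)" for e t
 have L'0: "L' e 0 = \<theta>' (tail e) (\<gamma> e 0)" for e by (simp add: L'_def)
 have L'1: "L' e 1 = \<theta>' (head e) (\<gamma> e 1)" if e: "e \<in> T" for e
 proof -
  have "L e 1 - L e 0 = \<theta> (head e) (\<gamma> e 1) - \<theta> (tail e) (\<gamma> e 0) + 2 * of_int (k (head e) - k (tail e)) * of_real pi * \<i>"
   using m[OF e] k[OF e] by simp
  then have "L e 1 = L e 0 + (\<theta> (head e) (\<gamma> e 1) - \<theta> (tail e) (\<gamma> e 0) + 2 * of_int (k (head e) - k (tail e)) * of_real pi * \<i>)"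
   by (simp add: algebra_simps)
  then show ?thesis by (simp add: L'_def \<theta>'_def algebra_simps)
 qed
 have L'e: "f (\<gamma> e t) = exp (L' e t)" if "e \<in> T" "t \<in> {0..1}" for e t
 proof -
  have eE: "e \<in> E" using that T by blast
  have "exp (\<theta>' (tail e) (\<gamma> e 0)) = f (\<gamma> e 0)"
   using th(2)[of "tail e" "\<gamma> e 0"] ends[OF eE] by (simp add: \<theta>'_def exp_shift)
  then have "exp (\<theta>' (tail e) (\<gamma> e 0)) = exp (L e 0)" using L(2)[of e 0] that by simp
  then show ?thesis using L(2)[OF that] by (simp add: L'_def exp_add exp_diff)
 qed
 define \<psi> where "\<psi> x = (if \<exists>v\<in>V. x \<in> \<Phi> v then \<theta>' (SOME v. v \<in> V \<and> x \<in> \<Phi> v) x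
   else L' (SOME e. e \<in> T \<and> x \<in> \<gamma> e ` {0<..<1}) (arcparam (\<gamma> (SOME e. e \<in> T \<and> x \<in> \<gamma> e ` {0<..<1})) x))" for x
 have psiV: "\<psi> x = \<theta>' v x" if v: "v \<in> V" "x \<in> \<Phi> v" for x v
 proof -
  have "(SOME v. v \<in> V \<and> x \<in> \<Phi> v) = v"
   using v vdisj by (intro some_equality) blast+
  then show ?thesis using v by (auto simp: \<psi>_def)
 qed
 have psiE: "\<psi> (\<gamma> e t) = L' e t" if e: "e \<in> T" "t \<in> {0..1}" for e t
 proof -
  have eE: "e \<in> E" using e T by blast
  consider "t = 0" | "t = 1" | "t \<in> {0<..<1}" using e(2) by force
  then show ?thesis
  proof cases
   case 1 then show ?thesis using psiV[of "tail e" "\<gamma> e 0"] ends[OF eE] L'0 by simp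
  next
   case 2 then show ?thesis using psiV[of "head e" "\<gamma> e 1"] ends[OF eE] L'1[OF e(1)] by simp
  next
   case 3
   then have x: "\<gamma> e t \<in> \<gamma> e ` {0<..<1}" by blast
   have "\<not> (\<exists>v\<in>V. \<gamma> e t \<in> \<Phi> v)" using inner[OF eE] x by blast
   moreover have "(SOME e'. e' \<in> T \<and> \<gamma> e t \<in> \<gamma> e' ` {0<..<1}) = e"
    using e x edisj T by (intro some_equality) blast+
   ultimately show ?thesis using arcparam[OF arc[OF eE] e(2)] by (simp add: \<psi>_def)
  qed
 qed
 have "contX X (drawn T) \<psi>"
  unfolding drawn_eq[OF T]
 proof (rule contX_closed_Un[where A = "\<Union>v\<in>V. \<Phi> v" and B = "\<Union>e\<in>T. \<gamma> e ` {0..1}"])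
  show "closedin X (\<Union>v\<in>V. \<Phi> v)" using finV vert by (intro closedin_Union) auto
  show "closedin X (\<Union>e\<in>T. \<gamma> e ` {0..1})" using finT arc_closed arc T by (intro closedin_Union) auto
  have "contX X (\<Union>v\<in>V. \<Phi> v) \<psi>"
  proof (rule contX_closed_UN[OF finV])
   fix v assume v: "v \<in> V"
   show "closedin X (\<Phi> v)" using vert[OF v] by blast
   show "contX X (\<Phi> v) \<psi>"
    by (rule contX_cong[OF contX_add[OF th(1)[OF v] contX_const[of _ _ "2 * of_int (k v) * of_real pi * \<i>"]]])
     (use psiV[OF v] in \<open>simp add: \<theta>'_def\<close>)
  qed
  then show "contX X ((\<Union>v\<in>V. \<Phi> v) \<inter> ((\<Union>v\<in>V. \<Phi> v) \<union> (\<Union>e\<in>T. \<gamma> e ` {0..1}))) \<psi>" by (rule contX_subset) blast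
  have "contX X (\<Union>e\<in>T. \<gamma> e ` {0..1}) \<psi>"
  proof (rule contX_closed_UN[OF finT])
   fix e assume e: "e \<in> T"
   then have eE: "e \<in> E" using T by blast
   show "closedin X (\<gamma> e ` {0..1})" using arc_closed[OF arc[OF eE]] .
   have "continuous_on {0..1} (L' e)" unfolding L'_def by (intro continuous_intros L(1)[OF e])
   then have "contX X (\<gamma> e ` {0..1}) (\<lambda>x. L' e (arcparam (\<gamma> e) x))" by (rule contX_arc[OF arc[OF eE]])
   then show "contX X (\<gamma> e ` {0..1}) \<psi>"
    by (rule contX_cong) (use psiE[OF e] arcparam[OF arc[OF eE]] in auto)
  qed
  then show "contX X ((\<Union>e\<in>T. \<gamma> e ` {0..1}) \<inter> ((\<Union>v\<in>V. \<Phi> v) \<union> (\<Union>e\<in>T. \<gamma> e ` {0..1}))) \<psi>" by (rule contX_subset) blast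
 qed auto
 moreover have "f x = exp (\<psi> x)" if "x \<in> drawn T" for x
 proof -
  have "(\<exists>v\<in>V. x \<in> \<Phi> v) \<or> (\<exists>e\<in>T. \<exists>t\<in>{0..1}. x = \<gamma> e t)"
   using that unfolding drawn_eq[OF T] by auto
  then consider v where "v \<in> V" "x \<in> \<Phi> v" | e t where "e \<in> T" "t \<in> {0..1}" "x = \<gamma> e t"
   by blast
  then show ?thesis
  proof cases
   case 1 then show ?thesis using psiV th(2) by (simp add: \<theta>'_def exp_shift)
  next
   case 2 then show ?thesis using psiE L'e by simp
  qed
 qed
 ultimately show "haslog X (drawn T) f" unfolding haslog_def by blast
qed

lemma pot_empty: "pot {}" by (simp add: pot_def)

text \<open>No edge of \<open>T\<close> constrains the potential at \<open>v\<close>, so its value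
  there can be set to give \<open>e\<close> its label.\<close>

lemma pot_leaf:
 assumes "pot T" "e \<in> E" "T <= E" "v \<in> e" "!!e'. e' \<in> T ==> v \<notin> e'"
 shows "pot (insert e T)"
 unfolding pot_def
proof
 fix w :: "nat set => int"
 obtain k :: "nat => int" where k: "\<forall>e\<in>T. k (head e) - k (tail e) = w e" using assms(1) unfolding pot_def by blast
 have et: "v = tail e \<or> v = head e" "tail e ~= head e" using ends[OF assms(2)] assms(4) by auto
 define k' where "k' = k(v := if v = head e then k (tail e) + w e else k (head e) - w e)"
 have "k' (head e') - k' (tail e') = w e'" if e': "e' \<in> insert e T" for e'
 proof (cases "e' = e")
  case True
  then show ?thesis using et unfolding k'_def by auto
 next
  case False
  then have e'T: "e' \<in> T" using e' by blast
  then have "head e' \<in> e'" "tail e' \<in> e'" using ends[of e'] assms(3) by blast+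
  then have "head e' ~= v" "tail e' ~= v" using assms(5)[OF e'T] by auto
  then show ?thesis using k e'T by (simp add: k'_def)
 qed
 then show "\<exists>k. \<forall>e\<in>insert e T. k (head e) - k (tail e) = w e" by blast
qed

text \<open>Cycles of a bipartite graph have at least four edges. Without a leaf, an edge
  \<open>ab\<close> continues at its ends to \<open>ac\<close> and \<open>bd\<close>; with three
  edges in all, the one that continues at \<open>c\<close> forces \<open>c = d\<close>, against the
  bipartition.\<close>

lemma small_leaf:
 assumes bip: "!!e. e \<in> E ==> (tail e \<in> B) ~= (head e \<in> B)"
  and T: "T <= E" "T ~= {}" "card T \<le> 3"
 shows "\<exists>e\<in>T. \<exists>v\<in>e. \<forall>e'\<in>T - {e}. v \<notin> e'"
proof (rule ccontr)
 assume "\<not> ?thesis"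
 then have H: "\<exists>e'\<in>T. e' ~= e \<and> v \<in> e'" if "e \<in> T" "v \<in> e" for e v using that by blast
 have fin: "finite T" using T finE finite_subset by blast
 have pair: "\<exists>x. e = {a, x} \<and> x ~= a \<and> ((a \<in> B) ~= (x \<in> B))" if "e \<in> T" "a \<in> e" for e a
 proof -
  have "e \<in> E" using that T by blast
  then show ?thesis using ends[of e] bip[of e] that(2) by (metis doubleton_eq_iff insertE singletonD)
 qed
 obtain e where e: "e \<in> T" using T by blast
 then have "e ~= {}" using ends[of e] T by blast
 then obtain a where a: "a \<in> e" by blast
 obtain b where b: "e = {a, b}" "b ~= a" "(a \<in> B) ~= (b \<in> B)" using pair[OF e a] by blast
 obtain e1 where e1: "e1 \<in> T" "e1 ~= e" "a \<in> e1" using H[OF e a] by blast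
 obtain e2 where e2: "e2 \<in> T" "e2 ~= e" "b \<in> e2" using H[OF e, of b] b by blast
 obtain c where c: "e1 = {a, c}" "c ~= a" "(a \<in> B) ~= (c \<in> B)" using pair[OF e1(1,3)] by blast
 obtain d where d: "e2 = {b, d}" "d ~= b" "(b \<in> B) ~= (d \<in> B)" using pair[OF e2(1,3)] by blast
 have cb: "c ~= b" using e1(2) c b by blast
 have da: "d ~= a" using e2(2) d b by blast
 have "e1 ~= e2" using c d cb b da by (metis doubleton_eq_iff)
 then have "card {e, e1, e2} = 3" using e1 e2 by auto
 moreover have "{e, e1, e2} <= T" using e e1 e2 by blast
 ultimately have Teq: "T = {e, e1, e2}" using T(3) fin card_seteq by (metis le_refl)
 obtain e3 where e3: "e3 \<in> T" "e3 ~= e1" "c \<in> e3" using H[OF e1(1), of c] c by blast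
 then have "e3 = e \<or> e3 = e2" using Teq by blast
 then have "c = d" using e3(3) b c d cb by blast
 then show False using b c d by blast
qed

lemma pot_small:
 assumes bip: "!!e. e \<in> E ==> (tail e \<in> B) ~= (head e \<in> B)"
  and T: "T <= E" "card T \<le> 3"
 shows "pot T"
proof -
 have "finite T" using T finE finite_subset by blast
 then show ?thesis using T
 proof (induction "card T" arbitrary: T)
  case 0 then show ?case using pot_empty by simp
 next
  case (Suc n)
  then have "T ~= {}" by auto
  then obtain e v where e: "e \<in> T" "v \<in> e" "\<forall>e'\<in>T - {e}. v \<notin> e'" using small_leaf[OF bip Suc.prems(2) _ Suc.prems(3)] by blast
  have "pot (T - {e})" using Suc.hyps(2) Suc.prems e by (intro Suc.hyps(1)) auto
  then have "pot (insert e (T - {e}))" using e Suc.prems by (intro pot_leaf) auto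
  then show ?case using e(1) by (simp add: insert_absorb)
 qed
qed

definition touches :: "nat set => 'a set => bool" where
 "touches e U \<longleftrightarrow> \<gamma> e ` {0<..<1} \<inter> X closure_of U ~= {}"

text \<open>The closure of \<open>U\<close> stays in \<open>U\<close> together with the vertex sets
  and the edges that touch it. At most three such edges form a forest by bipartiteness, so what
  bounds \<open>U\<close> is acyclic and cannot separate it from \<open>U'\<close>.\<close>

lemma touch_ge4:
 assumes bip: "!!e. e \<in> E ==> (tail e \<in> B) ~= (head e \<in> B)"
  and U: "openin X U" "openin X U'" "U \<inter> U' = {}" "U \<union> U' = topspace X - drawn E" "U ~= {}" "U' ~= {}"
 shows "4 \<le> card {e \<in> E. touches e U}"
proof (rule ccontr)
 assume less: "\<not> 4 \<le> card {e \<in> E. touches e U}"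
 define T where "T = {e \<in> E. touches e U}"
 have T: "T <= E" "card T \<le> 3" using less by (auto simp: T_def)
 have clK: "closedin X (drawn T)" using closedin_drawn[OF T(1)] .
 have "closedin X (topspace X - U')" using U by (simp add: closedin_diff)
 moreover have "U <= topspace X - U'" using U openin_subset by blast
 ultimately have "X closure_of U <= topspace X - U'" using closure_of_minimal by blast
 then have "X closure_of U <= U \<union> drawn E" using U by blast
 have sub: "X closure_of U <= U \<union> drawn T"
 proof
  fix x assume x: "x \<in> X closure_of U"
  then have "x \<in> U \<union> drawn E" using \<open>X closure_of U <= U \<union> drawn E\<close> by blast
  then consider "x \<in> U" | v where "v \<in> V" "x \<in> \<Phi> v" | e where "e \<in> E" "x \<in> \<gamma> e ` {0<..<1}"
   unfolding drawn_def by (elim UnE UN_E) auto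
  then show "x \<in> U \<union> drawn T"
  proof cases
   case (3 e)
   then have "touches e U" using x unfolding touches_def by blast
   then have "e \<in> T" using 3 by (simp add: T_def)
   then show ?thesis using 3(2) unfolding drawn_def by (intro UnI2 UN_I)
  qed (auto simp: drawn_def)
 qed
 have "U <= X closure_of U" using closure_of_subset openin_subset[OF U(1)] by blast
 then have "U \<union> drawn T = X closure_of U \<union> drawn T" using sub by blast
 then have cl: "closedin X (U \<union> drawn T)" using clK by (simp add: closedin_Un)
 show False
 proof (rule acyc_nonseparating[OF clK acyc_pot[OF T(1) pot_small[OF bip T]] U(1)])
  show "openin X (topspace X - (U \<union> drawn T))" using cl by blast
  show "U \<inter> (topspace X - (U \<union> drawn T)) = {}" by blast
  show "U \<union> (topspace X - (U \<union> drawn T)) = topspace X - drawn T"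
   using U drawn_mono[OF T(1)] by blast
  show "topspace X - (U \<union> drawn T) ~= {}" using U drawn_mono[OF T(1)] by blast
  show "U ~= {}" by fact
 qed
qed

text \<open>Dividing \<open>(b, - a)\<close> by the gcd makes the two entries coprime.\<close>

lemma even_solution: "\<exists>P Q::int. P * a + Q * b = 0 \<and> (odd P \<or> odd Q)"
proof (cases "a = 0 \<and> b = 0")
 case False
 define g where "g = gcd a b"
 have g: "g ~= 0" using False by (simp add: g_def)
 obtain a' b' where ab: "a = g * a'" "b = g * b'" unfolding g_def by (meson dvdE gcd_dvd1 gcd_dvd2)
 have "odd a' \<or> odd b'"
 proof (rule ccontr)
  assume "\<not> ?thesis"
  then have "2 * g dvd a" "2 * g dvd b" using ab by (auto simp: mult.commute[of 2] intro: mult_dvd_mono)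
  then have "2 * g dvd 1 * g" unfolding g_def using gcd_greatest by fastforce
  then have "2 dvd (1::int)" using g by (simp only: dvd_mult_cancel_right) simp
  then show False by simp
 qed
 then show ?thesis by (intro exI[of _ b'] exI[of _ "- a'"]) (auto simp: ab)
qed (auto intro!: exI[of _ 1])

text \<open>Suppose three faces lie along one edge. Dipoles from a point of the first face to points
  of the other two, supported near the open arc, have some winding numbers \<open>w\<close> and
  \<open>w'\<close> along it. Exponents \<open>P\<close> and \<open>Q\<close> that are not both even
  make the product wind 0 times, so that it has a logarithm on the whole drawing. Cancelling the
  poles in all faces but one then shows that \<open>P\<close> and \<open>Q\<close> are both
  even.\<close>

lemma touch_le2:
 fixes U :: "nat => 'a set"
 assumes e: "e \<in> E"
  and U: "!!i. i < 3 ==> openin X (U i) \<and> closedin X (U i \<union> drawn E) \<and> U i \<inter> drawn E = {} \<and> touches e (U i)"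
  and disj: "!!i j. i < 3 ==> j < 3 ==> i ~= j ==> U i \<inter> U j = {}"
 shows False
proof -
 let ?I = "\<gamma> e ` {0<..<1}" and ?A = "\<gamma> e ` {0..1}"
 define K0 where "K0 = drawn (E - {e})"
 have clK0: "closedin X K0" unfolding K0_def by (rule closedin_drawn) auto
 have IK0: "?I \<inter> K0 = {}" unfolding K0_def by (rule inner_disj_drawn) (use e in auto)
 have clE: "closedin X (drawn E)" by (rule closedin_drawn) simp
 have Ec: "drawn E = K0 \<union> ?A"
  unfolding K0_def using drawn_insert[of e "E - {e}"] e arc_in_drawn[of E e] by (auto simp: insert_absorb arc_eq)
 \<comment> \<open>The union of all connected open sets that meet the open arc and avoid the rest of
   the drawing is a connected neighbourhood of the open arc, in which poles can be slid.\<close>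
 define \<W> where "\<W> = {W. openin X W \<and> connectedin X W \<and> W \<inter> K0 = {} \<and> W \<inter> ?I ~= {}}"
 define N where "N = \<Union>\<W>"
 have cov: "\<exists>W\<in>\<W>. x \<in> W" if x: "x \<in> ?I" for x
 proof -
  have "openin X (topspace X - K0)" "x \<in> topspace X - K0"
   using clK0 x IK0 inner_top[OF e] by blast+
  then obtain W \<kappa> \<kappa>' where ch: "chart X W \<kappa> \<kappa>'" "x \<in> W" "W <= topspace X - K0" "\<kappa> x = 0"
   by (rule small_chart)
  have "connectedin X {x \<in> W. \<kappa> x \<in> UNIV}" by (rule chart_connected[OF ch(1)]) (simp add: convex_connected)
  then show ?thesis using ch chartD(1)[OF ch(1)] x unfolding \<W>_def by (intro bexI[of _ W]) auto
 qed
 have opN: "openin X N" unfolding N_def \<W>_def by (rule openin_Union) blast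
 have conI: "connectedin X ?I"
 proof -
  have "continuous_map (top_of_set {0..1}) X (\<gamma> e)" using arc[OF e] unfolding arcin_def pathin_def by blast
  then have "continuous_map (top_of_set {0<..<1}) X (\<gamma> e)" by (rule continuous_map_from_subtopology_mono) auto
  moreover have "connectedin (top_of_set {0<..<1::real}) {0<..<1}" by (simp add: connectedin_subtopology)
  ultimately show ?thesis by (rule connectedin_continuous_map_image)
 qed
 have neI: "?I ~= {}" by auto
 have "N = \<Union>((\<lambda>W. W \<union> ?I) ` \<W>)" unfolding N_def using cov by auto
 moreover have "connectedin X (\<Union>((\<lambda>W. W \<union> ?I) ` \<W>))"
 proof (rule connectedin_Union)
  show "connectedin X S" if "S \<in> (\<lambda>W. W \<union> ?I) ` \<W>" for S
   using that conI unfolding \<W>_def by (auto intro!: connectedin_Un)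
  show "\<Inter>((\<lambda>W. W \<union> ?I) ` \<W>) ~= {}" using neI by blast
 qed
 ultimately have conN: "connectedin X N" by simp
 have NK0: "N \<inter> K0 = {}" unfolding N_def \<W>_def by blast
 have "\<exists>a. a \<in> U i \<inter> N" if i: "i < 3" for i
 proof -
  obtain x where x: "x \<in> ?I" "x \<in> X closure_of U i" using U[OF i] unfolding touches_def by blast
  have "x \<in> N" using cov[OF x(1)] unfolding N_def by blast
  then show ?thesis using x(2) opN unfolding in_closure_of by blast
 qed
 then obtain a where a: "!!i. i < 3 ==> a i \<in> U i \<inter> N" by metis
 have aX: "a i \<in> topspace X" "a i \<notin> drawn E" if "i < 3" for i
  using a[OF that] U[OF that] openin_subset by blast+
 have ne: "a i ~= a j" if "i < 3" "j < 3" "i ~= j" for i j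
  using a[OF that(1)] a[OF that(2)] disj[OF that] by auto
 obtain f where f: "cmap X (topspace X - {a 0, a 1}) f" "\<forall>x\<in>topspace X - N. f x = 1" "gen X (a 1) f"
  using slide[OF opN conN, of "a 0" "a 1"] a ne unfolding slides_def by force
 obtain g where g: "cmap X (topspace X - {a 0, a 2}) g" "\<forall>x\<in>topspace X - N. g x = 1" "gen X (a 2) g"
  using slide[OF opN conN, of "a 0" "a 2"] a ne unfolding slides_def by force
 have AX: "?A <= topspace X" "?A <= drawn E" using arc_subset[OF arc[OF e]] Ec by auto
 have fA: "cmap X ?A f" by (rule cmap_subset[OF f(1)]) (use AX aX(2)[of 0] aX(2)[of 1] in auto)
 have gA: "cmap X ?A g" by (rule cmap_subset[OF g(1)]) (use AX aX(2)[of 0] aX(2)[of 2] in auto)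
 have K0X: "K0 <= topspace X" using closedin_subset[OF clK0] .
 have endK: "\<gamma> e 0 \<in> K0" "\<gamma> e 1 \<in> K0" using ends_drawn[OF e] unfolding K0_def by auto
 have one: "f x = 1" "g x = 1" if "x \<in> K0" for x using that f(2) g(2) NK0 K0X by blast+
 obtain l and w :: int where l: "continuous_on {0..1} l" "!!t. t \<in> {0..1} ==> f (\<gamma> e t) = exp (l t)"
   "l 0 = 0" "l 1 = 2 * of_int w * of_real pi * \<i>"
  by (rule arc_lift_loop[OF arc[OF e] fA]) (use one endK in auto)
 obtain l' and w' :: int where l': "continuous_on {0..1} l'" "!!t. t \<in> {0..1} ==> g (\<gamma> e t) = exp (l' t)"
   "l' 0 = 0" "l' 1 = 2 * of_int w' * of_real pi * \<i>"
  by (rule arc_lift_loop[OF arc[OF e] gA]) (use one endK in auto)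
 \<comment> \<open>The winding number of \<open>F\<close> along the arc is
   \<open>P * w + Q * w'\<close>.\<close>
 obtain P Q :: int where PQ: "P * w + Q * w' = 0" "odd P \<or> odd Q" using even_solution by blast
 define F where "F x = f x powi P * g x powi Q" for x
 have F: "cmap X (topspace X - {a 0, a 1, a 2}) F" unfolding F_def
  by (intro cmap_mult cmap_powi cmap_subset[OF f(1)] cmap_subset[OF g(1)]) auto
 \<comment> \<open>\<open>F\<close> is 1 on the rest of the drawing and has a logarithm along the
   arc that starts and ends at 0, so 0 continues it.\<close>
 have "haslog X (drawn E) F"
 proof -
  define m where "m t = of_int P * l t + of_int Q * l' t" for t
  have m01: "m 0 = 0" "m 1 = 0"
  proof -
   have "m 1 = 2 * of_int (P * w + Q * w') * of_real pi * \<i>" using l l' by (simp add: m_def algebra_simps)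
   then show "m 1 = 0" using PQ by simp
  qed (use l l' in \<open>simp add: m_def\<close>)
  have mc: "continuous_on {0..1} m" unfolding m_def by (intro continuous_intros l l')
  define \<theta> where "\<theta> x = (if x \<in> ?A then m (arcparam (\<gamma> e) x) else 0)" for x
  have "\<theta> x = 0" if "x \<in> K0" for x
  proof (cases "x \<in> ?A")
   case True
   then have "x = \<gamma> e 0 \<or> x = \<gamma> e 1" using that IK0 unfolding arc_eq by blast
   then show ?thesis using arcparam[OF arc[OF e], of 0] arcparam[OF arc[OF e], of 1] m01
    by (auto simp: \<theta>_def)
  qed (simp add: \<theta>_def)
  note th0 = this
  have "contX X (K0 \<union> ?A) \<theta>"
  proof (rule contX_closed_Un[OF clK0 arc_closed[OF arc[OF e]]])
   show "contX X (K0 \<inter> (K0 \<union> ?A)) \<theta>" by (rule contX_cong[OF contX_const[of _ _ 0]]) (use th0 in auto)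
   have "contX X ?A \<theta>" by (rule contX_cong[OF contX_arc[OF arc[OF e] mc]]) (simp add: \<theta>_def)
   then show "contX X (?A \<inter> (K0 \<union> ?A)) \<theta>" by (rule contX_subset) blast
  qed auto
  moreover have "F x = exp (\<theta> x)" if "x \<in> K0 \<union> ?A" for x
  proof (cases "x \<in> ?A")
   case True
   then obtain t where t: "t \<in> {0..1}" "x = \<gamma> e t" by blast
   have "F x = exp (l t) powi P * exp (l' t) powi Q" using l(2)[OF t(1)] l'(2)[OF t(1)] t by (simp add: F_def)
   also have "\<dots> = exp (m t)" by (simp add: m_def exp_add exp_power_int mult.commute)
   finally show ?thesis using True t arcparam[OF arc[OF e] t(1)] by (simp add: \<theta>_def)
  next
   case False
   then show ?thesis using that th0 one by (simp add: F_def)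
  qed
  ultimately show ?thesis unfolding haslog_def Ec by blast
 qed
 note Flog = this
 \<comment> \<open>The poles at \<open>a 0\<close> and \<open>a j\<close> lie in faces where they
   can be cancelled, which leaves \<open>a i\<close> as the only pole.\<close>
 have main: "even d" if ij: "(i, j) = (1, 2) \<or> (i, j) = (2, 1::nat)" and h: "gen X (a i) h" and d: "geq X (a i) F (\<lambda>x. h x powi d)" for i j h and d :: int
 proof -
  have i: "i < 3" "j < 3" "i ~= 0" "i ~= j" "j ~= 0" using ij by auto
  have set: "{a 0, a 1, a 2} = {a i, a j, a 0}" using ij by auto
  have "closedin X ((U 0 \<union> drawn E) \<union> (U j \<union> drawn E))"
   using U[of 0] U[of j] i by (intro closedin_Un[of X "U 0 \<union> drawn E" "U j \<union> drawn E"]) auto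
  then have cl: "closedin X ((U 0 \<union> U j) \<union> drawn E)" by (simp add: Un_ac)
  have op: "openin X (U 0 \<union> U j)" using U i by (intro openin_Un) auto
  obtain F' where F': "cmap X (topspace X - ({a i, a j, a 0} - (U 0 \<union> U j))) F'" "!!x. x \<notin> U 0 \<union> U j ==> F' x = F x"
   by (rule cancel_poles[OF clE F[unfolded set] _ Flog op cl]) (use aX i in auto)
  have "a i \<notin> U 0 \<union> U j" using a[OF i(1)] disj[of i 0] disj[of i j] i by auto
  then have "{a i, a j, a 0} - (U 0 \<union> U j) = {a i}" using a[OF i(2)] a[of 0] by auto
  then have c: "cmap X (topspace X - {a i}) F'" using F'(1) by simp
  have "geq X (a i) F' F"
  proof (rule geq_cong[of X "U i"])
   show "F' x = F x" if "x \<in> U i - {a i}" for x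
    using F'(2)[of x] that disj[of i 0] disj[of i j] i by auto
  qed (use U[OF i(1)] a[OF i(1)] in auto)
  then show ?thesis using parity[OF aX(1)[OF i(1)] c h geq_trans[OF _ d]] by blast
 qed
 have "geq X (a 1) F (\<lambda>x. f x powi P * 1)" unfolding F_def
  by (rule geq_mult[OF geq_refl geq_one[of "topspace X - {a 0, a 2}"]])
   (use aX(1)[of 1] ne[of 1 0] ne[of 1 2] openin_codiff g in \<open>auto intro!: cmap_powi\<close>)
 then have "even P" using main[of 1 2 f P] f(3) by auto
 have "geq X (a 2) F (\<lambda>x. 1 * g x powi Q)" unfolding F_def
  by (rule geq_mult[OF geq_one[of "topspace X - {a 0, a 1}"] geq_refl])
   (use aX(1)[of 2] ne[of 2 0] ne[of 2 1] openin_codiff f in \<open>auto intro!: cmap_powi\<close>)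
 then have "even Q" using main[of 2 1 g Q] g(3) by auto
 then show False using PQ(2) \<open>even P\<close> by blast
qed

end

context fat_graph
begin

text \<open>A map that winds once around the edge \<open>e\<close> and is trivial on the rest of the drawing, with
 finitely many poles: it is constructed inside a chart around an inner point of \<open>e\<close>.\<close>

lemma local_wind:
 assumes T: "T <= E" and e: "e \<in> T"
 shows "\<exists>f S l. finite S \<and> S <= topspace X - drawn T \<and> cmap X (topspace X - S) f \<and>
   (\<forall>x\<in>drawn (T - {e}). f x = 1) \<and> continuous_on {0..1} l \<and>
   (\<forall>t\<in>{0..1}. f (\<gamma> e t) = exp (l t)) \<and> l 0 = 0 \<and> l 1 = 2 * of_real pi * \<i>"
proof -
 have eE: "e \<in> E" using T e by blast
 let ?A = "\<gamma> e ` {0..1}"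
 define K0 where "K0 = drawn (T - {e})"
 have T': "T - {e} <= E" using T by blast
 have clK0: "closedin X K0" unfolding K0_def by (rule closedin_drawn[OF T'])
 define x where "x = \<gamma> e (1/2)"
 have xI: "x \<in> \<gamma> e ` {0<..<1}" unfolding x_def by (rule imageI) auto
 have "x \<in> topspace X - K0" using xI inner_top[OF eE] inner_disj_drawn[OF eE T'] unfolding K0_def by blast
 moreover have "openin X (topspace X - K0)" using clK0 by blast
 ultimately obtain W \<kappa> \<kappa>' where ch: "chart X W \<kappa> \<kappa>'" "x \<in> W" "W <= topspace X - K0" "\<kappa> x = 0"
  using small_chart by metis
 define D where "D = {y \<in> W. \<kappa> y \<in> ball 0 1}"
 have opD: "openin X D" unfolding D_def by (rule chart_open[OF ch(1)]) simp
 have pc: "continuous_map (top_of_set {0..1}) X (\<gamma> e)" using arc[OF eE] unfolding arcin_def pathin_def by blast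
 have "openin (top_of_set {0..1}) {t \<in> topspace (top_of_set {0..1}). \<gamma> e t \<in> D}"
  by (rule openin_continuous_map_preimage[OF pc opD])
 moreover have "1/2 \<in> {t \<in> topspace (top_of_set {0..1::real}). \<gamma> e t \<in> D}"
  using ch by (auto simp: D_def x_def)
 moreover obtain J where J: "open J" "{t \<in> topspace (top_of_set {0..1}). \<gamma> e t \<in> D} = {0..1} \<inter> J"
  using calculation(1) unfolding openin_open by blast
 ultimately have "1/2 \<in> J" by blast
 then obtain \<delta>0 where "\<delta>0 > 0" "ball (1/2) \<delta>0 <= J" using J(1) open_contains_ball by blast
 then have \<delta>0: "\<delta>0 > 0" "\<forall>t\<in>{0..1}. dist t (1/2) < \<delta>0 --> \<gamma> e t \<in> D"
  using J(2) by (auto simp: dist_commute)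
 define \<delta> where "\<delta> = min (\<delta>0/2) (1/2)"
 have \<delta>: "\<delta> > 0" "\<delta> \<le> 1/2" using \<delta>0(1) by (auto simp: \<delta>_def)
 have \<delta>D: "\<gamma> e t \<in> D" if "t \<in> {0..1}" "\<bar>t - 1/2\<bar> \<le> \<delta>" for t
  using \<delta>0(1) \<delta>0(2)[rule_format, OF that(1)] that(2) by (auto simp: \<delta>_def dist_real_def)
 define s where "s t = max 0 (min 1 ((t - (1/2 - \<delta>)) / (2 * \<delta>)))" for t :: real
 have s01: "s t = 0 \<or> s t = 1" if "\<not> \<bar>t - 1/2\<bar> \<le> \<delta>" for t
 proof -
  have "t < 1/2 - \<delta> \<or> t > 1/2 + \<delta>" using that by linarith
  then consider "t < 1/2 - \<delta>" | "t > 1/2 + \<delta>" by blast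
  then show ?thesis
  proof cases
   case 1
   then have "(t - (1/2 - \<delta>)) / (2 * \<delta>) < 0" using \<delta> by (simp add: divide_neg_pos)
   then show ?thesis by (simp add: s_def)
  next
   case 2
   then have "(t - (1/2 - \<delta>)) / (2 * \<delta>) \<ge> 1" using \<delta> by (simp add: le_divide_eq)
   then show ?thesis by (simp add: s_def)
  qed
 qed
 define l where "l t = 2 * of_real pi * \<i> * complex_of_real (s t)" for t
 have lc: "continuous_on {0..1} l" unfolding l_def s_def using \<delta> by (intro continuous_intros) auto
 have l01: "l 0 = 0" "l 1 = 2 * of_real pi * \<i>"
 proof -
  have "(0 - (1/2 - \<delta>)) / (2 * \<delta>) \<le> 0" using \<delta> by (simp add: divide_nonpos_pos)
  then show "l 0 = 0" by (simp add: l_def s_def)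
  have "(1 - (1/2 - \<delta>)) / (2 * \<delta>) \<ge> 1" using \<delta> by (simp add: le_divide_eq)
  then show "l 1 = 2 * of_real pi * \<i>" by (simp add: l_def s_def)
 qed
 have el1: "exp (l t) = 1" if "\<not> \<bar>t - 1/2\<bar> \<le> \<delta>" for t using s01[OF that] by (auto simp: l_def)
 define c where "c y = exp (l (arcparam (\<gamma> e) y))" for y
 have cA: "contX X ?A c" unfolding c_def by (rule contX_exp[OF contX_arc[OF arc[OF eE] lc]])
 have cn: "cmod (c y) = 1" for y unfolding c_def l_def by (simp add: norm_exp_eq_Re)
 have cg: "c (\<gamma> e t) = exp (l t)" if "t \<in> {0..1}" for t unfolding c_def using arcparam[OF arc[OF eE] that] by simp
 define KA where "KA = {z \<in> cball 0 1. \<kappa>' z \<in> ?A}"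
 define K where "K = KA \<union> sphere (0::complex) 1"
 \<comment> \<open>The prescribed values on the arc, and 1 elsewhere on the unit circle. On that
   circle the arc is outside \<open>D\<close>, where its values are 1 as well.\<close>
 define F where "F z = (if \<kappa>' z \<in> ?A then c (\<kappa>' z) else 1)" for z
 have "closedin euclidean {z \<in> topspace euclidean. \<kappa>' z \<in> ?A}"
  by (rule closedin_continuous_map_preimage[OF chartD(7)[OF ch(1)] arc_closed[OF arc[OF eE]]])
 then have "closed {z. \<kappa>' z \<in> ?A}" by simp
 moreover have "KA = cball 0 1 \<inter> {z. \<kappa>' z \<in> ?A}" by (auto simp: KA_def)
 ultimately have cKA: "compact KA" by (simp add: compact_Int_closed)
 then have cK: "compact K" unfolding K_def by (intro compact_Un) auto
 have Fsph: "F z = 1" if z: "z \<in> sphere 0 1" for z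
 proof (cases "\<kappa>' z \<in> ?A")
  case True
  then obtain t where t: "t \<in> {0..1}" "\<kappa>' z = \<gamma> e t" by blast
  have "\<gamma> e t \<notin> D" using chartD(5)[OF ch(1), of z] z t by (auto simp: D_def)
  then have "\<not> \<bar>t - 1/2\<bar> \<le> \<delta>" using \<delta>D t(1) by blast
  then show ?thesis using el1 cg[OF t(1)] t(2) True by (simp add: F_def)
 qed (simp add: F_def)
 have cF: "continuous_on K F" unfolding K_def
 proof (rule continuous_on_closed_Un)
  have "continuous_on KA (\<lambda>z. c (\<kappa>' z))" by (rule chart_pull[OF ch(1) cA]) (auto simp: KA_def)
  then show "continuous_on KA F" by (rule continuous_on_eq) (auto simp: F_def KA_def)
  show "continuous_on (sphere 0 1) F" using Fsph continuous_on_cong continuous_on_const by (metis (no_types, lifting))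
 qed (use cKA in \<open>auto simp: compact_imp_closed\<close>)
 have Fn: "F \<in> K \<rightarrow> sphere 0 1" using cn by (auto simp: F_def)
 \<comment> \<open>A circle-valued map on a compact plane set extends to the plane without finitely
   many points; those inside the unit disc become the poles.\<close>
 obtain S' G where G: "finite S'" "disjnt S' K" "continuous_on (- S') G" "G \<in> (- S') \<rightarrow> sphere 0 1"
   "!!z. z \<in> K ==> G z = F z"
 proof (rule extend_map_UNIV_to_sphere_cofinite[of 1 K F 0 UNIV])
  show "C \<inter> UNIV ~= {}" if "C \<in> components (- K)" for C using in_components_nonempty[OF that] by blast
 qed (use cK cF Fn in auto)
 define S where "S = {y \<in> W. \<kappa> y \<in> S' \<inter> cball 0 1}"
 define f where "f y = (if y \<in> W \<and> \<kappa> y \<in> cball 0 1 then G (\<kappa> y) else 1)" for y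
 have "S = \<kappa>' ` (S' \<inter> cball 0 1)" unfolding S_def by (rule chart_image[OF ch(1)])
 then have finS: "finite S" using G(1) by simp
 define A1 where "A1 = {y \<in> W. \<kappa> y \<in> cball 0 1}"
 have clA1: "closedin X A1" unfolding A1_def by (intro compact_closed chart_compact[OF ch(1)]) simp
 have clB: "closedin X (topspace X - D)" using opD by (simp add: closedin_diff)
 have sphK: "sphere 0 1 <= K" by (auto simp: K_def)
 have "cmap X (topspace X - S) f"
 proof (rule cmap_closed_Un[OF clA1 clB])
  have "contX X (A1 - S) (\<lambda>y. G (\<kappa> y))"
   by (rule contX_compose[OF contX_subset[OF chartD(3)[OF ch(1)]] G(3)]) (auto simp: A1_def S_def)
  moreover have "G (\<kappa> y) ~= 0" if "y \<in> A1 - S" for y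
  proof -
   have "\<kappa> y \<in> - S'" using that by (auto simp: A1_def S_def)
   then have "G (\<kappa> y) \<in> sphere 0 1" using G(4) by blast
   then show ?thesis by auto
  qed
  ultimately have "cmap X (A1 - S) (\<lambda>y. G (\<kappa> y))" by (simp add: cmap_def)
  then have "cmap X (A1 - S) f" by (rule cmap_cong) (auto simp: f_def A1_def)
  then show "cmap X (A1 \<inter> (topspace X - S)) f" by (rule cmap_subset) auto
  show "cmap X ((topspace X - D) \<inter> (topspace X - S)) f"
  proof (rule cmap_cong[OF cmap_one])
   fix y assume y: "y \<in> (topspace X - D) \<inter> (topspace X - S)"
   show "1 = f y"
   proof (cases "y \<in> W \<and> \<kappa> y \<in> cball 0 1")
    case True
    then have "\<kappa> y \<in> sphere 0 1" using y by (auto simp: D_def)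
    then show ?thesis using True G(5) sphK Fsph by (metis f_def subsetD)
   qed (auto simp: f_def)
  qed
 qed (auto simp: A1_def D_def)
 moreover have fK0: "\<forall>y\<in>K0. f y = 1" using ch(3) by (auto simp: f_def)
 moreover have "f (\<gamma> e t) = exp (l t)" if t: "t \<in> {0..1}" for t
 proof (cases "\<gamma> e t \<in> W \<and> \<kappa> (\<gamma> e t) \<in> cball 0 1")
  case True
  then have k: "\<kappa>' (\<kappa> (\<gamma> e t)) = \<gamma> e t" using chartD(6)[OF ch(1)] by blast
  then have "\<kappa> (\<gamma> e t) \<in> K" using True t by (auto simp: K_def KA_def)
  then have "f (\<gamma> e t) = F (\<kappa> (\<gamma> e t))" using True G(5) by (simp add: f_def)
  also have "\<dots> = c (\<gamma> e t)" using k t by (simp add: F_def)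
  finally show ?thesis using cg[OF t] by simp
 next
  case False
  then have "\<gamma> e t \<notin> D" by (auto simp: D_def)
  then have "\<not> \<bar>t - 1/2\<bar> \<le> \<delta>" using \<delta>D t by blast
  moreover have "f (\<gamma> e t) = 1" unfolding f_def using False by (rule if_not_P)
  ultimately show ?thesis using el1 by simp
 qed
 moreover have "S <= topspace X - drawn T"
 proof
  fix y assume y: "y \<in> S"
  then have yW: "y \<in> W" "\<kappa> y \<in> S'" "\<kappa> y \<in> cball 0 1" by (auto simp: S_def)
  have "y \<notin> K0" using yW ch(3) by blast
  moreover have "y \<notin> ?A"
  proof
   assume "y \<in> ?A"
   then have "\<kappa> y \<in> K" using yW chartD(6)[OF ch(1) yW(1)] by (auto simp: K_def KA_def)
   then show False using G(2) yW(2) by (auto simp: disjnt_def)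
  qed
  ultimately have "y \<notin> drawn T"
   using drawn_insert[of e "T - {e}"] e by (auto simp: K0_def insert_absorb arc_eq)
  then show "y \<in> topspace X - drawn T" using yW ch(3) by blast
 qed
 ultimately show ?thesis using finS lc l01 unfolding K0_def by blast
qed

text \<open>If \<open>drawn T\<close> does not separate the surface, all poles can be moved to one point, so that the
 edges in \<open>T\<close> give independent classes of maps, up to coboundaries of functions on the vertices.\<close>

lemma nonseparating_card:
 assumes T: "T <= E" and con: "connectedin X (topspace X - drawn T)"
 shows "card T \<le> card V + r + 1"
proof (rule ccontr)
 assume big: "\<not> card T \<le> card V + r + 1"
 define N where "N = topspace X - drawn T"
 have opN: "openin X N" unfolding N_def by (rule openin_undrawn[OF T])
 have conN: "connectedin X N" using con by (simp add: N_def)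
 obtain p where p: "p \<in> N" using undrawn_ne[OF T] unfolding N_def by blast
 have pX: "p \<in> topspace X" using p by (simp add: N_def)
 have finT: "finite T" using T finE finite_subset by blast
 have dX: "drawn T <= topspace X" using closedin_subset[OF closedin_drawn[OF T]] .
 define \<P> where "\<P> e g l \<longleftrightarrow> cmap X (topspace X - {p}) g \<and> (\<forall>x\<in>drawn (T - {e}). g x = 1) \<and> continuous_on {0..1} l \<and>
   (\<forall>t\<in>{0..1}. g (\<gamma> e t) = exp (l t)) \<and> l 0 = 0 \<and> l 1 = 2 * of_real pi * \<i>" for e g l
 have "\<exists>g l. \<P> e g l" if e: "e \<in> T" for e
 proof -
  obtain f S l where f: "finite S" "S <= N" "cmap X (topspace X - S) f"
    "\<forall>x\<in>drawn (T - {e}). f x = 1" "continuous_on {0..1} l"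
    "\<forall>t\<in>{0..1}. f (\<gamma> e t) = exp (l t)" "l 0 = 0" "l 1 = 2 * of_real pi * \<i>"
   using local_wind[OF T e] unfolding N_def by blast
  \<comment> \<open>Gathering the poles at \<open>p\<close> inside the connected complement leaves
    the values on the drawing unchanged.\<close>
  have "cmap X (topspace X - insert p (S - {p})) f" by (rule cmap_subset[OF f(3)]) auto
  then obtain g where g: "cmap X (topspace X - {p}) g" "\<forall>x\<in>topspace X - N. g x = f x"
   using gather[OF opN conN, of "S - {p}" p f] f p by auto
  have gd: "g x = f x" if "x \<in> drawn T" for x using g(2) that dX by (auto simp: N_def)
  have "g x = 1" if "x \<in> drawn (T - {e})" for x
   using gd[of x] f(4) that drawn_mono[of "T - {e}" T] by auto
  moreover have "g (\<gamma> e t) = exp (l t)" if t: "t \<in> {0..1}" for t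
  proof -
   have "\<gamma> e t \<in> drawn T" using arc_in_drawn[OF T e] t by blast
   then show ?thesis using gd f(6) t by simp
  qed
  ultimately show ?thesis using g(1) f(5,7,8) unfolding \<P>_def by blast
 qed
 then have "\<forall>e\<in>T. \<exists>gl. \<P> e (fst gl) (snd gl)" by simp
 then obtain gl where gl: "\<forall>e\<in>T. \<P> e (fst (gl e)) (snd (gl e))" by (rule bchoice[THEN exE])
 define g l where "g e = fst (gl e)" and "l e = snd (gl e)" for e
 have g: "!!e. e \<in> T ==> cmap X (topspace X - {p}) (g e)"
   "!!e x. e \<in> T ==> x \<in> drawn (T - {e}) ==> g e x = 1"
   "!!e t. e \<in> T ==> t \<in> {0..1} ==> g e (\<gamma> e t) = exp (l e t)"
  and l: "!!e. e \<in> T ==> continuous_on {0..1} (l e)" "!!e. e \<in> T ==> l e 0 = 0"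
   "!!e. e \<in> T ==> l e 1 = 2 * of_real pi * \<i>"
  using gl unfolding \<P>_def g_def l_def by blast+
 obtain U \<kappa> \<kappa>' where ch: "chart X U \<kappa> \<kappa>'" "p \<in> U" "U <= N" "\<kappa> p = 0" by (rule small_chart[OF opN p])
 define h where "h = (\<lambda>x. \<kappa> x - \<kappa> p)"
 have h: "gen X p h" unfolding h_def by (rule gen_chart[OF ch(1,2)])
 have "\<exists>d::int. geq X p (g e) (\<lambda>x. h x powi d)" if "e \<in> T" for e
  by (rule gen_exists[OF h gcmapI[OF openin_topspace pX g(1)[OF that]]])
 then obtain d :: "nat set => int" where d: "!!e. e \<in> T ==> geq X p (g e) (\<lambda>x. h x powi d e)" by metis
 have "T ~= {}" using big by auto
 then obtain e0 where e0: "e0 \<in> T" "d e0 ~= 0 \<or> (\<forall>e\<in>T. d e = 0)" by blast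
 \<comment> \<open>Exponents that cancel the pole at \<open>p\<close> of each map against that of
   \<open>g e0\<close>. If no map winds around \<open>p\<close>, then \<open>D = 1\<close> and
   \<open>c = 0\<close> leave the maps as they are.\<close>
 define D where "D = (if d e0 = 0 then 1 else d e0)"
 define c where "c e = (if d e0 = 0 then 0 else d e)" for e
 have D: "D ~= 0" by (simp add: D_def)
 have Dc: "D * d e - c e * d e0 = 0" if "e \<in> T" for e using e0 that by (auto simp: D_def c_def)
 define T' where "T' = T - {e0}"
 have finT': "finite T'" using finT by (simp add: T'_def)
 define F where "F e x = g e x powi D * g e0 x powi (- c e)" for e x
 \<comment> \<open>The winding number of \<open>F e\<close> at \<open>p\<close> is 0, so the
   puncture can be filled in off the drawing.\<close>
 have "\<exists>F'. cmap X (topspace X) F' \<and> (\<forall>x\<in>drawn T. F' x = F e x)" if e: "e \<in> T'" for e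
 proof -
  have eT: "e \<in> T" using e by (simp add: T'_def)
  have 1: "cmap X (topspace X - {p}) (F e)" unfolding F_def
   by (intro cmap_mult cmap_powi g(1) eT e0)
  have "geq X p (F e) (\<lambda>x. (h x powi d e) powi D * (h x powi d e0) powi (- c e))"
   unfolding F_def by (intro geq_mult geq_powi d eT e0)
  then have 2: "geq X p (F e) (\<lambda>x. h x powi (d e * D) * h x powi (d e0 * - c e))"
   by (simp only: power_int_mult)
  have "d e * D + d e0 * - c e = 0" using Dc[OF eT] by (simp add: algebra_simps)
  then have 3: "geq X p (F e) (\<lambda>_. 1)"
   using geq_trans[OF 2 gen_powi_add[OF gen_gcmap[OF h]]] by simp
  obtain F' where "cmap X (topspace X) F'" "!!x. x \<notin> N ==> F' x = F e x"
   by (rule remove_puncture[OF opN p openin_topspace pX 1 3]) blast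
  then show ?thesis unfolding N_def by blast
 qed
 then obtain F' where F': "!!e. e \<in> T' ==> cmap X (topspace X) (F' e)"
   "!!e x. e \<in> T' ==> x \<in> drawn T ==> F' e x = F e x" by metis
 obtain \<Lambda> :: "nat => nat set => int" where \<Lambda>: "!!w. (\<forall>j<r. (\<Sum>e\<in>T'. \<Lambda> j e * w e) = 0) ==>
   haslog X (topspace X) (\<lambda>x. \<Prod>e\<in>T'. F' e x powi w e)"
  using rank[OF finT', of F'] F'(1) by blast
 obtain vv where vv: "bij_betw vv {0..<card V} V" using ex_bij_betw_nat_finite[OF finV] by blast
 define inc where "inc e v = (if head e = v then 1 else 0) - (if tail e = v then 1 else (0::int))" for e v
 \<comment> \<open>The first \<open>r\<close> equations give the product a logarithm on the surface.
   The other \<open>card V\<close> make the exponents \<open>W\<close> below a cycle: the net flow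
   at every vertex is 0.\<close>
 define \<Lambda>' where "\<Lambda>' j e = (if j < r then \<Lambda> j e else D * inc e (vv (j - r)) - c e * inc e0 (vv (j - r)))" for j e
 have "r + card V < card T'" using big finT e0(1) by (simp add: T'_def)
 then obtain u where u: "\<exists>e\<in>T'. u e ~= 0" "\<forall>j<r + card V. (\<Sum>e\<in>T'. \<Lambda>' j e * u e) = 0"
  using integer_system[OF finT', of "r + card V" \<Lambda>'] by blast
 have "(\<Sum>e\<in>T'. \<Lambda> j e * u e) = 0" if "j < r" for j
 proof -
  have "(\<Sum>e\<in>T'. \<Lambda>' j e * u e) = 0" using u(2) that by simp
  then show ?thesis using that by (simp add: \<Lambda>'_def)
 qed
 then have "haslog X (topspace X) (\<lambda>x. \<Prod>e\<in>T'. F' e x powi u e)" by (intro \<Lambda>) blast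
 then obtain \<theta> where th: "contX X (topspace X) \<theta>" "!!x. x \<in> topspace X ==> (\<Prod>e\<in>T'. F' e x powi u e) = exp (\<theta> x)"
  unfolding haslog_def by blast
 have cyc: "(\<Sum>e\<in>T'. (D * inc e v - c e * inc e0 v) * u e) = 0" if v: "v \<in> V" for v
 proof -
  obtain i where i: "i < card V" "vv i = v" using vv v unfolding bij_betw_def by force
  have "(\<Sum>e\<in>T'. \<Lambda>' (r + i) e * u e) = 0" using u(2) i by simp
  then show ?thesis using i by (simp add: \<Lambda>'_def)
 qed
 \<comment> \<open>On the drawing, \<open>W e\<close> is the total exponent of \<open>g e\<close> in
   the product of the powers \<open>u\<close> of the maps \<open>F'\<close>.\<close>
 define W where "W e = (if e = e0 then - (\<Sum>e\<in>T'. c e * u e) else D * u e)" for e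
 have Wsum: "(\<Sum>e\<in>T. of_int (W e) * m e) = (\<Sum>e\<in>T'. of_int (u e) * (of_int D * m e - of_int (c e) * m e0))"
  for m :: "nat set => 'b::comm_ring_1"
 proof -
  have "(\<Sum>e\<in>T. of_int (W e) * m e) = of_int (W e0) * m e0 + (\<Sum>e\<in>T'. of_int (W e) * m e)"
   unfolding T'_def using finT e0(1) by (simp add: sum.remove)
  also have "(\<Sum>e\<in>T'. of_int (W e) * m e) = (\<Sum>e\<in>T'. of_int (u e) * (of_int D * m e))"
   by (rule sum.cong) (auto simp: W_def T'_def)
  also have "of_int (W e0) * m e0 = - (\<Sum>e\<in>T'. of_int (u e) * (of_int (c e) * m e0))"
   by (simp add: W_def sum_distrib_left mult_ac)
  finally show ?thesis by (simp add: sum_subtractf algebra_simps)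
 qed
 have prodG: "exp (\<theta> x) = exp (\<Sum>e\<in>T. of_int (W e) * m e)"
  if x: "x \<in> drawn T" and m: "!!e. e \<in> T ==> g e x = exp (m e)" for x m
 proof -
  have "exp (\<theta> x) = (\<Prod>e\<in>T'. F' e x powi u e)" using th(2) x dX by auto
  also have "\<dots> = (\<Prod>e\<in>T'. exp (of_int (u e) * (of_int D * m e - of_int (c e) * m e0)))"
  proof (rule prod.cong)
   fix e assume e: "e \<in> T'"
   then have eT: "e \<in> T" by (simp add: T'_def)
   have "F' e x = exp (m e) powi D * exp (m e0) powi (- c e)"
    using F'(2)[OF e x] m[OF eT] m[OF e0(1)] by (simp add: F_def)
   also have "\<dots> = exp (of_int D * m e + of_int (- c e) * m e0)" by (simp only: exp_power_int exp_add)
   finally show "F' e x powi u e = exp (of_int (u e) * (of_int D * m e - of_int (c e) * m e0))"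
    by (simp add: exp_power_int algebra_simps)
  qed simp
  also have "\<dots> = exp (\<Sum>e\<in>T. of_int (W e) * m e)"
   unfolding Wsum by (rule exp_sum[OF finT', symmetric])
  finally show ?thesis .
 qed
 have drawnV: "g e x = 1" if "e \<in> T" "v \<in> V" "x \<in> \<Phi> v" for e v x
  using g(2)[OF that(1)] verts_drawn[OF that(2)] that(3) by blast
 \<comment> \<open>All maps \<open>g e\<close> are 1 on the vertex sets, so on each of them the
   logarithm of the product is a constant multiple of 2 pi i.\<close>
 have "\<exists>k::int. \<forall>x\<in>\<Phi> v. \<theta> x = 2 * of_int k * of_real pi * \<i>" if v: "v \<in> V" for v
 proof -
  have "contX X (\<Phi> v) \<theta>" by (rule contX_subset[OF th(1)]) (use verts_drawn[OF v] dX in blast)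
  moreover have "exp (\<theta> x) = 1" if x: "x \<in> \<Phi> v" for x
  proof -
   have "x \<in> drawn T" using verts_drawn[OF v] x by blast
   then have "exp (\<theta> x) = exp (\<Sum>e\<in>T. of_int (W e) * 0)"
    by (rule prodG) (use drawnV[OF _ v x] in simp)
   then show ?thesis by simp
  qed
  ultimately show ?thesis using exp_one_const[of X "\<Phi> v" \<theta>] vert[OF v] by metis
 qed
 then obtain k :: "nat => int" where k: "!!v x. v \<in> V ==> x \<in> \<Phi> v ==> \<theta> x = 2 * of_int (k v) * of_real pi * \<i>"
  by metis
 \<comment> \<open>Along the arc of \<open>a\<close> only \<open>g a\<close> winds, and it does so
   once. The logarithm therefore changes by 2 pi i \<open>W a\<close> from tail to head, so
   \<open>W\<close> is the coboundary of \<open>k\<close>.\<close>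
 have Wk: "W a = k (head a) - k (tail a)" if a: "a \<in> T" for a
 proof -
  have aE: "a \<in> E" using a T by blast
  define q where "q t = \<theta> (\<gamma> a t) - of_int (W a) * l a t" for t
  have "continuous_on {0..1} (\<lambda>t. \<theta> (\<gamma> a t))"
   by (rule arc_pull[OF arc[OF aE] th(1)]) (use arc_subset[OF arc[OF aE]] in auto)
  then have "continuous_on {0..1} q" unfolding q_def by (intro continuous_intros l(1)[OF a])
  moreover have "exp (q t) = 1" if t: "t \<in> {0..1}" for t
  proof -
   have x: "\<gamma> a t \<in> drawn T" using arc_in_drawn[OF T a] t by blast
   have "exp (\<theta> (\<gamma> a t)) = exp (\<Sum>e\<in>T. of_int (W e) * (if e = a then l a t else 0))"
   proof (rule prodG[OF x])
    fix e assume e: "e \<in> T"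
    show "g e (\<gamma> a t) = exp (if e = a then l a t else 0)"
    proof (cases "e = a")
     case False
     have "\<gamma> a t \<in> drawn (T - {e})" using arc_in_drawn[of "T - {e}" a] T a False t by blast
     then show ?thesis using g(2)[OF e] False by simp
    qed (use g(3)[OF a t] in simp)
   qed
   also have "(\<Sum>e\<in>T. of_int (W e) * (if e = a then l a t else 0)) = of_int (W a) * l a t"
    using finT a by (simp add: if_distrib[of "\<lambda>x. _ * x"] cong: if_cong)
   finally show ?thesis by (simp add: q_def exp_diff)
  qed
  ultimately obtain n :: int where n: "!!t. t \<in> {0..1} ==> q t = 2 * of_int n * of_real pi * \<i>"
   using exp_one_const_on[of "{0..1}" q] by (metis connected_Icc)
  have "q 1 = q 0" using n[of 0] n[of 1] by simp
  then have "\<theta> (\<gamma> a 1) - \<theta> (\<gamma> a 0) = of_int (W a) * (2 * of_real pi * \<i>)"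
   using l(2,3)[OF a] by (simp add: q_def algebra_simps)
  moreover have "\<theta> (\<gamma> a 1) - \<theta> (\<gamma> a 0) = of_int (k (head a) - k (tail a)) * (2 * of_real pi * \<i>)"
   using k[of "head a" "\<gamma> a 1"] k[of "tail a" "\<gamma> a 0"] ends[OF aE] by (simp add: algebra_simps)
  ultimately have "(of_int (W a) :: complex) = of_int (k (head a) - k (tail a))" by simp
  then show ?thesis by (simp only: of_int_eq_iff)
 qed
 have cycW: "(\<Sum>e\<in>T. W e * inc e v) = 0" if v: "v \<in> V" for v
  using Wsum[of "\<lambda>e. inc e v"] cyc[OF v] by (simp add: mult.commute)
 \<comment> \<open>A cycle that is also a coboundary is orthogonal to itself.\<close>
 have "(\<Sum>e\<in>T. W e * W e) = (\<Sum>e\<in>T. W e * (\<Sum>v\<in>V. k v * inc e v))"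
 proof (rule sum.cong)
  fix e assume e: "e \<in> T"
  then have "e \<in> E" using T by blast
  note en = ends[OF this]
  have "(\<Sum>v\<in>V. k v * inc e v) = (\<Sum>v\<in>V. (if head e = v then k v else 0) - (if tail e = v then k v else 0))"
   by (rule sum.cong) (auto simp: inc_def)
  also have "\<dots> = k (head e) - k (tail e)" using finV en by (simp add: sum_subtractf)
  finally show "W e * W e = W e * (\<Sum>v\<in>V. k v * inc e v)" using Wk[OF e] by simp
 qed simp
 also have "\<dots> = (\<Sum>v\<in>V. k v * (\<Sum>e\<in>T. W e * inc e v))"
  unfolding sum_distrib_left by (subst sum.swap) (simp add: algebra_simps)
 also have "\<dots> = 0" using cycW by simp
 finally have "\<forall>e\<in>T. W e * W e = 0" using finT by (simp add: sum_nonneg_eq_0_iff)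
 moreover obtain e where e: "e \<in> T'" "u e ~= 0" using u(1) by blast
 moreover have "e \<in> T" "e ~= e0" using e(1) unfolding T'_def by blast+
 ultimately have "W e * W e = 0" by blast
 then have "D * u e = 0" using \<open>e ~= e0\<close> by (simp add: W_def)
 then show False using D e(2) by simp
qed

text \<open>By maximality of \<open>T\<close>, a further edge \<open>e\<close> by itself disconnects
  the complement of \<open>T\<close> into two sides, and both accumulate at a point of the open arc
  of \<open>e\<close>. The part of the current partition that contains this point is cut in two, so
  every further edge adds at least one part.\<close>

lemma faces:
 assumes T: "T <= E" and max: "!!e. e \<in> E - T ==> \<not> connectedin X (topspace X - drawn (insert e T))"
  and con: "connectedin X (topspace X - drawn T)" and "finite F" "F <= E - T"
 shows "\<exists>P. finite P \<and> card F + 1 \<le> card P \<and> \<Union>P = topspace X - drawn (T \<union> F) \<and>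
   (\<forall>U\<in>P. openin X U \<and> U ~= {}) \<and> pairwise disjnt P"
 using assms(4,5)
proof (induction F rule: finite_induct)
 case empty
 show ?case
  using openin_undrawn[OF T] undrawn_ne[OF T] by (intro exI[of _ "{topspace X - drawn T}"]) auto
next
 case (insert e F)
 obtain P where P: "finite P" "card F + 1 \<le> card P" "\<Union>P = topspace X - drawn (T \<union> F)"
   "!!U. U \<in> P ==> openin X U \<and> U ~= {}" "pairwise disjnt P"
  using insert.IH insert.prems by auto
 have e: "e \<in> E" "e \<notin> T" "e \<notin> T \<union> F" and TF: "T \<union> F <= E" using insert T by auto
 let ?I = "\<gamma> e ` {0<..<1}"
 define Y where "Y = topspace X - drawn (insert e T)"
 have eTE: "insert e T <= E" using e T by blast
 have opY: "openin X Y" unfolding Y_def by (rule openin_undrawn[OF eTE])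
 have "\<not> connectedin X Y" unfolding Y_def using max e by blast
 then obtain E1 E2 where E12: "openin X E1" "openin X E2" "Y <= E1 \<union> E2" "E1 \<inter> E2 \<inter> Y = {}" "E1 \<inter> Y ~= {}" "E2 \<inter> Y ~= {}"
  unfolding connectedin Y_def by blast
 define U1 U2 where "U1 = E1 \<inter> Y" and "U2 = E2 \<inter> Y"
 have U: "openin X U1" "openin X U2" "U1 \<inter> U2 = {}" "U1 \<union> U2 = Y" "U1 ~= {}" "U2 ~= {}"
  using E12 opY unfolding U1_def U2_def by (auto intro: openin_Int)
 define Q where "Q = topspace X - drawn T"
 have QY: "Q = Y \<union> ?I" unfolding Q_def Y_def drawn_insert using inner_top[OF e(1)] inner_disj_drawn[OF e(1) T e(2)] by blast
 have opQ: "openin X Q" unfolding Q_def by (rule openin_undrawn[OF T])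
 have dense: "\<not> G <= ?I" if "openin X G" "G ~= {}" for G
  using arc_nowhere_dense[OF that arc[OF e(1)]] unfolding arc_eq by blast
 have QYI: "Y \<inter> ?I = {}" unfolding Y_def drawn_insert by blast
 \<comment> \<open>Otherwise the complements of the two closures would split the connected set
   \<open>Q\<close>; they cannot overlap in \<open>Q\<close>, because an arc contains no nonempty
   open set.\<close>
 have "\<exists>x\<in>?I. x \<in> X closure_of U1 \<and> x \<in> X closure_of U2"
 proof (rule ccontr)
  assume no: "\<not> ?thesis"
  define V1 V2 where "V1 = Q - X closure_of U2" and "V2 = Q - X closure_of U1"
  have op: "openin X V1" "openin X V2" unfolding V1_def V2_def using opQ by (auto intro: openin_diff)
  have c1: "X closure_of U1 \<inter> U2 = {}" "X closure_of U2 \<inter> U1 = {}"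
   using U openin_Int_closure_of_eq_empty by (metis Int_commute)+
  have "Q <= V1 \<union> V2" using no c1 U QY unfolding V1_def V2_def by blast
  moreover have "V1 \<inter> V2 \<inter> Q = {}"
  proof (rule ccontr)
   assume ne: "V1 \<inter> V2 \<inter> Q ~= {}"
   have s: "U1 <= X closure_of U1" "U2 <= X closure_of U2"
    using closure_of_subset[OF openin_subset[OF U(1)]] closure_of_subset[OF openin_subset[OF U(2)]] by auto
   have "V1 \<inter> V2 \<inter> Q <= ?I" using QY U(4) s unfolding V1_def V2_def by blast
   moreover have "openin X (V1 \<inter> V2 \<inter> Q)" using op opQ by (intro openin_Int)
   ultimately show False using dense ne by blast
  qed
  moreover have "U1 <= V1 \<inter> Q" "U2 <= V2 \<inter> Q" using U(4) QY c1 unfolding V1_def V2_def by blast+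
  then have "V1 \<inter> Q ~= {}" "V2 \<inter> Q ~= {}" using U(5,6) by blast+
  ultimately show False using con op unfolding connectedin Q_def[symmetric] by blast
 qed
 then obtain x where x: "x \<in> ?I" "x \<in> X closure_of U1" "x \<in> X closure_of U2" by blast
 have "x \<in> topspace X - drawn (T \<union> F)" using x inner_top[OF e(1)] inner_disj_drawn[OF e(1) TF e(3)] by blast
 then obtain P0 where P0: "P0 \<in> P" "x \<in> P0" using P(3) by blast
 have sub: "R \<inter> U1 \<union> R \<inter> U2 = R - ?I" if "R \<in> P" for R
 proof -
  have "R <= topspace X - drawn (T \<union> F)" using P(3) that by blast
  moreover have "drawn T <= drawn (T \<union> F)" by (rule drawn_mono) blast
  ultimately have "R <= Q" unfolding Q_def by blast
  then show ?thesis using U(4) QY QYI by blast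
 qed
 define P' where "P' = ((\<lambda>R. R \<inter> U1) ` P \<union> (\<lambda>R. R \<inter> U2) ` P) - {{}}"
 have P0ne: "P0 \<inter> U1 ~= {}" "P0 \<inter> U2 ~= {}" using x P0 P(4)[OF P0(1)] unfolding in_closure_of by blast+
 have disj: "R \<inter> R' = {}" if "R \<in> P" "R' \<in> P" "R ~= R'" for R R'
  using P(5) that unfolding pairwise_def disjnt_def by blast
 \<comment> \<open>Every old part keeps a nonempty piece, which gives an injection; the second piece
   of \<open>P0\<close> is the additional part.\<close>
 define \<phi> where "\<phi> R = (if R \<inter> U1 ~= {} then R \<inter> U1 else R \<inter> U2)" for R
 have phi: "\<phi> R ~= {} \<and> \<phi> R <= R \<and> \<phi> R \<in> P'" if "R \<in> P" for R
 proof -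
  have "R - ?I ~= {}" using dense P(4)[OF that] by blast
  then have "R \<inter> U1 ~= {} \<or> R \<inter> U2 ~= {}" using sub[OF that] by blast
  then show ?thesis using that unfolding \<phi>_def P'_def by auto
 qed
 have inj: "inj_on \<phi> P"
 proof (rule inj_onI)
  fix R R' assume R: "R \<in> P" "R' \<in> P" "\<phi> R = \<phi> R'"
  then show "R = R'" using phi[OF R(1)] phi[OF R(2)] disj[OF R(1,2)] by blast
 qed
 have notin: "P0 \<inter> U2 \<notin> \<phi> ` P"
 proof
  assume "P0 \<inter> U2 \<in> \<phi> ` P"
  then obtain R where R: "R \<in> P" "P0 \<inter> U2 = \<phi> R" by blast
  then have "R = P0" using disj[OF R(1) P0(1)] phi[OF R(1)] P0ne by blast
  then have "P0 \<inter> U2 = P0 \<inter> U1" using R(2) P0ne by (simp add: \<phi>_def)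
  then show False using P0ne U(3) by blast
 qed
 have fin: "finite P'" using P(1) by (simp add: P'_def)
 have "insert (P0 \<inter> U2) (\<phi> ` P) <= P'" using phi P0 P0ne unfolding P'_def by blast
 then have "card (insert (P0 \<inter> U2) (\<phi> ` P)) \<le> card P'" using fin card_mono by blast
 moreover have "card (insert (P0 \<inter> U2) (\<phi> ` P)) = card P + 1"
  using notin P(1) card_image[OF inj] by simp
 moreover have "card (insert e F) = card F + 1" using insert by simp
 ultimately have "card (insert e F) + 1 \<le> card P'" using P(2) by simp
 moreover have "\<Union>P' = topspace X - drawn (T \<union> insert e F)"
 proof -
  have "\<Union>P' = (\<Union>R\<in>P. R \<inter> U1 \<union> R \<inter> U2)" unfolding P'_def by blast
  also have "\<dots> = (\<Union>R\<in>P. R - ?I)" using sub by simp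
  also have "\<dots> = \<Union>P - ?I" by blast
  finally show ?thesis unfolding P(3) by (simp add: drawn_insert) blast
 qed
 moreover have "openin X S \<and> S ~= {}" if "S \<in> P'" for S
  using that P(4) U unfolding P'_def by (auto intro: openin_Int)
 moreover have "pairwise disjnt P'"
  unfolding pairwise_def disjnt_def P'_def using disj U(3) by blast
 ultimately show ?case using fin by blast
qed

text \<open>This stands in for Euler's formula. A largest nonseparating \<open>T\<close> has at most
  |V| + r + 1 edges, and the remaining edges create at least |E| - |T| + 1 parts. If there are two
  parts or more, each is touched by at least 4 edges and each edge touches at most 2 parts, so that
  2 (|E| - |T| + 1) \<le> |E|. With a single part, \<open>T\<close> is all of
  \<open>E\<close>.\<close>

theorem bipartite_edges:
 assumes bip: "!!e. e \<in> E ==> (tail e \<in> B) ~= (head e \<in> B)"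
 shows "card E \<le> 2 * (card V + r + 1)"
proof -
 define \<T> where "\<T> = {T. T <= E \<and> connectedin X (topspace X - drawn T)}"
 have "connectedin X (topspace X - drawn {})"
 proof (rule ccontr)
  assume "\<not> ?thesis"
  then obtain E1 E2 where E12: "openin X E1" "openin X E2" "topspace X - drawn {} <= E1 \<union> E2"
    "E1 \<inter> E2 \<inter> (topspace X - drawn {}) = {}" "E1 \<inter> (topspace X - drawn {}) ~= {}" "E2 \<inter> (topspace X - drawn {}) ~= {}"
   unfolding connectedin by blast
  have op: "openin X (topspace X - drawn {})" by (rule openin_undrawn) simp
  show False
   by (rule acyc_nonseparating[OF closedin_drawn acyc_pot[OF _ pot_empty] openin_Int[OF E12(1) op] openin_Int[OF E12(2) op]])
    (use E12 in blast)+
 qed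
 then have "{} \<in> \<T>" by (simp add: \<T>_def)
 moreover have fin: "finite \<T>" using finE by (auto simp: \<T>_def intro: finite_subset[of _ "Pow E"])
 ultimately have "Max (card ` \<T>) \<in> card ` \<T>" by (intro Max_in) auto
 then obtain T where "T \<in> \<T>" "card T = Max (card ` \<T>)" by (metis imageE)
 then have T: "T \<in> \<T>" "\<forall>T'\<in>\<T>. card T' \<le> card T" using fin by auto
 then have TE: "T <= E" and con: "connectedin X (topspace X - drawn T)" by (auto simp: \<T>_def)
 have finT: "finite T" using TE finE finite_subset by blast
 have max: "\<not> connectedin X (topspace X - drawn (insert e T))" if "e \<in> E - T" for e
 proof
  assume "connectedin X (topspace X - drawn (insert e T))"
  then have "insert e T \<in> \<T>" using that TE by (simp add: \<T>_def)
  then have "card (insert e T) \<le> card T" using T(2) by blast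
  then show False using that finT by simp
 qed
 have cT: "card T \<le> card V + r + 1" by (rule nonseparating_card[OF TE con])
 obtain P where P: "finite P" "card (E - T) + 1 \<le> card P" "\<Union>P = topspace X - drawn E"
   "!!U. U \<in> P ==> openin X U \<and> U ~= {}" "pairwise disjnt P"
  using faces[OF TE max con, of "E - T"] finE TE by (auto simp: Un_absorb1)
 have cE: "card (E - T) = card E - card T" "card T \<le> card E" using TE finE finT by (auto simp: card_Diff_subset card_mono)
 show ?thesis
 proof (cases "card P \<le> 1")
  case True
  then show ?thesis using P(2) cE cT True by arith
 next
  case False
  have rest: "openin X (\<Union>(P - {U})) \<and> U \<inter> \<Union>(P - {U}) = {} \<and> U \<union> \<Union>(P - {U}) = topspace X - drawn E" if U: "U \<in> P" for U
  proof (intro conjI)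
   show "openin X (\<Union>(P - {U}))" using P(4) by (intro openin_Union) blast
   show "U \<inter> \<Union>(P - {U}) = {}" using P(5) U unfolding pairwise_def disjnt_def by blast
   show "U \<union> \<Union>(P - {U}) = topspace X - drawn E" using P(3) U by blast
  qed
  have four: "4 \<le> card {e \<in> E. touches e U}" if U: "U \<in> P" for U
  proof (rule touch_ge4[OF bip _ _ _ _ _, of _ "\<Union>(P - {U})"])
   have "\<not> P <= {U}" using False card_mono[of "{U}" P] by auto
   then show "\<Union>(P - {U}) ~= {}" using P(4) by blast
  qed (use rest[OF U] P(4)[OF U] in auto)
  have two: "card {U \<in> P. touches e U} \<le> 2" if e: "e \<in> E" for e
  proof (rule ccontr)
   assume "\<not> ?thesis"
   then have "3 \<le> card {U \<in> P. touches e U}" by simp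
   then obtain S where S: "S <= {U \<in> P. touches e U}" "card S = 3" by (meson obtain_subset_with_card_n)
   then obtain Us where Us: "bij_betw Us {0..<3::nat} S"
    using ex_bij_betw_nat_finite[of S] by (metis card.infinite zero_neq_numeral)
   have inS: "Us i \<in> P \<and> touches e (Us i)" if "i < 3" for i
   proof -
    have "Us i \<in> S" using Us that unfolding bij_betw_def by auto
    then show ?thesis using S(1) by blast
   qed
   show False
   proof (rule touch_le2[OF e, of Us])
    fix i :: nat assume i: "i < 3"
    note U = inS[OF i]
    have "closedin X (topspace X - \<Union>(P - {Us i}))" using rest U by (simp add: closedin_diff)
    moreover have "topspace X - \<Union>(P - {Us i}) = Us i \<union> drawn E"
     using rest[of "Us i"] U P(4)[of "Us i"] openin_subset closedin_subset[OF closedin_drawn[of E]] by blast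
    ultimately show "openin X (Us i) \<and> closedin X (Us i \<union> drawn E) \<and> Us i \<inter> drawn E = {} \<and> touches e (Us i)"
     using U P(3) P(4)[of "Us i"] by auto
    fix j :: nat assume j: "j < 3" "i ~= j"
    have "Us i ~= Us j" using Us i j unfolding bij_betw_def inj_on_def by auto
    then show "Us i \<inter> Us j = {}" using P(5) U inS[OF j(1)] unfolding pairwise_def disjnt_def by blast
   qed
  qed
  have "4 * card P \<le> (\<Sum>U\<in>P. card {e \<in> E. touches e U})"
   using sum_bounded_below[of P 4 "\<lambda>U. card {e \<in> E. touches e U}"] four by (simp add: mult.commute)
  also have "\<dots> = (\<Sum>U\<in>P. \<Sum>e\<in>E. if touches e U then 1 else 0)"
   using finE by (simp add: sum.If_cases Int_def)
  also have "\<dots> = (\<Sum>e\<in>E. \<Sum>U\<in>P. if touches e U then 1 else 0)" by (rule sum.swap)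
  also have "\<dots> = (\<Sum>e\<in>E. card {U \<in> P. touches e U})"
   using P(1) by (simp add: sum.If_cases Int_def)
  also have "\<dots> \<le> card E * 2" using sum_bounded_above[of E "\<lambda>e. card {U \<in> P. touches e U}" 2] two by simp
  finally show ?thesis using P(2) cE cT by arith
 qed
qed

end

section \<open>The sphere with holes and its gluings\<close>

abbreviation sphere2 :: "complex option topology" where
 "sphere2 \<equiv> Alexandroff_compactification euclidean"

lemma sphere2_Hausdorff: "Hausdorff_space sphere2"
 by (simp add: Hausdorff_space_Alexandroff_compactification locally_compact_space_euclidean Hausdorff_space_euclidean)

lemma openin_sphere2:
 "openin sphere2 V \<longleftrightarrow> (\<exists>U. open U \<and> V = Some ` U) \<or> (\<exists>C. compact C \<and> V = insert None (Some ` (- C)))"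
 by (auto simp: openin_Alexandroff_compactification compact_imp_closed Compl_eq_Diff_UNIV)

text \<open>The charts below are inverses of explicit parametrizations; an open continuous injection
  suffices.\<close>

lemma homeomorphic_map_param:
 assumes "continuous_map (top_of_set V) X \<psi>" "inj_on \<psi> V"
  and op: "!!W. W <= V ==> open W ==> openin X (\<psi> ` W)" and "open V"
 shows "\<exists>\<kappa>. homeomorphic_map (subtopology X (\<psi> ` V)) (top_of_set V) \<kappa>"
proof -
 have VX: "\<psi> ` V <= topspace X" using op[OF order_refl assms(4)] openin_subset by blast
 have "homeomorphic_map (top_of_set V) (subtopology X (\<psi> ` V)) \<psi>"
 proof (rule bijective_open_imp_homeomorphic_map)
  show "continuous_map (top_of_set V) (subtopology X (\<psi> ` V)) \<psi>"
   using assms(1) by (simp add: continuous_map_in_subtopology)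
  show "open_map (top_of_set V) (subtopology X (\<psi> ` V)) \<psi>"
   unfolding open_map_def
  proof (intro allI impI)
   fix W assume "openin (top_of_set V) W"
   then have "W <= V" "open W" using assms(4) openin_open_eq openin_imp_subset by blast+
   then show "openin (subtopology X (\<psi> ` V)) (\<psi> ` W)"
    using op openin_subtopology_Int2 by (metis image_mono inf.absorb_iff2)
  qed
 qed (use VX assms(2) in auto)
 then have "(top_of_set V) homeomorphic_space (subtopology X (\<psi> ` V))"
  using homeomorphic_map_imp_homeomorphic_space by blast
 then show ?thesis using homeomorphic_space_sym homeomorphic_space by metis
qed

text \<open>Inversion about \<open>c\<close> parametrizes the sphere without the point
  \<open>c\<close> by the plane and puts infinity at the origin. With \<open>c = 0\<close> it gives
  a chart at infinity; other centres serve to leave out a given point.\<close>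

definition invp :: "complex => complex => complex option" where
 "invp c w = (if w = 0 then None else Some (c + 1 / w))"

lemma inj_invp: "inj (invp c)"
 by (rule injI) (auto simp: invp_def split: if_splits)

lemma continuous_map_invp: "continuous_map euclidean sphere2 (invp c)"
 unfolding continuous_map_def
proof (intro conjI allI impI)
 show "invp c \<in> topspace euclidean \<rightarrow> topspace sphere2" by (auto simp: invp_def)
 fix U assume "openin sphere2 U"
 then consider (1) A where "open A" "U = Some ` A" | (2) C where "compact C" "U = insert None (Some ` (- C))"
  unfolding openin_sphere2 by blast
 then have "open {w. invp c w \<in> U}"
 proof cases
  case 1
  have "open ((- {0}) \<inter> (\<lambda>w. c + 1 / w) -` A)"
   by (rule continuous_open_preimage) (use 1 in \<open>auto intro!: continuous_intros simp: open_Compl\<close>)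
  moreover have "{w. invp c w \<in> U} = (- {0}) \<inter> (\<lambda>w. c + 1 / w) -` A"
   using 1 by (auto simp: invp_def split: if_splits)
  ultimately show ?thesis by simp
 next
  case 2
  obtain M where M: "M > 0" "\<forall>x\<in>C. norm x \<le> M" using 2(1) compact_imp_bounded bounded_pos by metis
  \<comment> \<open>If \<open>c + 1 / w\<close> lies in \<open>C\<close>, then \<open>1 / w\<close>
    has norm at most \<open>R\<close>, so \<open>w\<close> stays away from 0.\<close>
  define R where "R = M + norm c"
  have R: "R > 0" using M(1) by (simp add: R_def add_pos_nonneg)
  have "closed ({w. norm w \<ge> 1 / R} \<inter> (\<lambda>w. c + 1 / w) -` C)"
  proof (rule continuous_closed_preimage)
   show "continuous_on {w. 1 / R \<le> norm w} (\<lambda>w. c + 1 / w)"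
    by (intro continuous_intros) (use R in auto)
   show "closed {w::complex. 1 / R \<le> norm w}" by (intro closed_Collect_le continuous_intros)
  qed (use 2 compact_imp_closed in auto)
  moreover have "{w. invp c w \<in> U} = - ({w. norm w \<ge> 1 / R} \<inter> (\<lambda>w. c + 1 / w) -` C)"
  proof -
   have "norm w \<ge> 1 / R" if "w ~= 0" "c + 1 / w \<in> C" for w
   proof -
    have "norm (1 / w) \<le> norm (c + 1 / w) + norm c"
     using norm_triangle_ineq4[of "c + 1 / w" c] by simp
    also have "\<dots> \<le> R" using M(2) that by (simp add: R_def)
    finally have "1 / norm w \<le> R" by (simp add: norm_divide)
    then show ?thesis using that R by (simp add: divide_le_eq mult.commute)
   qed
   moreover have "w ~= 0" if "norm w \<ge> 1 / R" for w using that R by auto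
   ultimately show ?thesis using 2 by (auto simp: invp_def split: if_splits)
  qed
  ultimately show ?thesis by (simp only: open_Compl)
 qed
 then show "openin euclidean {w \<in> topspace euclidean. invp c w \<in> U}" by simp
qed

lemma openin_invp:
 assumes "open W" shows "openin sphere2 (invp c ` W)"
proof -
 have pre: "open {z. z ~= c \<and> 1 / (z - c) \<in> W}"
 proof -
  have "open ((- {c}) \<inter> (\<lambda>z. 1 / (z - c)) -` W)"
   by (rule continuous_open_preimage) (use assms in \<open>auto intro!: continuous_intros simp: open_Compl\<close>)
  moreover have "{z. z ~= c \<and> 1 / (z - c) \<in> W} = (- {c}) \<inter> (\<lambda>z. 1 / (z - c)) -` W" by auto
  ultimately show ?thesis by simp
 qed
 have im: "invp c ` (W - {0}) = Some ` {z. z ~= c \<and> 1 / (z - c) \<in> W}"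
 proof (intro equalityI subsetI)
  fix y assume "y \<in> Some ` {z. z ~= c \<and> 1 / (z - c) \<in> W}"
  then obtain z where z: "y = Some z" "z ~= c" "1 / (z - c) \<in> W" by blast
  then have "y = invp c (1 / (z - c))" by (simp add: invp_def)
  then show "y \<in> invp c ` (W - {0})" using z by auto
 qed (auto simp: invp_def)
 show ?thesis
 proof (cases "0 \<in> W")
  case False
  then have "invp c ` W = Some ` {z. z ~= c \<and> 1 / (z - c) \<in> W}" using im by simp
  then show ?thesis using pre by simp
 next
  case True
  \<comment> \<open>For \<open>z\<close> far from \<open>c\<close> the value
    \<open>1 / (z - c)\<close> falls into a disc about 0 inside \<open>W\<close>; so what is left
    out is bounded.\<close>
  define C where "C = - {z. z ~= c \<and> 1 / (z - c) \<in> W}"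
  obtain \<delta> where \<delta>: "\<delta> > 0" "ball 0 \<delta> <= W" using assms True open_contains_ball by blast
  have "z \<in> cball c (1 / \<delta>)" if "z \<in> C" for z
  proof (rule ccontr)
   assume "z \<notin> cball c (1 / \<delta>)"
   then have 1: "norm (z - c) > 1 / \<delta>" by (simp add: dist_norm norm_minus_commute)
   then have "z ~= c" using \<delta> by auto
   moreover have "norm (1 / (z - c)) < \<delta>"
    using 1 \<delta> \<open>z ~= c\<close> by (simp add: norm_divide divide_less_eq mult.commute)
   ultimately show False using that \<delta> by (auto simp: C_def)
  qed
  then have "bounded C" using bounded_subset[OF bounded_cball] by blast
  moreover have "closed C" using pre by (simp add: C_def closed_Compl)
  ultimately have "compact C" using compact_eq_bounded_closed by blast
  moreover have "W = insert 0 (W - {0})" using True by blast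
  then have "invp c ` W = insert (invp c 0) (invp c ` (W - {0}))" by (metis image_insert)
  then have "invp c ` W = insert None (Some ` (- C))" using im by (simp add: C_def invp_def)
  ultimately show ?thesis unfolding openin_sphere2 by blast
 qed
qed

lemma centre_dist: "i ~= j ==> norm (centre i - centre j) \<ge> 4"
proof -
 assume "i ~= j"
 then have "\<bar>real (4 * i) - real (4 * j)\<bar> \<ge> 4" by (simp add: abs_if)
 moreover have "centre i - centre j = complex_of_real (real (4 * i) - real (4 * j))"
  by (simp add: centre_def)
 ultimately show ?thesis by (metis norm_of_real)
qed

text \<open>Handles and crosscaps in one setting. A circle that is glued to itself has to use the
  antipodal map, so that no boundary point is glued to itself.\<close>

locale gluing =
 fixes m :: nat and \<pi> :: "nat => nat" and \<rho> :: "complex => complex"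
 assumes pi: "j < m ==> \<pi> j < m" "j < m ==> \<pi> (\<pi> j) = j"
  and rho: "\<rho> (\<rho> w) = w" "norm (\<rho> w) = norm w" "continuous_on UNIV \<rho>" "\<rho> (of_real t * w) = of_real t * \<rho> w"
  and free: "j < m ==> \<pi> j = j ==> \<rho> w = - w"
begin

definition rl :: "complex option => complex option => bool" where
 "rl x y \<longleftrightarrow> (\<exists>j<m. \<exists>w. norm w = 1 \<and> x = Some (centre j + w) \<and> y = Some (centre (\<pi> j) + \<rho> w))"

definition q :: "complex option => complex option set" where "q x = {y. y = x \<or> rl x y}"

definition H where "H = holed_sphere m"
definition X where "X = quotient_space H q"
definition D where "D = {z. \<forall>j<m. norm (z - centre j) \<ge> 1}"
definition Bd where "Bd = (\<Union>j<m. sphere (centre j) 1)"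

text \<open>Centres are at least 4 apart, so a point at distance less than 2 from one is at distance
  more than 2 from all others.\<close>

lemma circle_unique:
 assumes "centre i + w = centre j + w'" "norm w < 2" "norm w' \<le> 2"
 shows "i = j" "w = w'"
proof -
 show "i = j"
 proof (rule ccontr)
  assume "i ~= j"
  then have "4 \<le> norm (centre i - centre j)" by (rule centre_dist)
  also have "centre i - centre j = w' - w" using assms(1) by (simp add: algebra_simps)
  also have "norm (w' - w) \<le> norm w' + norm w" by (rule norm_triangle_ineq4)
  finally show False using assms by simp
 qed
 then show "w = w'" using assms by simp
qed

lemma rl_sym: "rl x y ==> rl y x"
 unfolding rl_def by (metis pi rho(1,2))

lemma rl_fun:
 assumes "rl x y" "rl x z" shows "y = z"
proof -
 obtain j w where j: "norm w = 1" "x = Some (centre j + w)" "y = Some (centre (\<pi> j) + \<rho> w)"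
  using assms(1) unfolding rl_def by blast
 obtain i v where i: "norm v = 1" "x = Some (centre i + v)" "z = Some (centre (\<pi> i) + \<rho> v)"
  using assms(2) unfolding rl_def by blast
 have "j = i" "w = v" using circle_unique[of j w i v] i j by auto
 then show ?thesis using i j by simp
qed

text \<open>A point has at most one partner, so the classes have at most two elements.\<close>

lemma q_eq_iff: "q x = q y \<longleftrightarrow> x = y \<or> rl x y"
proof
 assume "q x = q y"
 then have "x \<in> q y" unfolding q_def by blast
 then show "x = y \<or> rl x y" unfolding q_def using rl_sym by blast
next
 assume "x = y \<or> rl x y"
 then show "q x = q y"
 proof
  assume r: "rl x y"
  have "z = x" if "rl y z" for z using rl_fun[OF rl_sym[OF r] that] by simp
  moreover have "z = y" if "rl x z" for z using rl_fun[OF r that] by simp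
  ultimately show ?thesis unfolding q_def using r rl_sym[OF r] by blast
 qed simp
qed

lemma topspace_H: "topspace H = insert None (Some ` D)"
 unfolding H_def holed_sphere_def D_def by (auto simp: dist_norm norm_minus_commute not_less image_iff)

lemma D_eq: "D = - (\<Union>j<m. ball (centre j) 1)"
 unfolding D_def by (auto simp: dist_norm norm_minus_commute not_less)

lemma closed_D: "closed D"
 unfolding D_eq by (intro closed_Compl open_UN) auto

lemma H_eq: "H = subtopology sphere2 (insert None (Some ` D))"
proof -
 have "- (\<Union>j<m. Some ` ball (centre j) 1) = insert None (Some ` D)"
 proof (rule set_eqI)
  fix x :: "complex option"
  show "x \<in> - (\<Union>j<m. Some ` ball (centre j) 1) \<longleftrightarrow> x \<in> insert None (Some ` D)"
   by (cases x) (auto simp: D_eq)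
 qed
 then show ?thesis unfolding H_def holed_sphere_def by simp
qed

lemma closedin_H: "closedin sphere2 (topspace H)"
proof -
 have "topspace sphere2 - topspace H = Some ` (- D)" unfolding topspace_H by auto
 moreover have "openin sphere2 (Some ` (- D))" using closed_D by (simp add: open_Compl)
 ultimately show ?thesis unfolding closedin_def by (auto simp: topspace_H)
qed

lemma H_Hausdorff: "Hausdorff_space H"
 unfolding H_eq by (rule Hausdorff_space_subtopology[OF sphere2_Hausdorff])

lemma H_compact: "compact_space H"
 unfolding H_eq
 by (rule compact_space_subtopology[OF closedin_compact_space[OF compact_space_Alexandroff_compactification
    closedin_H[unfolded topspace_H]]])

lemma quotient_q: "quotient_map H X q"
 unfolding X_def by (rule quotient_map_quotient_space)

lemma topspace_X: "topspace X = q ` topspace H"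
 unfolding X_def by (rule topspace_quotient_space)

lemma openin_X: "openin X U \<longleftrightarrow> U <= q ` topspace H \<and> openin H {x \<in> topspace H. q x \<in> U}"
 unfolding X_def by (rule openin_quotient_space)

lemma Bd_D: "Bd <= D"
proof
 fix z assume "z \<in> Bd"
 then obtain j where j: "j < m" "norm (z - centre j) = 1" by (auto simp: Bd_def dist_norm norm_minus_commute)
 have "norm (z - centre i) \<ge> 1" for i
 proof (cases "i = j")
  case False
  then have "4 \<le> norm (centre i - centre j)" by (rule centre_dist)
  also have "\<dots> \<le> norm (z - centre j) + norm (z - centre i)"
   using norm_triangle_ineq4[of "z - centre j" "z - centre i"] by simp
  finally show ?thesis using j by simp
 qed (use j in simp)
 then show "z \<in> D" by (simp add: D_def)
qed

lemma rl_Bd: "rl x y ==> x \<in> Some ` Bd \<and> y \<in> Some ` Bd"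
proof -
 have *: "rl x y ==> x \<in> Some ` Bd" for x y unfolding rl_def Bd_def by (auto simp: dist_norm intro!: imageI)
 assume "rl x y"
 then show ?thesis using *[of x y] *[of y x] rl_sym by blast
qed

lemma rl_image: "{Some y | y. \<exists>z\<in>C. rl (Some z) (Some y)} =
  (\<Union>j<m. Some ` (\<lambda>z. centre (\<pi> j) + \<rho> (z - centre j)) ` (C \<inter> sphere (centre j) 1))"
proof (intro equalityI subsetI)
 fix x assume "x \<in> {Some y | y. \<exists>z\<in>C. rl (Some z) (Some y)}"
 then obtain y z j w where "x = Some y" "z \<in> C" "j < m" "norm w = 1" "z = centre j + w" "y = centre (\<pi> j) + \<rho> w"
  unfolding rl_def by blast
 then show "x \<in> (\<Union>j<m. Some ` (\<lambda>z. centre (\<pi> j) + \<rho> (z - centre j)) ` (C \<inter> sphere (centre j) 1))"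
  by (intro UN_I[of j]) (auto simp: dist_norm image_iff intro!: bexI[of _ z])
next
 fix x assume "x \<in> (\<Union>j<m. Some ` (\<lambda>z. centre (\<pi> j) + \<rho> (z - centre j)) ` (C \<inter> sphere (centre j) 1))"
 then obtain j z where "j < m" "z \<in> C" "norm (z - centre j) = 1" "x = Some (centre (\<pi> j) + \<rho> (z - centre j))"
  by (auto simp: dist_norm norm_minus_commute)
 then show "x \<in> {Some y | y. \<exists>z\<in>C. rl (Some z) (Some y)}"
 proof -
  have "rl (Some z) (Some (centre (\<pi> j) + \<rho> (z - centre j)))"
   unfolding rl_def using \<open>j < m\<close> \<open>norm (z - centre j) = 1\<close> by (intro exI[of _ j] conjI exI[of _ "z - centre j"]) auto
  then show ?thesis using \<open>z \<in> C\<close> \<open>x = _\<close> by blast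
 qed
qed

text \<open>Saturating a closed set adds only the images of its intersections with the finitely many
  circles, and these are compact.\<close>

lemma closed_map_q: "closed_map H X q"
 unfolding closed_map_def
proof (intro allI impI)
 fix C assume C: "closedin H C"
 have CH: "C <= topspace H" using C closedin_subset by blast
 define C' where "C' = {z. Some z \<in> C}"
 define P where "P = C \<union> {Some y | y. \<exists>z\<in>C'. rl (Some z) (Some y)}"
 have pre: "{x \<in> topspace H. q x \<in> q ` C} = P"
 proof (intro equalityI subsetI)
  fix x assume "x \<in> {x \<in> topspace H. q x \<in> q ` C}"
  then obtain c where c: "c \<in> C" "q c = q x" by auto
  then have "c = x \<or> rl c x" using q_eq_iff by blast
  then show "x \<in> P" using c(1) rl_Bd unfolding P_def C'_def by blast
 next
  fix x assume "x \<in> P"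
  then consider "x \<in> C" | y z where "x = Some y" "Some z \<in> C" "rl (Some z) (Some y)"
   unfolding P_def C'_def by blast
  then show "x \<in> {x \<in> topspace H. q x \<in> q ` C}"
  proof cases
   case 2
   then have "q x = q (Some z)" using q_eq_iff by metis
   moreover have "x \<in> topspace H" using rl_Bd[OF 2(3)] 2(1) Bd_D unfolding topspace_H by blast
   ultimately show ?thesis using 2 by auto
  qed (use CH in auto)
 qed
 have cS: "closedin sphere2 C"
  by (rule closedin_trans_full[OF C[unfolded H_eq] closedin_H[unfolded topspace_H]])
 have "closed C'"
 proof -
  have "closedin euclidean {z \<in> topspace euclidean. Some z \<in> C}"
   by (rule closedin_continuous_map_preimage[OF continuous_map_Some cS])
  then show ?thesis by (simp add: C'_def)
 qed
 have "closedin sphere2 (\<Union>j<m. Some ` (\<lambda>z. centre (\<pi> j) + \<rho> (z - centre j)) ` (C' \<inter> sphere (centre j) 1))"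
 proof (rule closedin_Union)
  fix S assume "S \<in> (\<lambda>j. Some ` (\<lambda>z. centre (\<pi> j) + \<rho> (z - centre j)) ` (C' \<inter> sphere (centre j) 1)) ` {..<m}"
  then obtain j where S: "S = Some ` (\<lambda>z. centre (\<pi> j) + \<rho> (z - centre j)) ` (C' \<inter> sphere (centre j) 1)" by blast
  have "compact ((\<lambda>z. centre (\<pi> j) + \<rho> (z - centre j)) ` (C' \<inter> sphere (centre j) 1))"
   by (intro compact_continuous_image continuous_intros continuous_on_compose2[OF rho(3)])
    (use \<open>closed C'\<close> in \<open>auto intro: closed_Int_compact\<close>)
  then show "closedin sphere2 S" unfolding S by (simp add: compact_imp_closed)
 qed auto
 then have "closedin sphere2 P" unfolding P_def rl_image using cS by (intro closedin_Un)
 moreover have "P <= insert None (Some ` D)" using pre topspace_H by auto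
 ultimately have "closedin H P" unfolding H_eq by (rule closedin_subset_topspace)
 moreover have "q ` C <= topspace X" using CH topspace_X by auto
 ultimately show "closedin X (q ` C)"
  using quotient_q pre unfolding quotient_map_closedin by auto
qed

lemma cont_q: "continuous_map H X q" using quotient_q quotient_imp_continuous_map by blast

lemma cont_qSome:
 assumes "continuous_on T f" "f ` T <= D"
 shows "continuous_map (top_of_set T) X (\<lambda>z. q (Some (f z)))"
proof -
 have "continuous_map (top_of_set T) sphere2 (Some \<circ> f)"
  by (rule continuous_map_compose[OF _ continuous_map_Some]) (use assms in simp)
 then have "continuous_map (top_of_set T) H (Some \<circ> f)"
  unfolding H_eq using assms by (auto simp: continuous_map_in_subtopology)
 then have "continuous_map (top_of_set T) X (q \<circ> (Some \<circ> f))" using cont_q by (rule continuous_map_compose)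
 then show ?thesis by (simp add: o_def)
qed

lemma openin_H_Some: "open A ==> openin H (Some ` (A \<inter> D))"
proof -
 assume "open A"
 then have "openin sphere2 (Some ` A)" by simp
 then have "openin H (Some ` A \<inter> insert None (Some ` D))" unfolding H_eq by (rule openin_subtopology_Int)
 moreover have "Some ` A \<inter> insert None (Some ` D) = Some ` (A \<inter> D)" by auto
 ultimately show ?thesis by simp
qed

lemma interior_chart:
 assumes z: "z \<in> D" "z \<notin> Bd"
 shows "\<exists>U V (\<kappa> :: complex option set => complex). openin X U \<and> q (Some z) \<in> U \<and> open V \<and>
      homeomorphic_map (subtopology X U) (top_of_set V) \<kappa>"
proof -
 define V where "V = - (\<Union>j<m. cball (centre j) 1)"
 define \<psi> where "\<psi> z = q (Some z)" for z
 have opV: "open V" unfolding V_def by (intro open_Compl closed_UN) auto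
 have zV: "z \<in> V" using z unfolding V_def D_def Bd_def by (fastforce simp: dist_norm norm_minus_commute)
 have VD: "V <= D" "V \<inter> Bd = {}" unfolding V_def D_def Bd_def by (fastforce simp: dist_norm norm_minus_commute)+
 have norl: "\<not> rl (Some x) y" if "x \<in> V" for x y using rl_Bd[of "Some x" y] VD that by auto
 have op: "openin X (\<psi> ` W)" if W: "W <= V" "open W" for W
 proof -
  have "{x \<in> topspace H. q x \<in> \<psi> ` W} = Some ` (W \<inter> D)"
  proof (intro equalityI subsetI)
   fix x assume "x \<in> {x \<in> topspace H. q x \<in> \<psi> ` W}"
   then obtain w where w: "w \<in> W" "q (Some w) = q x" by (auto simp: \<psi>_def)
   then have "x = Some w" using q_eq_iff[of "Some w" x] norl[of w x] W by blast
   then show "x \<in> Some ` (W \<inter> D)" using w W VD by blast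
  qed (auto simp: \<psi>_def topspace_H)
  moreover have "\<psi> ` W <= q ` topspace H" unfolding \<psi>_def topspace_H using W VD by blast
  ultimately show ?thesis using openin_X openin_H_Some[OF W(2)] by simp
 qed
 have "\<exists>\<kappa>. homeomorphic_map (subtopology X (\<psi> ` V)) (top_of_set V) \<kappa>"
 proof (rule homeomorphic_map_param[OF _ _ op opV])
  show "continuous_map (top_of_set V) X \<psi>" unfolding \<psi>_def by (rule cont_qSome) (use VD in auto)
  show "inj_on \<psi> V"
  proof (rule inj_onI)
   fix x y assume "x \<in> V" "y \<in> V" "\<psi> x = \<psi> y"
   then show "x = y" using q_eq_iff[of "Some x" "Some y"] norl[of x "Some y"] by (simp add: \<psi>_def)
  qed
 qed
 moreover have "q (Some z) \<in> \<psi> ` V" using zV by (auto simp: \<psi>_def)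
 ultimately show ?thesis using op[OF order_refl opV] opV by blast
qed

text \<open>A disc about \<open>w0\<close> is cut in two by the unit circle. Its outer part is
  placed outside circle \<open>j\<close>; its inner part is turned outwards by inversion in the unit
  circle and carried by \<open>\<rho>\<close> to the outside of circle \<open>\<pi> j\<close>. On
  the circle itself the two images are glued.\<close>

lemma boundary_chart:
 assumes j: "j < m" and w0: "norm w0 = 1"
 shows "\<exists>U V (\<kappa> :: complex option set => complex). openin X U \<and> q (Some (centre j + w0)) \<in> U \<and> open V \<and>
      homeomorphic_map (subtopology X U) (top_of_set V) \<kappa>"
proof -
 define V where "V = ball w0 (1/2)"
 define iv where "iv z = z / of_real ((norm z)^2)" for z :: complex
 define a b where "a z = centre j + z" and "b z = centre (\<pi> j) + \<rho> (iv z)" for z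
 define \<psi> where "\<psi> z = (if norm z \<ge> 1 then q (Some (a z)) else q (Some (b z)))" for z
 have Vn: "1/2 < norm z" "norm z < 3/2" "z ~= 0" if "z \<in> V" for z
 proof -
  have 1: "norm (w0 - z) < 1/2" using that by (simp add: V_def dist_norm)
  show n: "1/2 < norm z" using norm_triangle_ineq[of "w0 - z" z] 1 w0 by simp
  show "norm z < 3/2" using norm_triangle_ineq2[of z w0] 1 w0 by (simp add: norm_minus_commute)
  show "z ~= 0" using n by auto
 qed
 have ivn: "norm (iv z) = 1 / norm z" for z unfolding iv_def norm_divide norm_of_real by (simp add: power2_eq_square)
 have iviv: "iv (iv z) = z" for z
 proof (cases "z = 0")
  case False
  have "iv (iv z) = iv z / of_real ((1 / norm z)^2)" using ivn[of z] by (simp add: iv_def[of "iv z"])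
  then show ?thesis using False by (simp add: iv_def power_divide)
 qed (simp add: iv_def)
 have \<pi>j: "\<pi> j < m" using pi(1) j .
 have inD: "centre i + w \<in> D" if "i < m" "norm w \<ge> 1" "norm w \<le> 2" for i w
 proof -
  have "norm (centre i + w - centre k) \<ge> 1" for k
  proof (cases "k = i")
   case False
   then have "4 \<le> norm (centre k - centre i)" by (rule centre_dist)
   also have "\<dots> \<le> norm w + norm (centre i + w - centre k)"
    using norm_triangle_ineq4[of w "centre i + w - centre k"] by simp
   finally show ?thesis using that by simp
  qed (use that in simp)
  then show ?thesis by (simp add: D_def)
 qed
 have aD: "a z \<in> D" if "z \<in> V" "norm z \<ge> 1" for z
  unfolding a_def by (rule inD) (use j that Vn[of z] in auto)
 have bD: "b z \<in> D" if "z \<in> V" "norm z \<le> 1" for z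
  unfolding b_def by (rule inD) (use \<pi>j that Vn[of z] in \<open>auto simp: rho(2) ivn divide_le_eq le_divide_eq\<close>)
 have ab: "q (Some (a z)) = q (Some (b z))" if "norm z = 1" for z
 proof -
  have "iv z = z" using that by (simp add: iv_def)
  then have "rl (Some (a z)) (Some (b z))" using that j unfolding rl_def a_def b_def by auto
  then show ?thesis using q_eq_iff[of "Some (a z)" "Some (b z)"] by simp
 qed
 have ca: "continuous_map (top_of_set {z \<in> V. norm z \<ge> 1}) X (\<lambda>z. q (Some (a z)))"
  by (rule cont_qSome) (use aD in \<open>auto simp: a_def intro!: continuous_intros\<close>)
 have contb: "continuous_on (- {0}) b" unfolding b_def iv_def
  by (intro continuous_intros continuous_on_compose2[OF rho(3)]) auto
 have cb: "continuous_map (top_of_set {z \<in> V. norm z \<le> 1}) X (\<lambda>z. q (Some (b z)))"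
  by (rule cont_qSome[OF continuous_on_subset[OF contb]]) (use bD Vn in auto)
 have cpsi: "continuous_map (top_of_set V) X \<psi>"
 proof (rule pasting_lemma_closed[where I = "{True, False}" and T = "\<lambda>i. if i then {z \<in> V. norm z \<ge> 1} else {z \<in> V. norm z \<le> 1}"
    and f = "\<lambda>i. if i then (\<lambda>z. q (Some (a z))) else (\<lambda>z. q (Some (b z)))"])
  have "{z \<in> V. norm z \<ge> 1} = V \<inter> {z. norm z \<ge> 1}" "{z \<in> V. norm z \<le> 1} = V \<inter> {z. norm z \<le> 1}" by auto
  moreover have "closed {z::complex. norm z \<ge> 1}" "closed {z::complex. norm z \<le> 1}"
   by (intro closed_Collect_le continuous_intros)+
  ultimately show "closedin (top_of_set V) (if i then {z \<in> V. norm z \<ge> 1} else {z \<in> V. norm z \<le> 1})" for i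
   by (auto intro: closedin_closed_Int)
  show "continuous_map (subtopology (top_of_set V) (if i then {z \<in> V. norm z \<ge> 1} else {z \<in> V. norm z \<le> 1})) X
    (if i then (\<lambda>z. q (Some (a z))) else (\<lambda>z. q (Some (b z))))" for i
   using ca cb by (simp add: subtopology_subtopology Int_absorb1 Collect_restrict)
 qed (auto simp: \<psi>_def ab)
 have rla: "rl (Some (a z)) y ==> norm z = 1 \<and> y = Some (centre (\<pi> j) + \<rho> z)" if z: "z \<in> V" for z y
 proof -
  assume "rl (Some (a z)) y"
  then obtain i w where iw: "norm w = 1" "a z = centre i + w" "y = Some (centre (\<pi> i) + \<rho> w)" unfolding rl_def by blast
  have "i = j" "w = z" using circle_unique[of i w j z] iw Vn[OF z] by (auto simp: a_def)
  then show ?thesis using iw by simp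
 qed
 have rlb: "rl (Some (b z)) y ==> norm z = 1" if z: "z \<in> V" for z y
 proof -
  assume "rl (Some (b z)) y"
  then obtain i w where iw: "norm w = 1" "b z = centre i + w" unfolding rl_def by blast
  have "norm (\<rho> (iv z)) \<le> 2" using Vn[OF z] by (simp add: rho(2) ivn divide_le_eq)
  then have "w = \<rho> (iv z)" using circle_unique[of i w "\<pi> j" "\<rho> (iv z)"] iw by (auto simp: b_def)
  then show ?thesis using iw(1) Vn[OF z] by (simp add: rho(2) ivn)
 qed
 \<comment> \<open>\<open>V\<close> lies in an open half-plane through 0. This excludes the overlap
   that could occur when circle \<open>j\<close> is glued to itself, where \<open>\<rho>\<close> is
   the antipodal map.\<close>
 have noneg: "\<not> (z \<in> V \<and> z' \<in> V \<and> t > 0 \<and> z = - of_real t * z')" for z z' t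
 proof
  assume H: "z \<in> V \<and> z' \<in> V \<and> t > 0 \<and> z = - of_real t * z'"
  have pos: "Re (x * cnj w0) > 0" if "x \<in> V" for x
  proof -
   have "norm (w0 - x) < 1/2" using that by (simp add: V_def dist_norm)
   then have "norm ((w0 - x) * cnj w0) < 1/2" using w0 by (simp add: norm_mult)
   then have "Re ((w0 - x) * cnj w0) < 1/2" using complex_Re_le_cmod order_le_less_trans by blast
   moreover have "Re (w0 * cnj w0) = 1" using w0 by (simp add: complex_mult_cnj cmod_def)
   ultimately show ?thesis by (simp add: left_diff_distrib)
  qed
  have "Re (z * cnj w0) = - (t * Re (z' * cnj w0))" using H by (simp add: mult.assoc)
  moreover have "t * Re (z' * cnj w0) > 0" using pos[of z'] H by simp
  ultimately show False using pos[of z] H by linarith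
 qed
 have mixed: False if z: "z \<in> V" "z' \<in> V" "norm z \<ge> 1" "norm z' < 1" and eq: "q (Some (a z)) = q (Some (b z'))" for z z'
 proof -
  have "\<not> rl (Some (a z)) (Some (b z'))"
   using rlb[OF z(2), of "Some (a z)"] rl_sym[of "Some (a z)" "Some (b z')"] z(4) by auto
  then have e: "a z = b z'" using eq q_eq_iff[of "Some (a z)" "Some (b z')"] by simp
  have "norm (\<rho> (iv z')) \<le> 2" using Vn[OF z(2)] by (simp add: rho(2) ivn divide_le_eq)
  then have "j = \<pi> j" "z = \<rho> (iv z')"
   using circle_unique[of j z "\<pi> j" "\<rho> (iv z')"] e Vn[OF z(1)] by (auto simp: a_def b_def)
  then have "z = - iv z'" using free[OF j] by metis
  then have "z = - of_real (1 / (norm z')^2) * z'" by (simp add: iv_def)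
  moreover have "1 / (norm z')^2 > 0" using Vn[OF z(2)] by simp
  ultimately show False using noneg z by blast
 qed
 have inj: "inj_on \<psi> V"
 proof (rule inj_onI)
  fix z z' assume z: "z \<in> V" "z' \<in> V" "\<psi> z = \<psi> z'"
  consider "norm z \<ge> 1" "norm z' \<ge> 1" | "norm z < 1" "norm z' < 1" | "norm z \<ge> 1" "norm z' < 1" | "norm z < 1" "norm z' \<ge> 1"
   by linarith
  then show "z = z'"
  proof cases
   case 1
   then have "a z = a z' \<or> rl (Some (a z)) (Some (a z'))" using z(3) q_eq_iff[of "Some (a z)" "Some (a z')"] by (simp add: \<psi>_def)
   then show ?thesis
   proof
    assume "rl (Some (a z)) (Some (a z'))"
    then have r: "norm z = 1" "a z' = centre (\<pi> j) + \<rho> z" using rla[OF z(1)] by auto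
    have "j = \<pi> j" "z' = \<rho> z"
     using circle_unique[of j z' "\<pi> j" "\<rho> z"] r Vn[OF z(2)] rho(2)[of z] by (auto simp: a_def)
    then have "z' = - of_real 1 * z" using free[OF j] by (metis mult_1 mult_minus_left of_real_1)
    then show ?thesis using noneg[of z' z 1] z by auto
   qed (simp add: a_def)
  next
   case 2
   then have "b z = b z'"
    using z(3) q_eq_iff[of "Some (b z)" "Some (b z')"] rlb[OF z(1), of "Some (b z')"] by (auto simp: \<psi>_def)
   then have "\<rho> (iv z) = \<rho> (iv z')" by (simp add: b_def)
   then show ?thesis using rho(1) iviv by metis
  next
   case 3 then show ?thesis using mixed[of z z'] z by (simp add: \<psi>_def)
  next
   case 4 then show ?thesis using mixed[of z' z] z by (simp add: \<psi>_def)
  qed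
 qed
 have op: "openin X (\<psi> ` W)" if W: "W <= V" "open W" for W
 proof -
  \<comment> \<open>\<open>A\<close> and \<open>B\<close> describe the preimage as it is seen from
    circle \<open>j\<close> and from circle \<open>\<pi> j\<close>; \<open>b'\<close> is the inverse
    of \<open>b\<close>.\<close>
  define A where "A = (\<lambda>x. x - centre j) -` W"
  define b' where "b' x = iv (\<rho> (x - centre (\<pi> j)))" for x
  define B where "B = (- {centre (\<pi> j)}) \<inter> b' -` W"
  have b'b: "b' (b z) = z" for z unfolding b'_def b_def by (simp add: rho(1) iviv)
  have bb': "b (b' x) = x" for x unfolding b'_def b_def by (simp add: rho(1) iviv)
  have oA: "open A" unfolding A_def by (intro open_vimage W continuous_intros)
  have "\<rho> x ~= 0" if "x ~= 0" for x using rho(2)[of x] that by auto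
  then have oB: "open B" unfolding B_def b'_def iv_def
   by (intro continuous_open_preimage W continuous_intros continuous_on_compose2[OF rho(3)]) (auto simp: open_Compl)
  have "{x \<in> topspace H. q x \<in> \<psi> ` W} = Some ` (A \<inter> D) \<union> Some ` (B \<inter> D)"
  proof (intro equalityI subsetI)
   fix x assume x: "x \<in> {x \<in> topspace H. q x \<in> \<psi> ` W}"
   then obtain w where w: "w \<in> W" "q x = \<psi> w" by auto
   then have wV: "w \<in> V" using W by blast
   have aA: "a w \<in> A" using w by (simp add: A_def a_def)
   have bB: "b w \<in> B" using w b'b Vn[OF wV] rho(2)[of "iv w"] ivn[of w] by (auto simp: B_def b_def)
   show "x \<in> Some ` (A \<inter> D) \<union> Some ` (B \<inter> D)"
   proof (cases "norm w \<ge> 1")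
    case True
    then have "x = Some (a w) \<or> rl (Some (a w)) x" using w(2) q_eq_iff[of "Some (a w)" x] by (auto simp: \<psi>_def)
    moreover have "x = Some (b w) \<and> norm w \<le> 1" if "rl (Some (a w)) x"
     using rla[OF wV that] by (simp add: b_def iv_def)
    ultimately show ?thesis using aA bB aD[OF wV True] bD[OF wV] by blast
   next
    case False
    then have "x = Some (b w) \<or> rl (Some (b w)) x" using w(2) q_eq_iff[of "Some (b w)" x] by (auto simp: \<psi>_def)
    then have "x = Some (b w)" using rlb[OF wV] False by auto
    then show ?thesis using bB bD[OF wV] False by auto
   qed
  next
   fix x assume "x \<in> Some ` (A \<inter> D) \<union> Some ` (B \<inter> D)"
   then show "x \<in> {x \<in> topspace H. q x \<in> \<psi> ` W}"
   proof
    assume "x \<in> Some ` (A \<inter> D)"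
    then obtain z where z: "x = Some z" "z \<in> A" "z \<in> D" by blast
    have "norm (z - centre j) \<ge> 1" using z(3) j by (simp add: D_def)
    then have "q x = \<psi> (z - centre j)" using z by (simp add: \<psi>_def a_def)
    then show ?thesis using z by (auto simp: A_def topspace_H)
   next
    assume "x \<in> Some ` (B \<inter> D)"
    then obtain z where z: "x = Some z" "z \<in> B" "z \<in> D" by blast
    have n: "norm (z - centre (\<pi> j)) \<ge> 1" using z(3) \<pi>j by (simp add: D_def)
    have bn: "norm (b' z) = 1 / norm (z - centre (\<pi> j))" by (simp add: b'_def ivn rho(2))
    have "q x = \<psi> (b' z)"
    proof (cases "norm (b' z) \<ge> 1")
     case True
     moreover have "1 / norm (z - centre (\<pi> j)) \<le> 1" using n by (subst divide_le_eq_1_pos) linarith+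
     ultimately have "norm (b' z) = 1" using bn by simp
     then have "\<psi> (b' z) = q (Some (b (b' z)))" using ab[of "b' z"] by (simp add: \<psi>_def)
     then show ?thesis using z bb' by simp
    qed (use z bb' in \<open>simp add: \<psi>_def\<close>)
    then show ?thesis using z by (auto simp: B_def topspace_H)
   qed
  qed
  moreover have "\<psi> ` W <= q ` topspace H"
  proof
   fix y assume "y \<in> \<psi> ` W"
   then obtain w where "w \<in> V" "y = \<psi> w" using W by blast
   then show "y \<in> q ` topspace H" using aD[of w] bD[of w] by (auto simp: \<psi>_def topspace_H)
  qed
  ultimately show ?thesis using openin_X openin_H_Some[OF oA] openin_H_Some[OF oB] by (simp add: openin_Un)
 qed
 have opV: "open V" "w0 \<in> V" by (auto simp: V_def)
 obtain \<kappa> where "homeomorphic_map (subtopology X (\<psi> ` V)) (top_of_set V) \<kappa>"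
  using homeomorphic_map_param[OF cpsi inj op opV(1)] by blast
 moreover have "q (Some (centre j + w0)) \<in> \<psi> ` V" using opV w0 by (force simp: \<psi>_def a_def)
 ultimately show ?thesis using op[OF order_refl opV(1)] opV by blast
qed

lemma infinity_chart:
 "\<exists>U V (\<kappa> :: complex option set => complex). openin X U \<and> q None \<in> U \<and> open V \<and>
      homeomorphic_map (subtopology X U) (top_of_set V) \<kappa>"
proof -
 \<comment> \<open>The centres have norm below \<open>4 m\<close>, so beyond \<open>R\<close> there
   are neither holes nor boundary circles.\<close>
 define R where "R = 4 * real m + 2"
 have R: "R > 0" by (simp add: R_def)
 define V where "V = ball (0::complex) (1 / R)"
 have far: "norm (z - centre j) > 1" if "norm z > R" "j < m" for z j
 proof -
  have "norm (centre j) = 4 * real j" by (simp add: centre_def norm_mult)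
  then have "norm (centre j) \<le> 4 * real m" using that by simp
  then show ?thesis using norm_triangle_ineq2[of z "centre j"] that by (simp add: R_def)
 qed
 have inv: "invp 0 w = None \<or> (\<exists>z. invp 0 w = Some z \<and> z \<in> D \<and> z \<notin> Bd)" if "w \<in> V" for w
 proof (cases "w = 0")
  case False
  have "norm w < 1 / R" using that by (simp add: V_def)
  then have "norm (1 / w) > R" using False R by (simp add: norm_divide less_divide_eq mult.commute)
  then have "norm (1 / w - centre j) > 1" if "j < m" for j using far that by blast
  then have "1 / w \<in> D" "1 / w \<notin> Bd" unfolding D_def Bd_def by (auto simp: dist_norm norm_minus_commute less_imp_le) (metis less_irrefl norm_minus_commute)
  then show ?thesis using False by (simp add: invp_def)
 qed (simp add: invp_def)
 define \<psi> where "\<psi> w = q (invp 0 w)" for w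
 have norl: "\<not> rl (invp 0 w) y" if "w \<in> V" for w y
  using rl_Bd[of "invp 0 w" y] inv[OF that] by auto
 have inH: "invp 0 w \<in> topspace H" if "w \<in> V" for w using inv[OF that] by (auto simp: topspace_H)
 have op: "openin X (\<psi> ` W)" if W: "W <= V" "open W" for W
 proof -
  have "{x \<in> topspace H. q x \<in> \<psi> ` W} = invp 0 ` W"
  proof (intro equalityI subsetI)
   fix x assume "x \<in> {x \<in> topspace H. q x \<in> \<psi> ` W}"
   then obtain w where w: "w \<in> W" "q (invp 0 w) = q x" by (auto simp: \<psi>_def)
   then have "x = invp 0 w" using q_eq_iff[of "invp 0 w" x] norl[of w x] W by blast
   then show "x \<in> invp 0 ` W" using w by blast
  qed (use inH W in \<open>auto simp: \<psi>_def\<close>)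
  moreover have "openin H (invp 0 ` W)"
  proof -
   have "invp 0 ` W <= insert None (Some ` D)" using inH W topspace_H by auto
   moreover have "openin (subtopology sphere2 (insert None (Some ` D))) (invp 0 ` W \<inter> insert None (Some ` D))"
    by (rule openin_subtopology_Int[OF openin_invp[OF W(2)]])
   ultimately show ?thesis unfolding H_eq by (simp add: inf.absorb1)
  qed
  moreover have "\<psi> ` W <= q ` topspace H" unfolding \<psi>_def using inH W by auto
  ultimately show ?thesis using openin_X by simp
 qed
 have opV: "open V" "0 \<in> V" using R by (auto simp: V_def)
 have "continuous_map (top_of_set V) H (invp 0)" unfolding H_eq
  using continuous_map_from_subtopology[OF continuous_map_invp] inH topspace_H by (auto simp: continuous_map_in_subtopology)
 then have "continuous_map (top_of_set V) X (q \<circ> invp 0)" using cont_q by (rule continuous_map_compose)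
 moreover have "q \<circ> invp 0 = \<psi>" by (rule ext) (simp add: \<psi>_def)
 ultimately have "continuous_map (top_of_set V) X \<psi>" by simp
 moreover have "inj_on \<psi> V"
 proof (rule inj_onI)
  fix z z' assume z: "z \<in> V" "z' \<in> V" "\<psi> z = \<psi> z'"
  then have "invp 0 z = invp 0 z'"
   using q_eq_iff[of "invp 0 z" "invp 0 z'"] norl[of z "invp 0 z'"] by (simp add: \<psi>_def)
  then show "z = z'" using inj_invp by (simp add: inj_eq)
 qed
 ultimately obtain \<kappa> where "homeomorphic_map (subtopology X (\<psi> ` V)) (top_of_set V) \<kappa>"
  using homeomorphic_map_param[OF _ _ op opV(1)] by blast
 moreover have "q None \<in> \<psi> ` V" using opV by (force simp: \<psi>_def invp_def)
 ultimately show ?thesis using op[OF order_refl opV(1)] opV by blast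
qed

end

section \<open>Maps without zeros on the plane with holes\<close>

text \<open>Dividing by the power of \<open>z - centre m\<close> given by the winding number
  \<open>e\<close> around the last hole leaves a map with a logarithm on that circle. By Tietze the
  logarithm extends over the disc, so the hole can be filled and the induction hypothesis
  applies.\<close>

lemma planar_factor:
 assumes "continuous_on (- (\<Union>j<m. ball (centre j) 1)) F" "!!z. z \<in> - (\<Union>j<m. ball (centre j) 1) ==> F z ~= 0"
 shows "\<exists>d \<theta>. continuous_on (- (\<Union>j<m. ball (centre j) 1)) \<theta> \<and>
  (\<forall>z\<in>- (\<Union>j<m. ball (centre j) 1). F z = (\<Prod>j<m. (z - centre j) powi d j) * exp (\<theta> z))"
 using assms
proof (induction m arbitrary: F)
 case 0
 then obtain \<theta> where "continuous_on UNIV \<theta>" "!!z. F z = exp (\<theta> z)"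
  using continuous_logarithm_on_contractible[of UNIV F] contractible_UNIV by auto
 then show ?case by auto
next
 case (Suc m)
 let ?D = "\<lambda>m. - (\<Union>j<m. ball (centre j) 1)"
 have dj: "z \<in> ?D m" if "z \<in> cball (centre m) 1" for z
 proof -
  have "dist (centre j) z \<ge> 1" if "j < m" for j
  proof -
   have "4 \<le> norm (centre m - centre j)" using that by (intro centre_dist) simp
   also have "\<dots> \<le> dist (centre m) z + dist (centre j) z"
    using dist_triangle2[of "centre m" "centre j" z] by (simp add: dist_norm)
   finally show ?thesis using \<open>z \<in> _\<close> by simp
  qed
  then show ?thesis by (auto simp: not_less)
 qed
 have DS: "?D (Suc m) = ?D m - ball (centre m) 1" by (auto simp: less_Suc_eq)
 have Dm: "?D m = ?D (Suc m) \<union> cball (centre m) 1" using dj by (auto simp: less_Suc_eq)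
 have sD: "centre m + w \<in> ?D (Suc m)" if "norm w = 1" for w
  using dj[of "centre m + w"] that unfolding DS by (auto simp: dist_norm)
 have cl: "closed (?D (Suc m))" by (intro closed_Compl open_UN) auto
 have "continuous_on (sphere 0 1) (\<lambda>w. F (centre m + w))"
  by (rule continuous_on_compose2[OF Suc.prems(1)]) (use sD in \<open>auto intro!: continuous_intros\<close>)
 then obtain e :: int and \<eta> where e: "continuous_on (sphere 0 1) \<eta>" "!!w. w \<in> sphere 0 1 ==> F (centre m + w) = w powi e * exp (\<eta> w)"
  by (rule circle_degree) (use Suc.prems(2) sD in auto)
 have "closedin (top_of_set UNIV) (sphere (0::complex) 1)" by simp
 then obtain \<eta>' where \<eta>': "continuous_on UNIV \<eta>'" "!!w. w \<in> sphere 0 1 ==> \<eta>' w = \<eta> w"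
  using Tietze_unbounded[OF e(1)] by (metis UNIV_I)
 \<comment> \<open>On the circle both formulas agree, by the choice of
   \<open>\<eta>\<close>.\<close>
 define G where "G z = (if z \<in> cball (centre m) 1 then exp (\<eta>' (z - centre m)) else F z * (z - centre m) powi (- e))" for z
 have Geq: "G z = F z * (z - centre m) powi (- e)" if "z \<in> ?D (Suc m)" for z
 proof (cases "z \<in> cball (centre m) 1")
  case True
  then have w: "z - centre m \<in> sphere 0 1" using that unfolding DS by (auto simp: dist_norm norm_minus_commute)
  then have "F z = (z - centre m) powi e * exp (\<eta>' (z - centre m))" using e(2)[OF w] \<eta>'(2)[OF w] by simp
  moreover have "z - centre m ~= 0" using w by auto
  ultimately show ?thesis using True by (simp add: G_def power_int_minus)
 qed (simp add: G_def)
 have nc: "z ~= centre m" if "z \<in> ?D (Suc m)" for z using that unfolding DS by auto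
 have "continuous_on (?D (Suc m)) (\<lambda>z. F z * (z - centre m) powi (- e))"
  using nc by (intro continuous_intros Suc.prems) auto
 then have 1: "continuous_on (?D (Suc m)) G" by (rule continuous_on_eq) (simp add: Geq)
 have "continuous_on (cball (centre m) 1) (\<lambda>z. exp (\<eta>' (z - centre m)))"
  by (intro continuous_intros continuous_on_compose2[OF \<eta>'(1)]) auto
 then have 2: "continuous_on (cball (centre m) 1) G" by (rule continuous_on_eq) (simp add: G_def)
 have "continuous_on (?D m) G" unfolding Dm by (rule continuous_on_closed_Un[OF cl closed_cball 1 2])
 moreover have "G z ~= 0" if "z \<in> ?D m" for z
 proof (cases "z \<in> cball (centre m) 1")
  case False
  then have "z \<in> ?D (Suc m)" using that unfolding Dm by blast
  then show ?thesis using Geq Suc.prems(2) nc by simp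
 qed (simp add: G_def)
 ultimately obtain d \<theta> where d: "continuous_on (?D m) \<theta>" "\<forall>z\<in>?D m. G z = (\<Prod>j<m. (z - centre j) powi d j) * exp (\<theta> z)"
  using Suc.IH by blast
 define d' where "d' = d(m := e)"
 have "F z = (\<Prod>j<Suc m. (z - centre j) powi d' j) * exp (\<theta> z)" if z: "z \<in> ?D (Suc m)" for z
 proof -
  have "z \<in> ?D m" using z unfolding DS by blast
  then have "F z * (z - centre m) powi (- e) = (\<Prod>j<m. (z - centre j) powi d j) * exp (\<theta> z)" using d(2) Geq[OF z] by auto
  then have "F z = (\<Prod>j<m. (z - centre j) powi d j) * (z - centre m) powi e * exp (\<theta> z)"
   using nc[OF z] by (simp add: power_int_minus field_simps)
  moreover have "(\<Prod>j<m. (z - centre j) powi d j) = (\<Prod>j<m. (z - centre j) powi d' j)"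
   by (rule prod.cong) (auto simp: d'_def)
  moreover have "d' m = e" by (simp add: d'_def)
  ultimately show ?thesis by (simp only: prod.lessThan_Suc)
 qed
 moreover have "continuous_on (?D (Suc m)) \<theta>" by (rule continuous_on_subset[OF d(1)]) (auto simp: DS)
 ultimately show ?case by blast
qed

lemma exp_real_Im: "Im (exp z) = 0 ==> \<exists>n::int. Im z = of_int n * pi"
 by (simp add: Im_exp sin_zero_iff_int2)

context gluing
begin

text \<open>All centres are real, so moving a point vertically away from the real line does not
  bring it closer to any of them. This joins the upper and the lower part of \<open>D\<close> each
  to a far half-plane, and a half-plane to the left of all discs joins the two.\<close>

lemma connected_D: "connected D"
proof -
 define P where "P s = {z. s * Im z \<ge> 2} \<union> (\<Union>z\<in>{z \<in> D. s * Im z \<ge> 0}. closed_segment z (z + of_real (2 * s) * \<i>))" for s :: real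
 define L where "L = {z. Re z \<le> -2}"
 have Rc: "Re (centre j) \<ge> 0" "Im (centre j) = 0" for j by (simp_all add: centre_def)
 have far: "z \<in> D" if "!!j. \<bar>Im z - Im (centre j)\<bar> \<ge> 1 \<or> \<bar>Re z - Re (centre j)\<bar> \<ge> 1" for z
 proof -
  have "norm (z - centre j) \<ge> 1" for j
   using that[of j] abs_Im_le_cmod[of "z - centre j"] abs_Re_le_cmod[of "z - centre j"] by force
  then show ?thesis by (simp add: D_def)
 qed
 have LD: "L <= D"
 proof
  fix z assume "z \<in> L"
  then have "\<bar>Re z - Re (centre j)\<bar> \<ge> 1" for j using Rc(1)[of j] by (simp add: L_def)
  then show "z \<in> D" using far by blast
 qed
 have con: "connected (P s \<union> L) \<and> P s <= D" if s: "s = 1 \<or> s = -1" for s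
 proof
  have seg: "\<exists>u. Re w = Re z \<and> Im w = Im z + u * s \<and> 0 \<le> u \<and> u \<le> 2"
   if "w \<in> closed_segment z (z + of_real (2 * s) * \<i>)" for w z
  proof -
   from that[unfolded in_segment]
   obtain t where "0 \<le> t" "t \<le> 1" "w = (1 - t) *\<^sub>R z + t *\<^sub>R (z + of_real (2 * s) * \<i>)"
    by (elim exE conjE)
   moreover have "(1 - t) *\<^sub>R z + t *\<^sub>R (z + of_real (2 * s) * \<i>) = z + of_real (2 * t * s) * \<i>"
    by (simp add: scaleR_conv_of_real ring_distribs)
   ultimately show ?thesis by (intro exI[of _ "2 * t"]) simp
  qed
  show "P s <= D"
  proof
   fix w assume "w \<in> P s"
   then consider "s * Im w \<ge> 2" | z where "z \<in> D" "s * Im z \<ge> 0" "w \<in> closed_segment z (z + of_real (2 * s) * \<i>)"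
    unfolding P_def by blast
   then show "w \<in> D"
   proof cases
    case 1
    then have "\<bar>Im w\<bar> \<ge> 1" using s by auto
    then show ?thesis using far Rc by auto
   next
    case 2
    obtain u where u: "Re w = Re z" "Im w = Im z + u * s" "0 \<le> u" using seg[OF 2(3)] by blast
    have "\<bar>Im z\<bar> \<le> \<bar>Im w\<bar>" using u s 2(2) by auto
    then have "norm (z - centre j) \<le> norm (w - centre j)" for j
     unfolding cmod_def using u(1) Rc(2)[of j] by (intro real_sqrt_le_mono add_mono) (auto simp: abs_le_square_iff)
    then show ?thesis using 2(1) unfolding D_def by (auto intro: order_trans)
   qed
  qed
  have hs: "connected {z. s * Im z \<ge> 2}"
  proof -
   have "convex {z. s * Im z \<ge> 2}"
    using s
   proof
    assume "s = -1"
    then have "{z. s * Im z \<ge> 2} = {z. Im z \<le> -2}" by auto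
    then show ?thesis using convex_halfspace_Im_le[of "-2"] by simp
   qed (use convex_halfspace_Im_ge[of 2] in simp)
   then show ?thesis by (rule convex_connected)
  qed
  have "connected (P s)"
  proof -
   have "P s = \<Union>(insert {z. s * Im z \<ge> 2} ((\<lambda>z. {z. s * Im z \<ge> 2} \<union> closed_segment z (z + of_real (2 * s) * \<i>)) ` {z \<in> D. s * Im z \<ge> 0}))"
    unfolding P_def by blast
   moreover have "connected (\<Union>(insert {z. s * Im z \<ge> 2} ((\<lambda>z. {z. s * Im z \<ge> 2} \<union> closed_segment z (z + of_real (2 * s) * \<i>)) ` {z \<in> D. s * Im z \<ge> 0})))"
   proof (rule connected_Union)
    fix S assume "S \<in> insert {z. s * Im z \<ge> 2} ((\<lambda>z. {z. s * Im z \<ge> 2} \<union> closed_segment z (z + of_real (2 * s) * \<i>)) ` {z \<in> D. s * Im z \<ge> 0})"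
    then consider "S = {z. s * Im z \<ge> 2}" | z where "z \<in> D" "s * Im z \<ge> 0" "S = {z. s * Im z \<ge> 2} \<union> closed_segment z (z + of_real (2 * s) * \<i>)"
     by blast
    then show "connected S"
    proof cases
     case 2
     have "z + of_real (2 * s) * \<i> \<in> {z. s * Im z \<ge> 2}" using 2 s by auto
     moreover have "z + of_real (2 * s) * \<i> \<in> closed_segment z (z + of_real (2 * s) * \<i>)"
      by (rule ends_in_segment)
     ultimately have "{z. s * Im z \<ge> 2} \<inter> closed_segment z (z + of_real (2 * s) * \<i>) ~= {}" by blast
     then show ?thesis unfolding 2(3) by (rule connected_Un[OF hs connected_segment])
    qed (use hs in simp)
   next
    have "of_real (2 * s) * \<i> \<in> {z. s * Im z \<ge> 2}" using s by auto
    then show "\<Inter> (insert {z. s * Im z \<ge> 2} ((\<lambda>z. {z. s * Im z \<ge> 2} \<union> closed_segment z (z + of_real (2 * s) * \<i>)) ` {z \<in> D. s * Im z \<ge> 0})) ~= {}"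
     by blast
   qed
   ultimately show ?thesis by simp
  qed
  moreover have "connected L" unfolding L_def by (rule convex_connected[OF convex_halfspace_Re_le])
  moreover have "Complex (-2) (2 * s) \<in> P s \<inter> L" using s by (auto simp: P_def L_def)
  ultimately show "connected (P s \<union> L)" by (intro connected_Un) auto
 qed
 have "D <= (P 1 \<union> L) \<union> (P (-1) \<union> L)"
 proof
  fix z assume z: "z \<in> D"
  then have "z \<in> P (if Im z \<ge> 0 then 1 else -1)" unfolding P_def
   by (intro UnI2 UN_I[of z]) auto
  then show "z \<in> (P 1 \<union> L) \<union> (P (-1) \<union> L)" by (auto split: if_splits)
 qed
 then have "D = (P 1 \<union> L) \<union> (P (-1) \<union> L)" using con[of 1] con[of "-1"] LD by auto
 moreover have "Complex (-2) 0 \<in> L" by (simp add: L_def)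
 then have "(P 1 \<union> L) \<inter> (P (-1) \<union> L) ~= {}" by blast
 ultimately show ?thesis using con[of 1] con[of "-1"] connected_Un by metis
qed

lemma far_D: "norm z > 4 * real m + 2 ==> z \<in> D \<and> z \<notin> Bd"
proof -
 assume z: "norm z > 4 * real m + 2"
 have "norm (z - centre j) > 1" if "j < m" for j
 proof -
  have "norm (centre j) = 4 * real j" by (simp add: centre_def norm_mult)
  then have "norm (centre j) \<le> 4 * real m" using that by simp
  then show ?thesis using norm_triangle_ineq2[of z "centre j"] z by simp
 qed
 then show ?thesis unfolding D_def Bd_def by (force simp: dist_norm norm_minus_commute)
qed

lemma H_connected: "connected_space H"
proof -
 have "connectedin sphere2 (Some ` D)"
  by (rule connectedin_continuous_map_image[OF continuous_map_Some]) (simp add: connected_D)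
 then have 1: "connectedin H (Some ` D)" unfolding H_eq connectedin_subtopology by auto
 have "None \<in> H closure_of (Some ` D)"
  unfolding in_closure_of
 proof (intro conjI allI impI)
  show "None \<in> topspace H" by (simp add: topspace_H)
  fix T assume T: "None \<in> T \<and> openin H T"
  then obtain S where S: "openin sphere2 S" "T = S \<inter> insert None (Some ` D)"
   unfolding H_eq openin_subtopology by blast
  then obtain C where C: "compact C" "S = insert None (Some ` (- C))"
   using T unfolding openin_sphere2 by auto
  obtain M where M: "\<forall>x\<in>C. norm x \<le> M" using C(1) compact_imp_bounded bounded_iff by metis
  define z where "z = complex_of_real (max 0 M + 4 * real m + 3)"
  have "norm z = max 0 M + 4 * real m + 3" unfolding z_def norm_of_real by simp
  then have "norm z > M" "norm z > 4 * real m + 2" by auto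
  then have "z \<in> D" "z \<notin> C" using far_D M by force+
  then show "\<exists>y. y \<in> Some ` D \<and> y \<in> T" using S C by blast
 qed
 then have "insert None (Some ` D) <= H closure_of (Some ` D)"
  using closure_of_subset[of "Some ` D" H] by (simp add: topspace_H subset_insertI)
 then have "connectedin H (topspace H)"
  unfolding topspace_H by (rule connectedin_intermediate_closure_of[OF 1 subset_insertI])
 then show ?thesis by (simp add: connectedin_topspace)
qed

sublocale closed_surface X
proof
 have nH: "normal_space H" using H_Hausdorff H_compact by (simp add: compact_Hausdorff_or_regular_imp_normal_space)
 have surj: "q ` topspace H = topspace X" by (simp add: topspace_X)
 show "Hausdorff_space X"
  using normal_Hausdorff_space_closed_continuous_map_image[OF nH H_Hausdorff closed_map_q cont_q surj] by blast
 show "compact_space X"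
  using image_compactin[OF _ cont_q, of "topspace H"] H_compact surj by (simp add: compact_space_def)
 show "connected_space X"
  using connected_space_quotient_map_image[OF quotient_q H_connected] .
 fix x assume "x \<in> topspace X"
 then consider "x = q None" | z where "z \<in> D" "z \<notin> Bd" "x = q (Some z)" | z where "z \<in> Bd" "x = q (Some z)"
  unfolding topspace_X topspace_H by blast
 then show "\<exists>U V (\<kappa> :: complex option set => complex). openin X U \<and> x \<in> U \<and> open V \<and>
      homeomorphic_map (subtopology X U) (top_of_set V) \<kappa>"
 proof cases
  case 1 then show ?thesis using infinity_chart by simp
 next
  case 2 then show ?thesis using interior_chart by blast
 next
  case 3
  then obtain j where j: "j < m" "dist (centre j) z = 1" unfolding Bd_def by auto
  then have "norm (z - centre j) = 1" by (simp add: dist_norm norm_minus_commute)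
  then show ?thesis using boundary_chart[OF j(1), of "z - centre j"] 3 by simp
 qed
qed

section \<open>Passing between the surface and the plane domain\<close>

definition pull :: "(complex option set => complex) => complex => complex" where
 "pull f z = f (q (Some z))"

text \<open>The choice of \<open>z\<close> is immaterial if \<open>\<theta>\<close> respects the
  gluing, or off the boundary circles; see \<open>push_eq\<close>.\<close>

definition push :: "(complex => complex) => complex option set => complex" where
 "push \<theta> x = \<theta> (SOME z. z \<in> D \<and> x = q (Some z))"

definition sinv :: "(complex => complex) => bool" where
 "sinv \<theta> \<longleftrightarrow> (\<forall>j<m. \<forall>w. norm w = 1 --> \<theta> (centre j + w) = \<theta> (centre (\<pi> j) + \<rho> w))"

lemma pull_cont:
 assumes "contX X S f" "T <= D" "!!z. z \<in> T ==> q (Some z) \<in> S"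
 shows "continuous_on T (pull f)"
proof -
 have "continuous_map (top_of_set T) X (\<lambda>z. q (Some z))" by (rule cont_qSome) (use assms in auto)
 then have "continuous_map (top_of_set T) (subtopology X S) (\<lambda>z. q (Some z))"
  using assms(3) by (auto simp: continuous_map_in_subtopology)
 then have "continuous_map (top_of_set T) euclidean (f \<circ> (\<lambda>z. q (Some z)))"
  using assms(1) unfolding contX_def by (rule continuous_map_compose)
 then show ?thesis by (simp add: pull_def o_def cong: continuous_on_cong_simp)
qed

lemma pull_sinv: "sinv (pull f)"
 unfolding sinv_def pull_def
proof (intro allI impI)
 fix j w assume "j < m" "norm (w::complex) = 1"
 then have "rl (Some (centre j + w)) (Some (centre (\<pi> j) + \<rho> w))" unfolding rl_def by blast
 then show "f (q (Some (centre j + w))) = f (q (Some (centre (\<pi> j) + \<rho> w)))" using q_eq_iff by metis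
qed

lemma push_eq:
 assumes "z \<in> D" and "sinv \<theta> \<or> z \<notin> Bd" shows "push \<theta> (q (Some z)) = \<theta> z"
proof -
 define y where "y = (SOME y. y \<in> D \<and> q (Some z) = q (Some y))"
 have y: "y \<in> D \<and> q (Some z) = q (Some y)" unfolding y_def by (rule someI[of _ z]) (use assms in simp)
 then have "Some z = Some y \<or> rl (Some z) (Some y)" using q_eq_iff by metis
 then have "\<theta> y = \<theta> z"
 proof
  assume r: "rl (Some z) (Some y)"
  then have "z \<in> Bd" using rl_Bd[OF r] by auto
  then have s: "sinv \<theta>" using assms by blast
  show ?thesis using r s unfolding rl_def sinv_def by auto
 qed simp
 then show ?thesis unfolding push_def y_def .
qed

text \<open>Restricted to a saturated set with open image, the projection is still a quotient
  map.\<close>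

lemma push_cont:
 assumes T: "T <= D" and op: "openin X (q ` Some ` T)" and pre: "{x \<in> topspace H. q x \<in> q ` Some ` T} = Some ` T"
  and c: "continuous_on T \<theta>" and i: "sinv \<theta> \<or> T \<inter> Bd = {}"
 shows "contX X (q ` Some ` T) (push \<theta>)"
proof -
 have qm: "quotient_map (subtopology H (Some ` T)) (subtopology X (q ` Some ` T)) q"
  using quotient_map_restriction[OF quotient_q pre] op by blast
 have hm: "homeomorphic_map euclidean (subtopology sphere2 (Some ` UNIV)) Some"
  using embedding_map_Some[of euclidean] unfolding embedding_map_def by simp
 then obtain s where s: "homeomorphic_maps euclidean (subtopology sphere2 (Some ` UNIV)) Some s"
  using homeomorphic_map_maps by blast
 have "continuous_map (subtopology sphere2 (Some ` T)) euclidean s"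
  using s unfolding homeomorphic_maps_def by (blast intro: continuous_map_from_subtopology_mono)
 moreover have sS: "s (Some z) = z" for z using s unfolding homeomorphic_maps_def by simp
 ultimately have "continuous_map (subtopology sphere2 (Some ` T)) (top_of_set T) s"
  by (auto simp: continuous_map_in_subtopology)
 moreover have "continuous_map (top_of_set T) euclidean \<theta>" using c by simp
 ultimately have "continuous_map (subtopology sphere2 (Some ` T)) euclidean (\<theta> \<circ> s)" by (rule continuous_map_compose)
 moreover have "subtopology H (Some ` T) = subtopology sphere2 (Some ` T)"
  unfolding H_eq subtopology_subtopology using T by (intro arg_cong[where f = "subtopology sphere2"]) auto
 ultimately have "continuous_map (subtopology H (Some ` T)) euclidean (\<theta> \<circ> s)" by simp
 then have "continuous_map (subtopology H (Some ` T)) euclidean (push \<theta> \<circ> q)"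
 proof (rule continuous_map_eq)
  fix x assume "x \<in> topspace (subtopology H (Some ` T))"
  then obtain z where z: "z \<in> T" "x = Some z" by auto
  then show "(\<theta> \<circ> s) x = (push \<theta> \<circ> q) x" using push_eq[of z \<theta>] T i sS by (metis comp_apply disjoint_iff subsetD)
 qed
 then show ?thesis unfolding contX_def using continuous_compose_quotient_map[OF qm] by blast
qed

abbreviation p0 :: "complex option set" where "p0 \<equiv> q None"

lemma no_rl_None: "\<not> rl None y" "\<not> rl y None"
 unfolding rl_def by auto

lemma X_minus_p0: "topspace X - {p0} = q ` Some ` D"
proof -
 have "q (Some z) ~= q None" for z using q_eq_iff no_rl_None by blast
 then show ?thesis unfolding topspace_X topspace_H by auto
qed

lemma p0_X: "p0 \<in> topspace X" by (simp add: topspace_X topspace_H)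

lemma push_cont_D:
 assumes "continuous_on D \<theta>" "sinv \<theta>"
 shows "contX X (topspace X - {p0}) (push \<theta>)"
 unfolding X_minus_p0
proof (rule push_cont[OF order_refl _ _ assms(1)])
 show "openin X (q ` Some ` D)" unfolding X_minus_p0[symmetric] by (rule openin_codiff) simp
 show "{x \<in> topspace H. q x \<in> q ` Some ` D} = Some ` D"
 proof (intro equalityI subsetI)
  fix x assume x: "x \<in> {x \<in> topspace H. q x \<in> q ` Some ` D}"
  have "x ~= None"
  proof
   assume "x = None"
   then have "p0 \<in> topspace X - {p0}" using x unfolding X_minus_p0 by simp
   then show False by blast
  qed
  then show "x \<in> Some ` D" using x by (auto simp: topspace_H)
 qed (auto simp: topspace_H)
qed (use assms in blast)

text \<open>On the disc bounded by circle \<open>j\<close> the factors of the other centres have no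
  zeros and hence logarithms, so only the factor of \<open>j\<close> winds along the circle.\<close>

lemma circle_form:
 assumes \<theta>: "continuous_on D \<theta>" and F: "\<forall>z\<in>D. F z = (\<Prod>j<m. (z - centre j) powi d j) * exp (\<theta> z)" and j: "j < m"
 obtains \<eta> where "continuous_on (sphere 0 1) \<eta>" "!!w. w \<in> sphere 0 1 ==> F (centre j + w) = w powi d j * exp (\<eta> w)"
proof -
 have inD: "centre j + w \<in> D" if "w \<in> sphere 0 1" for w
 proof -
  have "centre j + w \<in> Bd" using that j unfolding Bd_def by (intro UN_I[of j]) (auto simp: dist_norm)
  then show ?thesis using Bd_D by blast
 qed
 have "\<exists>l. continuous_on (cball 0 1) l \<and> (\<forall>w\<in>cball 0 1. centre j + w - centre i = exp (l w))" if "i ~= j" for i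
 proof -
  have "centre j + w - centre i ~= 0" if "w \<in> cball 0 1" for w
  proof
   assume "centre j + w - centre i = 0"
   then have "centre j + w = centre i + 0" by simp
   then show False using circle_unique(1)[of j w i 0] that \<open>i ~= j\<close> by auto
  qed
  moreover have "continuous_on (cball 0 1) (\<lambda>w. centre j + w - centre i)" by (intro continuous_intros)
  ultimately obtain l where "continuous_on (cball 0 1) l" "!!w. w \<in> cball 0 1 ==> centre j + w - centre i = exp (l w)"
   using continuous_logarithm_on_cball[of 0 1 "\<lambda>w. centre j + w - centre i"] by blast
  then show ?thesis by blast
 qed
 then obtain l where l: "!!i. i ~= j ==> continuous_on (cball 0 1) (l i)"
   "!!i w. i ~= j ==> w \<in> cball 0 1 ==> centre j + w - centre i = exp (l i w)" by metis
 define \<eta> where "\<eta> w = \<theta> (centre j + w) + (\<Sum>i\<in>{..<m} - {j}. of_int (d i) * l i w)" for w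
 show ?thesis
 proof
  have sub: "sphere 0 1 <= cball (0::complex) 1" by auto
  show "continuous_on (sphere 0 1) \<eta>" unfolding \<eta>_def
   by (intro continuous_intros continuous_on_compose2[OF \<theta>] continuous_on_subset[OF l(1) sub])
    (use inD in \<open>auto intro!: continuous_intros\<close>)
  fix w :: complex assume w: "w \<in> sphere 0 1"
  have "F (centre j + w) = (\<Prod>i<m. (centre j + w - centre i) powi d i) * exp (\<theta> (centre j + w))" using F inD[OF w] by auto
  also have "(\<Prod>i<m. (centre j + w - centre i) powi d i) = w powi d j * (\<Prod>i\<in>{..<m} - {j}. (centre j + w - centre i) powi d i)"
   using j by (subst prod.remove[of _ j]) auto
  also have "(\<Prod>i\<in>{..<m} - {j}. (centre j + w - centre i) powi d i) = (\<Prod>i\<in>{..<m} - {j}. exp (of_int (d i) * l i w))"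
   by (rule prod.cong) (use l(2)[of _ w] w in \<open>auto simp: exp_power_int\<close>)
  also have "\<dots> = exp (\<Sum>i\<in>{..<m} - {j}. of_int (d i) * l i w)" by (simp add: exp_sum)
  finally show "F (centre j + w) = w powi d j * exp (\<eta> w)" by (simp add: \<eta>_def exp_add)
 qed
qed

lemma factor:
 assumes "cmap X (topspace X - {p0}) f"
 obtains d \<theta> where "continuous_on D \<theta>" "\<forall>z\<in>D. pull f z = (\<Prod>j<m. (z - centre j) powi d j) * exp (\<theta> z)"
proof -
 have "continuous_on D (pull f)" by (rule pull_cont[of "topspace X - {p0}"]) (use assms in \<open>auto simp: X_minus_p0 cmap_def\<close>)
 moreover have "pull f z ~= 0" if "z \<in> D" for z
  using assms that unfolding cmap_def X_minus_p0 pull_def by blast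
 ultimately show ?thesis using planar_factor[of m "pull f"] that unfolding D_eq[symmetric] by blast
qed

text \<open>Near infinity \<open>z - centre j\<close> is \<open>z\<close> times
  \<open>1 - centre j / z\<close>, and the latter has a logarithm. So \<open>f\<close> winds around
  \<open>p0\<close> like the power \<open>s\<close> of the coordinate, where \<open>s\<close> is the
  sum of all \<open>d j\<close>, and \<open>e\<close> is a multiple of \<open>s\<close>.\<close>

lemma even_degree:
 assumes sum_even: "!!F d \<theta>. continuous_on D \<theta> ==> sinv F ==>
   \<forall>z\<in>D. F z = (\<Prod>j<m. (z - centre j) powi d j) * exp (\<theta> z) ==> even (\<Sum>j<m. d j)"
  and f: "cmap X (topspace X - {p0}) f" and h: "gen X p0 h" and e: "geq X p0 f (\<lambda>x. h x powi e)"
 shows "even e"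
proof -
 obtain d \<theta> where d: "continuous_on D \<theta>" "\<forall>z\<in>D. pull f z = (\<Prod>j<m. (z - centre j) powi d j) * exp (\<theta> z)"
  by (rule factor[OF f])
 define s where "s = (\<Sum>j<m. d j)"
 have s: "even s" unfolding s_def by (rule sum_even[OF d(1) pull_sinv d(2)])
 define R where "R = 4 * real m + 2"
 have R: "R > 0" by (simp add: R_def)
 define T where "T = {z::complex. norm z > R}"
 have T: "T <= D" "T \<inter> Bd = {}" using far_D by (auto simp: T_def R_def)
 define V where "V = topspace X - q ` Some ` (D \<inter> cball 0 R)"
 have "closedin sphere2 (Some ` (D \<inter> cball 0 R))" using closed_D by (simp add: compact_imp_closed closed_Int_compact)
 then have "closedin H (Some ` (D \<inter> cball 0 R))" unfolding H_eq by (rule closedin_subset_topspace) auto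
 then have "closedin X (q ` Some ` (D \<inter> cball 0 R))" using closed_map_q unfolding closed_map_def by blast
 then have opV: "openin X V" unfolding V_def by blast
 have qne: "q (Some z) ~= p0" for z using q_eq_iff no_rl_None by blast
 have p0V: "p0 \<in> V" using p0_X qne unfolding V_def by force
 have qinj: "x = Some z" if "q x = q (Some z)" "z \<in> T" for x z
  using that q_eq_iff[of x "Some z"] rl_Bd[of x "Some z"] T by auto
 have VT: "V - {p0} = q ` Some ` T"
 proof -
  have "V - {p0} = q ` Some ` D - q ` Some ` (D \<inter> cball 0 R)" unfolding V_def X_minus_p0[symmetric] by blast
  also have "\<dots> = q ` Some ` T"
  proof (intro equalityI subsetI)
   fix x assume "x \<in> q ` Some ` D - q ` Some ` (D \<inter> cball 0 R)"
   then obtain z where z: "z \<in> D" "x = q (Some z)" "x \<notin> q ` Some ` (D \<inter> cball 0 R)" by blast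
   then have "z \<notin> cball 0 R" by blast
   then have "z \<in> T" by (simp add: T_def)
   then show "x \<in> q ` Some ` T" using z by blast
  next
   fix x assume "x \<in> q ` Some ` T"
   then obtain z where z: "z \<in> T" "x = q (Some z)" by blast
   have "x \<notin> q ` Some ` (D \<inter> cball 0 R)"
   proof
    assume "x \<in> q ` Some ` (D \<inter> cball 0 R)"
    then obtain y where y: "y \<in> cball 0 R" "q (Some y) = q (Some z)" using z by auto
    then have "y = z" using qinj z by blast
    then show False using y z by (simp add: T_def)
   qed
   then show "x \<in> q ` Some ` D - q ` Some ` (D \<inter> cball 0 R)" using z T by blast
  qed
  finally show ?thesis .
 qed
 have opT: "openin X (q ` Some ` T)" unfolding VT[symmetric] by (rule openin_diff_finite[OF _ opV]) simp
 have preT: "{x \<in> topspace H. q x \<in> q ` Some ` T} = Some ` T"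
  using qinj T by (auto simp: topspace_H)
 \<comment> \<open>The coordinate times a factor that is positive beyond radius \<open>R\<close> and
   therefore does not wind; \<open>\<xi>\<close> below compensates for it by its real
   logarithm.\<close>
 define u where "u z = of_real (max 0 (norm z - R)) * z" for z :: complex
 have uc: "continuous_on UNIV u" unfolding u_def by (intro continuous_intros)
 have upush: "push u (q (Some z)) = of_real (norm z - R) * z" if "z \<in> T" for z
  using push_eq[of z u] that T by (auto simp: u_def T_def)
 have ucm: "cmap X (V - {p0}) (push u)"
  unfolding VT cmap_def
 proof
  show "contX X (q ` Some ` T) (push u)"
   by (rule push_cont[OF T(1) opT preT continuous_on_subset[OF uc]]) (use T in auto)
  show "\<forall>x\<in>q ` Some ` T. push u x ~= 0"
  proof
   fix x assume "x \<in> q ` Some ` T"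
   then obtain z where z: "z \<in> T" "x = q (Some z)" by blast
   then have "norm z > R" by (simp add: T_def)
   then have "z ~= 0" "norm z - R ~= 0" using R by auto
   then show "push u x ~= 0" using upush[OF z(1)] z(2) by (simp flip: of_real_diff)
  qed
 qed
 obtain a :: int where a: "geq X p0 (push u) (\<lambda>x. h x powi a)"
  using gen_exists[OF h gcmapI[OF opV p0V ucm]] by blast
 define \<xi> where "\<xi> z = \<theta> z + (\<Sum>j<m. of_int (d j) * (Ln (1 - centre j / z) - of_real (ln (norm z - R))))" for z
 have nz: "1 - centre j / z \<notin> \<real>\<^sub>\<le>\<^sub>0" if "z \<in> T" "j < m" for z j
 proof -
  have zR: "norm z > R" "norm z > 0" using that R by (auto simp: T_def)
  have "norm (centre j) = 4 * real j" by (simp add: centre_def norm_mult)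
  then have "norm (centre j) < norm z" using that zR by (simp add: R_def)
  then have "norm (centre j / z) < 1" using zR by (simp add: norm_divide)
  then have "0 < Re (1 - centre j / z)" using complex_Re_le_cmod[of "centre j / z"] by simp
  then show ?thesis by (auto simp: complex_nonpos_Reals_iff)
 qed
 have xic: "continuous_on T \<xi>" unfolding \<xi>_def
  by (intro continuous_intros continuous_on_subset[OF d(1) T(1)]) (use nz R in \<open>auto simp: T_def\<close>)
 have pf: "f (q (Some z)) = push u (q (Some z)) powi s * exp (push \<xi> (q (Some z)))" if z: "z \<in> T" for z
 proof -
  have zR: "norm z > R" using z by (simp add: T_def)
  then have z0: "z ~= 0" using R by auto
  define t where "t = norm z - R"
  have t: "t > 0" using zR by (simp add: t_def)
  have each: "z - centre j = (of_real t * z) * exp (Ln (1 - centre j / z) - of_real (ln t))" if "j < m" for j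
  proof -
   have "1 - centre j / z ~= 0" using nz[OF z that] by auto
   then have "exp (Ln (1 - centre j / z) - of_real (ln t)) = (1 - centre j / z) / of_real t"
    using t by (simp add: exp_diff exp_of_real)
   then show ?thesis using t z0 by (simp add: field_simps)
  qed
  have "f (q (Some z)) = (\<Prod>j<m. (z - centre j) powi d j) * exp (\<theta> z)"
   using d(2) z T unfolding pull_def by blast
  also have "(\<Prod>j<m. (z - centre j) powi d j) = (\<Prod>j<m. (of_real t * z) powi d j * exp (of_int (d j) * (Ln (1 - centre j / z) - of_real (ln t))))"
  proof (rule prod.cong)
   fix j assume "j \<in> {..<m}"
   then have "(z - centre j) powi d j = ((of_real t * z) * exp (Ln (1 - centre j / z) - of_real (ln t))) powi d j" using each by simp
   also have "\<dots> = (of_real t * z) powi d j * exp (of_int (d j) * (Ln (1 - centre j / z) - of_real (ln t)))"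
    by (simp only: power_int_mult_distrib exp_power_int)
   finally show "(z - centre j) powi d j = \<dots>" .
  qed simp
  also have "\<dots> = (\<Prod>j<m. (of_real t * z) powi d j) * exp (\<Sum>j<m. of_int (d j) * (Ln (1 - centre j / z) - of_real (ln t)))"
   by (simp only: prod.distrib exp_sum[OF finite_lessThan])
  also have "(\<Prod>j<m. (of_real t * z) powi d j) = (of_real t * z) powi s"
  proof -
   have nz: "of_real t * z ~= 0" using t z0 by simp
   have "(\<Prod>j<k. y powi d j) = y powi (\<Sum>j<k. d j)" if "y ~= 0" for k and y :: complex
    using that by (induction k) (simp_all add: power_int_add)
   then show ?thesis using nz unfolding s_def by blast
  qed
  finally have "f (q (Some z)) = (of_real t * z) powi s * exp (\<xi> z)"
   by (simp add: \<xi>_def t_def exp_add)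
  moreover have "push \<xi> (q (Some z)) = \<xi> z" using push_eq[of z \<xi>] z T by blast
  ultimately show ?thesis using upush[OF z] by (simp add: t_def)
 qed
 have "geq X p0 f (\<lambda>x. push u x powi s)"
  unfolding geq_def
 proof (intro exI conjI)
  show "openin X V" "p0 \<in> V" by fact+
  show "contX X (V - {p0}) (push \<xi>)" unfolding VT
   by (rule push_cont[OF T(1) opT preT xic]) (use T in auto)
  show "\<forall>x\<in>V - {p0}. f x = push u x powi s * exp (push \<xi> x)" unfolding VT using pf by blast
 qed
 then have "geq X p0 f (\<lambda>x. (h x powi a) powi s)" by (rule geq_trans[OF _ geq_powi[OF a]])
 from geq_trans[OF geq_sym[OF e] this]
 have "geq X p0 (\<lambda>x. h x powi e) (\<lambda>x. h x powi (a * s))"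
  by (simp add: power_int_mult)
 then have "e = a * s" by (rule gen_powi_unique[OF h])
 then show ?thesis using s by simp
qed

text \<open>Once the degrees on all circles cancel, the product is \<open>exp\<close> of a function
  on \<open>D\<close>. If that function respects the gluing, it descends to the surface without
  \<open>p0\<close>, and \<open>log_extends\<close> fills in \<open>p0\<close>. It remains to find
  equations on the exponents that ensure both, which is the assumption \<open>inv\<close>.\<close>

lemma rank_bound:
 assumes inv: "!!T d \<theta>. finite T ==> (!!e::nat set. e \<in> T ==> continuous_on D (\<theta> e) \<and>
    sinv (\<lambda>z. (\<Prod>j<m. (z - centre j) powi d e j) * exp (\<theta> e z))) ==>
   \<exists>\<Lambda>::nat => nat set => int. \<forall>w. (\<forall>j<r. (\<Sum>e\<in>T. \<Lambda> j e * w e) = 0) -->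
    (\<forall>j<m. (\<Sum>e\<in>T. d e j * w e) = 0) \<and>
    (sinv (\<lambda>z. exp (\<Sum>e\<in>T. of_int (w e) * \<theta> e z)) --> sinv (\<lambda>z. \<Sum>e\<in>T. of_int (w e) * \<theta> e z))"
  and T: "finite T" and f: "!!e::nat set. e \<in> T ==> cmap X (topspace X) (f e)"
 shows "\<exists>\<Lambda>::nat => nat set => int. \<forall>w. (\<forall>j<r. (\<Sum>e\<in>T. \<Lambda> j e * w e) = 0) -->
     haslog X (topspace X) (\<lambda>x. \<Prod>e\<in>T. f e x powi w e)"
proof -
 have f': "cmap X (topspace X - {p0}) (f e)" if "e \<in> T" for e by (rule cmap_subset[OF f[OF that]]) auto
 have "\<exists>d \<theta>. continuous_on D \<theta> \<and> (\<forall>z\<in>D. pull (f e) z = (\<Prod>j<m. (z - centre j) powi d j) * exp (\<theta> z))" if "e \<in> T" for e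
  by (rule factor[OF f'[OF that]]) blast
 then have "\<forall>e\<in>T. \<exists>p. continuous_on D (snd p) \<and> (\<forall>z\<in>D. pull (f e) z = (\<Prod>j<m. (z - centre j) powi fst p j) * exp (snd p z))"
  by simp
 then obtain p where p: "\<forall>e\<in>T. continuous_on D (snd (p e)) \<and> (\<forall>z\<in>D. pull (f e) z = (\<Prod>j<m. (z - centre j) powi fst (p e) j) * exp (snd (p e) z))"
  by (rule bchoice[THEN exE])
 define d \<theta> where "d e = fst (p e)" and "\<theta> e = snd (p e)" for e
 have d: "continuous_on D (\<theta> e)" "!!z. z \<in> D ==> pull (f e) z = (\<Prod>j<m. (z - centre j) powi d e j) * exp (\<theta> e z)"
  if "e \<in> T" for e using p that unfolding d_def \<theta>_def by blast+
 have BdD: "centre j + w \<in> D" "centre (\<pi> j) + \<rho> w \<in> D" if "j < m" "norm w = 1" for j w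
 proof -
  have "centre j + w \<in> Bd" using that unfolding Bd_def by (intro UN_I[of j]) (auto simp: dist_norm)
  moreover have "centre (\<pi> j) + \<rho> w \<in> Bd"
   using that pi(1)[OF that(1)] unfolding Bd_def by (intro UN_I[of "\<pi> j"]) (auto simp: dist_norm rho(2))
  ultimately show "centre j + w \<in> D" "centre (\<pi> j) + \<rho> w \<in> D" using Bd_D by auto
 qed
 have sv: "sinv (\<lambda>z. (\<Prod>j<m. (z - centre j) powi d e j) * exp (\<theta> e z))" if e: "e \<in> T" for e
  using pull_sinv[of "f e"] d(2)[OF e] BdD unfolding sinv_def by metis
 obtain \<Lambda> :: "nat => nat set => int" where \<Lambda>: "!!w. (\<forall>j<r. (\<Sum>e\<in>T. \<Lambda> j e * w e) = 0) ==>
    (\<forall>j<m. (\<Sum>e\<in>T. d e j * w e) = 0) \<and>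
    (sinv (\<lambda>z. exp (\<Sum>e\<in>T. of_int (w e) * \<theta> e z)) --> sinv (\<lambda>z. \<Sum>e\<in>T. of_int (w e) * \<theta> e z))"
  using inv[OF T, of \<theta> d] d(1) sv by blast
 have "haslog X (topspace X) (\<lambda>x. \<Prod>e\<in>T. f e x powi w e)" if w: "\<forall>j<r. (\<Sum>e\<in>T. \<Lambda> j e * w e) = 0" for w
 proof -
  note L = \<Lambda>[OF w]
  define \<Theta> where "\<Theta> z = (\<Sum>e\<in>T. of_int (w e) * \<theta> e z)" for z
  define F where "F x = (\<Prod>e\<in>T. f e x powi w e)" for x
  have Fz: "pull F z = exp (\<Theta> z)" if z: "z \<in> D" for z
  proof -
   have nz: "z - centre j ~= 0" if "j < m" for j using z that unfolding D_def by force
   have "pull F z = (\<Prod>e\<in>T. ((\<Prod>j<m. (z - centre j) powi d e j) * exp (\<theta> e z)) powi w e)"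
    unfolding F_def pull_def by (rule prod.cong) (use d(2)[OF _ z] in \<open>auto simp: pull_def\<close>)
   also have "\<dots> = (\<Prod>e\<in>T. (\<Prod>j<m. (z - centre j) powi (d e j * w e)) * exp (of_int (w e) * \<theta> e z))"
   proof (rule prod.cong)
    fix e
    have "(\<Prod>j<k. x j) powi n = (\<Prod>j<k. x j powi n)" for x :: "nat => complex" and n :: int and k
     by (induction k) (simp_all add: power_int_mult_distrib)
    then show "((\<Prod>j<m. (z - centre j) powi d e j) * exp (\<theta> e z)) powi w e =
      (\<Prod>j<m. (z - centre j) powi (d e j * w e)) * exp (of_int (w e) * \<theta> e z)"
     by (simp add: power_int_mult_distrib exp_power_int power_int_mult)
   qed simp
   also have "\<dots> = (\<Prod>j<m. \<Prod>e\<in>T. (z - centre j) powi (d e j * w e)) * exp (\<Theta> z)"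
    unfolding \<Theta>_def prod.distrib exp_sum[OF T] by (subst prod.swap) simp
   also have "(\<Prod>j<m. \<Prod>e\<in>T. (z - centre j) powi (d e j * w e)) = (\<Prod>j<m. 1)"
   proof (rule prod.cong)
    fix j assume "j \<in> {..<m}"
    then have j: "j < m" by simp
    have "(\<Prod>e\<in>S. y powi (d e j * w e)) = y powi (\<Sum>e\<in>S. d e j * w e)" if "finite S" "y ~= 0" for S and y :: complex
     using that by (induction S rule: finite_induct) (simp_all add: power_int_add)
    from this[OF T nz[OF j]] show "(\<Prod>e\<in>T. (z - centre j) powi (d e j * w e)) = 1" using L j by simp
   qed simp
   finally show ?thesis by simp
  qed
  have "sinv (\<lambda>z. exp (\<Theta> z))" using pull_sinv[of F] Fz BdD unfolding sinv_def by metis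
  then have s: "sinv \<Theta>" using L unfolding \<Theta>_def by blast
  have c: "continuous_on D \<Theta>" unfolding \<Theta>_def by (intro continuous_intros d)
  have "haslog X (topspace X - {p0}) F"
   unfolding haslog_def
  proof (intro exI conjI ballI)
   show "contX X (topspace X - {p0}) (push \<Theta>)" by (rule push_cont_D[OF c s])
   fix x assume "x \<in> topspace X - {p0}"
   then obtain z where z: "z \<in> D" "x = q (Some z)" unfolding X_minus_p0 by blast
   then show "F x = exp (push \<Theta> x)" using Fz[OF z(1)] push_eq[OF z(1)] s by (simp add: pull_def)
  qed
  moreover have "cmap X (topspace X) F" unfolding F_def by (intro cmap_prod cmap_powi f)
  ultimately show ?thesis using log_extends[OF openin_topspace p0_X] unfolding F_def by blast
 qed
 then show ?thesis by blast
qed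

end

lemma connected_circle: "connected (sphere (0::complex) 1)"
 by (rule connected_sphere) simp

context gluing
begin

text \<open>\<open>rl\<close> is symmetric and gives each point at most one partner, so the
  equivalence closure adds only the diagonal.\<close>

lemma glue_eq:
 assumes "!!x y. R x y ==> rl x y" "!!x y. rl x y ==> R x y \<or> R y x"
 shows "glue (holed_sphere m) R = X"
proof -
 have "equivclp R x y \<longleftrightarrow> y = x \<or> rl x y" for x y
 proof
  assume "equivclp R x y"
  then show "y = x \<or> rl x y"
  proof (induction rule: equivclp_induct)
   case (step y z)
   then have "rl y z" using assms(1) rl_sym by blast
   then show ?case using step.IH rl_fun[of y z x] rl_sym by blast
  qed simp
 next
  assume "y = x \<or> rl x y"
  then show "equivclp R x y" using assms(2)[of x y] equivclp_sym r_into_equivclp by auto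
 qed
 then have "(\<lambda>x. {y. equivclp R x y}) = q" unfolding q_def by auto
 then show ?thesis unfolding glue_def X_def H_def by simp
qed

lemma Bd_in_D:
 assumes "j < m" "norm w = 1" shows "centre j + w \<in> D" "centre (\<pi> j) + \<rho> w \<in> D"
proof -
 have "centre j + w \<in> Bd" using assms unfolding Bd_def by (intro UN_I[of j]) (auto simp: dist_norm)
 moreover have "centre (\<pi> j) + \<rho> w \<in> Bd"
  using assms pi(1)[OF assms(1)] unfolding Bd_def by (intro UN_I[of "\<pi> j"]) (auto simp: dist_norm rho(2))
 ultimately show "centre j + w \<in> D" "centre (\<pi> j) + \<rho> w \<in> D" using Bd_D by auto
qed

text \<open>Only the exponential is known to respect the gluing; on the connected circle the two
  sides of its logarithm then differ by one period.\<close>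

lemma jump:
 assumes c: "continuous_on D \<theta>" and s: "sinv (\<lambda>z. exp (\<theta> z))" and j: "j < m"
 obtains k :: int where
  "!!w. norm w = 1 ==> \<theta> (centre j + w) - \<theta> (centre (\<pi> j) + \<rho> w) = 2 * of_int k * of_real pi * \<i>"
proof -
 have "continuous_on (sphere 0 1) (\<lambda>w. \<theta> (centre j + w) - \<theta> (centre (\<pi> j) + \<rho> w))"
  by (intro continuous_intros continuous_on_compose2[OF c] continuous_on_compose2[OF rho(3)])
   (use Bd_in_D[OF j] in auto)
 moreover have "exp (\<theta> (centre j + w) - \<theta> (centre (\<pi> j) + \<rho> w)) = 1" if "w \<in> sphere 0 1" for w
 proof -
  have "norm w = 1" using that by simp
  then have "exp (\<theta> (centre j + w)) = exp (\<theta> (centre (\<pi> j) + \<rho> w))" using s j unfolding sinv_def by blast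
  then show ?thesis by (simp add: exp_diff)
 qed
 ultimately obtain k :: int where "!!w. w \<in> sphere 0 1 ==> \<theta> (centre j + w) - \<theta> (centre (\<pi> j) + \<rho> w) = 2 * of_int k * of_real pi * \<i>"
  using exp_one_const_on[OF connected_circle] by blast
 then show ?thesis using that by simp
qed

end

section \<open>Parity and rank for handles and crosscaps\<close>

definition other :: "nat => nat" where "other j = (if even j then j + 1 else j - 1)"

lemma other_simps [simp]: "other (2 * i) = 2 * i + 1" "other (Suc (2 * i)) = 2 * i"
 by (simp_all add: other_def)

interpretation hand: gluing "2 * h" other "\<lambda>w. - cnj w" for h
proof
 fix j assume j: "j < 2 * h"
 then show "other j < 2 * h" "other (other j) = j"
  by (auto simp: other_def elim!: evenE oddE)
 fix w show "other j = j ==> - cnj w = - w" by (auto simp: other_def split: if_splits elim!: oddE)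
qed (auto intro!: continuous_intros)

interpretation crossc: gluing k "\<lambda>j. j" uminus for k
 by unfold_locales (auto intro!: continuous_intros)

lemma sphere_with_handles_eq: "sphere_with_handles h = hand.X h"
 unfolding sphere_with_handles_def
proof (rule hand.glue_eq)
 fix x y
 show "\<exists>i<h. \<exists>w. norm w = 1 \<and> x = Some (centre (2 * i) + w) \<and> y = Some (centre (2 * i + 1) - cnj w) ==> hand.rl h x y"
  unfolding hand.rl_def by (metis diff_conv_add_uminus other_simps(1) mult_less_cancel1 pos2)
 assume "hand.rl h x y"
 then obtain j w where j: "j < 2 * h" "norm w = 1" "x = Some (centre j + w)" "y = Some (centre (other j) + - cnj w)"
  unfolding hand.rl_def by blast
 show "(\<exists>i<h. \<exists>w. norm w = 1 \<and> x = Some (centre (2 * i) + w) \<and> y = Some (centre (2 * i + 1) - cnj w)) \<or>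
   (\<exists>i<h. \<exists>w. norm w = 1 \<and> y = Some (centre (2 * i) + w) \<and> x = Some (centre (2 * i + 1) - cnj w))"
 proof (cases "even j")
  case True
  then obtain i where "j = 2 * i" by blast
  then show ?thesis using j by (intro disjI1 exI[of _ i] conjI exI[of _ w]) auto
 next
  case False
  then obtain i where "j = Suc (2 * i)" using oddE by fastforce
  then show ?thesis using j by (intro disjI2 exI[of _ i] conjI exI[of _ "- cnj w"]) auto
 qed
qed

lemma sphere_with_crosscaps_eq: "sphere_with_crosscaps k = crossc.X k"
 unfolding sphere_with_crosscaps_def
 by (rule crossc.glue_eq) (auto simp: crossc.rl_def)

text \<open>On the unit circle \<open>- cnj w\<close> is \<open>- 1 / w\<close>: the gluing map
  reverses the direction of winding.\<close>

lemma handle_degrees: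
 assumes "continuous_on (hand.D h) \<theta>" "hand.sinv h F"
  and F: "\<forall>z\<in>hand.D h. F z = (\<Prod>j<2 * h. (z - centre j) powi d j) * exp (\<theta> z)" and i: "i < h"
 shows "d (2 * i) + d (2 * i + 1) = 0"
proof -
 have i1: "2 * i < 2 * h" "2 * i + 1 < 2 * h" using i by auto
 obtain \<eta> where \<eta>: "continuous_on (sphere 0 1) \<eta>" "!!w. w \<in> sphere 0 1 ==> F (centre (2 * i) + w) = w powi d (2 * i) * exp (\<eta> w)"
  by (rule hand.circle_form[OF assms(1) F i1(1)]) blast
 obtain \<eta>' where \<eta>': "continuous_on (sphere 0 1) \<eta>'" "!!w. w \<in> sphere 0 1 ==> F (centre (2 * i + 1) + w) = w powi d (2 * i + 1) * exp (\<eta>' w)"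
  by (rule hand.circle_form[OF assms(1) F i1(2)]) blast
 define e where "e = d (2 * i + 1)"
 define \<xi> where "\<xi> w = of_int e * (\<i> * of_real pi) + \<eta>' (- cnj w) - \<eta> w" for w
 show ?thesis
 proof (rule circle_power_no_log[of 1 \<xi>])
  show "continuous_on (sphere 0 1) \<xi>" unfolding \<xi>_def
   by (intro continuous_intros \<eta>(1) continuous_on_compose2[OF \<eta>'(1)]) auto
  fix w :: complex assume w: "w \<in> sphere 0 1"
  then have n: "norm w = 1" "w ~= 0" by auto
  have "F (centre (2 * i) + w) = F (centre (other (2 * i)) + - cnj w)"
   using assms(2) i1(1) n unfolding hand.sinv_def by blast
  then have eq: "w powi d (2 * i) * exp (\<eta> w) = (- cnj w) powi e * exp (\<eta>' (- cnj w))"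
   using \<eta>(2)[OF w] \<eta>'(2)[of "- cnj w"] w by (simp add: e_def)
  have "w * cnj w = 1" using n(1) by (simp add: complex_norm_square[symmetric])
  then have "cnj w = inverse w" by (metis inverse_unique)
  then have "- cnj w = exp (\<i> * of_real pi) * w powi (-1)" by (simp add: power_int_minus)
  then have "(- cnj w) powi e = exp (of_int e * (\<i> * of_real pi)) * w powi (- e)"
   by (simp only: power_int_mult_distrib exp_power_int power_int_mult[symmetric]) simp
  with eq have "w powi d (2 * i) * exp (\<eta> w) = exp (of_int e * (\<i> * of_real pi)) * w powi (- e) * exp (\<eta>' (- cnj w))" by simp
  then have "w powi d (2 * i) * w powi e * exp (\<eta> w) = exp (of_int e * (\<i> * of_real pi)) * (w powi (- e) * w powi e) * exp (\<eta>' (- cnj w))"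
   by (simp add: mult_ac)
  then have "w powi (d (2 * i) + e) * exp (\<eta> w) = exp (of_int e * (\<i> * of_real pi)) * exp (\<eta>' (- cnj w))"
   using n(2) by (simp add: power_int_add[symmetric])
  then show "w powi (d (2 * i) + d (2 * i + 1)) = exp (\<xi> w)"
   by (simp add: \<xi>_def e_def exp_diff exp_add field_simps)
 qed simp
qed

text \<open>If the power is odd, it changes sign between \<open>w\<close> and \<open>- w\<close>.
  Then \<open>\<eta> w - \<eta> (- w)\<close> is a constant odd multiple of pi i, although it
  changes sign when \<open>w\<close> is replaced by \<open>- w\<close>.\<close>

lemma crosscap_degrees:
 assumes "continuous_on (crossc.D k) \<theta>" "crossc.sinv k F"
  and F: "\<forall>z\<in>crossc.D k. F z = (\<Prod>j<k. (z - centre j) powi d j) * exp (\<theta> z)" and j: "j < k"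
 shows "even (d j)"
proof (rule ccontr)
 assume odd: "odd (d j)"
 obtain \<eta> where \<eta>: "continuous_on (sphere 0 1) \<eta>" "!!w. w \<in> sphere 0 1 ==> F (centre j + w) = w powi d j * exp (\<eta> w)"
  by (rule crossc.circle_form[OF assms(1) F j]) blast
 define g where "g w = \<eta> w - \<eta> (- w) - \<i> * of_real pi" for w
 have "continuous_on (sphere 0 1) g" unfolding g_def
  by (intro continuous_intros \<eta>(1) continuous_on_compose2[OF \<eta>(1)]) auto
 moreover have "exp (g w) = 1" if w: "w \<in> sphere 0 1" for w
 proof -
  have n: "norm w = 1" "w ~= 0" using w by auto
  have "F (centre j + w) = F (centre j + - w)" using assms(2) j n unfolding crossc.sinv_def by blast
  then have "w powi d j * exp (\<eta> w) = (- w) powi d j * exp (\<eta> (- w))"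
   using \<eta>(2)[OF w] \<eta>(2)[of "- w"] w by simp
  then have "w powi d j * exp (\<eta> w) = w powi d j * - exp (\<eta> (- w))"
   using odd by (simp add: power_int_minus_left_odd)
  moreover have "w powi d j ~= 0" using n by simp
  ultimately have "exp (\<eta> w) = - exp (\<eta> (- w))" using mult_cancel_left by blast
  then show ?thesis by (simp add: g_def exp_diff)
 qed
 ultimately obtain n :: int where n: "!!w. w \<in> sphere 0 1 ==> g w = 2 * of_int n * of_real pi * \<i>"
  using exp_one_const_on[OF connected_circle] by blast
 have "g 1 + g (- 1) = - 2 * \<i> * of_real pi" by (simp add: g_def)
 moreover have "g 1 + g (- 1) = 4 * of_int n * of_real pi * \<i>" using n[of 1] n[of "- 1"] by simp
 ultimately have "(4 * of_int n :: complex) * (of_real pi * \<i>) = - 2 * (of_real pi * \<i>)" by (simp add: mult_ac)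
 then have "(4 * of_int n :: complex) = - 2" by (simp only: mult_cancel_right) auto
 then have "(of_int (4 * n) :: complex) = of_int (- 2)" by simp
 then have "4 * n = - 2" by (simp only: of_int_eq_iff)
 then show False by presburger
qed

text \<open>One equation for the degree on each of the \<open>2 * h\<close> circles and one for the
  jump across each of the \<open>h\<close> handles.\<close>

lemma handle_rank:
 assumes T: "finite T" and *: "!!e::nat set. e \<in> T ==> continuous_on (hand.D h) (\<theta> e) \<and>
    hand.sinv h (\<lambda>z. (\<Prod>j<2 * h. (z - centre j) powi d e j) * exp (\<theta> e z))"
 shows "\<exists>\<Lambda>::nat => nat set => int. \<forall>w. (\<forall>j<3 * h. (\<Sum>e\<in>T. \<Lambda> j e * w e) = 0) -->
    (\<forall>j<2 * h. (\<Sum>e\<in>T. d e j * w e) = 0) \<and>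
    (hand.sinv h (\<lambda>z. exp (\<Sum>e\<in>T. of_int (w e) * \<theta> e z)) --> hand.sinv h (\<lambda>z. \<Sum>e\<in>T. of_int (w e) * \<theta> e z))"
proof -
 \<comment> \<open>\<open>a i\<close> and \<open>b i\<close> are two real points that are glued.
   There the product over the centres is real, so the jump of \<open>\<theta> e\<close> between them
   has an imaginary part in the integer multiples of pi, although \<open>\<theta> e\<close> alone
   need not respect the gluing modulo periods.\<close>
 define a b where "a i = centre (2 * i) + 1" and "b i = centre (2 * i + 1) + (- 1)" for i
 have "\<exists>n::int. Im (\<theta> e (a i) - \<theta> e (b i)) = of_int n * pi" if e: "e \<in> T" and i: "i < h" for e i
 proof -
  define P where "P z = (\<Prod>j<2 * h. (z - centre j) powi d e j)" for z
  have i1: "2 * i < 2 * h" "2 * i + 1 < 2 * h" using i by auto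
  have "P (a i) * exp (\<theta> e (a i)) = P (centre (other (2 * i)) + - cnj 1) * exp (\<theta> e (centre (other (2 * i)) + - cnj 1))"
   unfolding P_def a_def by (rule conjunct2[OF *[OF e], unfolded hand.sinv_def, rule_format, OF i1(1) norm_one])
  then have eq: "P (a i) * exp (\<theta> e (a i)) = P (b i) * exp (\<theta> e (b i))" by (simp add: b_def)
  have real: "P z \<in> \<real>" if "z \<in> \<real>" for z
  proof -
   have "(z - centre j) powi n \<in> \<real>" for j n
   proof -
    have "z - centre j \<in> \<real>" using that unfolding centre_def by (intro Reals_diff Reals_of_nat)
    then obtain t where "z - centre j = of_real t" by (rule Reals_cases)
    then show ?thesis by (metis of_real_power_int Reals_of_real)
   qed
   then show ?thesis unfolding P_def by (intro prod_in_Reals) auto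
  qed
  have ab: "a i \<in> \<real>" "b i \<in> \<real>" unfolding a_def b_def centre_def by (intro Reals_add Reals_of_nat Reals_minus Reals_1)+
  have "a i \<in> hand.D h" unfolding a_def using hand.Bd_in_D(1)[OF i1(1), of 1] by simp
  then have "a i - centre j ~= 0" if "j < 2 * h" for j using that unfolding hand.D_def by force
  then have nz: "P (a i) ~= 0" unfolding P_def by (simp add: prod_zero_iff)
  have "exp (\<theta> e (a i) - \<theta> e (b i)) = P (b i) / P (a i)"
   using eq nz by (simp add: exp_diff field_simps)
  moreover have "P (b i) / P (a i) \<in> \<real>" using real ab by (intro Reals_divide)
  ultimately have "Im (exp (\<theta> e (a i) - \<theta> e (b i))) = 0" using complex_is_Real_iff by metis
  then show ?thesis by (rule exp_real_Im)
 qed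
 then obtain \<mu> :: "nat set => nat => int" where \<mu>: "!!e i. e \<in> T ==> i < h ==> Im (\<theta> e (a i) - \<theta> e (b i)) = of_int (\<mu> e i) * pi"
  by metis
 define \<Lambda> where "\<Lambda> j e = (if j < 2 * h then d e j else \<mu> e (j - 2 * h))" for j e
 have "(\<forall>j<2 * h. (\<Sum>e\<in>T. d e j * w e) = 0) \<and>
    (hand.sinv h (\<lambda>z. exp (\<Sum>e\<in>T. of_int (w e) * \<theta> e z)) --> hand.sinv h (\<lambda>z. \<Sum>e\<in>T. of_int (w e) * \<theta> e z))"
  if w: "\<forall>j<3 * h. (\<Sum>e\<in>T. \<Lambda> j e * w e) = 0" for w
 proof (intro conjI allI impI)
  fix j assume j: "j < 2 * h"
  then have "(\<Sum>e\<in>T. \<Lambda> j e * w e) = 0" using w by simp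
  then show "(\<Sum>e\<in>T. d e j * w e) = 0" using j by (simp add: \<Lambda>_def)
 next
  define \<Theta> where "\<Theta> z = (\<Sum>e\<in>T. of_int (w e) * \<theta> e z)" for z
  assume "hand.sinv h (\<lambda>z. exp (\<Sum>e\<in>T. of_int (w e) * \<theta> e z))"
  then have s: "hand.sinv h (\<lambda>z. exp (\<Theta> z))" by (simp add: \<Theta>_def)
  have c: "continuous_on (hand.D h) \<Theta>" unfolding \<Theta>_def by (intro continuous_intros) (use * in blast)
  \<comment> \<open>The jump is constant along the circle, so it can be evaluated at
    \<open>a i\<close>, where the equations for \<open>\<mu>\<close> make it 0.\<close>
  have ev: "\<Theta> (centre (2 * i) + v) = \<Theta> (centre (2 * i + 1) + - cnj v)" if i: "i < h" and v: "norm v = 1" for i v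
  proof -
   have i1: "2 * i < 2 * h" using i by auto
   obtain k :: int where k: "!!w. norm w = 1 ==> \<Theta> (centre (2 * i) + w) - \<Theta> (centre (other (2 * i)) + - cnj w) = 2 * of_int k * of_real pi * \<i>"
    by (rule hand.jump[OF c s i1]) blast
   have "\<Theta> (a i) - \<Theta> (b i) = 2 * of_int k * of_real pi * \<i>" using k[of 1] by (simp add: a_def b_def)
   then have "Im (\<Theta> (a i) - \<Theta> (b i)) = 2 * of_int k * pi" by simp
   moreover have "\<Theta> (a i) - \<Theta> (b i) = (\<Sum>e\<in>T. of_int (w e) * (\<theta> e (a i) - \<theta> e (b i)))"
    by (simp add: \<Theta>_def sum_subtractf right_diff_distrib)
   moreover have "Im (\<Sum>e\<in>T. of_int (w e) * (\<theta> e (a i) - \<theta> e (b i))) = (\<Sum>e\<in>T. of_int (w e) * (of_int (\<mu> e i) * pi))"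
    unfolding Im_sum
   proof (rule sum.cong)
    fix e assume e: "e \<in> T"
    have "Im (of_int (w e) * z) = of_int (w e) * Im z" for z by simp
    then show "Im (of_int (w e) * (\<theta> e (a i) - \<theta> e (b i))) = of_int (w e) * (of_int (\<mu> e i) * pi)"
     using \<mu>[OF e i] by metis
   qed simp
   moreover have "(\<Sum>e\<in>T. of_int (w e) * (of_int (\<mu> e i) * pi)) = of_int (\<Sum>e\<in>T. \<mu> e i * w e) * pi"
    by (simp add: sum_distrib_left mult_ac)
   moreover have "(\<Sum>e\<in>T. \<mu> e i * w e) = 0"
   proof -
    have "(\<Sum>e\<in>T. \<Lambda> (2 * h + i) e * w e) = 0" using w i by simp
    then show ?thesis by (simp add: \<Lambda>_def)
   qed
   ultimately have "2 * of_int k * pi = 0" by simp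
   then have "k = 0" by simp
   then show ?thesis using k[OF v] by simp
  qed
  show "hand.sinv h (\<lambda>z. \<Sum>e\<in>T. of_int (w e) * \<theta> e z)"
   unfolding hand.sinv_def \<Theta>_def[symmetric]
  proof (intro allI impI)
   fix j v assume j: "j < 2 * h" and v: "norm (v::complex) = 1"
   show "\<Theta> (centre j + v) = \<Theta> (centre (other j) + - cnj v)"
   proof (cases "even j")
    case True
    then obtain i where "j = 2 * i" by blast
    then show ?thesis using ev[of i v] j v by simp
   next
    case False
    then obtain i where "j = Suc (2 * i)" using oddE by fastforce
    then show ?thesis using ev[of i "- cnj v"] j v by simp
   qed
  qed
 qed
 then show ?thesis by blast
qed

text \<open>The degrees alone give equations: the jump across a crosscap changes sign when
  \<open>v\<close> and \<open>- v\<close> are exchanged, but it is constant, so it is 0.\<close>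

lemma crosscap_rank:
 assumes T: "finite T" and *: "!!e::nat set. e \<in> T ==> continuous_on (crossc.D k) (\<theta> e) \<and>
    crossc.sinv k (\<lambda>z. (\<Prod>j<k. (z - centre j) powi d e j) * exp (\<theta> e z))"
 shows "\<exists>\<Lambda>::nat => nat set => int. \<forall>w. (\<forall>j<k. (\<Sum>e\<in>T. \<Lambda> j e * w e) = 0) -->
    (\<forall>j<k. (\<Sum>e\<in>T. d e j * w e) = 0) \<and>
    (crossc.sinv k (\<lambda>z. exp (\<Sum>e\<in>T. of_int (w e) * \<theta> e z)) --> crossc.sinv k (\<lambda>z. \<Sum>e\<in>T. of_int (w e) * \<theta> e z))"
proof (intro exI[of _ "\<lambda>j e. d e j"] allI impI conjI)
 fix w
 define \<Theta> where "\<Theta> z = (\<Sum>e\<in>T. of_int (w e) * \<theta> e z)" for z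
 assume "crossc.sinv k (\<lambda>z. exp (\<Sum>e\<in>T. of_int (w e) * \<theta> e z))"
 then have s: "crossc.sinv k (\<lambda>z. exp (\<Theta> z))" by (simp add: \<Theta>_def)
 have c: "continuous_on (crossc.D k) \<Theta>" unfolding \<Theta>_def by (intro continuous_intros) (use * in blast)
 show "crossc.sinv k (\<lambda>z. \<Sum>e\<in>T. of_int (w e) * \<theta> e z)"
  unfolding crossc.sinv_def \<Theta>_def[symmetric]
 proof (intro allI impI)
  fix j v assume j: "j < k" and v: "norm (v::complex) = 1"
  obtain n :: int where n: "!!w. norm w = 1 ==> \<Theta> (centre j + w) - \<Theta> (centre j + - w) = 2 * of_int n * of_real pi * \<i>"
   by (rule crossc.jump[OF c s j]) blast
  have "2 * of_int n * of_real pi * \<i> = - (2 * of_int n * of_real pi * \<i>)"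
   using n[of v] n[of "- v"] v by (metis minus_diff_eq minus_minus norm_minus_cancel)
  then have "n = 0" by simp
  then show "\<Theta> (centre j + v) = \<Theta> (centre j + - v)" using n[OF v] by simp
 qed
qed auto

lemma handles_ranked: "ranked_surface (sphere_with_handles h) (3 * h)"
proof -
 interpret closed_surface "hand.X h" by (rule hand.closed_surface_axioms)
 have "ranked_surface (hand.X h) (3 * h)"
 proof (unfold_locales)
  have "even (\<Sum>j<2 * h. d j)" if "continuous_on (hand.D h) \<theta>" "hand.sinv h F"
   "\<forall>z\<in>hand.D h. F z = (\<Prod>j<2 * h. (z - centre j) powi d j) * exp (\<theta> z)" for F d \<theta>
  proof -
   have "(\<Sum>j<2 * n. d j) = 0" if "n \<le> h" for n
    using that handle_degrees[OF \<open>continuous_on (hand.D h) \<theta>\<close> \<open>hand.sinv h F\<close> \<open>\<forall>z\<in>hand.D h. _ z\<close>]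
    by (induction n) (auto simp: add.assoc)
   then show ?thesis by simp
  qed
  then show "\<exists>p\<in>topspace (hand.X h). \<forall>f k d. cmap (hand.X h) (topspace (hand.X h) - {p}) f --> gen (hand.X h) p k -->
    geq (hand.X h) p f (\<lambda>x. k x powi d) --> even (d::int)"
   using hand.even_degree[of h] hand.p0_X[of h] by blast
 next
  fix T :: "nat set set" and f assume Tf: "finite T" "!!e. e \<in> T ==> cmap (hand.X h) (topspace (hand.X h)) (f e)"
  show "\<exists>\<Lambda>::nat => nat set => int. \<forall>w. (\<forall>j<3 * h. (\<Sum>e\<in>T. \<Lambda> j e * w e) = 0) -->
     haslog (hand.X h) (topspace (hand.X h)) (\<lambda>x. \<Prod>e\<in>T. f e x powi w e)"
   by (rule hand.rank_bound[OF _ Tf]) (rule handle_rank; assumption)+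
 qed
 then show ?thesis by (simp add: sphere_with_handles_eq)
qed

lemma crosscaps_ranked: "ranked_surface (sphere_with_crosscaps k) k"
proof -
 interpret closed_surface "crossc.X k" by (rule crossc.closed_surface_axioms)
 have "ranked_surface (crossc.X k) k"
 proof (unfold_locales)
  have "even (\<Sum>j<k. d j)" if "continuous_on (crossc.D k) \<theta>" "crossc.sinv k F"
   "\<forall>z\<in>crossc.D k. F z = (\<Prod>j<k. (z - centre j) powi d j) * exp (\<theta> z)" for F d \<theta>
   using crosscap_degrees[OF that] by (intro dvd_sum) auto
  then show "\<exists>p\<in>topspace (crossc.X k). \<forall>f h d. cmap (crossc.X k) (topspace (crossc.X k) - {p}) f --> gen (crossc.X k) p h -->
    geq (crossc.X k) p f (\<lambda>x. h x powi d) --> even (d::int)"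
   using crossc.even_degree[of k] crossc.p0_X[of k] by blast
 next
  fix T :: "nat set set" and f assume Tf: "finite T" "!!e. e \<in> T ==> cmap (crossc.X k) (topspace (crossc.X k)) (f e)"
  show "\<exists>\<Lambda>::nat => nat set => int. \<forall>w. (\<forall>j<k. (\<Sum>e\<in>T. \<Lambda> j e * w e) = 0) -->
     haslog (crossc.X k) (topspace (crossc.X k)) (\<lambda>x. \<Prod>e\<in>T. f e x powi w e)"
   by (rule crossc.rank_bound[OF _ Tf]) (rule crosscap_rank; assumption)+
 qed
 then show ?thesis by (simp add: sphere_with_crosscaps_eq)
qed

section \<open>Fat embeddings and minors\<close>

definition fat_embeds :: "nat sgraph => 'a topology => nat => bool" where
 "fat_embeds G X r \<longleftrightarrow> (\<exists>\<Phi> \<gamma> tail head. fat_graph X r (verts G) (edges G) \<Phi> \<gamma> tail head)"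

lemma (in closed_surface) open_infinite:
 assumes "openin X U" "U ~= {}" shows "infinite U"
proof -
 obtain x where "x \<in> U" using assms by blast
 then obtain W \<kappa> \<kappa>' where ch: "chart X W \<kappa> \<kappa>'" "W <= U" using small_chart[OF assms(1)] by metis
 have "inj \<kappa>'" using chartD(5)[OF ch(1)] by (metis injI)
 then have "infinite (range \<kappa>')" using finite_imageD infinite_UNIV_char_0 by blast
 moreover have "range \<kappa>' <= U" using chartD(4)[OF ch(1)] ch(2) by blast
 ultimately show ?thesis using finite_subset by blast
qed

lemma (in closed_surface) outside_point:
 assumes "finite P" "finite T" "!!e. e \<in> T ==> arcin X (g e)" "topspace X ~= {}"
 obtains p where "p \<in> topspace X" "p \<notin> P" "p \<notin> (\<Union>e\<in>T. g e ` {0..1})"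
proof -
 have "topspace X - P ~= {}" using open_infinite[OF openin_topspace assms(4)] assms(1)
  by (metis Diff_eq_empty_iff finite_subset)
 then have "\<not> topspace X - P <= (\<Union>e\<in>T. g e ` {0..1})"
  by (intro arcs_nowhere_dense assms openin_codiff)
 then show ?thesis using that by blast
qed

lemma (in ranked_surface) topspace_ne: "topspace X ~= {}"
 using parity0 by blast

lemma graphs_finite: "G \<in> graphs ==> finite (verts G) \<and> finite (edges G)"
 unfolding graphs_def by (auto intro: finite_subset[of _ "Pow (verts G)"])

lemma embeds_outside:
 assumes "ranked_surface X r" "G \<in> graphs" "finite Q"
  and a: "!!e. e \<in> edges G ==> pathin X (\<gamma> e) \<and> inj_on (\<gamma> e) {0..1}"
 obtains p where "p \<in> topspace X" "p \<notin> Q" "p \<notin> \<phi> ` verts G" "p \<notin> (\<Union>e\<in>edges G. \<gamma> e ` {0..1})"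
proof -
 interpret ranked_surface X r by fact
 have "finite (\<phi> ` verts G \<union> Q)" "finite (edges G)" using graphs_finite[OF assms(2)] assms(3) by auto
 then obtain p where "p \<in> topspace X" "p \<notin> \<phi> ` verts G \<union> Q" "p \<notin> (\<Union>e\<in>edges G. \<gamma> e ` {0..1})"
  using outside_point[of "\<phi> ` verts G \<union> Q" "edges G" \<gamma>] a topspace_ne unfolding arcin_def by blast
 then show ?thesis using that by blast
qed

text \<open>Single points are acyclic vertex sets, and finitely many points and arcs do not cover
  the surface.\<close>

lemma embeds_imp_fat:
 assumes rs: "ranked_surface X r" and G: "G \<in> graphs" and em: "embeds_in G X"
 shows "fat_embeds G X r"
proof -
 interpret ranked_surface X r by fact
 obtain \<phi> \<gamma> where inj: "inj_on \<phi> (verts G)" and im: "\<phi> ` verts G <= topspace X"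
  and e: "!!e. e \<in> edges G ==> pathin X (\<gamma> e) \<and> inj_on (\<gamma> e) {0..1} \<and>
    {\<gamma> e 0, \<gamma> e 1} = \<phi> ` e \<and> \<gamma> e ` {0<..<1} \<inter> \<phi> ` verts G = {}"
  and d: "!!e e'. e \<in> edges G ==> e' \<in> edges G ==> e ~= e' ==> \<gamma> e ` {0<..<1} \<inter> \<gamma> e' ` {0<..<1} = {}"
  using em unfolding embeds_in_def by metis
 have "\<exists>u v. u \<in> verts G \<and> v \<in> verts G \<and> u ~= v \<and> e = {u, v} \<and> \<gamma> e 0 = \<phi> u \<and> \<gamma> e 1 = \<phi> v" if E: "e \<in> edges G" for e
 proof -
  have "card e = 2" "e <= verts G" using G E unfolding graphs_def by auto
  then obtain a b where ab: "e = {a, b}" "a ~= b" "a \<in> verts G" "b \<in> verts G" unfolding card_2_iff by auto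
  then have "{\<gamma> e 0, \<gamma> e 1} = {\<phi> a, \<phi> b}" using e[OF E] by auto
  then have "\<gamma> e 0 = \<phi> a \<and> \<gamma> e 1 = \<phi> b \<or> \<gamma> e 0 = \<phi> b \<and> \<gamma> e 1 = \<phi> a" by (auto simp: doubleton_eq_iff)
  then show ?thesis using ab by (metis insert_commute)
 qed
 then obtain t h where th: "!!e. e \<in> edges G ==> t e \<in> verts G \<and> h e \<in> verts G \<and> t e ~= h e \<and> e = {t e, h e} \<and> \<gamma> e 0 = \<phi> (t e) \<and> \<gamma> e 1 = \<phi> (h e)"
  by metis
 have ep: "pathin X (\<gamma> e) \<and> inj_on (\<gamma> e) {0..1}" if "e \<in> edges G" for e using e[OF that] by blast
 obtain p where p: "p \<in> topspace X" "p \<notin> \<phi> ` verts G" "p \<notin> (\<Union>e\<in>edges G. \<gamma> e ` {0..1})"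
  by (rule embeds_outside[OF rs G finite.emptyI ep]) blast+
 have "fat_graph X r (verts G) (edges G) (\<lambda>v. {\<phi> v}) \<gamma> t h"
 proof
  show "finite (verts G)" "finite (edges G)" using graphs_finite[OF G] by auto
  show "closedin X {\<phi> v} \<and> connectedin X {\<phi> v} \<and> {\<phi> v} ~= {} \<and> acyc X {\<phi> v}" if "v \<in> verts G" for v
  proof -
   have "\<phi> v \<in> topspace X" using im that by blast
   then show ?thesis using closedin_finite[of "{\<phi> v}"] acyc_sing by (simp add: connectedin_sing)
  qed
  show "{\<phi> u} \<inter> {\<phi> v} = {}" if "u \<in> verts G" "v \<in> verts G" "u ~= v" for u v
   using inj that by (auto simp: inj_on_def)
  show "arcin X (\<gamma> e)" if "e \<in> edges G" for e using e[OF that] by (simp add: arcin_def)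
  show "\<gamma> e ` {0<..<1} \<inter> {\<phi> v} = {}" if "e \<in> edges G" "v \<in> verts G" for e v
   using e[OF that(1)] that(2) by blast
  show "\<exists>p\<in>topspace X. p \<notin> (\<Union>v\<in>verts G. {\<phi> v}) \<union> (\<Union>e\<in>edges G. \<gamma> e ` {0..1})"
   by (rule bexI[of _ p]) (use p in auto)
 qed (use th d in auto)
 then show ?thesis unfolding fat_embeds_def by blast
qed

lemma fat_bipartite:
 assumes "fat_embeds G X r" "!!e. e \<in> edges G ==> \<exists>x y. e = {x, y} \<and> x \<in> B \<and> y \<notin> B"
 shows "card (edges G) \<le> 2 * (card (verts G) + r + 1)"
proof -
 obtain \<Phi> \<gamma> t h where "fat_graph X r (verts G) (edges G) \<Phi> \<gamma> t h"
  using assms(1) unfolding fat_embeds_def by blast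
 then interpret fat_graph X r "verts G" "edges G" \<Phi> \<gamma> t h .
 show ?thesis
 proof (rule bipartite_edges[of B])
  fix e assume "e \<in> edges G"
  then show "(t e \<in> B) ~= (h e \<in> B)" using assms(2)[of e] ends[of e] by (metis doubleton_eq_iff)
 qed
qed

context fat_graph
begin

lemma restrict:
 assumes "V' <= V" "E' <= E" "!!e. e \<in> E' ==> e <= V'"
 shows "fat_graph X r V' E' \<Phi> \<gamma> tail head"
proof
 show "finite V'" "finite E'" using assms finV finE finite_subset by blast+
 fix e assume e: "e \<in> E'"
 then have eE: "e \<in> E" using assms by blast
 have "tail e \<in> e" "head e \<in> e" using ends[OF eE] by blast+
 then show "tail e \<in> V' \<and> head e \<in> V' \<and> tail e ~= head e \<and> e = {tail e, head e} \<and>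
    \<gamma> e 0 \<in> \<Phi> (tail e) \<and> \<gamma> e 1 \<in> \<Phi> (head e)"
  using assms(3)[OF e] ends[OF eE] by blast
 show "arcin X (\<gamma> e)" by (rule arc[OF eE])
 show "\<gamma> e ` {0<..<1} \<inter> \<Phi> v = {}" if "v \<in> V'" for v using inner[OF eE] that assms(1) by blast
 show "\<gamma> e ` {0<..<1} \<inter> \<gamma> e' ` {0<..<1} = {}" if "e' \<in> E'" "e ~= e'" for e'
  using edisj[OF eE _ that(2)] that(1) assms(2) by blast
next
 show "closedin X (\<Phi> v) \<and> connectedin X (\<Phi> v) \<and> \<Phi> v ~= {} \<and> acyc X (\<Phi> v)" if "v \<in> V'" for v
  using vert that assms(1) by blast
 show "\<Phi> u \<inter> \<Phi> v = {}" if "u \<in> V'" "v \<in> V'" "u ~= v" for u v using vdisj that assms(1) by blast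
 obtain p where p: "p \<in> topspace X" "p \<notin> (\<Union>v\<in>V. \<Phi> v) \<union> (\<Union>e\<in>E. \<gamma> e ` {0..1})" using proper by blast
 have "(\<Union>v\<in>V'. \<Phi> v) \<union> (\<Union>e\<in>E'. \<gamma> e ` {0..1}) <= (\<Union>v\<in>V. \<Phi> v) \<union> (\<Union>e\<in>E. \<gamma> e ` {0..1})"
  using assms(1,2) by (intro Un_mono UN_mono) auto
 from contra_subsetD[OF this p(2)] p(1)
 show "\<exists>p\<in>topspace X. p \<notin> (\<Union>v\<in>V'. \<Phi> v) \<union> (\<Union>e\<in>E'. \<gamma> e ` {0..1})" by (rule bexI)
qed

text \<open>The arc meets each end set in exactly one point, so \<open>acyc_Un_point\<close> applies
  twice.\<close>

lemma merged_vertex: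
 assumes e: "e \<in> E" and K: "K = \<Phi> (tail e) \<union> \<gamma> e ` {0..1} \<union> \<Phi> (head e)"
 shows "closedin X K \<and> connectedin X K \<and> acyc X K"
proof -
 let ?A = "\<gamma> e ` {0..1}"
 note en = ends[OF e]
 have t: "tail e \<in> V" and h: "head e \<in> V" and th: "tail e ~= head e" using en by auto
 have disj: "\<Phi> (tail e) \<inter> \<Phi> (head e) = {}" by (rule vdisj[OF t h th])
 have tA: "\<Phi> (tail e) \<inter> ?A = {\<gamma> e 0}" and Ah: "?A \<inter> \<Phi> (head e) = {\<gamma> e 1}"
  unfolding arc_eq using en disj inner[OF e t] inner[OF e h] by blast+
 have clA: "closedin X ?A" by (rule arc_closed[OF arc[OF e]])
 have cl1: "closedin X (\<Phi> (tail e) \<union> ?A)" using vert[OF t] clA by (simp add: closedin_Un)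
 have ac1: "acyc X (\<Phi> (tail e) \<union> ?A)"
  using acyc_Un_point[OF _ clA tA] vert[OF t] acyc_arc[OF arc[OF e]] by blast
 have "(\<Phi> (tail e) \<union> ?A) \<inter> \<Phi> (head e) = {\<gamma> e 1}" using Ah disj by blast
 then have "acyc X K" unfolding K using acyc_Un_point[OF cl1 _ _ ac1] vert[OF h] by blast
 moreover have "closedin X K" unfolding K using cl1 vert[OF h] by (simp add: closedin_Un)
 moreover have "connectedin X (\<Phi> (tail e) \<union> ?A)"
  using vert[OF t] arc_connected[OF arc[OF e]] tA by (intro connectedin_Un) auto
 then have "connectedin X K" unfolding K
  using vert[OF h] Ah by (intro connectedin_Un[of X "\<Phi> (tail e) \<union> ?A" "\<Phi> (head e)"]) auto
 ultimately show ?thesis by blast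
qed

lemma contract:
 assumes uv: "{u, v} \<in> E" "u ~= v"
  and f: "f = (\<lambda>x. if x = v then u else x)"
  and E': "E' = {f ` e |e. e \<in> E \<and> card (f ` e) = 2}"
 shows "\<exists>\<Phi> \<gamma> t h. fat_graph X r (V - {v}) E' \<Phi> \<gamma> t h"
proof -
 define e0 where "e0 = {u, v}"
 have e0: "e0 \<in> E" using uv by (simp add: e0_def)
 have "e0 = {tail e0, head e0}" using ends[OF e0] by blast
 then have tuv: "{tail e0, head e0} = {u, v}" by (simp add: e0_def)
 have uV: "u \<in> V" "v \<in> V"
 proof -
  have "{tail e0, head e0} <= V" using ends[OF e0] by blast
  then show "u \<in> V" "v \<in> V" unfolding tuv by auto
 qed
 define K where "K = \<Phi> (tail e0) \<union> \<gamma> e0 ` {0..1} \<union> \<Phi> (head e0)"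
 have K: "closedin X K" "connectedin X K" "acyc X K" using merged_vertex[OF e0 K_def] by auto
 have "\<Phi> (tail e0) \<union> \<Phi> (head e0) = (\<Union>x\<in>{tail e0, head e0}. \<Phi> x)" by blast
 also have "\<dots> = \<Phi> u \<union> \<Phi> v" unfolding tuv by blast
 finally have Keq: "K = \<Phi> u \<union> \<Phi> v \<union> \<gamma> e0 ` {0<..<1}"
  unfolding K_def arc_eq using ends[OF e0] by blast
 have "\<exists>e. e \<in> E \<and> f ` e = e'" if "e' \<in> E'" for e' using that unfolding E' by blast
 \<comment> \<open>Contraction may identify parallel edges; \<open>c\<close> selects the one whose
   arc is kept.\<close>
 then obtain c where c: "!!e'. e' \<in> E' ==> c e' \<in> E \<and> f ` c e' = e'" by metis
 have c2: "card e' = 2" if "e' \<in> E'" for e' using that unfolding E' by blast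
 have cne: "c e' ~= e0" if e': "e' \<in> E'" for e'
 proof
  assume "c e' = e0"
  then have "e' = {u}" using c[OF e'] f by (auto simp: e0_def)
  then show False using c2[OF e'] by simp
 qed
 define \<Phi>' where "\<Phi>' = \<Phi>(u := K)"
 have sub: "\<Phi> x <= \<Phi>' (f x)" for x unfolding \<Phi>'_def f Keq by auto
 have fV: "f x \<in> V - {v}" if "x \<in> V" for x using that uV uv(2) by (auto simp: f)
 have "fat_graph X r (V - {v}) E' \<Phi>' (\<lambda>e. \<gamma> (c e)) (\<lambda>e. f (tail (c e))) (\<lambda>e. f (head (c e)))"
 proof
  show "finite (V - {v})" using finV by simp
  have "E' <= (`) f ` E" unfolding E' by blast
  then show "finite E'" using finE finite_surj by blast
  show "closedin X (\<Phi>' w) \<and> connectedin X (\<Phi>' w) \<and> \<Phi>' w ~= {} \<and> acyc X (\<Phi>' w)" if w: "w \<in> V - {v}" for w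
  proof (cases "w = u")
   case True
   have "K ~= {}" using vert[OF uV(1)] Keq by blast
   then show ?thesis using True K by (simp add: \<Phi>'_def)
  qed (use vert[of w] w in \<open>simp add: \<Phi>'_def\<close>)
  have dK: "K \<inter> \<Phi> w = {}" if "w \<in> V" "w ~= u" "w ~= v" for w
   unfolding Keq using vdisj[OF uV(1) that(1)] vdisj[OF uV(2) that(1)] inner[OF e0 that(1)] that by blast
  show "\<Phi>' x \<inter> \<Phi>' y = {}" if "x \<in> V - {v}" "y \<in> V - {v}" "x ~= y" for x y
   using that vdisj[of x y] dK[of x] dK[of y] unfolding \<Phi>'_def by auto
  fix e' assume e': "e' \<in> E'"
  note ce = c[OF e']
  have cE: "c e' \<in> E" using ce by blast
  note en = ends[OF cE]
  have im: "e' = {f (tail (c e')), f (head (c e'))}" using ce en by (metis image_empty image_insert)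
  have ne: "f (tail (c e')) ~= f (head (c e'))"
  proof
   assume "f (tail (c e')) = f (head (c e'))"
   then have "e' = {f (tail (c e'))}" using im by simp
   then have "card e' = 1" by (metis is_singletonI is_singleton_altdef)
   then show False using c2[OF e'] by simp
  qed
  show "f (tail (c e')) \<in> V - {v} \<and> f (head (c e')) \<in> V - {v} \<and> f (tail (c e')) ~= f (head (c e')) \<and>
    e' = {f (tail (c e')), f (head (c e'))} \<and> \<gamma> (c e') 0 \<in> \<Phi>' (f (tail (c e'))) \<and> \<gamma> (c e') 1 \<in> \<Phi>' (f (head (c e')))"
   using fV en ne im sub by blast
  show "arcin X (\<gamma> (c e'))" by (rule arc[OF cE])
  show "\<gamma> (c e') ` {0<..<1} \<inter> \<Phi>' w = {}" if w: "w \<in> V - {v}" for w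
  proof (cases "w = u")
   case True
   have "\<gamma> (c e') ` {0<..<1} \<inter> K = {}"
    unfolding Keq using inner[OF cE uV(1)] inner[OF cE uV(2)] edisj[OF cE e0 cne[OF e']] by blast
   then show ?thesis using True by (simp add: \<Phi>'_def)
  qed (use inner[OF cE, of w] w in \<open>simp add: \<Phi>'_def\<close>)
  show "\<gamma> (c e') ` {0<..<1} \<inter> \<gamma> (c e'') ` {0<..<1} = {}" if e'': "e'' \<in> E'" "e' ~= e''" for e''
  proof -
   have "c e' ~= c e''" using c[OF e'] c[OF e''(1)] e''(2) by metis
   then show ?thesis using edisj[OF cE] c[OF e''(1)] by blast
  qed
 next
  obtain p where p: "p \<in> topspace X" "p \<notin> (\<Union>v\<in>V. \<Phi> v) \<union> (\<Union>e\<in>E. \<gamma> e ` {0..1})" using proper by blast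
  have "(\<Union>w\<in>V - {v}. \<Phi>' w) <= (\<Union>v\<in>V. \<Phi> v) \<union> (\<Union>e\<in>E. \<gamma> e ` {0..1})"
  proof
   fix x assume "x \<in> (\<Union>w\<in>V - {v}. \<Phi>' w)"
   then obtain w where w: "w \<in> V" "x \<in> \<Phi>' w" by blast
   show "x \<in> (\<Union>v\<in>V. \<Phi> v) \<union> (\<Union>e\<in>E. \<gamma> e ` {0..1})"
   proof (cases "w = u")
    case True
    then have "x \<in> K" using w by (simp add: \<Phi>'_def)
    then show ?thesis using ends[OF e0] e0 unfolding K_def by blast
   next
    case False
    then show ?thesis using w by (auto simp: \<Phi>'_def)
   qed
  qed
  moreover have "(\<Union>e\<in>E'. \<gamma> (c e) ` {0..1}) <= (\<Union>e\<in>E. \<gamma> e ` {0..1})"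
  proof
   fix x assume "x \<in> (\<Union>e\<in>E'. \<gamma> (c e) ` {0..1})"
   then obtain e' where e': "e' \<in> E'" "x \<in> \<gamma> (c e') ` {0..1}" by (elim UN_E)
   then show "x \<in> (\<Union>e\<in>E. \<gamma> e ` {0..1})" using c[OF e'(1)] by (intro UN_I[of "c e'"]) auto
  qed
  ultimately have "(\<Union>w\<in>V - {v}. \<Phi>' w) \<union> (\<Union>e\<in>E'. \<gamma> (c e) ` {0..1}) <= (\<Union>v\<in>V. \<Phi> v) \<union> (\<Union>e\<in>E. \<gamma> e ` {0..1})"
   by (rule Un_least[OF _ le_supI2])
  from contra_subsetD[OF this p(2)] p(1)
  show "\<exists>p\<in>topspace X. p \<notin> (\<Union>w\<in>V - {v}. \<Phi>' w) \<union> (\<Union>e\<in>E'. \<gamma> (c e) ` {0..1})" by (rule bexI)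
 qed
 then show ?thesis by blast
qed

end

lemma minor_step_fat:
 assumes "minor_step G H" "fat_embeds G X r"
 shows "fat_embeds H X r"
proof -
 obtain \<Phi> \<gamma> t h where fg: "fat_graph X r (verts G) (edges G) \<Phi> \<gamma> t h"
  using assms(2) unfolding fat_embeds_def by blast
 interpret fat_graph X r "verts G" "edges G" \<Phi> \<gamma> t h by (rule fg)
 from assms(1) show ?thesis
 proof cases
  case (1 v)
  have "fat_graph X r (verts G - {v}) {e \<in> edges G. e <= verts G - {v}} \<Phi> \<gamma> t h"
   by (rule restrict) auto
  then show ?thesis unfolding 1(1) fat_embeds_def induced_subgraph_def by auto
 next
  case (2 e)
  have "fat_graph X r (verts G) (edges G - {e}) \<Phi> \<gamma> t h"
  proof (rule restrict)
   fix e' assume "e' \<in> edges G - {e}"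
   then have "e' \<in> edges G" by blast
   then show "e' <= verts G" using ends[of e'] by (metis empty_subsetI insert_subset)
  qed auto
  then show ?thesis unfolding 2(1) fat_embeds_def delete_edge_def by auto
 next
  case (3 u v)
  have "\<exists>\<Phi> \<gamma> t h. fat_graph X r (verts G - {v}) {(\<lambda>x. if x = v then u else x) ` e |e. e \<in> edges G \<and> card ((\<lambda>x. if x = v then u else x) ` e) = 2} \<Phi> \<gamma> t h"
   by (rule contract[OF 3(2,3) refl refl])
  then show ?thesis unfolding 3(1) fat_embeds_def contract_edge_def Let_def by simp
 qed
qed

lemma minor_step_graphs:
 assumes "minor_step G H" "G \<in> graphs" shows "H \<in> graphs"
 using assms(1)
proof cases
 case (3 u v)
 have fin: "finite (verts G)" and ed: "!!e. e \<in> edges G ==> e <= verts G \<and> card e = 2"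
  using assms(2) by (auto simp: graphs_def)
 have "u \<in> verts G" using ed[OF 3(2)] by blast
 then show ?thesis using fin ed 3(3) unfolding 3(1) contract_edge_def Let_def graphs_def by fastforce
qed (use assms(2) in \<open>auto simp: graphs_def induced_subgraph_def delete_edge_def\<close>)

lemma is_minor_graphs: "is_minor H G ==> G \<in> graphs ==> H \<in> graphs"
 unfolding is_minor_def by (induction rule: rtranclp_induct) (auto intro: minor_step_graphs)

section \<open>Carrying embeddings over to other surfaces and graphs\<close>

lemma embeds_transfer:
 assumes em: "inj_on \<phi> (verts G)" "!!e. e \<in> edges G ==> pathin X (\<gamma> e) \<and> inj_on (\<gamma> e) {0..1} \<and>
    {\<gamma> e 0, \<gamma> e 1} = \<phi> ` e \<and> \<gamma> e ` {0<..<1} \<inter> \<phi> ` verts G = {}"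
  "!!e e'. e \<in> edges G ==> e' \<in> edges G ==> e ~= e' ==> \<gamma> e ` {0<..<1} \<inter> \<gamma> e' ` {0<..<1} = {}"
  and S: "\<phi> ` verts G <= S" "!!e. e \<in> edges G ==> \<gamma> e ` {0..1} <= S" "S <= topspace X"
  and c: "continuous_map (subtopology X S) Y \<theta>" and inj: "inj_on \<theta> S"
 shows "embeds_in G Y"
 unfolding embeds_in_def
proof (intro exI conjI ballI impI)
 show "inj_on (\<lambda>v. \<theta> (\<phi> v)) (verts G)"
  using comp_inj_on[OF em(1) inj_on_subset[OF inj S(1)]] by (simp add: o_def)
 have "\<theta> x \<in> topspace Y" if "x \<in> S" for x using c that S(3) by (auto simp: continuous_map_def)
 then show "(\<lambda>v. \<theta> (\<phi> v)) ` verts G <= topspace Y" using S(1) by auto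
 fix e assume e: "e \<in> edges G"
 note ee = em(2)[OF e]
 have "continuous_map (top_of_set {0..1}) (subtopology X S) (\<gamma> e)"
  using ee S(2)[OF e] unfolding pathin_def by (auto simp: continuous_map_in_subtopology)
 then have "continuous_map (top_of_set {0..1}) Y (\<theta> \<circ> \<gamma> e)" using c by (rule continuous_map_compose)
 then show "pathin Y (\<lambda>t. \<theta> (\<gamma> e t))" by (simp add: pathin_def o_def)
 show "inj_on (\<lambda>t. \<theta> (\<gamma> e t)) {0..1}"
  using comp_inj_on[of "\<gamma> e" "{0..1}" \<theta>] ee inj_on_subset[OF inj S(2)[OF e]] by (simp add: o_def)
 have "\<theta> ` {\<gamma> e 0, \<gamma> e 1} = \<theta> ` \<phi> ` e" using ee by simp
 then show "{\<theta> (\<gamma> e 0), \<theta> (\<gamma> e 1)} = (\<lambda>v. \<theta> (\<phi> v)) ` e" by (simp add: image_image)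
 have i: "\<gamma> e' ` {0<..<1} <= S" if "e' \<in> edges G" for e'
 proof -
  have "\<gamma> e' ` {0<..<1} <= \<gamma> e' ` {0..1}" by (intro image_mono) auto
  then show ?thesis using S(2)[OF that] by blast
 qed
 have "\<theta> ` (\<gamma> e ` {0<..<1}) \<inter> \<theta> ` (\<phi> ` verts G) = \<theta> ` (\<gamma> e ` {0<..<1} \<inter> \<phi> ` verts G)"
  by (rule inj_on_image_Int[OF inj i[OF e] S(1), symmetric])
 then show "(\<lambda>t. \<theta> (\<gamma> e t)) ` {0<..<1} \<inter> (\<lambda>v. \<theta> (\<phi> v)) ` verts G = {}"
  using ee by (simp add: image_image)
 fix e' assume e': "e' \<in> edges G" "e ~= e'"
 have "\<theta> ` (\<gamma> e ` {0<..<1}) \<inter> \<theta> ` (\<gamma> e' ` {0<..<1}) = \<theta> ` (\<gamma> e ` {0<..<1} \<inter> \<gamma> e' ` {0<..<1})"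
  by (rule inj_on_image_Int[OF inj i[OF e] i[OF e'(1)], symmetric])
 then show "(\<lambda>t. \<theta> (\<gamma> e t)) ` {0<..<1} \<inter> (\<lambda>t. \<theta> (\<gamma> e' t)) ` {0<..<1} = {}"
  using em(3)[OF e e'] by (simp add: image_image)
qed

text \<open>The drawing misses a point of the sphere; without it the sphere is a plane, which is the
  domain of a chart inverse on any surface. This bridges the convention that \<open>NE\<close>
  stands for the planar graphs when the bound is 0: they remain in the class when the bound becomes
  positive.\<close>

lemma planar_crosscaps:
 assumes G: "G \<in> graphs" and em: "embeds_in G (sphere_with_handles 0)"
 shows "embeds_in G (sphere_with_crosscaps k)"
proof -
 let ?X = "sphere_with_handles 0" and ?Y = "sphere_with_crosscaps k"
 obtain \<phi> \<gamma> where inj: "inj_on \<phi> (verts G)" and im: "\<phi> ` verts G <= topspace ?X"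
  and e: "!!e. e \<in> edges G ==> pathin ?X (\<gamma> e) \<and> inj_on (\<gamma> e) {0..1} \<and>
    {\<gamma> e 0, \<gamma> e 1} = \<phi> ` e \<and> \<gamma> e ` {0<..<1} \<inter> \<phi> ` verts G = {}"
  and d: "!!e e'. e \<in> edges G ==> e' \<in> edges G ==> e ~= e' ==> \<gamma> e ` {0<..<1} \<inter> \<gamma> e' ` {0<..<1} = {}"
  using em unfolding embeds_in_def by metis
 interpret X: ranked_surface ?X 0 using handles_ranked[of 0] by (simp only: mult_0_right)
 interpret Y: ranked_surface ?Y k by (rule crosscaps_ranked)
 have ep: "pathin ?X (\<gamma> e) \<and> inj_on (\<gamma> e) {0..1}" if "e \<in> edges G" for e using e[OF that] by blast
 have Xeq: "?X = hand.X 0" by (rule sphere_with_handles_eq)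
 define q where "q = hand.q 0"
 \<comment> \<open>The omitted point is chosen different from infinity, so that it is the centre of
   some \<open>invp\<close>.\<close>
 obtain p where p: "p \<in> topspace ?X" "p \<notin> {q None}" "p \<notin> \<phi> ` verts G" "p \<notin> (\<Union>e\<in>edges G. \<gamma> e ` {0..1})"
  by (rule embeds_outside[OF X.ranked_surface_axioms G _ ep, of "{q None}"]) blast+
 have DU: "hand.D 0 = UNIV" using hand.D_def[of 0] by simp
 have tX: "topspace ?X = q ` UNIV" unfolding Xeq hand.topspace_X hand.topspace_H DU q_def by (metis UNIV_option_conv)
 obtain z0 where z0: "p = q (Some z0)" using p(1,2) unfolding tX by (metis imageE insertI1 not_None_eq)
 have norl: "\<not> hand.rl 0 x y" for x y unfolding hand.rl_def by simp
 have qinj: "inj q" unfolding q_def by (rule injI) (metis hand.q_eq_iff norl)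
 define \<psi> where "\<psi> w = q (invp z0 w)" for w
 have Heq: "hand.H 0 = sphere2" unfolding hand.H_eq DU by (metis UNIV_option_conv subtopology_UNIV)
 have "continuous_map euclidean (hand.X 0) (hand.q 0 \<circ> invp z0)"
  by (rule continuous_map_compose[OF continuous_map_invp hand.cont_q[of 0, unfolded Heq]])
 moreover have "hand.q 0 \<circ> invp z0 = \<psi>" by (rule ext) (simp add: \<psi>_def q_def)
 ultimately have c1: "continuous_map (top_of_set UNIV) ?X \<psi>" unfolding Xeq by simp
 have c2: "inj_on \<psi> UNIV" using qinj inj_invp[of z0] unfolding \<psi>_def inj_def by metis
 have c3: "openin ?X (\<psi> ` W)" if "W <= UNIV" "open W" for W
 proof -
  have "{x \<in> topspace (hand.H 0). hand.q 0 x \<in> \<psi> ` W} = invp z0 ` W"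
   using qinj unfolding \<psi>_def q_def inj_def hand.topspace_H DU by (auto simp: image_iff)
  moreover have "openin (hand.H 0) (invp z0 ` W)" unfolding Heq by (rule openin_invp[OF that(2)])
  moreover have "\<psi> ` W <= hand.q 0 ` topspace (hand.H 0)"
   using tX unfolding Xeq hand.topspace_X \<psi>_def q_def by auto
  ultimately show ?thesis unfolding Xeq hand.openin_X by simp
 qed
 have "\<exists>\<kappa>. homeomorphic_map (subtopology ?X (\<psi> ` UNIV)) (top_of_set (UNIV::complex set)) \<kappa>"
  by (rule homeomorphic_map_param[OF c1 c2 c3 open_UNIV])
 then obtain \<kappa> where hm: "homeomorphic_map (subtopology ?X (\<psi> ` UNIV)) (top_of_set (UNIV::complex set)) \<kappa>" by blast
 have rng: "\<psi> ` UNIV = topspace ?X - {p}"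
 proof -
  have "range (invp z0) = UNIV - {Some z0}"
  proof (intro equalityI subsetI)
   fix x assume x: "x \<in> UNIV - {Some z0}"
   show "x \<in> range (invp z0)"
   proof (cases x)
    case None then show ?thesis by (metis invp_def rangeI)
   next
    case (Some z)
    then have "invp z0 (1 / (z - z0)) = x" using x by (auto simp: invp_def)
    then show ?thesis by blast
   qed
  qed (auto simp: invp_def split: if_splits)
  then have "\<psi> ` UNIV = q ` (UNIV - {Some z0})" unfolding \<psi>_def by (metis image_image)
  also have "\<dots> = q ` UNIV - {q (Some z0)}" using qinj by (metis image_empty image_insert image_set_diff)
  finally show ?thesis unfolding tX z0 .
 qed
 define S where "S = topspace ?X - {p}"
 have hm': "homeomorphic_map (subtopology ?X S) euclidean \<kappa>" using hm unfolding rng S_def by simp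
 have k: "continuous_map (subtopology ?X S) euclidean \<kappa>" by (rule homeomorphic_imp_continuous_map[OF hm'])
 have "topspace (subtopology ?X S) = S" by (auto simp: S_def)
 then have kinj: "inj_on \<kappa> S" using homeomorphic_imp_injective_map[OF hm'] by simp
 obtain y where y: "y \<in> topspace ?Y" using Y.topspace_ne by blast
 obtain U c c' where ch: "chart ?Y U c c'" by (rule Y.small_chart[OF openin_topspace y]) blast
 have "continuous_map (subtopology ?X S) ?Y (c' \<circ> \<kappa>)"
  by (rule continuous_map_compose[OF k chartD(7)[OF ch]])
 moreover have "inj c'" using chartD(5)[OF ch] by (metis injI)
 then have "inj_on (c' \<circ> \<kappa>) S" using kinj by (metis comp_inj_on inj_on_subset subset_UNIV)
 moreover have "\<phi> ` verts G <= S" using im p(3) by (auto simp: S_def)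
 moreover have "\<gamma> e ` {0..1} <= S" if E: "e \<in> edges G" for e
 proof -
  have "\<gamma> e ` {0..1} <= topspace ?X" by (rule arc_subset) (use ep[OF E] in \<open>simp add: arcin_def\<close>)
  then show ?thesis using p(4) E unfolding S_def by blast
 qed
 ultimately show ?thesis by (intro embeds_transfer[OF inj e d, where \<theta> = "c' \<circ> \<kappa>" and S = S]) (auto simp: S_def)
qed

lemma embeds_isolated:
 assumes rs: "ranked_surface X r" and G: "G \<in> graphs" and em: "embeds_in G X" and v: "v \<notin> verts G"
 shows "embeds_in (insert v (verts G), edges G) X"
proof -
 obtain \<phi> \<gamma> where inj: "inj_on \<phi> (verts G)" and im: "\<phi> ` verts G <= topspace X"
  and e: "!!e. e \<in> edges G ==> pathin X (\<gamma> e) \<and> inj_on (\<gamma> e) {0..1} \<and>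
    {\<gamma> e 0, \<gamma> e 1} = \<phi> ` e \<and> \<gamma> e ` {0<..<1} \<inter> \<phi> ` verts G = {}"
  and d: "!!e e'. e \<in> edges G ==> e' \<in> edges G ==> e ~= e' ==> \<gamma> e ` {0<..<1} \<inter> \<gamma> e' ` {0<..<1} = {}"
  using em unfolding embeds_in_def by metis
 have ep: "pathin X (\<gamma> e) \<and> inj_on (\<gamma> e) {0..1}" if "e \<in> edges G" for e using e[OF that] by blast
 obtain p where p: "p \<in> topspace X" "p \<notin> \<phi> ` verts G" "p \<notin> (\<Union>e\<in>edges G. \<gamma> e ` {0..1})"
  by (rule embeds_outside[OF rs G finite.emptyI ep]) blast+
 define \<phi>' where "\<phi>' = \<phi>(v := p)"
 have im': "\<phi>' ` insert v (verts G) = insert p (\<phi> ` verts G)" using v by (auto simp: \<phi>'_def)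
 have inj': "inj_on \<phi>' (insert v (verts G))"
  using inj p(2) v unfolding \<phi>'_def inj_on_def by (auto simp: image_iff)
 have eq: "\<phi>' ` e = \<phi> ` e" if "e \<in> edges G" for e
 proof (rule image_cong)
  fix x assume "x \<in> e"
  then have "x \<in> verts G" using that G by (auto simp: graphs_def)
  then show "\<phi>' x = \<phi> x" using v by (auto simp: \<phi>'_def)
 qed simp
 have pI: "p \<notin> \<gamma> e ` {0<..<1}" if "e \<in> edges G" for e using p(3) that by force
 show ?thesis unfolding embeds_in_def
  by (rule exI[of _ \<phi>'], rule exI[of _ \<gamma>])
   (use inj' im' im p e d eq pI in \<open>simp add: disjoint_iff\<close>)
qed

lemma embeds_empty: "embeds_in ({}, {}) X"
 unfolding embeds_in_def by auto

lemma embeds_iso: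
 assumes iso: "(G, H) \<in> graph_iso" and em: "embeds_in G X"
 shows "embeds_in H X"
proof -
 obtain \<phi> \<gamma> where inj: "inj_on \<phi> (verts G)" and im: "\<phi> ` verts G <= topspace X"
  and e: "!!e. e \<in> edges G ==> pathin X (\<gamma> e) \<and> inj_on (\<gamma> e) {0..1} \<and>
    {\<gamma> e 0, \<gamma> e 1} = \<phi> ` e \<and> \<gamma> e ` {0<..<1} \<inter> \<phi> ` verts G = {}"
  and d: "!!e e'. e \<in> edges G ==> e' \<in> edges G ==> e ~= e' ==> \<gamma> e ` {0<..<1} \<inter> \<gamma> e' ` {0<..<1} = {}"
  using em unfolding embeds_in_def by metis
 obtain f where f: "bij_betw f (verts G) (verts H)" "edges H = (`) f ` edges G" and G: "G \<in> graphs"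
  using iso unfolding graph_iso_def by blast
 define g where "g = inv_into (verts G) f"
 have gf: "g (f x) = x" if "x \<in> verts G" for x
  using f(1) that unfolding g_def bij_betw_def by (simp add: inv_into_f_f)
 have sub: "a <= verts G" if "a \<in> edges G" for a using G that by (auto simp: graphs_def)
 have gfe: "g ` f ` a = a" if "a \<in> edges G" for a
 proof -
  have "g ` f ` a = (\<lambda>x. x) ` a" unfolding image_image by (rule image_cong) (use gf sub[OF that] in auto)
  then show ?thesis by simp
 qed
 have vH: "verts H = f ` verts G" using f(1) by (simp add: bij_betw_def)
 have gH: "g ` verts H = verts G" unfolding vH image_image using gf by (auto simp: image_iff)
 have ginj: "inj_on g (verts H)" unfolding vH inj_on_def using gf by auto
 have im2: "(\<lambda>x. \<phi> (g x)) ` verts H = \<phi> ` verts G" using gH by (metis image_image)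
 show ?thesis unfolding embeds_in_def
 proof (intro exI conjI)
  show "inj_on (\<lambda>x. \<phi> (g x)) (verts H)"
   using comp_inj_on[OF ginj, of \<phi>] inj gH by (simp add: o_def)
  show "(\<lambda>x. \<phi> (g x)) ` verts H <= topspace X" using im im2 by simp
  show "\<forall>e\<in>edges H. pathin X (\<gamma> (g ` e)) \<and> inj_on (\<gamma> (g ` e)) {0..1} \<and>
    {\<gamma> (g ` e) 0, \<gamma> (g ` e) 1} = (\<lambda>x. \<phi> (g x)) ` e \<and> \<gamma> (g ` e) ` {0<..<1} \<inter> (\<lambda>x. \<phi> (g x)) ` verts H = {}"
  proof
   fix b assume "b \<in> edges H"
   then obtain a where a: "a \<in> edges G" "b = f ` a" using f(2) by blast
   have "g ` b = a" using gfe a by simp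
   moreover have "(\<lambda>x. \<phi> (g x)) ` b = \<phi> ` g ` b" by (simp add: image_image)
   ultimately show "pathin X (\<gamma> (g ` b)) \<and> inj_on (\<gamma> (g ` b)) {0..1} \<and>
    {\<gamma> (g ` b) 0, \<gamma> (g ` b) 1} = (\<lambda>x. \<phi> (g x)) ` b \<and> \<gamma> (g ` b) ` {0<..<1} \<inter> (\<lambda>x. \<phi> (g x)) ` verts H = {}"
    using e[OF a(1)] im2 by simp
  qed
  show "\<forall>e\<in>edges H. \<forall>e'\<in>edges H. e ~= e' --> \<gamma> (g ` e) ` {0<..<1} \<inter> \<gamma> (g ` e') ` {0<..<1} = {}"
   using d gfe f(2) by (metis imageE)
 qed
qed

section \<open>Graphs, isomorphism and contraction\<close>

lemma graphsD: "G \<in> graphs ==> e \<in> edges G ==> e <= verts G \<and> card e = 2"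
 unfolding graphs_def by auto

lemma edge_pair:
 assumes "G \<in> graphs" "e \<in> edges G" "x \<in> e"
 obtains y where "e = {x, y}" "y ~= x" "x \<in> verts G" "y \<in> verts G"
proof -
 have "card e = 2" "e <= verts G" using graphsD[OF assms(1,2)] by auto
 then obtain a b where ab: "e = {a, b}" "a ~= b" unfolding card_2_iff by blast
 show ?thesis
 proof (cases "x = a")
  case True
  then show ?thesis using that[of b] ab \<open>e <= verts G\<close> by auto
 next
  case False
  then have "x = b" using ab assms(3) by blast
  then show ?thesis using that[of a] ab \<open>e <= verts G\<close> by auto
 qed
qed

lemma edge_ne: "G \<in> graphs ==> {x, y} \<in> edges G ==> x ~= y \<and> x \<in> verts G \<and> y \<in> verts G"
 using graphsD[of G "{x, y}"] by (auto simp: card_insert_if split: if_splits)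

lemma graph_iso_refl: "G \<in> graphs ==> (G, G) \<in> graph_iso"
 unfolding graph_iso_def by (auto intro!: exI[of _ id])

lemma graph_iso_sym:
 assumes "(G, H) \<in> graph_iso" shows "(H, G) \<in> graph_iso"
proof -
 obtain f where f: "bij_betw f (verts G) (verts H)" "edges H = (`) f ` edges G" "G \<in> graphs" "H \<in> graphs"
  using assms unfolding graph_iso_def by blast
 define g where "g = inv_into (verts G) f"
 have g: "bij_betw g (verts H) (verts G)" unfolding g_def by (rule bij_betw_inv_into[OF f(1)])
 have "g ` f ` e = e" if "e \<in> edges G" for e
 proof -
  have "g ` f ` e = (\<lambda>x. x) ` e" unfolding image_image
   by (rule image_cong) (use f(1) graphsD[OF f(3) that] in \<open>auto simp: g_def bij_betw_def\<close>)
  then show ?thesis by simp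
 qed
 then have "edges G = (`) g ` edges H" unfolding f(2) image_image by simp
 then show ?thesis using g f unfolding graph_iso_def by blast
qed

lemma graph_iso_trans:
 assumes "(G, H) \<in> graph_iso" "(H, K) \<in> graph_iso" shows "(G, K) \<in> graph_iso"
proof -
 obtain f where f: "bij_betw f (verts G) (verts H)" "edges H = (`) f ` edges G" "G \<in> graphs"
  using assms unfolding graph_iso_def by blast
 obtain g where g: "bij_betw g (verts H) (verts K)" "edges K = (`) g ` edges H" "K \<in> graphs"
  using assms unfolding graph_iso_def by blast
 have "edges K = (`) (g \<circ> f) ` edges G" unfolding f g by (simp add: image_image image_comp o_def)
 then show ?thesis using bij_betw_trans[OF f(1) g(1)] f g unfolding graph_iso_def by blast
qed

lemma graph_iso_card:
 assumes "(G, H) \<in> graph_iso"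
 shows "card (verts H) = card (verts G)" "card (edges H) \<le> card (edges G)" "G \<in> graphs" "H \<in> graphs"
proof -
 obtain f where f: "bij_betw f (verts G) (verts H)" "edges H = (`) f ` edges G" and G: "G \<in> graphs" "H \<in> graphs"
  using assms unfolding graph_iso_def by blast
 show "card (verts H) = card (verts G)" using bij_betw_same_card[OF f(1)] by simp
 show "card (edges H) \<le> card (edges G)" unfolding f(2) using graphs_finite[OF G(1)] card_image_le by blast
qed (use assms in \<open>auto simp: graph_iso_def\<close>)

lemma iso_image:
 assumes "G \<in> graphs" "inj_on f (verts G)"
 shows "(G, (f ` verts G, (`) f ` edges G)) \<in> graph_iso"
proof -
 have "card (f ` e) = 2 \<and> f ` e <= f ` verts G" if "e \<in> edges G" for e
  using graphsD[OF assms(1) that] assms(2) card_image[of f e] inj_on_subset by fastforce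
 then have "(f ` verts G, (`) f ` edges G) \<in> graphs" using assms(1) unfolding graphs_def by auto
 then show ?thesis using assms unfolding graph_iso_def by (auto simp: bij_betw_def intro!: exI[of _ f])
qed

definition nbs :: "'a sgraph => 'a => 'a set" where "nbs G v = {u. {u, v} \<in> edges G}"

lemma contract_edges:
 assumes G: "G \<in> graphs" and us: "u ~= s"
 shows "edges (contract_edge G u s) = {e \<in> edges G. s \<notin> e} \<union> {{u, z} |z. {s, z} \<in> edges G \<and> z ~= u}"
  "verts (contract_edge G u s) = verts G - {s}"
proof -
 let ?f = "\<lambda>x. if x = s then u else x"
 have 1: "?f ` e = e" if "s \<notin> e" for e using that by force
 have 2: "?f ` {s, z} = {u, z}" if "z ~= s" for z using that by auto
 show "edges (contract_edge G u s) = {e \<in> edges G. s \<notin> e} \<union> {{u, z} |z. {s, z} \<in> edges G \<and> z ~= u}"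
 proof (intro equalityI subsetI)
  fix a assume "a \<in> edges (contract_edge G u s)"
  then obtain e where e: "e \<in> edges G" "a = ?f ` e" "card a = 2" unfolding contract_edge_def Let_def by auto
  show "a \<in> {e \<in> edges G. s \<notin> e} \<union> {{u, z} |z. {s, z} \<in> edges G \<and> z ~= u}"
  proof (cases "s \<in> e")
   case True
   obtain z where z: "e = {s, z}" "z ~= s" by (rule edge_pair[OF G e(1) True]) blast
   then have "a = {u, z}" using e(2) 2[of z] by simp
   moreover have "z ~= u" using \<open>a = {u, z}\<close> e(3) by auto
   moreover have "{s, z} \<in> edges G" using e(1) z(1) by simp
   ultimately show ?thesis by blast
  next
   case False
   then show ?thesis using e(1,2) 1[OF False] by simp
  qed
 next
  fix a assume "a \<in> {e \<in> edges G. s \<notin> e} \<union> {{u, z} |z. {s, z} \<in> edges G \<and> z ~= u}"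
  then have "\<exists>e\<in>edges G. a = ?f ` e \<and> card a = 2"
  proof
   assume "a \<in> {e \<in> edges G. s \<notin> e}"
   then show ?thesis using 1[of a] graphsD[OF G, of a] by (intro bexI[of _ a]) auto
  next
   assume "a \<in> {{u, z} |z. {s, z} \<in> edges G \<and> z ~= u}"
   then obtain z where z: "a = {u, z}" "{s, z} \<in> edges G" "z ~= u" by blast
   then show ?thesis using edge_ne[OF G z(2)] 2[of z] by (intro bexI[of _ "{s, z}"]) auto
  qed
  then show "a \<in> edges (contract_edge G u s)" unfolding contract_edge_def Let_def snd_conv mem_Collect_eq by metis
 qed
 show "verts (contract_edge G u s) = verts G - {s}" unfolding contract_edge_def Let_def by simp
qed

definition adj_twin :: "'a sgraph => 'a => 'a => bool" where
 "adj_twin G u v \<longleftrightarrow> {u, v} \<in> edges G \<or> nbs G u = nbs G v"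

text \<open>For an edge this is a contraction. Merging two non-adjacent twins is the same as
  deleting one of them, because the other has all its edges already.\<close>

lemma merge_minor:
 assumes G: "G \<in> graphs" and uv: "u ~= v" "u \<in> verts G" "v \<in> verts G" and at: "adj_twin G u v"
 shows "minor_step G (contract_edge G u v)"
proof (cases "{u, v} \<in> edges G")
 case True
 then show ?thesis using uv(1) by (rule minor_step.intros(3))
next
 case False
 then have tw: "nbs G u = nbs G v" using at by (simp add: adj_twin_def)
 have "{{u, z} |z. {v, z} \<in> edges G \<and> z ~= u} <= {e \<in> edges G. v \<notin> e}"
 proof
  fix a assume "a \<in> {{u, z} |z. {v, z} \<in> edges G \<and> z ~= u}"
  then obtain z where z: "a = {u, z}" "{v, z} \<in> edges G" "z ~= u" by blast
  have "z \<in> nbs G v" using z by (simp add: nbs_def insert_commute)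
  then have "{z, u} \<in> edges G" using tw by (auto simp: nbs_def)
  then show "a \<in> {e \<in> edges G. v \<notin> e}" using z uv(1) edge_ne[OF G z(2)] by (auto simp: insert_commute)
 qed
 then have "edges (contract_edge G u v) = {e \<in> edges G. v \<notin> e}" using contract_edges(1)[OF G uv(1)] by blast
 also have "\<dots> = {e \<in> edges G. e <= verts G - {v}}" using graphsD[OF G] by blast
 finally have "contract_edge G u v = induced_subgraph G (verts G - {v})"
  using contract_edges(2)[OF G uv(1)] unfolding induced_subgraph_def by (simp add: prod_eq_iff)
 then show ?thesis using minor_step.intros(1)[OF uv(3)] by simp
qed

text \<open>Away from \<open>u\<close> and \<open>v\<close> a neighbourhood only has
  \<open>v\<close> renamed to \<open>u\<close>, so equal ones stay equal. Disjoint pairs can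
  therefore be merged one after the other.\<close>

lemma adj_twin_contract:
 assumes G: "G \<in> graphs" and uv: "u ~= v" and at: "adj_twin G a b" and ab: "a \<notin> {u, v}" "b \<notin> {u, v}"
 shows "adj_twin (contract_edge G u v) a b"
proof (cases "{a, b} \<in> edges G")
 case True
 then show ?thesis using ab unfolding adj_twin_def contract_edges(1)[OF G uv] by auto
next
 case False
 then have tw: "nbs G a = nbs G b" using at by (simp add: adj_twin_def)
 have "nbs (contract_edge G u v) x = (\<lambda>y. if y = v then u else y) ` nbs G x" if x: "x \<notin> {u, v}" for x
 proof (intro equalityI subsetI)
  fix z assume "z \<in> nbs (contract_edge G u v) x"
  then have "{z, x} \<in> {e \<in> edges G. v \<notin> e} \<union> {{u, z} |z. {v, z} \<in> edges G \<and> z ~= u}"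
   unfolding nbs_def contract_edges(1)[OF G uv] by simp
  then show "z \<in> (\<lambda>y. if y = v then u else y) ` nbs G x"
  proof
   assume "{z, x} \<in> {e \<in> edges G. v \<notin> e}"
   then show ?thesis by (intro image_eqI[of _ _ z]) (auto simp: nbs_def)
  next
   assume "{z, x} \<in> {{u, z} |z. {v, z} \<in> edges G \<and> z ~= u}"
   then obtain y where "{z, x} = {u, y}" "{v, y} \<in> edges G" by blast
   then have "z = u" "{v, x} \<in> edges G" using x by (auto simp: doubleton_eq_iff)
   then show ?thesis by (intro image_eqI[of _ _ v]) (auto simp: nbs_def)
  qed
 next
  fix z assume "z \<in> (\<lambda>y. if y = v then u else y) ` nbs G x"
  then obtain y where y: "{y, x} \<in> edges G" "z = (if y = v then u else y)" by (auto simp: nbs_def)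
  have "{z, x} \<in> {e \<in> edges G. v \<notin> e} \<union> {{u, z} |z. {v, z} \<in> edges G \<and> z ~= u}"
   using y x by (cases "y = v") auto
  then show "z \<in> nbs (contract_edge G u v) x" unfolding nbs_def contract_edges(1)[OF G uv] by simp
 qed
 then show ?thesis using tw ab unfolding adj_twin_def by simp
qed

section \<open>Merging pairs and folding\<close>

fun merge_map :: "(nat \<times> nat) list => nat => nat" where
 "merge_map [] x = x"
| "merge_map ((u, v) # ps) x = merge_map ps (if x = v then u else x)"

definition pairs_ok :: "nat sgraph => (nat \<times> nat) list => bool" where
 "pairs_ok G ps \<longleftrightarrow> distinct (map fst ps @ map snd ps) \<and> set (map fst ps @ map snd ps) <= verts G \<and>
   (\<forall>(u, v)\<in>set ps. adj_twin G u v)"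

lemma merge_map_cases:
 "distinct (map fst ps @ map snd ps) ==> merge_map ps x = x \<or> (merge_map ps x, x) \<in> set ps"
proof (induction ps arbitrary: x)
 case (Cons p ps)
 obtain u v where p: "p = (u, v)" by force
 have id: "merge_map qs y = y" if "y \<notin> snd ` set qs" for qs y
  using that by (induction qs) auto
 show ?case
 proof (cases "x = v")
  case True
  have "merge_map ps u = u" by (rule id) (use Cons.prems p in auto)
  then show ?thesis using True p by simp
 next
  case False
  then show ?thesis using Cons p by auto
 qed
qed simp

lemma merge_pairs:
 assumes cl: "!!G H. G \<in> \<D> ==> minor_step G H ==> H \<in> \<D>" and sub: "\<D> <= graphs"
 shows "G \<in> \<D> ==> pairs_ok G ps ==> \<exists>Q\<in>\<D>. verts Q = verts G - snd ` set ps \<and>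
  (\<forall>e\<in>edges G. \<exists>x y. e = {x, y} \<and> (merge_map ps x = merge_map ps y \<or> {merge_map ps x, merge_map ps y} \<in> edges Q))"
proof (induction ps arbitrary: G)
 case Nil
 have "\<exists>x y. e = {x, y} \<and> {x, y} \<in> edges G" if "e \<in> edges G" for e
 proof -
  have "G \<in> graphs" using Nil sub by blast
  then have "card e = 2" using graphsD that by blast
  then show ?thesis using that unfolding card_2_iff by metis
 qed
 then have "\<forall>e\<in>edges G. \<exists>x y. e = {x, y} \<and> (x = y \<or> {x, y} \<in> edges G)" by blast
 then show ?case using Nil by (intro bexI[of _ G]) simp_all
next
 case (Cons p ps)
 obtain u v where p: "p = (u, v)" by force
 have G: "G \<in> graphs" using Cons.prems sub by blast
 have uv: "u ~= v" "u \<in> verts G" "v \<in> verts G" "adj_twin G u v" using Cons.prems(2) p by (auto simp: pairs_ok_def)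
 define G1 where "G1 = contract_edge G u v"
 have G1: "G1 \<in> \<D>" unfolding G1_def using cl[OF Cons.prems(1) merge_minor[OF G uv]] .
 have ok1: "pairs_ok G1 ps"
 proof -
  have d: "distinct (map fst ps @ map snd ps)" "set (map fst ps @ map snd ps) <= verts G - {u, v}"
   using Cons.prems(2) p by (auto simp: pairs_ok_def)
  have at: "adj_twin G a b" if "(a, b) \<in> set ps" for a b using Cons.prems(2) that unfolding pairs_ok_def by auto
  have "adj_twin G1 a b" if ab: "(a, b) \<in> set ps" for a b
  proof -
   have "a \<in> fst ` set ps" "b \<in> snd ` set ps" using ab by force+
   then have "a \<notin> {u, v}" "b \<notin> {u, v}" using d(2) by auto
   then show ?thesis unfolding G1_def by (intro adj_twin_contract[OF G uv(1) at[OF ab]])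
  qed
  then show ?thesis using d contract_edges(2)[OF G uv(1)] unfolding pairs_ok_def G1_def by auto
 qed
 obtain Q where Q: "Q \<in> \<D>" "verts Q = verts G1 - snd ` set ps"
   "\<forall>e\<in>edges G1. \<exists>x y. e = {x, y} \<and> (merge_map ps x = merge_map ps y \<or> {merge_map ps x, merge_map ps y} \<in> edges Q)"
  using Cons.IH[OF G1 ok1] by blast
 let ?f = "\<lambda>x. if x = v then u else x"
 have "\<exists>x y. e = {x, y} \<and> (merge_map (p # ps) x = merge_map (p # ps) y \<or> {merge_map (p # ps) x, merge_map (p # ps) y} \<in> edges Q)"
  if e: "e \<in> edges G" for e
 proof -
  have "e ~= {}" using graphsD[OF G e] by auto
  then obtain x where "x \<in> e" by blast
  then obtain y where y: "e = {x, y}" "y ~= x" by (rule edge_pair[OF G e]) blast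
  show ?thesis
  proof (cases "?f x = ?f y")
   case True
   then show ?thesis using y p by (intro exI[of _ x] exI[of _ y]) simp
  next
   case False
   have fe: "{?f x, ?f y} \<in> edges G1"
   proof -
    have eq: "{?f x, ?f y} = ?f ` e" unfolding y(1) by (simp only: image_insert image_empty)
    have c: "card {?f x, ?f y} = 2" using False by (simp only: card_2_iff) blast
    show ?thesis unfolding G1_def contract_edge_def Let_def snd_conv mem_Collect_eq
     by (rule exI[of _ e]) (intro conjI eq e c[unfolded eq])
   qed
   obtain a b where ab: "{?f x, ?f y} = {a, b}" "merge_map ps a = merge_map ps b \<or> {merge_map ps a, merge_map ps b} \<in> edges Q"
    using bspec[OF Q(3) fe] by (elim exE conjE) (rule that)
   from ab(1) have "?f x = a \<and> ?f y = b \<or> ?f x = b \<and> ?f y = a" unfolding doubleton_eq_iff .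
   then have "merge_map ps (?f x) = merge_map ps (?f y) \<or> {merge_map ps (?f x), merge_map ps (?f y)} \<in> edges Q"
   proof (elim disjE conjE)
    assume q: "?f x = b" "?f y = a"
    have "{b, a} = {a, b}" for a b :: nat by (rule insert_commute)
    then show ?thesis unfolding q using ab(2) by (metis (no_types))
   qed (use ab(2) in simp)
   then show ?thesis using y p by (intro exI[of _ x] exI[of _ y]) simp
  qed
 qed
 moreover have "verts Q = verts G - snd ` set (p # ps)"
  using Q(2) contract_edges(2)[OF G uv(1)] p unfolding G1_def by auto
 ultimately show ?case using Q(1) by blast
qed

text \<open>\<open>G\<close> lives on at most two copies of each vertex of \<open>Q\<close>, with edges only inside or between copies
 of adjacent vertices, so that \<open>G\<close> is determined by \<open>Q\<close> and a bounded amount of information per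
 vertex and edge of \<open>Q\<close>.\<close>

definition folds :: "nat sgraph => nat sgraph => bool" where
 "folds G Q \<longleftrightarrow> (\<exists>\<pi> b::nat => nat. (\<forall>x\<in>verts G. \<pi> x \<in> verts Q \<and> b x \<le> 1) \<and> inj_on (\<lambda>x. (\<pi> x, b x)) (verts G) \<and>
   (\<forall>e\<in>edges G. \<exists>x y. e = {x, y} \<and> (\<pi> x = \<pi> y \<or> {\<pi> x, \<pi> y} \<in> edges Q)))"

lemma folds_iso:
 assumes "folds G Q" "(Q, Q') \<in> graph_iso" "G \<in> graphs" shows "folds G Q'"
proof -
 obtain \<pi> b where f: "\<forall>x\<in>verts G. \<pi> x \<in> verts Q \<and> b x \<le> (1::nat)" "inj_on (\<lambda>x. (\<pi> x, b x)) (verts G)"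
   "\<forall>e\<in>edges G. \<exists>x y. e = {x, y} \<and> (\<pi> x = \<pi> y \<or> {\<pi> x, \<pi> y} \<in> edges Q)"
  using assms(1) unfolding folds_def by blast
 obtain h where h: "bij_betw h (verts Q) (verts Q')" "edges Q' = (`) h ` edges Q"
  using assms(2) unfolding graph_iso_def by blast
 have hi: "h x = h y ==> x \<in> verts Q ==> y \<in> verts Q ==> x = y" for x y
  using h(1) by (meson bij_betw_imp_inj_on inj_onD)
 show ?thesis unfolding folds_def
 proof (intro exI conjI)
  show "\<forall>x\<in>verts G. h (\<pi> x) \<in> verts Q' \<and> b x \<le> 1" using f(1) h(1) bij_betwE by blast
  show "inj_on (\<lambda>x. (h (\<pi> x), b x)) (verts G)"
   using f(1,2) hi unfolding inj_on_def by (metis prod.inject)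
  show "\<forall>e\<in>edges G. \<exists>x y. e = {x, y} \<and> (h (\<pi> x) = h (\<pi> y) \<or> {h (\<pi> x), h (\<pi> y)} \<in> edges Q')"
  proof
   fix e assume "e \<in> edges G"
   then obtain x y where xy: "e = {x, y}" "\<pi> x = \<pi> y \<or> {\<pi> x, \<pi> y} \<in> edges Q" using f(3) by blast
   have "{h (\<pi> x), h (\<pi> y)} \<in> edges Q'" if "{\<pi> x, \<pi> y} \<in> edges Q"
    unfolding h(2) using that by (intro image_eqI[of _ _ "{\<pi> x, \<pi> y}"]) auto
   then show "\<exists>x y. e = {x, y} \<and> (h (\<pi> x) = h (\<pi> y) \<or> {h (\<pi> x), h (\<pi> y)} \<in> edges Q')" using xy by metis
  qed
 qed
qed

definition vcov :: "nat sgraph => nat set" where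
 "vcov Q = (\<lambda>q. 2 * q) ` verts Q \<union> (\<lambda>q. 2 * q + 1) ` verts Q"

text \<open>Copy \<open>b\<close> of the vertex \<open>q\<close> is the number
  \<open>2 * q + b\<close>. Admitting all subsets of the four copies over an edge, whatever their
  size, gives the simple count of 16 per edge.\<close>

definition ecov :: "nat sgraph => nat set set" where
 "ecov Q = (\<Union>e\<in>edges Q. Pow {x. x div 2 \<in> e}) \<union> (\<lambda>q. {2 * q, 2 * q + 1}) ` verts Q"

lemma vcov_card: "finite (verts Q) ==> finite (vcov Q) \<and> card (vcov Q) \<le> 2 * card (verts Q)"
 unfolding vcov_def using card_image_le[of "verts Q" "\<lambda>q. 2 * q"] card_image_le[of "verts Q" "\<lambda>q. 2 * q + 1"]
  card_Un_le[of "(\<lambda>q. 2 * q) ` verts Q" "(\<lambda>q. 2 * q + 1) ` verts Q"] by auto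

lemma ecov_card:
 assumes "Q \<in> graphs" shows "finite (ecov Q) \<and> card (ecov Q) \<le> 16 * card (edges Q) + card (verts Q)"
proof -
 note fin = graphs_finite[OF assms]
 have ev: "{x. x div 2 \<in> e} = (\<lambda>q. 2 * q) ` e \<union> (\<lambda>q. 2 * q + 1) ` e" for e :: "nat set"
 proof (intro equalityI subsetI)
  fix x assume "x \<in> {x. x div 2 \<in> e}"
  then have x: "x div 2 \<in> e" by simp
  have "x = 2 * (x div 2) \<or> x = 2 * (x div 2) + 1" by presburger
  then show "x \<in> (\<lambda>q. 2 * q) ` e \<union> (\<lambda>q. 2 * q + 1) ` e" using x by blast
 qed auto
 have pw: "finite (Pow {x. x div 2 \<in> e}) \<and> card (Pow {x. x div 2 \<in> e}) \<le> 16" if "e \<in> edges Q" for e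
 proof -
  have c: "card e = 2" using graphsD[OF assms that] by blast
  then have f: "finite e" by (metis card.infinite zero_neq_numeral)
  have "card {x. x div 2 \<in> e} \<le> card ((\<lambda>q. 2 * q) ` e) + card ((\<lambda>q. 2 * q + 1) ` e)" unfolding ev by (rule card_Un_le)
  also have "\<dots> \<le> 2 + 2" using card_image_le[OF f, of "\<lambda>q. 2 * q"] card_image_le[OF f, of "\<lambda>q. 2 * q + 1"] c by linarith
  finally have "card {x. x div 2 \<in> e} \<le> 4" by simp
  moreover have "finite {x. x div 2 \<in> e}" unfolding ev using f by simp
  ultimately have "card (Pow {x. x div 2 \<in> e}) \<le> 2 ^ 4" unfolding card_Pow[OF \<open>finite {x. x div 2 \<in> e}\<close>]
   by (intro power_increasing) auto
  then show ?thesis using \<open>finite {x. x div 2 \<in> e}\<close> by simp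
 qed
 have "card (\<Union>e\<in>edges Q. Pow {x. x div 2 \<in> e}) \<le> (\<Sum>e\<in>edges Q. card (Pow {x. x div 2 \<in> e}))"
  by (rule card_UN_le) (use fin in blast)
 also have "\<dots> \<le> card (edges Q) * 16" using sum_bounded_above[of "edges Q" "\<lambda>e. card (Pow {x. x div 2 \<in> e})" 16] pw by simp
 finally have 1: "card (\<Union>e\<in>edges Q. Pow {x. x div 2 \<in> e}) \<le> card (edges Q) * 16" .
 have 2: "card ((\<lambda>q. {2 * q, 2 * q + 1}) ` verts Q) \<le> card (verts Q)" using fin card_image_le by blast
 have "finite (\<Union>e\<in>edges Q. Pow {x. x div 2 \<in> e})" using fin pw by blast
 then have "finite (ecov Q)" using fin unfolding ecov_def by simp
 moreover have "card (ecov Q) \<le> 16 * card (edges Q) + card (verts Q)"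
  unfolding ecov_def using card_Un_le[of "\<Union>e\<in>edges Q. Pow {x. x div 2 \<in> e}"] 1 2
  by (smt (verit, best) add_mono le_trans mult.commute)
 ultimately show ?thesis by blast
qed

lemma folds_lift:
 assumes "folds G Q" and G: "G \<in> graphs"
 shows "\<exists>H\<in>Pow (vcov Q) \<times> Pow (ecov Q). (G, H) \<in> graph_iso"
proof -
 obtain \<pi> b where f: "\<forall>x\<in>verts G. \<pi> x \<in> verts Q \<and> b x \<le> (1::nat)" and inj: "inj_on (\<lambda>x. (\<pi> x, b x)) (verts G)"
   and ed: "\<forall>e\<in>edges G. \<exists>x y. e = {x, y} \<and> (\<pi> x = \<pi> y \<or> {\<pi> x, \<pi> y} \<in> edges Q)"
  using assms(1) unfolding folds_def by (elim exE conjE) (rule that)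
 define i where "i x = 2 * \<pi> x + b x" for x
 have i2: "i x div 2 = \<pi> x" "i x mod 2 = b x" if "x \<in> verts G" for x using bspec[OF f that] unfolding i_def by auto
 have "inj_on i (verts G)"
 proof (rule inj_onI)
  fix x y assume xy: "x \<in> verts G" "y \<in> verts G" "i x = i y"
  then have "(\<pi> x, b x) = (\<pi> y, b y)" using i2[OF xy(1)] i2[OF xy(2)] by simp
  then show "x = y" using inj_onD[OF inj _ xy(1,2)] by simp
 qed
 then have iso: "(G, (i ` verts G, (`) i ` edges G)) \<in> graph_iso" by (rule iso_image[OF G])
 have vs: "i ` verts G <= vcov Q"
 proof
  fix z assume "z \<in> i ` verts G"
  then obtain x where x: "x \<in> verts G" "z = i x" by blast
  then have "\<pi> x \<in> verts Q" "z = 2 * \<pi> x \<or> z = 2 * \<pi> x + 1" using bspec[OF f x(1)] unfolding i_def by auto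
  then show "z \<in> vcov Q" unfolding vcov_def by blast
 qed
 have "i ` e \<in> ecov Q" if e: "e \<in> edges G" for e
 proof -
  obtain x y where xy: "e = {x, y}" "\<pi> x = \<pi> y \<or> {\<pi> x, \<pi> y} \<in> edges Q"
   using bspec[OF ed e] by (elim exE conjE) (rule that)
  have v: "x \<in> verts G" "y \<in> verts G" "x ~= y" using edge_ne[OF G e[unfolded xy(1)]] by auto
  show ?thesis using xy(2)
  proof
   assume q: "{\<pi> x, \<pi> y} \<in> edges Q"
   have "i ` e \<in> Pow {z. z div 2 \<in> {\<pi> x, \<pi> y}}" using xy(1) i2(1)[OF v(1)] i2(1)[OF v(2)] by simp
   then show ?thesis using q unfolding ecov_def by blast
  next
   assume pe: "\<pi> x = \<pi> y"
   have "b x ~= b y" using inj_onD[OF inj _ v(1,2)] pe v(3) by auto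
   then have "b x = 0 \<and> b y = 1 \<or> b x = 1 \<and> b y = 0" using bspec[OF f v(1)] bspec[OF f v(2)] by linarith
   then have "i ` e = {2 * \<pi> x, 2 * \<pi> x + 1}" using pe unfolding xy(1) i_def by (elim disjE conjE) auto
   then show ?thesis using bspec[OF f v(1)] unfolding ecov_def by blast
  qed
 qed
 then have "(`) i ` edges G <= ecov Q" by blast
 then show ?thesis using iso vs by (intro bexI[of _ "(i ` verts G, (`) i ` edges G)"]) simp_all
qed

section \<open>Exponential counting of sparse classes\<close>

text \<open>Each such subset is read off a list of length \<open>k\<close>, where
  \<open>None\<close> pads the list.\<close>

lemma card_small_subsets:
 assumes "finite S"
 shows "finite {T. T <= S \<and> card T \<le> k} \<and> card {T. T <= S \<and> card T \<le> k} \<le> (card S + 1) ^ k"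
proof -
 define S' where "S' = insert None (Some ` S)"
 have fO: "finite S'" "card S' = card S + 1" using assms by (auto simp: S'_def card_image)
 let ?L = "{xs. set xs <= S' \<and> length xs = k}"
 have "{T. T <= S \<and> card T \<le> k} <= (\<lambda>xs. {x. Some x \<in> set xs}) ` ?L"
 proof
  fix T assume T: "T \<in> {T. T <= S \<and> card T \<le> k}"
  then have "finite T" using assms finite_subset by blast
  then obtain ys where ys: "set ys = T" "distinct ys" using finite_distinct_list by blast
  then have "length ys \<le> k" using T distinct_card by fastforce
  then show "T \<in> (\<lambda>xs. {x. Some x \<in> set xs}) ` ?L"
   using ys T by (intro image_eqI[of _ _ "map Some ys @ replicate (k - length ys) None"]) (auto simp: S'_def)
 qed
 note sub = this
 have L: "finite ?L" "card ?L = (card S + 1) ^ k"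
  using finite_lists_length_eq[OF fO(1), of k] card_lists_length_eq[OF fO(1), of k] fO(2) by auto
 show ?thesis
  using finite_subset[OF sub finite_imageI[OF L(1)]]
   le_trans[OF card_mono[OF finite_imageI[OF L(1)] sub] card_image_le[OF L(1)]] L(2) by simp
qed

text \<open>A bound on the number of isomorphism types by way of representatives. These may come
  from anywhere, so the recursion can build them freely.\<close>

definition represented :: "nat sgraph set => nat => nat => bool" where
 "represented \<D> n k \<longleftrightarrow> (\<exists>R. finite R \<and> card R \<le> k \<and> (\<forall>G\<in>\<D>. card (verts G) = n --> (\<exists>Q\<in>R. (G, Q) \<in> graph_iso)))"

lemma iso_class_eq: assumes "(G, H) \<in> graph_iso" shows "graph_iso `` {G} = graph_iso `` {H}"
proof (intro equalityI subsetI)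
 fix K assume "K \<in> graph_iso `` {G}"
 then show "K \<in> graph_iso `` {H}" using graph_iso_trans[OF graph_iso_sym[OF assms]] by simp
next
 fix K assume "K \<in> graph_iso `` {H}"
 then show "K \<in> graph_iso `` {G}" using graph_iso_trans[OF assms] by simp
qed

lemma represented_unlabelled:
 assumes "represented \<D> n k"
 shows "finite (unlabelled {G \<in> \<D>. card (verts G) = n}) \<and> card (unlabelled {G \<in> \<D>. card (verts G) = n}) \<le> k"
proof -
 obtain R where R: "finite R" "card R \<le> k" "\<forall>G\<in>\<D>. card (verts G) = n --> (\<exists>Q\<in>R. (G, Q) \<in> graph_iso)"
  using assms unfolding represented_def by (elim exE conjE) (rule that)
 have sub: "unlabelled {G \<in> \<D>. card (verts G) = n} <= (\<lambda>Q. graph_iso `` {Q}) ` R"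
 proof
  fix c assume "c \<in> unlabelled {G \<in> \<D>. card (verts G) = n}"
  then obtain G where G: "G \<in> \<D>" "card (verts G) = n" "c = graph_iso `` {G}" unfolding unlabelled_def quotient_def by blast
  then obtain Q where Q: "Q \<in> R" "(G, Q) \<in> graph_iso" using R(3) by blast
  have "graph_iso `` {G} = graph_iso `` {Q}" by (rule iso_class_eq[OF Q(2)])
  then show "c \<in> (\<lambda>Q. graph_iso `` {Q}) ` R" using Q G by blast
 qed
 show ?thesis
  using finite_subset[OF sub finite_imageI[OF R(1)]]
   le_trans[OF card_mono[OF finite_imageI[OF R(1)] sub] card_image_le[OF R(1)]] R(2) by simp
qed

text \<open>The additive defect \<open>g\<close> grows with the genus on surfaces and is 1 for a
  proper minor-closed class. It is kept apart from \<open>c\<close> in order to enter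
  \<open>base\<close> but not \<open>rate\<close>.\<close>

locale sparse_class =
 fixes \<D> :: "nat sgraph set" and c g :: nat
 assumes graphs: "\<D> <= graphs" and minor: "G \<in> \<D> ==> minor_step G H ==> H \<in> \<D>"
  and few_edges: "G \<in> \<D> ==> card (edges G) \<le> c * (card (verts G) + g)"
  and few_nbs: "G \<in> \<D> ==> L <= verts G ==> (!!e. e \<in> edges G ==> \<not> e <= L) ==> inj_on (nbs G) L ==>
    card L \<le> c * (card (verts G - L) + g)"
  and c: "c > 0"
begin

text \<open>In a longest list of \<open>p\<close> disjoint pairs, the unpaired vertices are
  independent with distinct neighbourhoods, so there are at most \<open>c (2 p + g)\<close> of them.
  Hence \<open>n \<le> (2 c + 2) p + c g\<close>, and for \<open>2 c g \<le> n\<close> the last term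
  is at most \<open>n / 2\<close>: merging removes a proportion of at least
  \<open>1 / (4 c + 4)\<close> of the vertices.\<close>

lemma fold_step:
 assumes G: "G \<in> \<D>" and big: "2 * c * g \<le> card (verts G)"
 shows "\<exists>Q\<in>\<D>. folds G Q \<and> (4 * c + 4) * card (verts Q) + card (verts G) \<le> (4 * c + 4) * card (verts G)"
proof -
 have Gg: "G \<in> graphs" using G graphs by blast
 have fin: "finite (verts G)" using graphs_finite[OF Gg] by blast
 have len: "2 * length ps \<le> card (verts G)" if "pairs_ok G ps" for ps
 proof -
  have "card (set (map fst ps @ map snd ps)) \<le> card (verts G)"
   by (rule card_mono[OF fin]) (use that in \<open>simp add: pairs_ok_def\<close>)
  moreover have "card (set (map fst ps @ map snd ps)) = length (map fst ps @ map snd ps)"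
   using that unfolding pairs_ok_def by (intro distinct_card) blast
  ultimately show ?thesis by simp
 qed
 have "pairs_ok G []" by (simp add: pairs_ok_def)
 moreover have "\<forall>qs. pairs_ok G qs --> length qs < card (verts G) + 1" using len by fastforce
 ultimately have "\<exists>ps. pairs_ok G ps \<and> (\<forall>qs. pairs_ok G qs --> length qs \<le> length ps)"
  by (rule ex_has_greatest_nat)
 then obtain ps where ps: "pairs_ok G ps" "\<forall>qs. pairs_ok G qs --> length qs \<le> length ps"
  by (elim exE conjE) (rule that)
 define Y where "Y = set (map fst ps @ map snd ps)"
 define L where "L = verts G - Y"
 have YV: "Y <= verts G" using ps(1) by (simp add: pairs_ok_def Y_def)
 have cY: "card Y = 2 * length ps"
 proof -
  have "distinct (map fst ps @ map snd ps)" using ps(1) unfolding pairs_ok_def by blast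
  from distinct_card[OF this] show ?thesis by (simp add: Y_def)
 qed
 have ext: "\<not> adj_twin G u v" if "u \<in> L" "v \<in> L" "u ~= v" for u v
 proof
  assume "adj_twin G u v"
  then have "pairs_ok G ((u, v) # ps)"
   using ps(1) that unfolding pairs_ok_def L_def Y_def by auto
  then have "length ((u, v) # ps) \<le> length ps" using ps(2) by blast
  then show False by simp
 qed
 have "card L \<le> c * (card (verts G - L) + g)"
 proof (rule few_nbs[OF G])
  show "L <= verts G" by (auto simp: L_def)
  show "inj_on (nbs G) L" using ext unfolding inj_on_def adj_twin_def by blast
  fix e assume e: "e \<in> edges G"
  show "\<not> e <= L"
  proof
   assume eL: "e <= L"
   have "e ~= {}" using graphsD[OF Gg e] by auto
   then obtain x where "x \<in> e" by blast
   then obtain y where "e = {x, y}" "y ~= x" by (rule edge_pair[OF Gg e]) blast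
   then show False using ext[of x y] eL e by (auto simp: adj_twin_def)
  qed
 qed
 moreover have "verts G - L = Y" using YV by (auto simp: L_def)
 ultimately have cL: "card L \<le> c * (2 * length ps + g)" using cY by simp
 have "card (verts G) = card L + card Y"
  using card_Diff_subset[of Y "verts G"] YV fin card_mono[OF fin YV] finite_subset[OF YV fin] by (simp add: L_def)
 then have "2 * card (verts G) \<le> 2 * (c * (2 * length ps + g) + 2 * length ps)" using cL cY by simp
 also have "\<dots> = (4 * c + 4) * length ps + 2 * c * g" by (simp add: algebra_simps)
 finally have key: "card (verts G) \<le> (4 * c + 4) * length ps" using big by linarith
 obtain Q where Q: "Q \<in> \<D>" "verts Q = verts G - snd ` set ps"
   "\<forall>e\<in>edges G. \<exists>x y. e = {x, y} \<and> (merge_map ps x = merge_map ps y \<or> {merge_map ps x, merge_map ps y} \<in> edges Q)"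
 proof (rule bexE[OF merge_pairs[OF _ graphs G ps(1)]])
  show "!!G H. G \<in> \<D> ==> minor_step G H ==> H \<in> \<D>" by (rule minor)
 qed (elim conjE, rule that)
 have dist: "distinct (map fst ps @ map snd ps)" using ps(1) by (simp add: pairs_ok_def)
 have sv: "snd ` set ps <= verts G" using ps(1) by (auto simp: pairs_ok_def)
 have "card (snd ` set ps) = length ps"
 proof -
  have "distinct (map snd ps)" using dist by simp
  from distinct_card[OF this] show ?thesis by simp
 qed
 then have cQ: "card (verts Q) + length ps = card (verts G)"
  unfolding Q(2) using card_Diff_subset[of "snd ` set ps" "verts G"] sv card_mono[OF fin sv] by simp
 have "folds G Q" unfolding folds_def
 proof (intro exI conjI)
  \<comment> \<open>The bit marks the vertex of a pair that is merged into its partner.\<close>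
  let ?b = "\<lambda>x. if merge_map ps x = x then 0 else 1::nat"
  note mc = merge_map_cases[OF dist]
  show "\<forall>x\<in>verts G. merge_map ps x \<in> verts Q \<and> ?b x \<le> 1"
  proof (intro ballI conjI)
   fix x assume x: "x \<in> verts G"
   have nf: "z \<notin> snd ` set ps" if "z \<in> fst ` set ps" for z using dist that by auto
   show "merge_map ps x \<in> verts Q"
   proof (cases "x \<in> snd ` set ps")
    case True
    then obtain u where u: "(u, x) \<in> set ps" by force
    have id: "merge_map qs y = y" if "y \<notin> snd ` set qs" for qs y
     using that by (induction qs) auto
    have "merge_map qs x \<in> fst ` set qs" if "x \<in> snd ` set qs" "distinct (map fst qs @ map snd qs)" for qs
     using that
    proof (induction qs)
     case (Cons q qs)
     obtain a b where q: "q = (a, b)" by force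
     show ?case
     proof (cases "x = b")
      case True
      then have "merge_map (q # qs) x = merge_map qs a" using q by simp
      also have "\<dots> = a" by (rule id) (use Cons.prems q in auto)
      finally show ?thesis using q by simp
     next
      case False
      then show ?thesis using Cons q by auto
     qed
    qed simp
    then have m: "merge_map ps x \<in> fst ` set ps" using True dist by blast
    then have "merge_map ps x \<in> verts G" using ps(1) by (auto simp: pairs_ok_def)
    then show ?thesis using nf[OF m] Q(2) by blast
   next
    case False
    then have "(merge_map ps x, x) \<notin> set ps" by force
    then have "merge_map ps x = x" using mc[of x] by blast
    then show ?thesis using False x Q(2) by simp
   qed
  qed simp
  show "inj_on (\<lambda>x. (merge_map ps x, ?b x)) (verts G)"
  proof (rule inj_onI)
   fix x y assume e: "(merge_map ps x, ?b x) = (merge_map ps y, ?b y)"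
   show "x = y"
   proof (cases "merge_map ps x = x")
    case True
    then show ?thesis using e by (auto split: if_splits)
   next
    case False
    then have "(merge_map ps x, x) \<in> set ps" "(merge_map ps x, y) \<in> set ps"
     using mc[of x] mc[of y] e by (auto split: if_splits)
    moreover have "distinct (map fst ps)" using dist by simp
    ultimately show ?thesis by (metis eq_key_imp_eq_value)
   qed
  qed
  show "\<forall>e\<in>edges G. \<exists>x y. e = {x, y} \<and> (merge_map ps x = merge_map ps y \<or> {merge_map ps x, merge_map ps y} \<in> edges Q)"
   by (rule Q(3))
 qed
 moreover have "(4 * c + 4) * card (verts Q) + card (verts G) \<le> (4 * c + 4) * card (verts G)"
 proof -
  have "(4 * c + 4) * card (verts Q) + (4 * c + 4) * length ps = (4 * c + 4) * card (verts G)"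
   using cQ by (metis add_mult_distrib2)
  then show ?thesis using key by linarith
 qed
 ultimately show ?thesis using Q(1) by blast
qed

text \<open>For fewer than \<open>2 * c * g\<close> vertices, where \<open>fold_step\<close> does
  not apply: at most \<open>(2 * c * g) ^ 2\<close> pairs of vertices, of which at most
  \<open>c * (2 * c * g + g)\<close> are edges.\<close>

definition base :: nat where "base = ((2 * c * g) ^ 2 + 1) ^ (c * (2 * c * g + g))"
text \<open>With \<open>d = 4 * c + 4\<close> and \<open>a = 32 * c + 4\<close> this is
  \<open>2 ^ (a * d)\<close>. The folded graph has at most \<open>(1 - 1 / d) n\<close> vertices, so
  the recursion gains a factor \<open>2 ^ (a * n)\<close>, and this pays for the choice of the order
  and for unfolding.\<close>

definition rate :: nat where "rate = 2 ^ ((32 * c + 4) * (4 * c + 4))"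

lemma represented_small:
 assumes "n < 2 * c * g" shows "represented \<D> n base"
proof -
 define Pr where "Pr = {e. e <= {..<n} \<and> card e = 2}"
 define M where "M = c * (n + g)"
 have "Pr <= (\<lambda>(x, y). {x, y}) ` ({..<n} \<times> {..<n})"
 proof
  fix e assume "e \<in> Pr"
  then obtain x y where "e = {x, y}" "e <= {..<n}" unfolding Pr_def card_2_iff by blast
  then show "e \<in> (\<lambda>(x, y). {x, y}) ` ({..<n} \<times> {..<n})" by auto
 qed
 then have P: "finite Pr" "card Pr \<le> n * n"
  using card_mono[of "(\<lambda>(x, y). {x, y}) ` ({..<n} \<times> {..<n})" Pr] card_image_le[of "{..<n} \<times> {..<n}" "\<lambda>(x, y). {x, y}"]
  by (auto intro: finite_subset simp: card_cartesian_product)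
 define R where "R = Pair {..<n} ` {T. T <= Pr \<and> card T \<le> M}"
 have "finite R" using card_small_subsets[OF P(1), of M] by (simp add: R_def)
 moreover have "card R \<le> base"
 proof -
  have "card R \<le> card {T. T <= Pr \<and> card T \<le> M}" unfolding R_def using card_small_subsets[OF P(1), of M] card_image_le by blast
  also have "\<dots> \<le> (card Pr + 1) ^ M" using card_small_subsets[OF P(1), of M] by blast
  also have "\<dots> \<le> ((2 * c * g) ^ 2 + 1) ^ M"
  proof (rule power_mono)
   have "n * n \<le> (2 * c * g) * (2 * c * g)" using assms by (intro mult_le_mono) auto
   then show "card Pr + 1 \<le> (2 * c * g)\<^sup>2 + 1" using P(2) by (simp add: power2_eq_square)
  qed simp
  also have "\<dots> \<le> base" unfolding base_def M_def
   using assms by (intro power_increasing mult_le_mono) auto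
  finally show ?thesis .
 qed
 moreover have "\<exists>Q\<in>R. (G, Q) \<in> graph_iso" if G: "G \<in> \<D>" "card (verts G) = n" for G
 proof -
  have Gg: "G \<in> graphs" using G graphs by blast
  obtain f where f: "bij_betw f (verts G) {0..<n}"
   using ex_bij_betw_finite_nat graphs_finite[OF Gg] G(2) by blast
  define H where "H = (f ` verts G, (`) f ` edges G)"
  have iso: "(G, H) \<in> graph_iso" unfolding H_def using f by (intro iso_image[OF Gg]) (simp add: bij_betw_def)
  have vH: "verts H = {..<n}" using f by (auto simp: H_def bij_betw_def)
  note Hc = graph_iso_card[OF iso]
  have "edges H <= Pr" using graphsD[OF Hc(4)] vH unfolding Pr_def by blast
  moreover have "card (edges H) \<le> M" using Hc(2) few_edges[OF G(1)] G(2) by (simp add: M_def)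
  ultimately have "H \<in> R" unfolding R_def using vH by (intro image_eqI[of _ _ "edges H"]) (auto simp: prod_eq_iff)
  then show ?thesis using iso by blast
 qed
 ultimately show ?thesis unfolding represented_def by blast
qed

lemma represented_all: "represented \<D> n (base * rate ^ n)"
proof (induction n rule: less_induct)
 case (less n)
 define d where "d = 4 * c + 4"
 define a where "a = 32 * c + 4"
 have rate: "rate = 2 ^ (a * d)" by (simp add: rate_def a_def d_def)
 show ?case
 proof (cases "n < 2 * c * g")
  case True
  have "base * 1 \<le> base * rate ^ n" by (intro mult_le_mono) (auto simp: rate_def)
  then show ?thesis using represented_small[OF True] unfolding represented_def mult_1_right by (elim exE conjE) (intro exI conjI; assumption?; linarith)
 next
  case False
  then have big: "2 * c * g \<le> n" by simp
  then have gn: "g \<le> n" using c mult_le_mono1[of 1 "2 * c" g] by linarith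
  define I where "I = {k. k < n \<and> d * k + n \<le> d * n}"
  show ?thesis
  proof (cases "n = 0")
   case True
   then have "represented \<D> n 1"
   proof -
    have "(G, ({}, {})) \<in> graph_iso" if "G \<in> \<D>" "card (verts G) = n" for G
    proof -
     have Gg: "G \<in> graphs" using that graphs by blast
     then have v: "verts G = {}" using graphs_finite[OF Gg] that True by simp
     then have "edges G = {}" using graphsD[OF Gg] by fastforce
     then have "G = ({}, {})" using v by (simp add: prod_eq_iff)
     then show ?thesis using graph_iso_refl[OF Gg] by simp
    qed
    then show ?thesis unfolding represented_def by (intro exI[of _ "{({}, {})}"]) auto
   qed
   moreover have "1 \<le> base * rate ^ n" using True by (simp add: base_def)
   ultimately show ?thesis unfolding represented_def by (elim exE conjE) (intro exI conjI; assumption?; linarith)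
  next
   case n0: False
   have "\<forall>k\<in>I. \<exists>R. finite R \<and> card R \<le> base * rate ^ k \<and> (\<forall>G\<in>\<D>. card (verts G) = k --> (\<exists>Q\<in>R. (G, Q) \<in> graph_iso))"
    using less.IH unfolding represented_def I_def by simp
   then obtain R where R: "\<forall>k\<in>I. finite (R k) \<and> card (R k) \<le> base * rate ^ k \<and> (\<forall>G\<in>\<D>. card (verts G) = k --> (\<exists>Q\<in>R k. (G, Q) \<in> graph_iso))"
    by (rule bchoice[THEN exE])
   \<comment> \<open>Representatives may be arbitrary; only those with the right order and few edges
     are kept, since they have small covers.\<close>
   define R' where "R' k = {Q \<in> R k. Q \<in> graphs \<and> card (verts Q) = k \<and> card (edges Q) \<le> c * (k + g)}" for k
   define S where "S = (\<Union>k\<in>I. \<Union>Q\<in>R' k. Pow (vcov Q) \<times> Pow (ecov Q))"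
   have fI: "finite I" "card I \<le> n" unfolding I_def
    using card_mono[of "{..<n}" "{k. k < n \<and> d * k + n \<le> d * n}"] by auto
   have fR: "finite (R' k) \<and> card (R' k) \<le> base * rate ^ k" if "k \<in> I" for k
    using R that card_mono[of "R k" "R' k"] unfolding R'_def by (auto intro: le_trans)
   have fQ: "finite (Pow (vcov Q) \<times> Pow (ecov Q)) \<and> card (Pow (vcov Q) \<times> Pow (ecov Q)) \<le> 2 ^ ((32 * c + 3) * n)"
    if k: "k \<in> I" and Q: "Q \<in> R' k" for k Q
   proof -
    have Qg: "Q \<in> graphs" "card (verts Q) = k" "card (edges Q) \<le> c * (k + g)" using Q by (auto simp: R'_def)
    have kn: "k \<le> n" using k by (simp add: I_def)
    have v: "finite (vcov Q)" "card (vcov Q) \<le> 2 * k" using vcov_card[of Q] graphs_finite[OF Qg(1)] Qg(2) by blast+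
    have e: "finite (ecov Q)" "card (ecov Q) \<le> 16 * (c * (k + g)) + k" using ecov_card[OF Qg(1)] Qg(2,3) by auto
    have "card (Pow (vcov Q) \<times> Pow (ecov Q)) = 2 ^ (card (vcov Q) + card (ecov Q))"
     using v e by (simp add: card_cartesian_product card_Pow power_add)
    also have "\<dots> \<le> 2 ^ ((32 * c + 3) * n)"
    proof (rule power_increasing)
     have "card (vcov Q) + card (ecov Q) \<le> 2 * k + (16 * (c * (k + g)) + k)" using v e by linarith
     also have "\<dots> \<le> 2 * n + (16 * (c * (n + n)) + n)" using kn gn by (intro add_mono mult_le_mono) auto
     also have "\<dots> = (32 * c + 3) * n" by (simp add: algebra_simps)
     finally show "card (vcov Q) + card (ecov Q) \<le> (32 * c + 3) * n" .
    qed simp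
    finally show ?thesis using v e by simp
   qed
   have inner_le: "card (\<Union>Q\<in>R' k. Pow (vcov Q) \<times> Pow (ecov Q)) \<le> base * 2 ^ (a * (d - 1) * n) * 2 ^ ((32 * c + 3) * n)" if k: "k \<in> I" for k
   proof -
    have "card (\<Union>Q\<in>R' k. Pow (vcov Q) \<times> Pow (ecov Q)) \<le> (\<Sum>Q\<in>R' k. card (Pow (vcov Q) \<times> Pow (ecov Q)))"
     by (rule card_UN_le) (use fR k in blast)
    also have "\<dots> \<le> card (R' k) * 2 ^ ((32 * c + 3) * n)"
     using sum_bounded_above[of "R' k" "\<lambda>Q. card (Pow (vcov Q) \<times> Pow (ecov Q))" "2 ^ ((32 * c + 3) * n)"] fQ[OF k] by simp
    also have "\<dots> \<le> base * 2 ^ (a * (d - 1) * n) * 2 ^ ((32 * c + 3) * n)"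
    proof (rule mult_le_mono1)
     have "d * k \<le> (d - 1) * n" using k unfolding I_def diff_mult_distrib by simp linarith
     then have "a * d * k \<le> a * (d - 1) * n" unfolding mult.assoc by (rule mult_le_mono2)
     then have "rate ^ k \<le> 2 ^ (a * (d - 1) * n)" unfolding rate power_mult[symmetric] by (intro power_increasing) auto
     then show "card (R' k) \<le> base * 2 ^ (a * (d - 1) * n)" using fR[OF k] le_trans[OF _ mult_le_mono2] by blast
    qed
    finally show ?thesis .
   qed
   have "card S \<le> (\<Sum>k\<in>I. card (\<Union>Q\<in>R' k. Pow (vcov Q) \<times> Pow (ecov Q)))" unfolding S_def by (rule card_UN_le[OF fI(1)])
   also have "\<dots> \<le> card I * (base * 2 ^ (a * (d - 1) * n) * 2 ^ ((32 * c + 3) * n))"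
    using sum_bounded_above[of I "\<lambda>k. card (\<Union>Q\<in>R' k. Pow (vcov Q) \<times> Pow (ecov Q))" "base * 2 ^ (a * (d - 1) * n) * 2 ^ ((32 * c + 3) * n)"] inner_le by simp
   \<comment> \<open>There are at most \<open>n\<close> possible orders of the folded graph;
     \<open>2 ^ n\<close> fits the exponents.\<close>
   also have "\<dots> \<le> 2 ^ n * (base * 2 ^ (a * (d - 1) * n) * 2 ^ ((32 * c + 3) * n))"
    by (rule mult_le_mono1) (use fI(2) less_exp[of n] in linarith)
   also have "\<dots> = base * 2 ^ (n + a * (d - 1) * n + (32 * c + 3) * n)" by (simp add: power_add mult_ac)
   also have "n + a * (d - 1) * n + (32 * c + 3) * n = a * d * n"
   proof -
    have "n + (32 * c + 3) * n = a * n" by (simp add: a_def algebra_simps)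
    moreover have "a * n + a * (d - 1) * n = a * d * n"
    proof -
     have "d = Suc (d - 1)" by (simp add: d_def)
     then have "a * d * n = a * Suc (d - 1) * n" by simp
     then show ?thesis by (simp add: algebra_simps)
    qed
    ultimately show ?thesis by linarith
   qed
   also have "base * 2 ^ (a * d * n) = base * rate ^ n" by (simp add: rate power_mult)
   finally have "card S \<le> base * rate ^ n" .
   moreover have "finite S" unfolding S_def using fI fR fQ by blast
   moreover have "\<exists>Q\<in>S. (G, Q) \<in> graph_iso" if G: "G \<in> \<D>" "card (verts G) = n" for G
   proof -
    have Gg: "G \<in> graphs" using G graphs by blast
    obtain Q where Q: "Q \<in> \<D>" "folds G Q" "d * card (verts Q) + n \<le> d * n"
     using fold_step[OF G(1)] big G(2) unfolding d_def by auto
    have "card (verts Q) < n"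
    proof (rule ccontr)
     assume "\<not> card (verts Q) < n"
     then have "d * n \<le> d * card (verts Q)" by simp
     then show False using Q(3) n0 by linarith
    qed
    then have kI: "card (verts Q) \<in> I" using Q(3) by (simp add: I_def)
    have "\<exists>Q'\<in>R (card (verts Q)). (Q, Q') \<in> graph_iso" using bspec[OF R kI] Q(1) by blast
    then obtain Q' where Q': "Q' \<in> R (card (verts Q))" "(Q, Q') \<in> graph_iso" by blast
    note qc = graph_iso_card[OF Q'(2)]
    have "Q' \<in> R' (card (verts Q))" using Q'(1) qc few_edges[OF Q(1)] unfolding R'_def by auto
    moreover obtain H where "H \<in> Pow (vcov Q') \<times> Pow (ecov Q')" "(G, H) \<in> graph_iso"
     using folds_lift[OF folds_iso[OF Q(2) Q'(2) Gg] Gg] by blast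
    ultimately show ?thesis using kI unfolding S_def by blast
   qed
   ultimately show ?thesis unfolding represented_def by blast
  qed
 qed
qed

end

section \<open>Minor-closed classes and their subgraphs\<close>

locale minor_closed =
 fixes \<D> :: "nat sgraph set"
 assumes graphs: "\<D> <= graphs" and minor: "G \<in> \<D> ==> minor_step G H ==> H \<in> \<D>"
begin

lemma remove_edges: "finite F ==> G \<in> \<D> ==> (verts G, edges G - F) \<in> \<D>"
proof (induction F rule: finite_induct)
 case (insert e F)
 show ?case
 proof (cases "e \<in> edges G - F")
  case True
  have "minor_step (verts G, edges G - F) (delete_edge (verts G, edges G - F) e)"
   using True by (intro minor_step.intros(2)) simp
  from minor[OF _ this] show ?thesis using insert by (simp add: delete_edge_def Diff_insert[symmetric])
 next
  case False
  then have "edges G - insert e F = edges G - F" by blast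
  then show ?thesis using insert by simp
 qed
qed simp

lemma edge_subset: assumes "G \<in> \<D>" "F <= edges G" shows "(verts G, F) \<in> \<D>"
proof -
 have "finite (edges G - F)" using graphs_finite[of G] assms(1) graphs by blast
 from remove_edges[OF this assms(1)] show ?thesis using assms(2) by (simp add: double_diff)
qed

lemma remove_verts: "finite D ==> D <= verts G ==> G \<in> \<D> ==> induced_subgraph G (verts G - D) \<in> \<D>"
proof (induction D rule: finite_induct)
 case empty
 then have "G \<in> graphs" using graphs by blast
 then have "induced_subgraph G (verts G - {}) = G"
  using graphsD[of G] by (auto simp: induced_subgraph_def prod_eq_iff)
 then show ?case using empty by simp
next
 case (insert v D)
 let ?H = "induced_subgraph G (verts G - D)"
 have "minor_step ?H (induced_subgraph ?H (verts ?H - {v}))"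
  by (rule minor_step.intros(1)) (use insert in \<open>auto simp: induced_subgraph_def\<close>)
 moreover have "induced_subgraph ?H (verts ?H - {v}) = induced_subgraph G (verts G - insert v D)"
  by (auto simp: induced_subgraph_def)
 ultimately show ?case using minor[of ?H] insert by simp
qed

lemma induced: assumes "G \<in> \<D>" "W <= verts G" shows "induced_subgraph G W \<in> \<D>"
proof -
 have "finite (verts G - W)" using graphs_finite[of G] assms(1) graphs by blast
 from remove_verts[OF this _ assms(1)] show ?thesis using assms(2) by (simp add: double_diff)
qed

lemma subgraph:
 assumes "G \<in> \<D>" "W <= verts G" "F <= edges G" "\<Union>F <= W" shows "(W, F) \<in> \<D>"
proof -
 have "(verts (induced_subgraph G W), F) \<in> \<D>"
  by (rule edge_subset[OF induced[OF assms(1,2)]]) (use assms(3,4) in \<open>auto simp: induced_subgraph_def\<close>)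
 then show ?thesis by (simp add: induced_subgraph_def)
qed

end

definition clique :: "'a sgraph => 'a set => bool" where
 "clique G S \<longleftrightarrow> (\<forall>x\<in>S. \<forall>y\<in>S. x ~= y --> {x, y} \<in> edges G)"

lemma nbs_edges:
 assumes "G \<in> graphs"
 shows "{e \<in> edges G. v \<in> e} = (\<lambda>u. {u, v}) ` nbs G v" "card {e \<in> edges G. v \<in> e} = card (nbs G v)"
  "nbs G v <= verts G - {v}"
proof -
 show 1: "{e \<in> edges G. v \<in> e} = (\<lambda>u. {u, v}) ` nbs G v"
 proof (intro equalityI subsetI)
  fix e assume e: "e \<in> {e \<in> edges G. v \<in> e}"
  then have "e \<in> edges G" "v \<in> e" by auto
  then obtain y where "e = {v, y}" by (rule edge_pair[OF assms]) blast
  then show "e \<in> (\<lambda>u. {u, v}) ` nbs G v" using e by (intro image_eqI[of _ _ y]) (auto simp: nbs_def insert_commute)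
 qed (auto simp: nbs_def)
 have "inj_on (\<lambda>u. {u, v}) (nbs G v)" by (auto simp: inj_on_def doubleton_eq_iff)
 then show "card {e \<in> edges G. v \<in> e} = card (nbs G v)" unfolding 1 by (rule card_image)
 show "nbs G v <= verts G - {v}" unfolding nbs_def using edge_ne[OF assms] by blast
qed

lemma nbs_indep:
 assumes "H \<in> graphs" "\<forall>e\<in>edges H. \<not> e <= L" "s \<in> L" shows "nbs H s <= verts H - L"
proof
 fix u assume "u \<in> nbs H s"
 then have e: "{u, s} \<in> edges H" by (simp add: nbs_def)
 show "u \<in> verts H - L" using bspec[OF assms(2) e] assms(3) graphsD[OF assms(1) e] by auto
qed

lemma card_nbs_sum:
 assumes "G \<in> graphs" "finite S" "!!e. e \<in> edges G ==> card (S \<inter> e) = k"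
 shows "(\<Sum>v\<in>S. card (nbs G v)) = k * card (edges G)"
proof -
 have "(\<Sum>v\<in>S. card {e \<in> edges G. v \<in> e}) = (\<Sum>e\<in>edges G. card (S \<inter> e))"
  by (rule sum_multicount_gen) (use assms graphs_finite in \<open>auto simp: Int_def\<close>)
 then show ?thesis using assms by (simp add: nbs_edges(2)[OF assms(1)])
qed

lemma handshake: assumes "G \<in> graphs" shows "(\<Sum>v\<in>verts G. card (nbs G v)) = 2 * card (edges G)"
proof (rule card_nbs_sum[OF assms])
 fix e assume "e \<in> edges G"
 then have "e <= verts G" "card e = 2" using graphsD[OF assms] by auto
 then show "card (verts G \<inter> e) = 2" by (simp add: Int_absorb1)
qed (use graphs_finite[OF assms] in blast)

text \<open>While some neighbourhood of a vertex of the independent set \<open>L\<close> is not a clique, contracting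
 an edge at that vertex adds an edge outside \<open>L\<close>.\<close>

lemma (in minor_closed) clique_part:
 assumes "card L = n" "G \<in> \<D>" "L <= verts G" "\<forall>e\<in>edges G. \<not> e <= L"
 shows "\<exists>L' H. L' <= L \<and> H \<in> \<D> \<and> verts H = verts G - L' \<and> (\<forall>e\<in>edges H. \<not> e <= L) \<and>
  (\<forall>s\<in>L - L'. nbs H s = nbs G s \<and> clique H (nbs H s)) \<and>
  card L' + card {e \<in> edges G. e <= verts G - L} \<le> card {e \<in> edges H. e <= verts G - L}"
 using assms
proof (induction n arbitrary: L G rule: less_induct)
 case (less n)
 have G: "G \<in> graphs" using less.prems graphs by blast
 have finL: "finite L" using less.prems(3) graphs_finite[OF G] finite_subset by blast
 show ?case
 proof (cases "\<forall>s\<in>L. clique G (nbs G s)")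
  case True
  then show ?thesis using less.prems by (intro exI[of _ "{}"] exI[of _ G]) simp
 next
  case False
  then obtain s x y where s: "s \<in> L" and xy: "{x, s} \<in> edges G" "{y, s} \<in> edges G" "x ~= y" "{x, y} \<notin> edges G"
   unfolding clique_def nbs_def by blast
  have nL: "x \<notin> L" "y \<notin> L" using less.prems(4) xy(1,2) s by auto
  have xs: "x ~= s" "s ~= x" using s nL by auto
  \<comment> \<open>Contracting \<open>s\<close> into \<open>x\<close> creates the edge between
    \<open>x\<close> and \<open>y\<close>. The other vertices of \<open>L\<close> keep their
    neighbourhoods, as none of them is adjacent to \<open>s\<close>.\<close>
  define G1 where "G1 = contract_edge G x s"
  have vG1: "verts G1 = verts G - {s}" and
   eG1: "edges G1 = {e \<in> edges G. s \<notin> e} \<union> {{x, z} |z. {s, z} \<in> edges G \<and> z ~= x}"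
   using contract_edges[OF G xs(1)] by (simp_all add: G1_def)
  have G1: "G1 \<in> \<D>" unfolding G1_def using minor[OF less.prems(2) minor_step.intros(3)[OF xy(1) xs(1)]] .
  have c1: "card (L - {s}) < n" using less.prems(1) finL s by (metis card_Diff1_less)
  have c2: "L - {s} <= verts G1" using less.prems(3) vG1 by blast
  have c3: "\<forall>e\<in>edges G1. \<not> e <= L - {s}" using less.prems(4) nL unfolding eG1 by blast
  obtain L' H where IH: "L' <= L - {s}" "H \<in> \<D>" "verts H = verts G1 - L'" "\<forall>e\<in>edges H. \<not> e <= L - {s}"
   "\<forall>t\<in>L - {s} - L'. nbs H t = nbs G1 t \<and> clique H (nbs H t)"
   "card L' + card {e \<in> edges G1. e <= verts G1 - (L - {s})} \<le> card {e \<in> edges H. e <= verts G1 - (L - {s})}"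
   using less.IH[OF c1 refl G1 c2 c3] by (elim exE conjE) (rule that)
  have Y: "verts G1 - (L - {s}) = verts G - L" using vG1 s by blast
  have sL': "s \<notin> L'" using IH(1) by blast
  have "card (insert s L') + card {e \<in> edges G. e <= verts G - L} \<le> card {e \<in> edges H. e <= verts G - L}"
  proof -
   have yV: "y \<in> verts G" "x \<in> verts G" using graphsD[OF G xy(2)] graphsD[OF G xy(1)] by auto
   have "{s, y} \<in> edges G" using xy(2) by (simp add: insert_commute)
   then have "{x, y} \<in> edges G1" unfolding eG1 using xy(3) by blast
   then have "insert {x, y} {e \<in> edges G. e <= verts G - L} <= {e \<in> edges G1. e <= verts G - L}"
    using nL yV s unfolding eG1 by auto
   then have "card (insert {x, y} {e \<in> edges G. e <= verts G - L}) \<le> card {e \<in> edges G1. e <= verts G - L}"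
    by (rule card_mono[rotated]) (use graphs_finite[of G1] G1 graphs in auto)
   moreover have "card (insert {x, y} {e \<in> edges G. e <= verts G - L}) = Suc (card {e \<in> edges G. e <= verts G - L})"
    using xy(4) graphs_finite[OF G] by simp
   moreover have "card (insert s L') = Suc (card L')"
    using sL' finite_subset[OF IH(1)] finL by simp
   ultimately show ?thesis using IH(6) unfolding Y by linarith
  qed
  moreover have "verts H = verts G - insert s L'" using IH(3) vG1 by blast
  moreover have "\<forall>e\<in>edges H. \<not> e <= L"
  proof
   fix e assume e: "e \<in> edges H"
   have "H \<in> graphs" using IH(2) graphs by blast
   then have "e <= verts H" using graphsD e by blast
   then have "s \<notin> e" using IH(3) vG1 by blast
   then show "\<not> e <= L" using IH(4) e by blast
  qed
  moreover have "\<forall>t\<in>L - insert s L'. nbs H t = nbs G t \<and> clique H (nbs H t)"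
  proof
   fix t assume t: "t \<in> L - insert s L'"
   have "{u, t} \<in> edges G1 \<longleftrightarrow> {u, t} \<in> edges G" for u
   proof
    assume "{u, t} \<in> edges G1"
    then consider "{u, t} \<in> edges G" | z where "{u, t} = {x, z}" "{s, z} \<in> edges G" unfolding eG1 by blast
    then show "{u, t} \<in> edges G"
    proof cases
     case 2
     then have "t = z" using t nL by (auto simp: doubleton_eq_iff)
     then have "{s, t} \<in> edges G" using 2(2) by simp
     then have "\<not> {s, t} <= L" by (rule bspec[OF less.prems(4)])
     then show ?thesis using s t by simp
    qed
   next
    assume e: "{u, t} \<in> edges G"
    then have "u ~= s" using bspec[OF less.prems(4) e] s t by auto
    then show "{u, t} \<in> edges G1" unfolding eG1 using e t by auto
   qed
   then have "nbs G1 t = nbs G t" by (simp add: nbs_def)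
   then show "nbs H t = nbs G t \<and> clique H (nbs H t)" using bspec[OF IH(5), of t] t by auto
  qed
  moreover have "insert s L' <= L" using IH(1) s by blast
  ultimately show ?thesis using IH(2) by (intro exI[of _ "insert s L'"] exI[of _ H]) blast
 qed
qed

text \<open>Vertices are placed one at a time, each on the side that cuts at least half of its edges
  to the vertices already placed.\<close>

lemma max_cut:
 assumes "finite V" "finite F" "!!e. e \<in> F ==> e <= V \<and> card e = 2"
 shows "\<exists>C. card F \<le> 2 * card {e \<in> F. e \<inter> C ~= {} \<and> \<not> e <= C}"
 using assms
proof (induction V arbitrary: F rule: finite_induct)
 case empty
 then have "F = {}" by fastforce
 then show ?case by simp
next
 case (insert v V)
 define F0 where "F0 = {e \<in> F. v \<notin> e}"
 obtain C0 where C0: "card F0 \<le> 2 * card {e \<in> F0. e \<inter> C0 ~= {} \<and> \<not> e <= C0}"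
 proof -
  have "e <= V \<and> card e = 2" if "e \<in> F0" for e using insert.prems(2)[of e] that unfolding F0_def by blast
  then show thesis using insert.IH[of F0] insert.prems(1) that unfolding F0_def by auto
 qed
 define C where "C = C0 - {v}"
 define K where "K = {e \<in> F0. e \<inter> C ~= {} \<and> \<not> e <= C}"
 have K: "card F0 \<le> 2 * card K"
 proof -
  have "K = {e \<in> F0. e \<inter> C0 ~= {} \<and> \<not> e <= C0}" unfolding K_def C_def F0_def by blast
  then show ?thesis using C0 by simp
 qed
 define Fa where "Fa = {e \<in> F. v \<in> e \<and> e \<inter> C ~= {}}"
 define Fb where "Fb = {e \<in> F. v \<in> e \<and> e \<inter> C = {}}"
 have fin: "finite F0" "finite Fa" "finite Fb" "finite K" using insert.prems(1) by (auto simp: F0_def Fa_def Fb_def K_def)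
 have "F = F0 \<union> (Fa \<union> Fb)" by (auto simp: F0_def Fa_def Fb_def)
 then have "card F = card (F0 \<union> (Fa \<union> Fb))" by simp
 then have cF: "card F \<le> card F0 + (card Fa + card Fb)"
  using card_Un_le[of F0 "Fa \<union> Fb"] card_Un_le[of Fa Fb] by linarith
 have dis: "K \<inter> Fa = {}" "K \<inter> Fb = {}" by (auto simp: K_def F0_def Fa_def Fb_def)
 show ?case
 proof (cases "card Fb \<le> card Fa")
  case True
  have "K \<union> Fa <= {e \<in> F. e \<inter> C ~= {} \<and> \<not> e <= C}" by (auto simp: K_def F0_def Fa_def C_def)
  then have "card K + card Fa \<le> card {e \<in> F. e \<inter> C ~= {} \<and> \<not> e <= C}"
   using card_Un_disjoint[OF fin(4,2) dis(1)] card_mono[of "{e \<in> F. e \<inter> C ~= {} \<and> \<not> e <= C}" "K \<union> Fa"] insert.prems(1) by simp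
  then show ?thesis using cF K True by (intro exI[of _ C]) linarith
 next
  case False
  let ?C = "insert v C"
  have "K \<union> Fb <= {e \<in> F. e \<inter> ?C ~= {} \<and> \<not> e <= ?C}"
  proof
   fix e assume "e \<in> K \<union> Fb"
   then show "e \<in> {e \<in> F. e \<inter> ?C ~= {} \<and> \<not> e <= ?C}"
   proof
    assume "e \<in> K" then show ?thesis by (auto simp: K_def F0_def)
   next
    assume e: "e \<in> Fb"
    have "e ~= {v}" using insert.prems(2)[of e] e by (auto simp: Fb_def)
    then show ?thesis using e unfolding Fb_def by blast
   qed
  qed
  then have "card K + card Fb \<le> card {e \<in> F. e \<inter> ?C ~= {} \<and> \<not> e <= ?C}"
   using card_Un_disjoint[OF fin(4,3) dis(2)] card_mono[of "{e \<in> F. e \<inter> ?C ~= {} \<and> \<not> e <= ?C}" "K \<union> Fb"] insert.prems(1) by simp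
  then show ?thesis using cF K False by (intro exI[of _ ?C]) linarith
 qed
qed

section \<open>Sparsity from a bound for bipartite graphs\<close>

text \<open>After \<open>clique_part\<close> there are three kinds of vertices in \<open>L\<close>:
  contracted ones, paid for by the edges they created outside \<open>L\<close>; those of degree at
  least 3, which are few because 2 < 3; and those of degree at most 2, whose neighbourhoods are
  distinct and are empty, single vertices or edges outside \<open>L\<close>.\<close>

lemma (in minor_closed) bipartite_sparse:
 assumes bip: "!!G C. G \<in> \<D> ==> (!!e. e \<in> edges G ==> \<exists>x y. e = {x, y} \<and> x \<in> C \<and> y \<notin> C) ==>
   card (edges G) \<le> 2 * (card (verts G) + \<rho>)" and \<rho>: "\<rho> > 0"
 shows "sparse_class \<D> 12 \<rho>"
proof -
 have few: "card (edges G) \<le> 4 * (card (verts G) + \<rho>)" if GD: "G \<in> \<D>" for G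
 proof -
  have G: "G \<in> graphs" using GD graphs by blast
  obtain C where C: "card (edges G) \<le> 2 * card {e \<in> edges G. e \<inter> C ~= {} \<and> \<not> e <= C}"
   using max_cut[of "verts G" "edges G"] graphs_finite[OF G] graphsD[OF G] by blast
  let ?F = "{e \<in> edges G. e \<inter> C ~= {} \<and> \<not> e <= C}"
  have "\<exists>x y. e = {x, y} \<and> x \<in> C \<and> y \<notin> C" if e: "e \<in> ?F" for e
  proof -
   obtain x where x: "x \<in> e" "x \<in> C" using e by blast
   have "e \<in> edges G" using e by blast
   then obtain y where "e = {x, y}" using x(1) by (rule edge_pair[OF G]) blast
   then show ?thesis using x e by blast
  qed
  then have "card ?F \<le> 2 * (card (verts G) + \<rho>)"
   using bip[OF edge_subset[OF GD, of ?F], of C] by simp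
  then show ?thesis using C by linarith
 qed
 have nbs: "card L \<le> 12 * (card (verts G - L) + \<rho>)"
  if GD: "G \<in> \<D>" and L: "L <= verts G" and ind: "!!e. e \<in> edges G ==> \<not> e <= L" and inj: "inj_on (nbs G) L" for G L
 proof -
  have G: "G \<in> graphs" using GD graphs by blast
  have finL: "finite L" using L graphs_finite[OF G] finite_subset by blast
  define Y where "Y = verts G - L"
  have finY: "finite Y" using graphs_finite[OF G] by (simp add: Y_def)
  have ind': "\<forall>e\<in>edges G. \<not> e <= L" using ind by blast
  obtain L' H where L': "L' <= L" "H \<in> \<D>" "verts H = verts G - L'" "\<forall>e\<in>edges H. \<not> e <= L"
   "\<forall>s\<in>L - L'. nbs H s = nbs G s \<and> clique H (nbs H s)"
   "card L' + card {e \<in> edges G. e <= verts G - L} \<le> card {e \<in> edges H. e <= verts G - L}"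
   using clique_part[OF refl GD L ind'] by (elim exE conjE) (rule that)
  have H: "H \<in> graphs" using L'(2) graphs by blast
  define F where "F = {e \<in> edges H. e <= Y}"
  have "(Y, F) \<in> \<D>" by (rule subgraph[OF L'(2)]) (use L'(1,3) in \<open>auto simp: F_def Y_def\<close>)
  then have cF: "card F \<le> 4 * (card Y + \<rho>)" using few[of "(Y, F)"] by simp
  have c1: "card L' \<le> 4 * (card Y + \<rho>)" using L'(6) cF unfolding F_def Y_def by linarith
  have nY: "nbs H s <= Y" if "s \<in> L" for s
   using nbs_indep[OF H L'(4) that] L'(3) by (auto simp: Y_def)
  define L3 where "L3 = {s \<in> L - L'. card (nbs H s) \<ge> 3}"
  have fin3: "finite L3" using finL by (simp add: L3_def)
  \<comment> \<open>The bipartite graph between \<open>L3\<close> and \<open>Y\<close>: at least 3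
    edges per vertex of \<open>L3\<close>, but at most 2 per vertex overall up to the
    defect.\<close>
  define J where "J = {e \<in> edges H. e \<inter> L3 ~= {}}"
  have J: "\<exists>x y. e = {x, y} \<and> x \<in> L3 \<and> y \<in> Y" if e: "e \<in> J" for e
  proof -
   obtain x where x: "x \<in> e" "x \<in> L3" using e unfolding J_def by blast
   have eH: "e \<in> edges H" using e unfolding J_def by blast
   then obtain y where y: "e = {x, y}" using x(1) by (rule edge_pair[OF H]) blast
   then have "y \<in> nbs H x" using eH by (simp add: nbs_def insert_commute)
   then show ?thesis using nY[of x] x y unfolding L3_def by blast
  qed
  have L3Y: "L3 \<inter> Y = {}" by (auto simp: L3_def Y_def)
  have JD: "(L3 \<union> Y, J) \<in> \<D>"
  proof (rule subgraph[OF L'(2)])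
   show "L3 \<union> Y <= verts H" using L L'(1,3) by (auto simp: L3_def Y_def)
   show "\<Union>J <= L3 \<union> Y" using J by fastforce
  qed (auto simp: J_def)
  have "card J \<le> 2 * (card (L3 \<union> Y) + \<rho>)"
  proof -
   have "\<exists>x y. e = {x, y} \<and> x \<in> L3 \<and> y \<notin> L3" if "e \<in> edges (L3 \<union> Y, J)" for e
    using J[of e] that L3Y by (metis disjoint_iff snd_conv)
   from bip[OF JD this] show ?thesis by simp
  qed
  moreover have "3 * card L3 \<le> card J"
  proof -
   have JG: "(L3 \<union> Y, J) \<in> graphs" using JD graphs by blast
   have "card (L3 \<inter> e) = 1" if "e \<in> edges (L3 \<union> Y, J)" for e
   proof -
    have "e \<in> J" using that by simp
    then obtain x y where "e = {x, y}" "x \<in> L3" "y \<in> Y" using J by blast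
    then have "L3 \<inter> e = {x}" using L3Y by blast
    then show ?thesis by simp
   qed
   then have "(\<Sum>v\<in>L3. card (nbs (L3 \<union> Y, J) v)) = card J" using card_nbs_sum[OF JG fin3, of 1] by simp
   moreover have "nbs (L3 \<union> Y, J) v = nbs H v" if "v \<in> L3" for v using that by (auto simp: nbs_def J_def)
   ultimately have "(\<Sum>v\<in>L3. card (nbs H v)) = card J" by simp
   moreover have "(\<Sum>v\<in>L3. 3) \<le> (\<Sum>v\<in>L3. card (nbs H v))" by (rule sum_mono) (simp add: L3_def)
   ultimately show ?thesis by simp
  qed
  moreover have "card (L3 \<union> Y) = card L3 + card Y" by (rule card_Un_disjoint[OF fin3 finY L3Y])
  ultimately have "3 * card L3 \<le> 2 * (card L3 + card Y + \<rho>)" by simp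
  then have c3: "card L3 \<le> 2 * (card Y + \<rho>)" by simp
  define L2 where "L2 = L - L' - L3"
  have inj2: "inj_on (nbs H) L2"
  proof (rule inj_onI)
   fix s t assume "s \<in> L2" "t \<in> L2" "nbs H s = nbs H t"
   then show "s = t" using inj_onD[OF inj, of s t] L'(5) by (auto simp: L2_def)
  qed
  have sub2: "nbs H ` L2 <= insert {} ((\<lambda>u. {u}) ` Y \<union> F)"
  proof
   fix S assume "S \<in> nbs H ` L2"
   then obtain s where s: "s \<in> L2" "S = nbs H s" by blast
   have sL: "s \<in> L - L'" "\<not> 3 \<le> card S" using s by (auto simp: L2_def L3_def)
   have SY: "S <= Y" using nY[of s] sL(1) s(2) by blast
   have cl: "clique H S" using bspec[OF L'(5) sL(1)] unfolding s(2) by blast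
   have "finite S" using finite_subset[OF SY finY] .
   consider "card S = 0" | "card S = 1" | "card S = 2" using sL(2) by linarith
   then show "S \<in> insert {} ((\<lambda>u. {u}) ` Y \<union> F)"
   proof cases
    case 1 then show ?thesis using \<open>finite S\<close> by simp
   next
    case 2 then obtain u where "S = {u}" by (rule card_1_singletonE)
    then show ?thesis using SY by blast
   next
    case 3 then obtain a b where ab: "S = {a, b}" "a ~= b" unfolding card_2_iff by blast
    then have "{a, b} \<in> edges H" using cl unfolding clique_def by blast
    then show ?thesis using SY ab(1) by (simp add: F_def)
   qed
  qed
  have finF: "finite F" using graphs_finite[OF H] by (simp add: F_def)
  have "card L2 = card (nbs H ` L2)" using inj2 by (simp add: card_image)
  also have "\<dots> \<le> card (insert {} ((\<lambda>u. {u}) ` Y \<union> F))" by (rule card_mono[OF _ sub2]) (use finY finF in simp)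
  also have "\<dots> \<le> Suc (card ((\<lambda>u. {u}) ` Y \<union> F))" using finY finF by (simp add: card_insert_if)
  also have "\<dots> \<le> Suc (card Y + card F)"
   using card_Un_le[of "(\<lambda>u. {u}) ` Y" F] card_image_le[OF finY, of "\<lambda>u. {u}"] by linarith
  finally have c2: "card L2 \<le> 1 + card Y + 4 * (card Y + \<rho>)" using cF by linarith
  have "L = L' \<union> (L3 \<union> L2)" using L'(1) by (auto simp: L2_def L3_def)
  then have "card L = card (L' \<union> (L3 \<union> L2))" by (rule arg_cong)
  then have "card L \<le> card L' + (card L3 + card L2)"
   using card_Un_le[of L' "L3 \<union> L2"] card_Un_le[of L3 L2] by linarith
  also have "\<dots> \<le> 4 * (card Y + \<rho>) + (2 * (card Y + \<rho>) + (1 + card Y + 4 * (card Y + \<rho>)))"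
   by (intro add_mono c1 c2 c3)
  \<comment> \<open>4 + 2 + 1 + 4 = 11, and the single extra neighbourhood, the empty one, is
    absorbed by the positive defect.\<close>
  also have "\<dots> \<le> 12 * (card Y + \<rho>)" using \<rho> by simp
  finally show ?thesis unfolding Y_def .
 qed
 show ?thesis
 proof
  show "card (edges G) \<le> 12 * (card (verts G) + \<rho>)" if "G \<in> \<D>" for G using few[OF that] by linarith
 qed (use graphs minor nbs in auto)
qed

section \<open>Sparsity from a linear number of edges\<close>

lemma min_degree:
 assumes "G \<in> graphs" "verts G ~= {}" "card (edges G) \<le> c * card (verts G)"
 shows "\<exists>v\<in>verts G. card (nbs G v) \<le> 2 * c"
proof (rule ccontr)
 assume "\<not> ?thesis"
 then have "(\<Sum>v\<in>verts G. 2 * c + 1) \<le> (\<Sum>v\<in>verts G. card (nbs G v))" by (intro sum_mono) auto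
 then have "card (verts G) * (2 * c + 1) \<le> 2 * card (edges G)" using handshake[OF assms(1)] by simp
 moreover have "2 * card (edges G) \<le> card (verts G) * (2 * c)" using mult_le_mono2[OF assms(3), of 2] by (simp add: mult_ac)
 moreover have "card (verts G) > 0" using assms(1,2) graphs_finite[OF assms(1)] by (simp add: card_gt_0_iff)
 ultimately show False by (simp add: distrib_left)
qed

text \<open>Some vertex \<open>v\<close> has degree at most \<open>2 * c\<close>. The cliques
  through \<open>v\<close> come from subsets of its neighbourhood, and all others are cliques of the
  graph without \<open>v\<close>.\<close>

lemma (in minor_closed) few_cliques:
 assumes few: "!!G. G \<in> \<D> ==> card (edges G) \<le> c * card (verts G)"
 shows "card (verts G) = n ==> G \<in> \<D> ==> card {S. S <= verts G \<and> clique G S} \<le> 1 + n * 2 ^ (2 * c)"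
proof (induction n arbitrary: G)
 case 0
 then have "verts G = {}" using graphs_finite[of G] graphs by auto
 then have "{S. S <= verts G \<and> clique G S} <= {{}}" by auto
 from card_mono[OF _ this] show ?case by simp
next
 case (Suc n)
 have G: "G \<in> graphs" using Suc.prems graphs by blast
 note fin = graphs_finite[OF G]
 obtain v where v: "v \<in> verts G" "card (nbs G v) \<le> 2 * c"
  using min_degree[OF G _ few[OF Suc.prems(2)]] Suc.prems(1) by fastforce
 let ?H = "induced_subgraph G (verts G - {v})"
 have HD: "?H \<in> \<D>" by (rule induced[OF Suc.prems(2)]) blast
 have cH: "card (verts ?H) = n" using Suc.prems(1) v(1) fin by (simp add: induced_subgraph_def)
 have finN: "finite (nbs G v)" using nbs_edges(3)[OF G, of v] fin finite_subset by blast
 have "{S. S <= verts G \<and> clique G S} <= {S. S <= verts ?H \<and> clique ?H S} \<union> insert v ` Pow (nbs G v)"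
 proof
  fix S assume "S \<in> {S. S <= verts G \<and> clique G S}"
  then have S: "S <= verts G" "clique G S" by auto
  show "S \<in> {S. S <= verts ?H \<and> clique ?H S} \<union> insert v ` Pow (nbs G v)"
  proof (cases "v \<in> S")
   case True
   then have "S - {v} <= nbs G v" using S(2) unfolding clique_def nbs_def by blast
   moreover have "S = insert v (S - {v})" using True by blast
   ultimately show ?thesis by blast
  next
   case False
   then have "S <= verts ?H \<and> clique ?H S" using S by (auto simp: clique_def induced_subgraph_def)
   then show ?thesis by blast
  qed
 qed
 moreover have "finite {S. S <= verts ?H \<and> clique ?H S}" using fin by (simp add: induced_subgraph_def)
 ultimately have "card {S. S <= verts G \<and> clique G S} \<le> card ({S. S <= verts ?H \<and> clique ?H S} \<union> insert v ` Pow (nbs G v))"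
  using finN by (intro card_mono) auto
 also have "\<dots> \<le> card {S. S <= verts ?H \<and> clique ?H S} + card (insert v ` Pow (nbs G v))" by (rule card_Un_le)
 also have "\<dots> \<le> (1 + n * 2 ^ (2 * c)) + 2 ^ (2 * c)"
 proof (rule add_mono[OF Suc.IH[OF cH HD]])
  have "card (insert v ` Pow (nbs G v)) \<le> 2 ^ card (nbs G v)"
   using card_image_le[of "Pow (nbs G v)" "insert v"] finN by (simp add: card_Pow)
  also have "\<dots> \<le> 2 ^ (2 * c)" by (rule power_increasing[OF v(2)]) simp
  finally show "card (insert v ` Pow (nbs G v)) \<le> 2 ^ (2 * c)" .
 qed
 finally show ?case by simp
qed

text \<open>The vertices contracted by \<open>clique_part\<close> are paid for by at most
  \<open>c * card Y\<close> edges outside \<open>L\<close>; the neighbourhoods of the others are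
  distinct cliques of a graph of the class on \<open>Y\<close>, to which \<open>few_cliques\<close>
  applies.\<close>

lemma (in minor_closed) linear_sparse:
 assumes few: "!!G. G \<in> \<D> ==> card (edges G) \<le> c * card (verts G)"
 shows "sparse_class \<D> (c + 2 ^ (2 * c) + 1) 1"
proof
 let ?c = "c + 2 ^ (2 * c) + 1 :: nat"
 show "card (edges G) \<le> ?c * (card (verts G) + 1)" if "G \<in> \<D>" for G
  using le_trans[OF few[OF that]] by (simp add: algebra_simps)
 fix G L assume GD: "G \<in> \<D>" and L: "L <= verts G" and ind: "!!e. e \<in> edges G ==> \<not> e <= L" and inj: "inj_on (nbs G) L"
 have G: "G \<in> graphs" using GD graphs by blast
 define Y where "Y = verts G - L"
 have ind': "\<forall>e\<in>edges G. \<not> e <= L" using ind by blast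
 obtain L' H where L': "L' <= L" "H \<in> \<D>" "verts H = verts G - L'" "\<forall>e\<in>edges H. \<not> e <= L"
  "\<forall>s\<in>L - L'. nbs H s = nbs G s \<and> clique H (nbs H s)"
  "card L' + card {e \<in> edges G. e <= verts G - L} \<le> card {e \<in> edges H. e <= verts G - L}"
  using clique_part[OF refl GD L ind'] by (elim exE conjE) (rule that)
 have H: "H \<in> graphs" using L'(2) graphs by blast
 let ?K = "induced_subgraph H Y"
 have KD: "?K \<in> \<D>" by (rule induced[OF L'(2)]) (use L'(1,3) in \<open>auto simp: Y_def\<close>)
 have K: "verts ?K = Y" "edges ?K = {e \<in> edges H. e <= Y}" by (auto simp: induced_subgraph_def)
 have c1: "card L' \<le> c * card Y" using L'(6) few[OF KD, unfolded K] unfolding Y_def by linarith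
 have sub: "nbs G ` (L - L') <= {S. S <= verts ?K \<and> clique ?K S}"
 proof
  fix S assume "S \<in> nbs G ` (L - L')"
  then obtain s where s: "s \<in> L - L'" "S = nbs H s" using L'(5) by auto
  have SY: "S <= Y"
   using nbs_indep[OF H L'(4), of s] L'(3) s by (auto simp: Y_def)
  moreover have "clique H S" using bspec[OF L'(5) s(1)] unfolding s(2) by blast
  ultimately show "S \<in> {S. S <= verts ?K \<and> clique ?K S}" unfolding clique_def K by blast
 qed
 have "finite Y" using graphs_finite[OF G] by (simp add: Y_def)
 then have "finite {S. S <= verts ?K \<and> clique ?K S}" unfolding K by simp
 from card_mono[OF this sub] have "card (nbs G ` (L - L')) \<le> 1 + card Y * 2 ^ (2 * c)"
  using few_cliques[OF few K(1)[THEN arg_cong[where f = card]] KD] by linarith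
 then have c2: "card (L - L') \<le> 1 + card Y * 2 ^ (2 * c)"
  using card_image[OF inj_on_subset[OF inj, of "L - L'"]] by auto
 have "card L \<le> card L' + card (L - L')" using card_Un_le[of L' "L - L'"] L'(1) by (simp add: Un_absorb1)
 also have "\<dots> \<le> ?c * (card Y + 1)" using c1 c2 by (simp add: algebra_simps)
 finally show "card L \<le> ?c * (card (verts G - L) + 1)" unfolding Y_def .
qed (use graphs minor in auto)

section \<open>Complete minors of dense graphs\<close>

definition cone :: "'a => 'a sgraph => 'a sgraph" where
 "cone u G = (insert u (verts G), edges G \<union> (\<lambda>x. {u, x}) ` verts G)"

text \<open>Minor steps off the apex commute with coning. Hence the graphs whose cone lies in a
  minor-closed class form a minor-closed class themselves, and an induction can descend to
  it.\<close>

lemma cone_minor_step: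
 assumes "minor_step G H" "G \<in> graphs" "u \<notin> verts G"
 shows "minor_step (cone u G) (cone u H) \<and> u \<notin> verts H"
 using assms(1)
proof cases
 case (1 v)
 have "cone u H = induced_subgraph (cone u G) (verts (cone u G) - {v})"
  using 1 assms(3) unfolding cone_def induced_subgraph_def by (auto dest: graphsD[OF assms(2)])
 then show ?thesis using 1 assms(3) minor_step.intros(1)[of v "cone u G"] by (auto simp: cone_def induced_subgraph_def)
next
 case (2 e)
 have "e ~= {u, x}" for x using 2(2) graphsD[OF assms(2), of e] assms(3) by blast
 then have "cone u H = delete_edge (cone u G) e" using 2 by (auto simp: cone_def delete_edge_def)
 then show ?thesis using 2 assms(3) minor_step.intros(2)[of e "cone u G"] by (auto simp: cone_def delete_edge_def)
next
 case (3 a b)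
 have ab: "a \<in> verts G" "b \<in> verts G" using edge_ne[OF assms(2) 3(2)] by auto
 let ?f = "\<lambda>x. if x = b then a else x"
 have "cone u H = contract_edge (cone u G) a b"
 proof -
  have fu: "?f ` {u, x} = {u, ?f x}" if "x \<in> verts G" for x using ab assms(3) by auto
  have A: "{u, x} \<in> {?f ` e |e. e \<in> edges (cone u G) \<and> card (?f ` e) = 2}" if x: "x \<in> verts G - {b}" for x
  proof -
   have "?f ` {u, x} = {u, x}" using fu[of x] x by simp
   moreover have "u ~= x" using x assms(3) by blast
   ultimately have "?f ` {u, x} = {u, x}" "card {u, x} = 2" by simp_all
   then show ?thesis using x unfolding cone_def by (intro CollectI exI[of _ "{u, x}"]) auto
  qed
  have B: "?f ` e \<in> edges (cone u H)" if eG: "e \<in> edges (cone u G)" and c2: "card (?f ` e) = 2" for e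
  proof (cases "e \<in> edges G")
   case True
   then show ?thesis using c2 unfolding 3(1) cone_def contract_edge_def Let_def by auto
  next
   case False
   then obtain x where x: "e = {u, x}" "x \<in> verts G" using eG by (auto simp: cone_def)
   then have "?f x \<in> verts H" using ab 3(3) by (auto simp: 3(1) contract_edge_def)
   then show ?thesis using fu[OF x(2)] unfolding x(1) cone_def by simp
  qed
  have vH: "verts H = verts G - {b}" unfolding 3(1) contract_edge_def Let_def by simp
  have eH: "edges H = {?f ` e |e. e \<in> edges G \<and> card (?f ` e) = 2}" unfolding 3(1) contract_edge_def Let_def by simp
  have "edges (cone u H) = {?f ` e |e. e \<in> edges (cone u G) \<and> card (?f ` e) = 2}"
  proof (intro equalityI subsetI)
   fix d assume "d \<in> edges (cone u H)"
   then have "d \<in> edges H \<or> (\<exists>x\<in>verts G - {b}. d = {u, x})" unfolding cone_def vH by auto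
   then show "d \<in> {?f ` e |e. e \<in> edges (cone u G) \<and> card (?f ` e) = 2}"
   proof
    assume "d \<in> edges H"
    then obtain e where e: "d = ?f ` e" "e \<in> edges G" "card (?f ` e) = 2" unfolding eH by blast
    have "e \<in> edges (cone u G)" using e(2) by (simp add: cone_def)
    then show ?thesis using e(1,3) by blast
   qed (use A in blast)
  qed (use B in blast)
  moreover have "verts (cone u H) = verts (cone u G) - {b}" using ab assms(3) unfolding cone_def vH by auto
  ultimately show ?thesis unfolding contract_edge_def Let_def by (simp add: prod_eq_iff)
 qed
 moreover have "{a, b} \<in> edges (cone u G)" using 3(2) by (simp add: cone_def)
 ultimately show ?thesis using minor_step.intros(3)[of a b "cone u G"] 3(1,3) assms(3) by (simp add: contract_edge_def)
qed

text \<open>Besides the contracted edge, one edge is lost for every common neighbour.\<close>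

lemma contract_card_edges:
 assumes G: "G \<in> graphs" and uw: "{u, w} \<in> edges G" "u ~= w"
 shows "card (edges G) \<le> card (edges (contract_edge G u w)) + 1 + card (nbs G u \<inter> nbs G w)"
proof -
 note fin = graphs_finite[OF G]
 let ?A = "{e \<in> edges G. w \<notin> e}" and ?B = "{e \<in> edges G. w \<in> e}" and ?M = "nbs G w - {u} - nbs G u"
 let ?N = "(\<lambda>z. {u, z}) ` ?M"
 have fN: "finite (nbs G w)" using nbs_edges(3)[OF G, of w] fin finite_subset by blast
 have wu: "u \<in> nbs G w" using uw(1) by (simp add: nbs_def)
 have "card (nbs G w) \<le> card (insert u (?M \<union> (nbs G u \<inter> nbs G w)))" by (rule card_mono) (use fN in auto)
 also have "\<dots> \<le> Suc (card (?M \<union> (nbs G u \<inter> nbs G w)))" using fN by (simp add: card_insert_if)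
 also have "\<dots> \<le> Suc (card ?M + card (nbs G u \<inter> nbs G w))" using card_Un_le[of ?M] by simp
 finally have "card ?B \<le> Suc (card ?M + card (nbs G u \<inter> nbs G w))" unfolding nbs_edges(2)[OF G] .
 moreover have "card (edges G) = card ?A + card ?B"
 proof -
  have "edges G = ?A \<union> ?B" by blast
  moreover have "card (?A \<union> ?B) = card ?A + card ?B" by (rule card_Un_disjoint) (use fin in auto)
  ultimately show ?thesis by simp
 qed
 moreover have "card ?A + card ?M \<le> card (edges (contract_edge G u w))"
 proof -
  have "card ?N = card ?M" by (rule card_image) (auto simp: inj_on_def doubleton_eq_iff)
  moreover have "?A \<inter> ?N = {}" by (auto simp: nbs_def insert_commute)
  ultimately have "card (?A \<union> ?N) = card ?A + card ?M" using card_Un_disjoint[of ?A ?N] fin fN by simp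
  moreover have S: "?A \<union> ?N <= edges (contract_edge G u w)"
   unfolding contract_edges(1)[OF G uw(2)] by (auto simp: nbs_def insert_commute)
  moreover have F: "finite (edges (contract_edge G u w))"
   using minor_step_graphs[OF minor_step.intros(3)[OF uw] G] graphs_finite by blast
  ultimately show ?thesis using card_mono[OF F S] by linarith
 qed
 ultimately show ?thesis by linarith
qed

text \<open>Mader: in a vertex-minimal dense minor every edge lies in many triangles, so that the
 neighbourhood of a vertex is dense again.\<close>

lemma dense_imp_complete_minor:
 assumes "minor_closed \<D>" "G \<in> \<D>" "verts G ~= {}" "2 ^ t * card (verts G) \<le> card (edges G)"
 shows "\<exists>K\<in>\<D>. card (verts K) = t \<and> clique K (verts K)"
 using assms
proof (induction t arbitrary: \<D> G)
 case 0
 interpret minor_closed \<D> by (rule 0(1))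
 show ?case using induced[OF 0(2), of "{}"] by (intro bexI[of _ "induced_subgraph G {}"]) (simp_all add: induced_subgraph_def clique_def)
next
 case (Suc t)
 interpret minor_closed \<D> by (rule Suc.prems(1))
 let ?P = "\<lambda>G. G \<in> \<D> \<and> verts G ~= {} \<and> 2 ^ Suc t * card (verts G) \<le> card (edges G)"
 have "?P G" using Suc.prems by simp
 from ex_has_least_nat[of ?P, OF this, of "\<lambda>G. card (verts G)"]
 obtain M where M: "?P M" and least: "\<forall>H. ?P H --> card (verts M) \<le> card (verts H)" by blast
 have Mg: "M \<in> graphs" using M graphs by blast
 note fin = graphs_finite[OF Mg]
 have "card (verts M) > 0" using M fin by (simp add: card_gt_0_iff)
 have "0 < 2 ^ Suc t * card (verts M)" using \<open>card (verts M) > 0\<close> by simp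
 then have "card (edges M) > 0" using M by linarith
 then have "edges M ~= {}" by auto
 then obtain e0 where e0: "e0 \<in> edges M" by blast
 then have "e0 ~= {}" using graphsD[OF Mg e0] by auto
 then obtain u where "u \<in> e0" by blast
 with e0 obtain w0 where w0: "e0 = {u, w0}" by (rule edge_pair[OF Mg]) blast
 \<comment> \<open>The contraction has one vertex less, so by minimality it is no longer dense and
   must lose more than \<open>2 ^ Suc t\<close> edges.\<close>
 have common: "2 ^ Suc t \<le> card (nbs M u \<inter> nbs M w)" if w: "w \<in> nbs M u" for w
 proof -
  have uw: "{u, w} \<in> edges M" "u ~= w" "u \<in> verts M" "w \<in> verts M"
   using w edge_ne[OF Mg, of w u] by (auto simp: nbs_def insert_commute)
  let ?H = "contract_edge M u w"
  have HD: "?H \<in> \<D>" using minor[of M ?H] M minor_step.intros(3)[OF uw(1,2)] by blast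
  have vH: "verts ?H = verts M - {w}" by (rule contract_edges(2)[OF Mg uw(2)])
  have cv: "card (verts M) = Suc (card (verts ?H))" unfolding vH using fin uw(4) by (metis card_Suc_Diff1)
  have "verts ?H ~= {}" using uw vH by blast
  then have "card (edges ?H) < 2 ^ Suc t * card (verts ?H)" using least HD cv by fastforce
  moreover have "2 ^ Suc t * card (verts ?H) + 2 ^ Suc t \<le> card (edges M)" using M cv by simp
  ultimately show ?thesis using contract_card_edges[OF Mg uw(1,2)] by linarith
 qed
 define N where "N = nbs M u"
 have NV: "N <= verts M - {u}" unfolding N_def by (rule nbs_edges(3)[OF Mg])
 have uV: "u \<in> verts M" using graphsD[OF Mg e0] w0 by blast
 let ?H = "induced_subgraph M N"
 \<comment> \<open>The induction hypothesis is applied to this class, so that \<open>u\<close> stays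
   adjacent to everything: the complete graph found there has one more vertex in its cone.\<close>
 define \<D>' where "\<D>' = {H \<in> graphs. u \<notin> verts H \<and> cone u H \<in> \<D>}"
 have mc: "minor_closed \<D>'"
 proof
  fix G H assume "G \<in> \<D>'" "minor_step G H"
  then show "H \<in> \<D>'" using cone_minor_step[of G H u] minor_step_graphs[of G H] minor[of "cone u G" "cone u H"]
   by (simp add: \<D>'_def)
 qed (auto simp: \<D>'_def)
 have Hg: "?H \<in> graphs" using induced[of M N] M NV graphs by blast
 have "(insert u N, edges ?H \<union> (\<lambda>x. {u, x}) ` N) \<in> \<D>"
  by (rule subgraph[of M]) (use M NV uV in \<open>auto simp: induced_subgraph_def N_def nbs_def insert_commute\<close>)
 then have HD: "?H \<in> \<D>'" using Hg NV by (auto simp: \<D>'_def cone_def induced_subgraph_def)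
 have "w0 \<in> N" using e0 w0 by (simp add: N_def nbs_def insert_commute)
 then have ne: "verts ?H ~= {}" by (auto simp: induced_subgraph_def)
 have "2 ^ Suc t * card N \<le> (\<Sum>w\<in>N. card (nbs ?H w))"
 proof -
  have "2 ^ Suc t \<le> card (nbs ?H w)" if "w \<in> N" for w
  proof -
   have "nbs ?H w = nbs M u \<inter> nbs M w" using that by (auto simp: nbs_def induced_subgraph_def N_def)
   then show ?thesis using common[of w] that by (simp add: N_def)
  qed
  then have "(\<Sum>w\<in>N. 2 ^ Suc t) \<le> (\<Sum>w\<in>N. card (nbs ?H w))" by (rule sum_mono)
  then show ?thesis by (simp add: mult.commute)
 qed
 also have "\<dots> = 2 * card (edges ?H)" using handshake[OF Hg] by (simp add: induced_subgraph_def)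
 finally have "2 ^ t * card (verts ?H) \<le> card (edges ?H)" by (simp add: induced_subgraph_def)
 from Suc.IH[OF mc HD ne this] obtain K where K: "K \<in> \<D>'" "card (verts K) = t" "clique K (verts K)" by blast
 have "card (verts (cone u K)) = Suc t" using K(1,2) graphs_finite[of K] by (simp add: cone_def \<D>'_def)
 moreover have "clique (cone u K) (verts (cone u K))" using K(3) unfolding clique_def cone_def by (auto simp: insert_commute)
 ultimately show ?case using K(1) by (intro bexI[of _ "cone u K"]) (auto simp: \<D>'_def)
qed

section \<open>Isolated vertices\<close>

definition add_vertex :: "nat => nat sgraph => nat sgraph" where
 "add_vertex v G = (insert v (verts G), edges G)"

lemma add_vertex_graphs: "G \<in> graphs ==> add_vertex v G \<in> graphs"
 by (auto simp: add_vertex_def graphs_def)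

text \<open>An isomorphism that does not match the two isolated vertices is rerouted: the preimage of \<open>w\<close>
 is isolated as well and is sent to the image of \<open>u\<close>.\<close>

lemma iso_remove_vertex:
 assumes "(add_vertex u G, add_vertex w H) \<in> graph_iso" "G \<in> graphs" "H \<in> graphs" "u \<notin> verts G" "w \<notin> verts H"
 shows "(G, H) \<in> graph_iso"
proof -
 obtain f where f: "bij_betw f (insert u (verts G)) (insert w (verts H))" "edges H = (`) f ` edges G"
  using assms(1) unfolding graph_iso_def add_vertex_def by auto
 define h where "h z = (if f z = w then f u else f z)" for z
 have inj: "inj_on f (insert u (verts G))" using f(1) by (rule bij_betw_imp_inj_on)
 have ne: "f z ~= f u" if "z \<in> verts G" for z using inj_onD[OF inj, of z u] that assms(4) by auto
 have fin: "finite (verts G)" "finite (verts H)" using graphs_finite assms(2,3) by blast+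
 have into: "h ` verts G <= verts H"
 proof
  fix y assume "y \<in> h ` verts G"
  then obtain z where z: "z \<in> verts G" "y = h z" by blast
  have "f z \<in> insert w (verts H)" "f u \<in> insert w (verts H)" using f(1) z(1) by (auto simp: bij_betw_def)
  then show "y \<in> verts H" using ne[OF z(1)] z(2) unfolding h_def by auto
 qed
 have injh: "inj_on h (verts G)"
 proof (rule inj_onI)
  fix x y assume xy: "x \<in> verts G" "y \<in> verts G" "h x = h y"
  have "f x = f y" using xy(3) ne[OF xy(1)] ne[OF xy(2)] unfolding h_def by (auto split: if_splits)
  then show "x = y" using inj_onD[OF inj] xy(1,2) by blast
 qed
 have "card (verts G) = card (verts H)" using bij_betw_same_card[OF f(1)] fin assms(4,5) by simp
 then have bij: "bij_betw h (verts G) (verts H)"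
  using card_subset_eq[OF fin(2) into] card_image[OF injh] injh by (simp add: bij_betw_def)
 have "f ` e = h ` e" if e: "e \<in> edges G" for e
 proof (rule image_cong[OF refl])
  fix z assume "z \<in> e"
  have "f ` e \<in> edges H" using e f(2) by blast
  then have "f ` e <= verts H" using graphsD[OF assms(3)] by blast
  then show "f z = h z" using \<open>z \<in> e\<close> assms(5) unfolding h_def by auto
 qed
 then have "edges H = (`) h ` edges G" unfolding f(2) by (rule image_cong[OF refl])
 then show ?thesis using bij assms(2,3) unfolding graph_iso_def by blast
qed

lemma add_vertex_disconnected:
 assumes "(add_vertex v G, C) \<in> graph_iso" "G \<in> graphs" "v \<notin> verts G" "verts G ~= {}"
 shows "C \<notin> connected_graphs"
proof
 assume C: "C \<in> connected_graphs"
 obtain f where f: "bij_betw f (insert v (verts G)) (verts C)" "edges C = (`) f ` edges G"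
  using assms(1) unfolding graph_iso_def add_vertex_def by auto
 obtain x where x: "x \<in> verts G" using assms(4) by blast
 have ne: "f z ~= f v" if "z \<in> verts G" for z
  using inj_onD[OF bij_betw_imp_inj_on[OF f(1)], of z v] that assms(3) by auto
 have "f v \<in> verts C" "f x \<in> verts C" using f(1) x by (auto simp: bij_betw_def)
 then have "(\<lambda>x y. {x, y} \<in> edges C)\<^sup>*\<^sup>* (f v) (f x)" using C unfolding connected_graphs_def by blast
 then have "\<exists>y. {f v, y} \<in> edges C" using ne[OF x] by (cases rule: converse_rtranclpE) auto
 then obtain y where "{f v, y} \<in> edges C" by blast
 then obtain e where e: "e \<in> edges G" "{f v, y} = f ` e" using f(2) by blast
 then have "f v \<in> f ` e" by blast
 then obtain z where z: "z \<in> e" "f v = f z" by blast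
 have "z \<in> verts G" using graphsD[OF assms(2) e(1)] z(1) by blast
 then show False using ne[of z] z(2) by simp
qed

section \<open>From growth to density\<close>

text \<open>At each index outside the set the sequence grows at least by the factor
  \<open>K = C ^ m\<close>, and it never decreases. So \<open>b\<close> such indices up to
  \<open>n\<close> give \<open>K ^ b \<le> C ^ n\<close>, that is
  \<open>m b \<le> n\<close>.\<close>

lemma growth_density:
 fixes a :: "nat => nat" and \<epsilon> :: real
 assumes pos: "a 1 \<ge> 1" and mono: "!!n. n \<ge> 1 ==> a n \<le> a (Suc n)"
  and growth: "\<forall>\<^sub>F n in sequentially. a n \<le> C ^ n" and C: "C \<ge> 2" and \<epsilon>: "\<epsilon> > 0"
 shows "\<exists>K\<ge>1. lower_density_at_least {n. n \<ge> 2 \<and> a n \<le> K * a (n - 1)} (1 - \<epsilon>)"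
proof -
 \<comment> \<open>With this \<open>m\<close> at most \<open>\<epsilon> n / 2\<close> indices from 2
   on fail; the other half of \<open>\<epsilon> n\<close> makes room for the index 1, which the set
   leaves out.\<close>
 obtain m :: nat where m: "2 / \<epsilon> \<le> real m" using real_arch_simple by blast
 define K where "K = C ^ m"
 define I where "I = {n. n \<ge> 2 \<and> a n \<le> K * a (n - 1)}"
 have K: "K \<ge> 1" using C by (simp add: K_def)
 have key: "K ^ card ({2..n} - I) \<le> a n" if "n \<ge> 1" for n using that
 proof (induction n rule: nat_induct_at_least)
  case base
  then show ?case using pos by simp
 next
  case (Suc n)
  have S: "{2..Suc n} = insert (Suc n) {2..n}" using Suc.hyps by auto
  show ?case
  proof (cases "Suc n \<in> I")
   case True
   then have "{2..Suc n} - I = {2..n} - I" unfolding S by blast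
   then show ?thesis using Suc.IH mono[OF Suc.hyps] by simp
  next
   case False
   then have "{2..Suc n} - I = insert (Suc n) ({2..n} - I)" unfolding S by blast
   then have "K ^ card ({2..Suc n} - I) = K * K ^ card ({2..n} - I)" by simp
   also have "\<dots> \<le> K * a n" using Suc.IH by simp
   also have "\<dots> \<le> a (Suc n)" using False Suc.hyps by (simp add: I_def)
   finally show ?thesis .
  qed
 qed
 have "(1 - \<epsilon>) * real n \<le> real (card (I \<inter> {1..n}))" if n: "a n \<le> C ^ n" "max 1 m \<le> n" for n
 proof -
  define b where "b = card ({2..n} - I)"
  have "C ^ (m * b) \<le> C ^ n" using key[of n] n unfolding b_def K_def power_mult by simp
  then have "m * b \<le> n" using C by (simp add: power_le_imp_le_exp)
  then have "real m * real b \<le> real n" by (metis of_nat_le_iff of_nat_mult)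
  moreover have "2 / \<epsilon> * real b \<le> real m * real b" by (rule mult_right_mono[OF m]) simp
  ultimately have "2 / \<epsilon> * real b \<le> real n" by linarith
  then have b: "2 * real b \<le> \<epsilon> * real n" using \<epsilon> by (simp add: field_simps)
  have "2 / \<epsilon> \<le> real n" using m n by linarith
  then have one: "2 \<le> \<epsilon> * real n" using \<epsilon> by (simp add: field_simps)
  have "{1..n} <= (I \<inter> {1..n}) \<union> insert 1 ({2..n} - I)" by auto
  then have "card {1..n} \<le> card ((I \<inter> {1..n}) \<union> insert 1 ({2..n} - I))" by (rule card_mono[rotated]) simp
  also have "\<dots> \<le> card (I \<inter> {1..n}) + card (insert 1 ({2..n} - I))" by (rule card_Un_le)
  also have "\<dots> \<le> card (I \<inter> {1..n}) + Suc b" by (simp add: card_insert_if b_def)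
  finally have "real n \<le> real (card (I \<inter> {1..n})) + 1 + real b" by simp
  then show ?thesis using b one by (simp add: left_diff_distrib)
 qed
 then have "lower_density_at_least I (1 - \<epsilon>)" unfolding lower_density_at_least_def
  using eventually_conj[OF growth eventually_ge_at_top[of "max 1 m"]] by (auto elim: eventually_mono)
 then show ?thesis using K unfolding I_def by blast
qed

locale vertex_closed =
 fixes B :: "nat sgraph set"
 assumes graphs: "B <= graphs" and empty: "({}, {}) \<in> B" and add: "G \<in> B ==> v \<notin> verts G ==> add_vertex v G \<in> B"
  and fin: "finite (unlabelled {G \<in> B. card (verts G) = n})"
begin

definition classes :: "nat => nat sgraph set set" where "classes n = unlabelled {G \<in> B. card (verts G) = n}"
definition count :: "nat => nat" where "count n = card (classes n)"

lemma finite_classes: "finite (classes n)" unfolding classes_def by (rule fin)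

lemma classes_cases: assumes "c \<in> classes n" shows "\<exists>G. G \<in> B \<and> card (verts G) = n \<and> c = graph_iso `` {G}"
 using assms unfolding classes_def unlabelled_def quotient_def by blast

lemma in_classes: "G \<in> B ==> graph_iso `` {G} \<in> classes (card (verts G))"
 unfolding classes_def unlabelled_def quotient_def by blast

lemma fresh: assumes "G \<in> B" obtains v where "v \<notin> verts G" "card (verts (add_vertex v G)) = Suc (card (verts G))"
proof -
 have f: "finite (verts G)" using graphs_finite assms graphs by blast
 obtain v where "v \<notin> verts G" using ex_new_if_finite[OF infinite_UNIV_nat f] by blast
 then show thesis using that f by (simp add: add_vertex_def)
qed

lemma count_pos: "count n \<ge> 1"
proof -
 have "\<exists>G\<in>B. card (verts G) = n"
 proof (induction n)
  case 0
  show ?case using empty by (intro bexI[of _ "({}, {})"]) auto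
 next
  case (Suc n)
  then obtain G where G: "G \<in> B" "card (verts G) = n" by blast
  obtain v where "v \<notin> verts G" "card (verts (add_vertex v G)) = Suc (card (verts G))" by (rule fresh[OF G(1)])
  then show ?case using add[OF G(1)] G(2) by blast
 qed
 then have "classes n ~= {}" using in_classes by blast
 then show ?thesis using finite_classes by (simp add: count_def Suc_le_eq card_gt_0_iff)
qed

text \<open>Adding an isolated vertex is injective on isomorphism types by
  \<open>iso_remove_vertex\<close>. For \<open>n \<ge> 1\<close> something else is present, so the
  result is disconnected.\<close>

lemma disconnected_classes: assumes "n \<ge> 1" shows "count n \<le> card (classes (Suc n) - unlabelled connected_graphs)"
proof -
 have "\<forall>c\<in>classes n. \<exists>p. fst p \<in> B \<and> card (verts (fst p)) = n \<and> c = graph_iso `` {fst p} \<and> snd p \<notin> verts (fst p) \<and>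
   card (verts (add_vertex (snd p) (fst p))) = Suc n"
 proof
  fix c assume "c \<in> classes n"
  then obtain G where G: "G \<in> B" "card (verts G) = n" "c = graph_iso `` {G}" using classes_cases by blast
  obtain v where "v \<notin> verts G" "card (verts (add_vertex v G)) = Suc (card (verts G))" by (rule fresh[OF G(1)])
  then show "\<exists>p. fst p \<in> B \<and> card (verts (fst p)) = n \<and> c = graph_iso `` {fst p} \<and> snd p \<notin> verts (fst p) \<and>
   card (verts (add_vertex (snd p) (fst p))) = Suc n" using G by (intro exI[of _ "(G, v)"]) simp
 qed
 then obtain p where p: "\<forall>c\<in>classes n. fst (p c) \<in> B \<and> card (verts (fst (p c))) = n \<and> c = graph_iso `` {fst (p c)} \<and>
   snd (p c) \<notin> verts (fst (p c)) \<and> card (verts (add_vertex (snd (p c)) (fst (p c)))) = Suc n" by (rule bchoice[THEN exE])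
 let ?G = "\<lambda>c. fst (p c)" and ?H = "\<lambda>c. add_vertex (snd (p c)) (fst (p c))"
 have G: "?G c \<in> graphs" "?G c \<in> B" "snd (p c) \<notin> verts (?G c)" "c = graph_iso `` {?G c}" "card (verts (?G c)) = n"
  "card (verts (?H c)) = Suc n" if "c \<in> classes n" for c
  using bspec[OF p that] graphs by blast+
 have inj: "inj_on (\<lambda>c. graph_iso `` {?H c}) (classes n)"
 proof (rule inj_onI)
  fix c d assume cd: "c \<in> classes n" "d \<in> classes n" "graph_iso `` {?H c} = graph_iso `` {?H d}"
  have "(?H d, ?H d) \<in> graph_iso" by (rule graph_iso_refl[OF add_vertex_graphs[OF G(1)[OF cd(2)]]])
  then have "(?H c, ?H d) \<in> graph_iso" using cd(3) by blast
  then have "(?G c, ?G d) \<in> graph_iso"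
   by (rule iso_remove_vertex[OF _ G(1)[OF cd(1)] G(1)[OF cd(2)] G(3)[OF cd(1)] G(3)[OF cd(2)]])
  then have "graph_iso `` {?G c} = graph_iso `` {?G d}" by (rule iso_class_eq)
  then show "c = d" using G(4)[OF cd(1)] G(4)[OF cd(2)] by (metis (no_types))
 qed
 have "graph_iso `` {?H c} \<in> classes (Suc n) - unlabelled connected_graphs" if c: "c \<in> classes n" for c
 proof
  show "graph_iso `` {?H c} \<in> classes (Suc n)"
   using in_classes[OF add[OF G(2)[OF c] G(3)[OF c]]] unfolding G(6)[OF c] .
  show "graph_iso `` {?H c} \<notin> unlabelled connected_graphs"
  proof
   assume "graph_iso `` {?H c} \<in> unlabelled connected_graphs"
   then obtain C where C: "C \<in> connected_graphs" "graph_iso `` {?H c} = graph_iso `` {C}"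
    unfolding unlabelled_def quotient_def by blast
   have "(C, C) \<in> graph_iso" using C(1) by (intro graph_iso_refl) (simp add: connected_graphs_def)
   then have "(?H c, C) \<in> graph_iso" using C(2) by blast
   moreover have "verts (?G c) ~= {}" using G(5)[OF c] assms by auto
   ultimately show False using add_vertex_disconnected[OF _ G(1)[OF c] G(3)[OF c]] C(1) by blast
  qed
 qed
 then have "(\<lambda>c. graph_iso `` {?H c}) ` classes n <= classes (Suc n) - unlabelled connected_graphs" by blast
 from card_inj_on_le[OF inj this] show ?thesis using finite_classes by (simp add: count_def)
qed

lemma count_mono: "n \<ge> 1 ==> count n \<le> count (Suc n)"
 using disconnected_classes[of n] card_mono[of "classes (Suc n)" "classes (Suc n) - unlabelled connected_graphs"] finite_classes[of "Suc n"]
 unfolding count_def by (meson Diff_subset le_trans)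

lemma prob_le:
 assumes "n \<ge> 1" "count (Suc n) \<le> K * count n" "K \<ge> 1"
 shows "prob_connected (random_unlabelled B (Suc n)) \<le> 1 - 1 / real K"
proof -
 let ?U = "classes (Suc n)" and ?C = "unlabelled connected_graphs"
 have U: "?U ~= {}" "finite ?U" "real (card ?U) > 0" using finite_classes count_pos[of "Suc n"] by (auto simp: count_def)
 have "prob_connected (random_unlabelled B (Suc n)) = real (card (?U \<inter> ?C)) / real (card ?U)"
  unfolding prob_connected_def random_unlabelled_def classes_def[symmetric] by (rule measure_pmf_of_set[OF U(1,2)])
 also have "\<dots> \<le> (real (card ?U) - real (card ?U) / real K) / real (card ?U)"
 proof (rule divide_right_mono)
  have "card ?U = card (?U \<inter> ?C) + card (?U - ?C)" by (rule card_Int_Diff[OF U(2)])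
  then have "real (card (?U \<inter> ?C)) + real (count n) \<le> real (card ?U)" using disconnected_classes[OF assms(1)] by linarith
  moreover have "real (card ?U) \<le> real K * real (count n)" using assms(2) unfolding count_def by (metis of_nat_le_iff of_nat_mult)
  then have "real (card ?U) / real K \<le> real (count n)" using assms(3) by (simp add: divide_le_eq mult.commute)
  ultimately show "real (card (?U \<inter> ?C)) \<le> real (card ?U) - real (card ?U) / real K" by linarith
 qed simp
 also have "\<dots> = 1 - 1 / real K" using U(3) by (simp add: diff_divide_distrib)
 finally show ?thesis .
qed

lemma rarely_connected:
 assumes growth: "\<forall>\<^sub>F n in sequentially. count n \<le> C ^ n" and R: "!!n. n \<ge> 1 ==> R n = random_unlabelled B n"
 shows "(\<forall>\<epsilon>>0. \<exists>I\<subseteq>{1..}. lower_density_at_least I (1 - \<epsilon>) \<and> (SUP n\<in>I. ereal (prob_connected (R n))) < 1)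
     \<and> liminf (\<lambda>n. ereal (prob_connected (R n))) < 1"
proof -
 have g2: "\<forall>\<^sub>F n in sequentially. count n \<le> max C 2 ^ n"
  using growth by (rule eventually_mono) (meson le_trans max.cobounded1 power_mono zero_le)
 have ex: "\<exists>I K. I <= {1..} \<and> K \<ge> (1::nat) \<and> lower_density_at_least I (1 - \<epsilon>) \<and> (\<forall>n\<in>I. prob_connected (R n) \<le> 1 - 1 / real K)"
  if \<epsilon>: "\<epsilon> > 0" for \<epsilon>
 proof -
  have C: "2 \<le> max C 2" by simp
  obtain K where K: "K \<ge> 1" "lower_density_at_least {n. n \<ge> 2 \<and> count n \<le> K * count (n - 1)} (1 - \<epsilon>)"
   using growth_density[OF count_pos count_mono g2 C \<epsilon>] by auto
  have "prob_connected (R n) \<le> 1 - 1 / real K" if n: "n \<ge> 2" "count n \<le> K * count (n - 1)" for n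
  proof -
   have "n = Suc (n - 1)" "n - 1 \<ge> 1" using n by auto
   then show ?thesis using prob_le[of "n - 1" K] n K(1) R[of n] by simp
  qed
  then show ?thesis using K by (intro exI[of _ "{n. n \<ge> 2 \<and> count n \<le> K * count (n - 1)}"] exI[of _ K]) auto
 qed
 have "\<exists>I\<subseteq>{1..}. lower_density_at_least I (1 - \<epsilon>) \<and> (SUP n\<in>I. ereal (prob_connected (R n))) < 1" if \<epsilon>: "\<epsilon> > 0" for \<epsilon>
 proof -
  obtain I K where I: "I <= {1..}" "K \<ge> (1::nat)" "lower_density_at_least I (1 - \<epsilon>)" "\<forall>n\<in>I. prob_connected (R n) \<le> 1 - 1 / real K"
   using ex[OF \<epsilon>] by blast
  have "(SUP n\<in>I. ereal (prob_connected (R n))) \<le> ereal (1 - 1 / real K)" by (rule SUP_least) (use I(4) in simp)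
  also have "\<dots> < 1" using I(2) by simp
  finally show ?thesis using I(1,3) by blast
 qed
 \<comment> \<open>A set of lower density at least 1/2 is infinite, so a bound along it bounds the
   limes inferior.\<close>
 moreover have "liminf (\<lambda>n. ereal (prob_connected (R n))) < 1"
 proof (rule ccontr)
  assume *: "\<not> ?thesis"
  obtain I K where I: "K \<ge> (1::nat)" "lower_density_at_least I (1 - 1 / 2)" "\<forall>n\<in>I. prob_connected (R n) \<le> 1 - 1 / real K"
   using ex[of "1 / 2"] by auto
  have "ereal (1 - 1 / real K) < 1" using I(1) by simp
  then have "ereal (1 - 1 / real K) < liminf (\<lambda>n. ereal (prob_connected (R n)))" using * by (meson less_le_trans not_le)
  then have "\<forall>\<^sub>F n in sequentially. ereal (1 - 1 / real K) < ereal (prob_connected (R n))" by (rule less_LiminfD)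
  then obtain N where N: "\<forall>n\<ge>N. 1 - 1 / real K < prob_connected (R n)" unfolding eventually_sequentially by auto
  obtain N' where N': "\<forall>n\<ge>N'. (1 - 1 / 2) * real n \<le> real (card (I \<inter> {1..n}))"
   using I(2) unfolding lower_density_at_least_def eventually_sequentially by blast
  let ?n = "N' + 2 * N + 1"
  have "I \<inter> {1..?n} <= {..<N}" using N I(3) by (metis IntD1 lessThan_iff not_le subsetI)
  then have "card (I \<inter> {1..?n}) \<le> N" using card_mono[of "{..<N}"] by simp
  moreover have "(1 - 1 / 2) * real ?n \<le> real (card (I \<inter> {1..?n}))" using N' by (meson le_add1 le_trans)
  ultimately show False by simp
 qed
 ultimately show ?thesis by blast
qed

end

section \<open>Graphs of bounded Euler genus\<close>

text \<open>Here the bound on the genus is fixed, unlike in \<open>E g\<close>, and so minors stay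
  in the class. The ranks are those of \<open>handles_ranked\<close> and
  \<open>crosscaps_ranked\<close>.\<close>

definition fat_class :: "nat => nat sgraph set" where
 "fat_class \<gamma> = {H \<in> graphs. (\<exists>h. 2 * h \<le> \<gamma> \<and> fat_embeds H (sphere_with_handles h) (3 * h)) \<or>
   (\<exists>k\<le>\<gamma>. fat_embeds H (sphere_with_crosscaps k) k)}"

lemma fat_class_sparse: "sparse_class (fat_class \<gamma>) 12 (2 * \<gamma> + 1)"
proof -
 interpret minor_closed "fat_class \<gamma>"
 proof
  fix G H assume GH: "G \<in> fat_class \<gamma>" "minor_step G H"
  have "H \<in> graphs" using minor_step_graphs[OF GH(2)] GH(1) by (simp add: fat_class_def)
  then show "H \<in> fat_class \<gamma>" using GH(1) minor_step_fat[OF GH(2)] unfolding fat_class_def by blast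
 qed (simp add: fat_class_def)
 show ?thesis
 proof (rule bipartite_sparse)
  fix G C assume G: "G \<in> fat_class \<gamma>" and C: "!!e. e \<in> edges G ==> \<exists>x y. e = {x, y} \<and> x \<in> C \<and> y \<notin> C"
  have "\<exists>r\<le>2 * \<gamma>. card (edges G) \<le> 2 * (card (verts G) + r + 1)"
  proof -
   have "(\<exists>h. 2 * h \<le> \<gamma> \<and> fat_embeds G (sphere_with_handles h) (3 * h)) \<or> (\<exists>k\<le>\<gamma>. fat_embeds G (sphere_with_crosscaps k) k)"
    using G by (simp add: fat_class_def)
   then show ?thesis
   proof (elim disjE exE conjE)
    fix h assume h: "2 * h \<le> \<gamma>" "fat_embeds G (sphere_with_handles h) (3 * h)"
    from fat_bipartite[OF h(2) C] show ?thesis using h(1) by (intro exI[of _ "3 * h"]) simp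
   next
    fix k assume k: "k \<le> \<gamma>" "fat_embeds G (sphere_with_crosscaps k) k"
    from fat_bipartite[OF k(2) C] show ?thesis using k(1) by (intro exI[of _ k]) simp
   qed
  qed
  then show "card (edges G) \<le> 2 * (card (verts G) + (2 * \<gamma> + 1))" by auto
 qed simp
qed

lemma represented_subset:
 assumes "represented \<D> n k" "{G \<in> B. card (verts G) = n} <= \<D>"
 shows "finite (unlabelled {G \<in> B. card (verts G) = n}) \<and> card (unlabelled {G \<in> B. card (verts G) = n}) \<le> k"
 by (rule represented_unlabelled) (use assms in \<open>unfold represented_def, blast\<close>)

text \<open>The point is the order of the quantifiers: \<open>D\<close> is independent of \<gamma>.
  The rest is \<open>base\<close> for \<open>c = 12\<close> and defect
  \<open>2 * \<gamma> + 1\<close>, with 24 = 2 * 12 and 300 = 12 * 25.\<close>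

lemma fat_class_count:
 "\<exists>D. \<forall>\<gamma> n B. {G \<in> B. card (verts G) = n} <= fat_class \<gamma> --> finite (unlabelled {G \<in> B. card (verts G) = n}) \<and>
   card (unlabelled {G \<in> B. card (verts G) = n}) \<le> ((24 * (2 * \<gamma> + 1))\<^sup>2 + 1) ^ (300 * (2 * \<gamma> + 1)) * D ^ n"
proof (intro exI allI impI)
 fix \<gamma> n and B :: "nat sgraph set"
 assume B: "{G \<in> B. card (verts G) = n} <= fat_class \<gamma>"
 define x where "x = 2 * \<gamma> + 1"
 interpret sparse_class "fat_class \<gamma>" 12 x unfolding x_def by (rule fat_class_sparse)
 have "12 * (2 * 12 * x + x) = 300 * x" "2 * 12 * x = 24 * x" by simp_all
 then have "base = ((24 * x)\<^sup>2 + 1) ^ (300 * x)" unfolding base_def by metis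
 then show "finite (unlabelled {G \<in> B. card (verts G) = n}) \<and>
   card (unlabelled {G \<in> B. card (verts G) = n}) \<le> ((24 * (2 * \<gamma> + 1))\<^sup>2 + 1) ^ (300 * (2 * \<gamma> + 1)) * sparse_class.rate 12 ^ n"
  using represented_subset[OF represented_all B] unfolding x_def[symmetric] by metis
qed

text \<open>With \<open>x = 2 * g n + 1\<close> of order at most \<open>n / ln n\<close>, the
  initial term is at most \<open>(n ^ 4) ^ (300 * x) = exp (1200 * x * ln n)\<close>, which is
  exponential in \<open>n\<close>.\<close>

lemma genus_growth:
 fixes g :: "nat => nat"
 assumes "(\<lambda>n. real (g n)) \<in> O(\<lambda>n. real n / ln (real n))"
 shows "\<exists>C. \<forall>\<^sub>F n in sequentially. ((24 * (2 * g n + 1))\<^sup>2 + 1) ^ (300 * (2 * g n + 1)) * D ^ n \<le> (C::nat) ^ n"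
proof -
 obtain c where c: "c > 0" "\<forall>\<^sub>F n in sequentially. norm (real (g n)) \<le> c * norm (real n / ln (real n))"
  using landau_o.bigE[OF assms] by blast
 \<comment> \<open>\<open>n / ln n\<close> is at least 1 for the \<open>n\<close> considered, so
   \<open>\<kappa>\<close> also covers the summand 1 in \<open>2 * g n + 1\<close>.\<close>
 define \<kappa> where "\<kappa> = 2 * c + 1"
 \<comment> \<open>From \<open>q\<close> on, \<open>24 * x\<close> is at most
   \<open>(n - 1) * n\<close>, so that its square plus 1 stays below \<open>n ^ 4\<close>.\<close>
 define q :: nat where "q = nat \<lceil>24 * \<kappa>\<rceil> + 1"
 define C :: nat where "C = nat \<lceil>exp (1200 * \<kappa>)\<rceil>"
 have "((24 * (2 * g n + 1))\<^sup>2 + 1) ^ (300 * (2 * g n + 1)) * D ^ n \<le> (C * D) ^ n"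
  if gn: "norm (real (g n)) \<le> c * norm (real n / ln (real n))" and n: "max q 3 \<le> n" for n
 proof -
  define x where "x = 2 * g n + 1"
  have n3: "real n \<ge> 3" "real n > 0" using n by auto
  have "exp 1 \<le> real n" using exp_le n3 by linarith
  then have l1: "1 \<le> ln (real n)" using n3 by (simp add: ln_ge_iff)
  have "ln (real n) \<le> real n - 1" by (rule ln_le_minus_one) (use n3 in simp)
  then have y1: "1 \<le> real n / ln (real n)" using l1 by (simp add: le_divide_eq)
  have y2: "real (g n) \<le> c * (real n / ln (real n))" using gn l1 n3 by simp
  have "2 * real (g n) + 1 \<le> \<kappa> * y" if "1 \<le> y" "real (g n) \<le> c * y" for y
   using that unfolding \<kappa>_def by (simp add: algebra_simps)
  from this[OF y1 y2] have x: "real x \<le> \<kappa> * (real n / ln (real n))" unfolding x_def by simp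
  have \<kappa>: "\<kappa> > 0" using c(1) by (simp add: \<kappa>_def)
  have "real n / ln (real n) \<le> real n" using l1 n3 by (simp add: divide_le_eq)
  then have xn: "real x \<le> \<kappa> * real n" using x mult_left_mono[of "real n / ln (real n)" "real n" \<kappa>] \<kappa> by linarith
  have q: "24 * \<kappa> \<le> real q - 1" "real q \<le> real n" unfolding q_def using \<kappa> n by (auto simp: q_def)
  have "24 * real x \<le> (real q - 1) * real n"
  proof -
   have "24 * real x \<le> (24 * \<kappa>) * real n" using xn by simp
   also have "\<dots> \<le> (real q - 1) * real n" by (rule mult_right_mono[OF q(1)]) simp
   finally show ?thesis .
  qed
  then have "(24 * real x)\<^sup>2 \<le> ((real q - 1) * real n)\<^sup>2" by (rule power_mono) simp
  also have "\<dots> \<le> ((real n - 1) * real n)\<^sup>2"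
   by (intro power_mono mult_right_mono mult_nonneg_nonneg) (use q \<kappa> in auto)
  also have "\<dots> \<le> real n ^ 4 - 1"
  proof -
   have "1 * 1 \<le> real n * real n" using n3 by (intro mult_mono) auto
   moreover have "1 * (real n * real n) \<le> (2 * real n - 1) * (real n * real n)" using n3 by (intro mult_right_mono) auto
   ultimately have "1 \<le> (2 * real n - 1) * (real n * real n)" by linarith
   then show ?thesis by (simp add: power2_eq_square power4_eq_xxxx algebra_simps)
  qed
  finally have b: "(24 * real x)\<^sup>2 + 1 \<le> real n ^ 4" by simp
  have "real (((24 * x)\<^sup>2 + 1) ^ (300 * x)) = ((24 * real x)\<^sup>2 + 1) ^ (300 * x)" by (simp only: of_nat_power of_nat_add of_nat_mult of_nat_1 of_nat_numeral)
  also have "\<dots> \<le> (real n ^ 4) ^ (300 * x)" by (rule power_mono[OF b]) simp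
  also have "\<dots> = exp (ln (real n)) ^ (4 * (300 * x))" using n3 by (simp add: power_mult[symmetric])
  also have "\<dots> = exp (real (4 * (300 * x)) * ln (real n))" by (rule exp_of_nat_mult[symmetric])
  also have "\<dots> \<le> exp (real n * (1200 * \<kappa>))"
  proof -
   have "real x * ln (real n) \<le> \<kappa> * (real n / ln (real n)) * ln (real n)" by (rule mult_right_mono[OF x]) (use l1 in simp)
   also have "\<dots> = \<kappa> * real n" using l1 by simp
   finally show ?thesis by (simp add: mult_ac)
  qed
  also have "\<dots> = exp (1200 * \<kappa>) ^ n" by (rule exp_of_nat_mult)
  also have "\<dots> \<le> real C ^ n" unfolding C_def by (rule power_mono[OF real_nat_ceiling_ge]) simp
  finally have "((24 * x)\<^sup>2 + 1) ^ (300 * x) \<le> C ^ n" by (metis of_nat_le_iff of_nat_power)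
  then show ?thesis unfolding x_def[symmetric] power_mult_distrib by (rule mult_le_mono1)
 qed
 then show ?thesis
  using eventually_conj[OF c(2) eventually_ge_at_top[of "max q 3"]] by (intro exI[of _ "C * D"]) (auto elim: eventually_mono)
qed

text \<open>Common properties of the four surface classes, from which \<open>Hered\<close> and
  \<open>Minor\<close> inherit closure under adding isolated vertices.\<close>

definition genus_class :: "nat sgraph set => bool" where
 "genus_class A \<longleftrightarrow> A <= graphs \<and> ({}, {}) \<in> A \<and> (\<forall>G H. (G, H) \<in> graph_iso --> G \<in> A --> H \<in> A) \<and>
   (\<forall>G v. G \<in> A --> v \<notin> verts G --> add_vertex v G \<in> A)"

lemma genus_classI:
 fixes g :: "nat => nat"
 assumes mono: "mono_on {1..} g" and A: "A = {G \<in> graphs. P (g (card (verts G))) G}" and empty: "!!\<gamma>. P \<gamma> ({}, {})"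
  and iso: "!!\<gamma> G H. (G, H) \<in> graph_iso ==> P \<gamma> G ==> P \<gamma> H"
  and add: "!!\<gamma> \<gamma>' G v. G \<in> graphs ==> v \<notin> verts G ==> P \<gamma> G ==> \<gamma> \<le> \<gamma>' ==> P \<gamma>' (add_vertex v G)"
 shows "genus_class A"
proof -
 have "H \<in> A" if "(G, H) \<in> graph_iso" "G \<in> A" for G H
  using that(2) iso[OF that(1)] graph_iso_card[OF that(1)] unfolding A by simp
 moreover have "add_vertex v G \<in> A" if G: "G \<in> A" and v: "v \<notin> verts G" for G v
 proof -
  have Gg: "G \<in> graphs" using G A by simp
  have fin: "finite (verts G)" using graphs_finite[OF Gg] by blast
  have "P (g (card (verts (add_vertex v G)))) (add_vertex v G)"
  \<comment> \<open>\<open>g\<close> is monotone from 1 on only, so the step from the empty graph to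
    one vertex is separate; the empty graph embeds whatever the bound is.\<close>
  proof (cases "verts G = {}")
   case True
   then have "edges G = {}" using graphsD[OF Gg] by fastforce
   then have "G = ({}, {})" using True by (simp add: prod_eq_iff)
   have "P \<gamma> (add_vertex v G)" for \<gamma>
    using add[of G v \<gamma> \<gamma>] Gg v empty[of \<gamma>] \<open>G = ({}, {})\<close> by simp
   then show ?thesis .
  next
   case False
   then have "card (verts G) \<ge> 1" using fin by (simp add: Suc_le_eq card_gt_0_iff)
   then have le: "g (card (verts G)) \<le> g (card (verts (add_vertex v G)))"
    using fin v by (intro mono_onD[OF mono]) (auto simp: add_vertex_def)
   have "P (g (card (verts G))) G" using G unfolding A by simp
   then show ?thesis by (rule add[OF Gg v _ le])
  qed
  then show ?thesis using add_vertex_graphs[OF Gg] unfolding A by simp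
 qed
 moreover have "({}, {}) \<in> A" using empty A by (simp add: graphs_def)
 ultimately show ?thesis using A unfolding genus_class_def by blast
qed

lemma genus_class_surfaces:
 assumes mono: "mono_on {1..} g" and A: "A \<in> {E g, OE g, NE g, OE g \<inter> NE g}"
 shows "genus_class A"
proof -
 have h: "embeds_in (add_vertex v G) (sphere_with_handles h)"
  if "G \<in> graphs" "v \<notin> verts G" "embeds_in G (sphere_with_handles h)" for G v h
  unfolding add_vertex_def by (rule embeds_isolated[OF handles_ranked that(1,3,2)])
 have k: "embeds_in (add_vertex v G) (sphere_with_crosscaps k)"
  if "G \<in> graphs" "v \<notin> verts G" "embeds_in G (sphere_with_crosscaps k)" for G v k
  unfolding add_vertex_def by (rule embeds_isolated[OF crosscaps_ranked that(1,3,2)])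
 have "genus_class (OE g)"
 proof (rule genus_classI[OF mono OE_def])
  show "\<exists>h. 2 * h \<le> \<gamma> \<and> embeds_in ({}, {}) (sphere_with_handles h)" for \<gamma>
   using embeds_empty by (intro exI[of _ 0]) simp
 qed (meson embeds_iso, meson h le_trans)
 moreover have "genus_class (E g)"
 proof (rule genus_classI[OF mono E_def])
  show "(\<exists>h. 2 * h \<le> \<gamma> \<and> embeds_in ({}, {}) (sphere_with_handles h)) \<or>
    (\<exists>k. 1 \<le> k \<and> k \<le> \<gamma> \<and> embeds_in ({}, {}) (sphere_with_crosscaps k))" for \<gamma>
   using embeds_empty by (intro disjI1 exI[of _ 0]) simp
 qed (meson embeds_iso, meson h k le_trans)
 moreover have "genus_class (NE g)"
 proof (rule genus_classI[OF mono NE_def])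
  let ?P = "\<lambda>\<gamma> G. if \<gamma> = 0 then embeds_in G (sphere_with_handles 0)
    else \<exists>k. 1 \<le> k \<and> k \<le> \<gamma> \<and> embeds_in G (sphere_with_crosscaps k)"
  show "?P \<gamma> ({}, {})" for \<gamma> using embeds_empty by (auto intro!: exI[of _ 1])
  show "?P \<gamma> H" if "(G, H) \<in> graph_iso" "?P \<gamma> G" for \<gamma> G H
   using that(2) embeds_iso[OF that(1)] by (cases "\<gamma> = 0") auto
  show "?P \<gamma>' (add_vertex v G)" if G: "G \<in> graphs" "v \<notin> verts G" "?P \<gamma> G" "\<gamma> \<le> \<gamma>'" for \<gamma> \<gamma>' G v
  proof (cases "\<gamma>' = 0")
   case True
   then show ?thesis using G(3,4) h[OF G(1,2)] by simp
  next
   case False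
   have "\<exists>k. 1 \<le> k \<and> k \<le> \<gamma>' \<and> embeds_in G (sphere_with_crosscaps k)"
   proof (cases "\<gamma> = 0")
    case True
    \<comment> \<open>When the bound leaves 0, a planar drawing is moved to the projective
      plane.\<close>
    then show ?thesis using G(3) planar_crosscaps[OF G(1), of 1] False by (intro exI[of _ 1]) simp
   next
    case False
    then show ?thesis using G(3,4) le_trans by auto
   qed
   then show ?thesis using k[OF G(1,2)] False by auto
  qed
 qed
 ultimately show ?thesis using A unfolding genus_class_def by blast
qed

lemma surfaces_fat:
 assumes "A \<in> {E g, OE g, NE g, OE g \<inter> NE g}" "G \<in> A"
 shows "G \<in> fat_class (g (card (verts G)))"
proof -
 have G: "G \<in> graphs" using assms by (auto simp: E_def OE_def NE_def)
 have "(\<exists>h. 2 * h \<le> g (card (verts G)) \<and> embeds_in G (sphere_with_handles h)) \<or>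
   (\<exists>k\<le>g (card (verts G)). embeds_in G (sphere_with_crosscaps k))"
  using assms unfolding E_def OE_def NE_def by (auto split: if_splits)
 then show ?thesis
  using embeds_imp_fat[OF handles_ranked G] embeds_imp_fat[OF crosscaps_ranked G] G unfolding fat_class_def by blast
qed

text \<open>An induced subgraph of the enlarged graph is one of \<open>G\<close>, possibly with
  \<open>v\<close> added. For \<open>W = {v}\<close> the part in \<open>G\<close> is empty, which is
  where the empty graph in \<open>A\<close> is used.\<close>

lemma Hered_closed:
 assumes A: "genus_class A" and G: "G \<in> Hered A" and v: "v \<notin> verts G" shows "add_vertex v G \<in> Hered A"
proof -
 have Gg: "G \<in> graphs" and ind: "\<forall>W. W <= verts G \<and> W ~= {} --> induced_subgraph G W \<in> A" using G by (auto simp: Hered_def)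
 have addA: "add_vertex v H \<in> A" if "H \<in> A" "v \<notin> verts H" for H using A that unfolding genus_class_def by blast
 have "induced_subgraph (add_vertex v G) W \<in> A" if W: "W <= insert v (verts G)" "W ~= {}" for W
 proof -
  have nv: "v \<notin> e" if "e \<in> edges G" for e using graphsD[OF Gg that] v by blast
  show ?thesis
  proof (cases "v \<in> W")
   case True
   have "induced_subgraph G (W - {v}) \<in> A"
   proof (cases "W - {v} = {}")
    case True
    have "\<not> e <= {}" if "e \<in> edges G" for e using graphsD[OF Gg that] by auto
    then have "induced_subgraph G {} = ({}, {})" by (auto simp: induced_subgraph_def)
    then show ?thesis using A unfolding True genus_class_def by simp
   next
    case False
    have "W - {v} <= verts G" using W(1) by blast
    then show ?thesis using ind[rule_format, OF conjI[OF _ False]] by blast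
   qed
   then have "add_vertex v (induced_subgraph G (W - {v})) \<in> A"
    by (rule addA) (simp add: induced_subgraph_def)
   moreover have "induced_subgraph (add_vertex v G) W = add_vertex v (induced_subgraph G (W - {v}))"
   proof -
    have "{e \<in> edges G. e <= W} = {e \<in> edges G. e <= W - {v}}" using nv by blast
    then show ?thesis using True by (simp add: induced_subgraph_def add_vertex_def insert_absorb)
   qed
   ultimately show ?thesis by simp
  next
   case False
   then have "induced_subgraph (add_vertex v G) W = induced_subgraph G W" by (simp add: induced_subgraph_def add_vertex_def)
   moreover have "W <= verts G" using W(1) False by blast
   ultimately show ?thesis using ind[rule_format, OF conjI[OF _ W(2)]] by simp
  qed
 qed
 then show ?thesis using add_vertex_graphs[OF Gg] by (simp add: Hered_def add_vertex_def)
qed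

text \<open>A step either deletes the isolated vertex or takes place in \<open>G\<close>.\<close>

lemma minor_step_add_vertex:
 assumes "minor_step (add_vertex v G) H" "G \<in> graphs" "v \<notin> verts G"
 shows "H = G \<or> (\<exists>G'. minor_step G G' \<and> v \<notin> verts G' \<and> H = add_vertex v G')"
 using assms(1)
proof cases
 case (1 x)
 have nv: "e <= verts G \<and> v \<notin> e" if "e \<in> edges G" for e using graphsD[OF assms(2) that] assms(3) by blast
 show ?thesis
 proof (cases "x = v")
  case True
  have "{e \<in> edges G. e <= verts G} = edges G" using nv by blast
  then have "H = G" using 1(1) True assms(3) by (simp add: add_vertex_def induced_subgraph_def prod_eq_iff)
  then show ?thesis by simp
 next
  case False
  have "{e \<in> edges G. e <= insert v (verts G) - {x}} = {e \<in> edges G. e <= verts G - {x}}" using nv by blast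
  then have "H = add_vertex v (induced_subgraph G (verts G - {x}))"
   using 1(1) False by (simp add: add_vertex_def induced_subgraph_def insert_Diff_if)
  moreover have "x \<in> verts G" using 1 False by (simp add: add_vertex_def)
  ultimately show ?thesis using minor_step.intros(1)[of x G] assms(3) by (auto simp: induced_subgraph_def)
 qed
next
 case (2 e)
 then show ?thesis using minor_step.intros(2)[of e G] assms(3)
  by (intro disjI2 exI[of _ "delete_edge G e"]) (simp add: add_vertex_def delete_edge_def)
next
 case (3 a b)
 have ab: "{a, b} \<in> edges G" using 3(2) by (simp add: add_vertex_def)
 then have "v ~= b" using edge_ne[OF assms(2) ab] assms(3) by auto
 then have "H = add_vertex v (contract_edge G a b)" using 3(1) by (simp add: add_vertex_def contract_edge_def Let_def insert_Diff_if)
 then show ?thesis using minor_step.intros(3)[OF ab 3(3)] assms(3) by (auto simp: contract_edge_def Let_def)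
qed

lemma Minor_closed:
 assumes A: "genus_class A" and G: "G \<in> Minor A" and v: "v \<notin> verts G" shows "add_vertex v G \<in> Minor A"
proof -
 have Gg: "G \<in> graphs" and mA: "\<forall>H. is_minor H G --> H \<in> A" using G by (auto simp: Minor_def)
 have dec: "\<exists>G'. is_minor G' G \<and> (H = G' \<or> v \<notin> verts G' \<and> H = add_vertex v G')" if "minor_step\<^sup>*\<^sup>* (add_vertex v G) H" for H
  using that
 proof (induction rule: rtranclp_induct)
  case base
  show ?case using v by (intro exI[of _ G]) (simp add: is_minor_def)
 next
  case (step H K)
  obtain G' where G': "is_minor G' G" "H = G' \<or> v \<notin> verts G' \<and> H = add_vertex v G'" using step.IH by blast
  have g: "G' \<in> graphs" by (rule is_minor_graphs[OF G'(1) Gg])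
  have up: "is_minor L G" if "minor_step G' L" for L using G'(1) that unfolding is_minor_def by (rule rtranclp.rtrancl_into_rtrancl)
  show ?case using G'(2)
  proof
   assume "H = G'"
   then show ?thesis using up step.hyps(2) by blast
  next
   assume H: "v \<notin> verts G' \<and> H = add_vertex v G'"
   then have "K = G' \<or> (\<exists>L. minor_step G' L \<and> v \<notin> verts L \<and> K = add_vertex v L)"
    using minor_step_add_vertex[OF _ g, of v K] step.hyps(2) by blast
   then show ?thesis using G'(1) up by blast
  qed
 qed
 have "H \<in> A" if H: "is_minor H (add_vertex v G)" for H
 proof -
  obtain G' where G': "is_minor G' G" "H = G' \<or> v \<notin> verts G' \<and> H = add_vertex v G'"
   using dec[OF H[unfolded is_minor_def]] by blast
  have "G' \<in> A" using mA G'(1) by blast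
  then show ?thesis using G'(2) A unfolding genus_class_def by (elim disjE) blast+
 qed
 then show ?thesis using add_vertex_graphs[OF Gg] by (simp add: Minor_def)
qed

lemma Minor_minor_closed: "minor_closed (Minor A)"
proof
 fix G H assume G: "G \<in> Minor A" and s: "minor_step G H"
 have "is_minor K G" if "is_minor K H" for K using s that unfolding is_minor_def by (rule converse_rtranclp_into_rtranclp)
 then show "H \<in> Minor A" using G minor_step_graphs[OF s] by (simp add: Minor_def)
qed (auto simp: Minor_def)

text \<open>Every graph on \<open>s\<close> vertices is a subgraph of the complete graph on
  \<open>s\<close> vertices. If one of them is outside \<open>A\<close>, no graph in
  \<open>Minor A\<close> has that complete minor, and \<open>dense_imp_complete_minor\<close> bounds
  the density by \<open>2 ^ s\<close>.\<close>

lemma Minor_few_edges: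
 assumes A: "genus_class A" and ne: "A ~= graphs"
 shows "\<exists>c. \<forall>G\<in>Minor A. card (edges G) \<le> c * card (verts G)"
proof -
 interpret minor_closed "Minor A" by (rule Minor_minor_closed)
 obtain M where M: "M \<in> graphs" "M \<notin> A" using A ne unfolding genus_class_def by blast
 have "card (edges G) \<le> 2 ^ card (verts M) * card (verts G)" if G: "G \<in> Minor A" for G
 proof (rule ccontr)
  assume *: "\<not> ?thesis"
  have Gg: "G \<in> graphs" using G graphs by blast
  have "edges G ~= {}" using * by auto
  then have "verts G ~= {}" using graphsD[OF Gg] by fastforce
  then obtain K where K: "K \<in> Minor A" "card (verts K) = card (verts M)" "clique K (verts K)"
   using dense_imp_complete_minor[OF Minor_minor_closed G, of "card (verts M)"] * by auto
  have "finite (verts K)" "finite (verts M)" using K(1) M(1) graphs graphs_finite by blast+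
  then obtain f where f: "bij_betw f (verts M) (verts K)" using finite_same_card_bij K(2) by metis
  have inj: "inj_on f (verts M)" by (rule bij_betw_imp_inj_on[OF f])
  have fM: "f ` verts M = verts K" using f by (simp add: bij_betw_def)
  have "(`) f ` edges M <= edges K"
  proof
   fix d assume "d \<in> (`) f ` edges M"
   then obtain e where e: "e \<in> edges M" "d = f ` e" by blast
   then obtain x y where xy: "e = {x, y}" "x ~= y" "x \<in> verts M" "y \<in> verts M"
    using graphsD[OF M(1) e(1)] unfolding card_2_iff by auto
   have "f x ~= f y" using inj_onD[OF inj] xy(2-4) by blast
   moreover have "f x \<in> verts K" "f y \<in> verts K" using xy(3,4) fM by blast+
   ultimately show "d \<in> edges K" using K(3) e(2) xy(1) unfolding clique_def by simp
  qed
  then have "(f ` verts M, (`) f ` edges M) \<in> Minor A" using edge_subset[OF K(1)] fM by simp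
  then have "(f ` verts M, (`) f ` edges M) \<in> A" unfolding Minor_def is_minor_def by blast
  then have "M \<in> A" using graph_iso_sym[OF iso_image[OF M(1) inj]] A unfolding genus_class_def by blast
  then show False using M(2) by simp
 qed
 then show ?thesis by blast
qed

section \<open>The cases of bounded genus and of excluded minors\<close>

theorem theorem43:
  fixes g :: "nat \<Rightarrow> nat" and A B :: "nat sgraph set" and R :: "nat \<Rightarrow> nat sgraph set pmf"
  assumes "mono_on {1..} g"
    and "A \<in> {E g, OE g, NE g, OE g \<inter> NE g}"
    and "((\<lambda>n. real (g n)) \<in> O(\<lambda>n. real n / ln (real n)) \<and> B \<in> {A, Hered A})
         \<or> (A \<noteq> graphs \<and> B = Minor A)"
    and "\<And>n. n \<ge> 1 \<Longrightarrow> R n = random_unlabelled B n"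
  shows "(\<forall>\<epsilon>>0. \<exists>I\<subseteq>{1..}. lower_density_at_least I (1 - \<epsilon>) \<and>
            (SUP n\<in>I. ereal (prob_connected (R n))) < 1)
         \<and> liminf (\<lambda>n. ereal (prob_connected (R n))) < 1"
proof -
 have A: "genus_class A" by (rule genus_class_surfaces[OF assms(1,2)])
 have Asub: "A <= graphs" and empty: "({}, {}) \<in> A" and addA: "!!G v. G \<in> A ==> v \<notin> verts G ==> add_vertex v G \<in> A"
  using A unfolding genus_class_def by auto
 have emptyG: "({}, {}) \<in> graphs" by (simp add: graphs_def)
 from assms(3) show ?thesis
 proof
  assume a: "(\<lambda>n. real (g n)) \<in> O(\<lambda>n. real n / ln (real n)) \<and> B \<in> {A, Hered A}"
  \<comment> \<open>A nonempty graph is an induced subgraph of itself; \<open>Hered\<close> says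
    nothing about the empty graph, which lies in \<open>A\<close> anyway.\<close>
  have BA: "B <= A"
  proof
   fix G assume G: "G \<in> B"
   show "G \<in> A"
   proof (cases "B = A")
    case False
    then have h: "G \<in> graphs" "\<forall>W. W <= verts G \<and> W ~= {} --> induced_subgraph G W \<in> A" using a G by (auto simp: Hered_def)
    have ind: "induced_subgraph G (verts G) = G" using graphsD[OF h(1)] by (auto simp: induced_subgraph_def prod_eq_iff)
    show ?thesis
    proof (cases "verts G = {}")
     case True
     then have "edges G = {}" using graphsD[OF h(1)] by fastforce
     then show ?thesis using empty True by (metis prod.collapse)
    next
     case False
     then show ?thesis using h(2) ind by (metis order_refl)
    qed
   qed (use G in simp)
  qed
  obtain D where D: "\<forall>\<gamma> n B. {G \<in> B. card (verts G) = n} <= fat_class \<gamma> --> finite (unlabelled {G \<in> B. card (verts G) = n}) \<and>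
    card (unlabelled {G \<in> B. card (verts G) = n}) \<le> ((24 * (2 * \<gamma> + 1))\<^sup>2 + 1) ^ (300 * (2 * \<gamma> + 1)) * D ^ n"
   using fat_class_count by (elim exE) (rule that)
  \<comment> \<open>For each order \<open>n\<close> separately, the graphs of that order lie in a
    minor-closed class with bound \<open>g n\<close>, and \<open>D\<close> serves for all of
    them.\<close>
  have fat: "{G \<in> B. card (verts G) = n} <= fat_class (g n)" for n using surfaces_fat[OF assms(2)] BA by blast
  interpret vertex_closed B
  proof
   show "B <= graphs" using BA Asub by blast
   show "({}, {}) \<in> B" using a empty emptyG by (auto simp: Hered_def)
   show "add_vertex v G \<in> B" if "G \<in> B" "v \<notin> verts G" for G v using that a addA[OF _ that(2)] Hered_closed[OF A _ that(2)] by blast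
   show "finite (unlabelled {G \<in> B. card (verts G) = n})" for n using D fat by blast
  qed
  obtain C where C: "\<forall>\<^sub>F n in sequentially. ((24 * (2 * g n + 1))\<^sup>2 + 1) ^ (300 * (2 * g n + 1)) * D ^ n \<le> (C::nat) ^ n"
   using genus_growth a by blast
  have le: "count n \<le> ((24 * (2 * g n + 1))\<^sup>2 + 1) ^ (300 * (2 * g n + 1)) * D ^ n" for n
   unfolding count_def classes_def using D fat by blast
  show ?thesis
  proof (rule rarely_connected[OF _ assms(4)])
   show "\<forall>\<^sub>F n in sequentially. count n \<le> C ^ n" using C by (rule eventually_mono) (rule le_trans[OF le])
  qed
 next
  assume b: "A ~= graphs \<and> B = Minor A"
  obtain c where c: "\<forall>G\<in>Minor A. card (edges G) \<le> c * card (verts G)" using Minor_few_edges[OF A] b by blast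
  interpret sparse_class "Minor A" "c + 2 ^ (2 * c) + 1" 1
   by (rule minor_closed.linear_sparse[OF Minor_minor_closed]) (use c in blast)
  note bound = represented_unlabelled[OF represented_all]
  interpret vertex_closed B
  proof
   show "B <= graphs" using b by (auto simp: Minor_def)
   have "H = ({}, {})" if "minor_step\<^sup>*\<^sup>* ({}, {}) H" for H :: "nat sgraph"
    using that by (induction rule: rtranclp_induct) (auto elim: minor_step.cases)
   then show "({}, {}) \<in> B" using b empty emptyG by (auto simp: Minor_def is_minor_def)
   show "add_vertex v G \<in> B" if "G \<in> B" "v \<notin> verts G" for G v using that b Minor_closed[OF A] by blast
   show "finite (unlabelled {G \<in> B. card (verts G) = n})" for n using bound b by blast
  qed
  have "count n \<le> (base * rate) ^ n" if "n \<ge> 1" for n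
  proof -
   have "count n \<le> base * rate ^ n" unfolding count_def classes_def using bound b by blast
   also have "\<dots> \<le> base ^ n * rate ^ n"
   proof (rule mult_le_mono1)
    have "1 \<le> base" unfolding base_def by (rule one_le_power) simp
    then show "base \<le> base ^ n" by (rule self_le_power) (rule less_le_trans[OF zero_less_one that])
   qed
   finally show ?thesis by (simp add: power_mult_distrib)
  qed
  then have ev: "\<forall>\<^sub>F n in sequentially. count n \<le> (base * rate) ^ n" unfolding eventually_sequentially by blast
  show ?thesis by (rule rarely_connected[OF ev assms(4)])
 qed
qed

end
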